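(* Let $d\ge 2$, $0<p<\infty$, $0<q\le\infty$ and $$d\,\max\Big(\frac1p,\frac1q\Big)<s<1 .$$ Then a radial function $f\in L_p(\mathbb{R}^d)$ belongs to $F^s_{p,q}(\mathbb{R}^d)$ if, and only if, $g:=\operatorname{tr} f$ satisfies $$\|g\|^\# := \|g\,|L_p(\mathbb{R},|t|^{d-1})\| + \Big(\int_{-\infty}^\infty |r|^{d-1}\Big[\int_0^1 t^{-sq}\sup_{-t\le w\le t}|g(r+w)-g(r)|^q\,\frac{dt}{t}\Big]^{p/q}dr\Big)^{1/p}<\infty .$$ Moreover, $\|g\|^\#$ is equivalent to $\|f\,|F^s_{p,q}(\mathbb{R}^d)\|$, i.e. there are constants $c_1,c_2>0$ independent of $f$ such that $c_1\|g\|^\#\le \|f\,|F^s_{p,q}(\mathbb{R}^d)\|\le c_2\|g\|^\#$.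
   Context: Functions are complex-valued and identified when they agree almost everywhere; accordingly the supremum over $w$ is understood as an essential supremum. A (locally integrable) function belongs to $F^s_{p,q}(\mathbb{R}^d)$ if the associated tempered distribution does. If $q=\infty$, expressions $\big(\int(\cdot)^q\,dt/t\big)^{1/q}$ and $\ell_q$-sums are replaced by (essential) suprema in the usual way. Lizorkin-Triebel spaces: let $\psi\in C_0^\infty(\mathbb{R}^d)$ with $\psi(x)=1$ for $|x|\le1$ and $\psi(x)=0$ for $|x|\ge2$; put $\varphi_0:=\psi$, $\varphi_1(x):=\varphi_0(x/2)-\varphi_0(x)$, $\varphi_j(x):=\varphi_1(2^{-j+1}x)$ for $j\in\mathbb{N}$. For $0<p<\infty$, $0<q\le\infty$, $s\in\mathbb{R}$, $F^s_{p,q}(\mathbb{R}^d)$ is the set of all $f\in\mathcal{S}'(\mathbb{R}^d)$ with $$\|f\,|F^s_{p,q}(\mathbb{R}^d)\|:=\Big\|\Big(\sum_{j=0}^\infty 2^{jsq}|\mathcal{F}^{-1}[\varphi_j\,\mathcal{F}f](\cdot)|^q\Big)^{1/q}\Big|L_p(\mathbb{R}^d)\Big\|<\infty ,$$ where $\mathcal{F}$ is the Fourier transform. Trace: for a radial function $f$ on $\mathbb{R}^d$, $(\operatorname{tr}f)(t):=f(t,0,\dots,0)$, $t\in\mathbb{R}$; i.e. $\operatorname{tr} f$ is the even function $g$ on $\mathbb{R}$ (determined a.e.) with $f(x)=g(|x|)$ for a.e. $x$. Weighted norm: $\|g\,|L_p(\mathbb{R},|t|^{d-1})\|:=\big(\int_{-\infty}^\infty|g(t)|^p|t|^{d-1}dt\big)^{1/p}$.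 *)

theory Defs
  imports "HOL-Analysis.Analysis" "HOL-Probability.Essential_Supremum"
begin

section \<open>Schwartz functions\<close>

text \<open>Multi-indices are lists of coordinates; on smooth functions the order in the list is
  irrelevant.\<close>

fun iter_partial :: "'n::finite list \<Rightarrow> (real^'n \<Rightarrow> complex) \<Rightarrow> real^'n \<Rightarrow> complex" where
  "iter_partial [] f = f"
| "iter_partial (i # \<alpha>) f = (\<lambda>x. frechet_derivative (iter_partial \<alpha> f) (at x) (axis i 1))"

definition smooth :: "(real^'n::finite \<Rightarrow> complex) \<Rightarrow> bool" where
  "smooth f \<longleftrightarrow> (\<forall>\<alpha> x. iter_partial \<alpha> f differentiable (at x))"

definition schwartz :: "(real^'n::finite \<Rightarrow> complex) set" where
  "schwartz = {\<eta>. smooth \<eta> \<and>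
     (\<forall>N \<alpha>. bounded (range (\<lambda>x. (1 + norm x) ^ N * cmod (iter_partial \<alpha> \<eta> x))))}"

definition schwartz_seminorm :: "nat \<Rightarrow> (real^'n::finite \<Rightarrow> complex) \<Rightarrow> real" where
  "schwartz_seminorm N \<eta> =
     (SUP (\<alpha>, x) \<in> {\<alpha>. length \<alpha> \<le> N} \<times> UNIV. (1 + norm x) ^ N * cmod (iter_partial \<alpha> \<eta> x))"

definition fourier :: "(real^'n::finite \<Rightarrow> complex) \<Rightarrow> real^'n \<Rightarrow> complex" where
  "fourier \<eta> \<xi> = complex_of_real ((2 * pi) powr (- real CARD('n) / 2)) *
     (LINT x|lebesgue. cis (- (x \<bullet> \<xi>)) * \<eta> x)"

definition inv_fourier :: "(real^'n::finite \<Rightarrow> complex) \<Rightarrow> real^'n \<Rightarrow> complex" where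
  "inv_fourier \<eta> x = complex_of_real ((2 * pi) powr (- real CARD('n) / 2)) *
     (LINT \<xi>|lebesgue. cis (x \<bullet> \<xi>) * \<eta> \<xi>)"


section \<open>Tempered distributions\<close>

text \<open>A distribution is a functional of which only the values on Schwartz functions matter.\<close>

type_synonym 'n dist = "(real^'n \<Rightarrow> complex) \<Rightarrow> complex"

definition tempered :: "'n::finite dist \<Rightarrow> bool" where
  "tempered T \<longleftrightarrow>
     (\<forall>\<eta>\<in>schwartz. \<forall>\<theta>\<in>schwartz. T (\<lambda>x. \<eta> x + \<theta> x) = T \<eta> + T \<theta>) \<and>
     (\<forall>c. \<forall>\<eta>\<in>schwartz. T (\<lambda>x. c * \<eta> x) = c * T \<eta>) \<and>
     (\<exists>C N. \<forall>\<eta>\<in>schwartz. cmod (T \<eta>) \<le> C * schwartz_seminorm N \<eta>)"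

definition dist_of :: "(real^'n::finite \<Rightarrow> complex) \<Rightarrow> 'n dist" where
  "dist_of f = (\<lambda>\<eta>. LINT x|lebesgue. f x * \<eta> x)"

definition dist_fourier :: "'n::finite dist \<Rightarrow> 'n dist" where
  "dist_fourier T = (\<lambda>\<eta>. T (fourier \<eta>))"

definition dist_inv_fourier :: "'n::finite dist \<Rightarrow> 'n dist" where
  "dist_inv_fourier T = (\<lambda>\<eta>. T (inv_fourier \<eta>))"

definition dist_mult :: "(real^'n::finite \<Rightarrow> complex) \<Rightarrow> 'n dist \<Rightarrow> 'n dist" where
  "dist_mult \<phi> T = (\<lambda>\<eta>. T (\<lambda>x. \<phi> x * \<eta> x))"

definition represented_by :: "'n::finite dist \<Rightarrow> (real^'n \<Rightarrow> complex) \<Rightarrow> bool" where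
  "represented_by T h \<longleftrightarrow>
     (\<forall>\<eta>\<in>schwartz. integrable lebesgue (\<lambda>x. h x * \<eta> x) \<and> T \<eta> = dist_of h \<eta>)"


section \<open>Lizorkin--Triebel spaces\<close>

definition resolution_generator :: "(real^'n::finite \<Rightarrow> complex) \<Rightarrow> bool" where
  "resolution_generator \<psi> \<longleftrightarrow>
     smooth \<psi> \<and> (\<forall>x. norm x \<le> 1 \<longrightarrow> \<psi> x = 1) \<and> (\<forall>x. norm x \<ge> 2 \<longrightarrow> \<psi> x = 0)"

text \<open>Below, \<open>k = j - 1\<close>, so \<open>(1/2) ^ k\<close> is the scaling factor \<open>2\<^sup>-\<^sup>j\<^sup>+\<^sup>1\<close>.\<close>

fun dyadic :: "(real^'n::finite \<Rightarrow> complex) \<Rightarrow> nat \<Rightarrow> real^'n \<Rightarrow> complex" where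
  "dyadic \<psi> 0 = \<psi>"
| "dyadic \<psi> (Suc k) = (let \<phi>\<^sub>1 = (\<lambda>y. \<psi> ((1/2) *\<^sub>R y) - \<psi> y) in (\<lambda>x. \<phi>\<^sub>1 ((1/2) ^ k *\<^sub>R x)))"

text \<open>The distribution \<open>\<F>\<^sup>-\<^sup>1[\<phi>\<^sub>j \<F>T]\<close> has a compactly supported Fourier transform; by the
  Paley--Wiener--Schwartz theorem it is therefore given by a (unique) continuous function.\<close>

definition lp_block ::
  "(real^'n::finite \<Rightarrow> complex) \<Rightarrow> nat \<Rightarrow> 'n dist \<Rightarrow> real^'n \<Rightarrow> complex" where
  "lp_block \<psi> j T = (THE h. continuous_on UNIV h \<and>
     represented_by (dist_inv_fourier (dist_mult (dyadic \<psi> j) (dist_fourier T))) h)"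

text \<open>Real powers on \<open>[0,\<infinity>]\<close>; only used with positive exponent.\<close>

definition enn_powr :: "ennreal \<Rightarrow> real \<Rightarrow> ennreal" where
  "enn_powr x a = (if x = \<infinity> then \<infinity> else ennreal (enn2real x powr a))"

definition lq_seq :: "real \<Rightarrow> ereal \<Rightarrow> (nat \<Rightarrow> complex) \<Rightarrow> ennreal" where
  "lq_seq s q a =
     (if q = \<infinity> then (SUP j. ennreal (2 powr (real j * s) * cmod (a j)))
      else let q' = real_of_ereal q in
        enn_powr (\<Sum>j. ennreal (2 powr (real j * s * q') * cmod (a j) powr q')) (1 / q'))"

definition F_norm ::
  "(real^'n::finite \<Rightarrow> complex) \<Rightarrow> real \<Rightarrow> real \<Rightarrow> ereal \<Rightarrow> 'n dist \<Rightarrow> ennreal" where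
  "F_norm \<psi> s p q T =
     enn_powr (\<integral>\<^sup>+x. enn_powr (lq_seq s q (\<lambda>j. lp_block \<psi> j T x)) p \<partial>lebesgue) (1 / p)"

definition F_space ::
  "(real^'n::finite \<Rightarrow> complex) \<Rightarrow> real \<Rightarrow> real \<Rightarrow> ereal \<Rightarrow> 'n dist set" where
  "F_space \<psi> s p q = {T. tempered T \<and> F_norm \<psi> s p q T < \<infinity>}"


section \<open>Radial functions, traces and the one-dimensional quasi-norm\<close>

definition in_Lp :: "real \<Rightarrow> (real^'n::finite \<Rightarrow> complex) \<Rightarrow> bool" where
  "in_Lp p f \<longleftrightarrow> f \<in> borel_measurable lebesgue \<and>
     (\<integral>\<^sup>+x. ennreal (cmod (f x) powr p) \<partial>lebesgue) < \<infinity>"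

definition radial :: "(real^'n::finite \<Rightarrow> complex) \<Rightarrow> bool" where
  "radial f \<longleftrightarrow>
     (\<exists>g0. g0 \<in> borel_measurable lebesgue \<and> (AE x in lebesgue. f x = g0 (norm x)))"

text \<open>The trace is only determined almost everywhere, hence a relation: \<open>g\<close> is a representative
  of the trace of \<open>f\<close>.\<close>

definition is_trace :: "(real^'n::finite \<Rightarrow> complex) \<Rightarrow> (real \<Rightarrow> complex) \<Rightarrow> bool" where
  "is_trace f g \<longleftrightarrow> g \<in> borel_measurable lebesgue \<and>
     (AE t in lebesgue. g (- t) = g t) \<and> (AE x in lebesgue. f x = g (norm x))"

definition weighted_Lp_norm :: "nat \<Rightarrow> real \<Rightarrow> (real \<Rightarrow> complex) \<Rightarrow> ennreal" where
  "weighted_Lp_norm d p g =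
     enn_powr (\<integral>\<^sup>+t. ennreal (cmod (g t) powr p * \<bar>t\<bar> ^ (d - 1)) \<partial>lebesgue) (1 / p)"

text \<open>The inner bracket raised to the power \<open>p/q\<close>. For \<open>q = \<infinity>\<close> it is the \<open>p\<close>-th power of
  the essential supremum, the measure \<open>dt/t\<close> having the same null sets as \<open>dt\<close> on \<open>(0,1)\<close>.\<close>

definition local_osc_pow :: "real \<Rightarrow> real \<Rightarrow> ereal \<Rightarrow> (real \<Rightarrow> complex) \<Rightarrow> real \<Rightarrow> ennreal" where
  "local_osc_pow s p q g r =
     (if q = \<infinity> then
        enn_powr (esssup (lebesgue_on {0<..<1}) (\<lambda>t. ennreal (t powr (- s)) *
          esssup (lebesgue_on {-t..t}) (\<lambda>w. ennreal (cmod (g (r + w) - g r))))) p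
      else let q' = real_of_ereal q in
        enn_powr (\<integral>\<^sup>+t. ennreal (t powr (- s * q')) *
          esssup (lebesgue_on {-t..t}) (\<lambda>w. ennreal (cmod (g (r + w) - g r) powr q')) *
          ennreal (1 / t) \<partial>lebesgue_on {0<..<1}) (p / q'))"

definition sharp_norm :: "nat \<Rightarrow> real \<Rightarrow> real \<Rightarrow> ereal \<Rightarrow> (real \<Rightarrow> complex) \<Rightarrow> ennreal" where
  "sharp_norm d s p q g = weighted_Lp_norm d p g +
     enn_powr (\<integral>\<^sup>+r. ennreal (\<bar>r\<bar> ^ (d - 1)) * local_osc_pow s p q g r \<partial>lebesgue) (1 / p)"

lemma radial_iff_trace: "radial f \<longleftrightarrow> (\<exists>g. is_trace f g)"
proof
  assume "radial f"
  then obtain g0 where g0: "g0 \<in> borel_measurable lebesgue" "AE x in lebesgue. f x = g0 (norm x)"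
    unfolding radial_def by auto
  have minus: "(\<lambda>t::real. - t) \<in> lebesgue \<rightarrow>\<^sub>M lebesgue"
    using lebesgue_measurable_scaling[of "-1::real"] by (simp add: fun_eq_iff cong: measurable_cong)
  define g where "g = (\<lambda>t. if t \<in> {0..} then g0 t else g0 (- t))"
  have "g \<in> borel_measurable lebesgue"
    unfolding g_def
    by (rule measurable_If_set) (use g0(1) measurable_compose[OF minus g0(1)] in auto)
  moreover have "g (- t) = g t" for t
    by (cases t "0::real" rule: linorder_cases) (auto simp: g_def)
  moreover have "AE x in lebesgue. f x = g (norm x)"
    using g0(2) by (simp add: g_def)
  ultimately show "\<exists>g. is_trace f g"
    unfolding is_trace_def by (intro exI[of _ g]) simp
qed (auto simp: radial_def is_trace_def)

end

theory Submission
  imports Defs "HOL-Probability.Characteristic_Functions"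
begin

text \<open>Write \<open>f\<^sub>j\<close> for the blocks of \<open>f\<close>; they are correlations of \<open>f\<close> with rescaled Schwartz kernels, of
  mean zero for \<open>j > 0\<close>.

  From oscillation to blocks: since the kernel has mean zero, \<open>f\<^sub>j(x)\<close> is an average of \<open>f(y) - f(x)\<close>, and
  \<open>\<bar>norm y - norm x\<bar> \<le> norm (y - x)\<close>. An annulus \<open>norm (y - x) \<approx> 2\<^sup>-\<^sup>k\<close> therefore contributes at most the
  oscillation of \<open>g\<close> at \<open>norm x\<close> on scale \<open>2\<^sup>-\<^sup>k\<close>, with a weight decaying geometrically in \<open>j - k\<close>, and Young's
  inequality for sequences applies.

  From blocks to oscillation: almost everywhere \<open>f\<close> is the sum of its blocks, and for a radial function the
  variation of \<open>g\<close> near \<open>norm x\<close> is the variation of \<open>f\<close> along the ray through \<open>x\<close>. Each block is reproduced by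
  a slightly wider kernel, so its increments over distance \<open>2\<^sup>-\<^sup>k\<close> are bounded by a Peetre type average of order
  \<open>r\<close>, with a weight that grows like \<open>2\<close> to the power \<open>(j - k) b / r\<close> for \<open>j > k\<close> and decays like \<open>2 ^ (j - k)\<close>
  otherwise. Both sums converge against \<open>2\<close> to the power \<open>- (j - k) s\<close> exactly when \<open>b / r < s < 1\<close>; as \<open>b\<close>
  must exceed the dimension \<open>d\<close> while \<open>r < p\<close> and \<open>r < q\<close>, such \<open>b\<close> and \<open>r\<close> exist because \<open>s > d max(1/p, 1/q)\<close>.
  The averages are removed by the vector-valued inequality of Fefferman--Stein type. Passing to polar
  coordinates turns integrals of radial functions into weighted integrals on the line.\<close>


section \<open>Real powers on the extended half-line\<close>

text \<open>As s < 1, the hypothesis puts p and q above d and leaves room for an r with d / s < r <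
  min(p, q). Then p / r and q / r both exceed 1, the range in which the vector-valued inequality
  holds. It is proved only for averages against \<open>decay b \<mu>\<close> with b > d; these are
  dominated by the maximal function and are self-adjoint, so they can be moved to a test function.
  In the other direction b = d + 2 is taken: the surplus 2 over the dimension leaves the rate 4 ^
  -(j - k), which still decays after multiplication by 2 ^ ((j - k) s). The obstacle that shapes the
  proof is that f, its trace and the supremum over w are known almost everywhere only. The blocks
  are genuine continuous functions, so their increments are estimated at every point; what remains
  is convergence of the block series at almost every point of almost every line through the origin.
  All estimates live in [0, infinity], so comparing the quasi-norms also compares their finiteness.
  An infinite norm of the blocks makes its half of the claim trivial; a finite one makes the block
  series converge.\<close>

lemma enn_powr_ennreal [simp]: "0 \<le> x \<Longrightarrow> enn_powr (ennreal x) a = ennreal (x powr a)"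
  by (simp add: enn_powr_def)

lemma enn_powr_top [simp]: "enn_powr top a = top"
  by (simp add: enn_powr_def)

lemma enn_powr_0 [simp]: "enn_powr 0 a = 0"
  by (simp add: enn_powr_def)

lemma enn_powr_one [simp]: "enn_powr x 1 = x"
  by (cases x) auto

lemma enn_powr_eq_top_iff [simp]: "enn_powr x a = top \<longleftrightarrow> x = top"
  by (cases x) auto

lemma enn_powr_eq_0_iff [simp]: "enn_powr x a = 0 \<longleftrightarrow> x = 0"
  by (cases x) auto

lemma enn_powr_mono: "x \<le> y \<Longrightarrow> 0 \<le> a \<Longrightarrow> enn_powr x a \<le> enn_powr y a"
  by (cases x; cases y) (auto simp: top_unique intro!: ennreal_leI powr_mono2)

lemma enn_powr_mult: "0 < a \<Longrightarrow> enn_powr (x * y) a = enn_powr x a * enn_powr y a"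
proof (cases x; cases y)
  fix r r' assume "0 < a" "0 \<le> r" "x = ennreal r" "0 \<le> r'" "y = ennreal r'"
  then show ?thesis by (simp add: ennreal_mult[symmetric] powr_mult)
qed (auto simp: ennreal_mult_top ennreal_top_mult)

lemma enn_powr_powr: "enn_powr (enn_powr x a) b = enn_powr x (a * b)"
  by (cases x) (auto simp: powr_powr)

lemma enn_powr_le_iff: "0 < a \<Longrightarrow> enn_powr x a \<le> enn_powr y a \<longleftrightarrow> x \<le> y"
  using enn_powr_mono[of "enn_powr x a" "enn_powr y a" "1 / a"] enn_powr_mono[of x y a]
  by (auto simp: enn_powr_powr)

lemma enn_powr_add: "0 < a \<Longrightarrow> 0 < b \<Longrightarrow> enn_powr x (a + b) = enn_powr x a * enn_powr x b"
  by (cases x) (auto simp: powr_add ennreal_mult)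

lemma enn_powr_inverse: "0 < a \<Longrightarrow> enn_powr (inverse x) a = inverse (enn_powr x a)"
proof (cases x)
  case (real r)
  assume "0 < a"
  then show ?thesis
    using real by (cases "r = 0") (auto simp: inverse_ennreal powr_minus[symmetric] inverse_powr)
qed auto

text \<open>The power \<open>1 / a\<close> is a monotone inverse of the power \<open>a\<close>, so
  the map is an order isomorphism of [0, infinity] and commutes with suprema.\<close>

lemma enn_powr_SUP:
  assumes "0 < a"
  shows "enn_powr (SUP i\<in>I. f i) a = (SUP i\<in>I. enn_powr (f i) a)"
proof (rule antisym)
  have "f i \<le> enn_powr (SUP i\<in>I. enn_powr (f i) a) (1 / a)" if "i \<in> I" for i
  proof -
    have "f i = enn_powr (enn_powr (f i) a) (1 / a)"
      using assms by (simp add: enn_powr_powr)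
    also have "\<dots> \<le> enn_powr (SUP i\<in>I. enn_powr (f i) a) (1 / a)"
      using assms that by (intro enn_powr_mono SUP_upper) auto
    finally show ?thesis .
  qed
  then have "(SUP i\<in>I. f i) \<le> enn_powr (SUP i\<in>I. enn_powr (f i) a) (1 / a)"
    by (rule SUP_least)
  then have "enn_powr (SUP i\<in>I. f i) a \<le> enn_powr (enn_powr (SUP i\<in>I. enn_powr (f i) a) (1 / a)) a"
    using assms by (intro enn_powr_mono) auto
  then show "enn_powr (SUP i\<in>I. f i) a \<le> (SUP i\<in>I. enn_powr (f i) a)"
    using assms by (simp add: enn_powr_powr)
qed (use assms in \<open>auto intro!: SUP_least enn_powr_mono SUP_upper\<close>)

lemma measurable_enn_powr [measurable]:
  assumes [measurable]: "f \<in> borel_measurable M"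
  shows "(\<lambda>x. enn_powr (f x) a) \<in> borel_measurable M"
  unfolding enn_powr_def by measurable

text \<open>Replaces the triangle inequality: \<open>x + y\<close> is at most twice the larger
  summand. The constant \<open>2 powr a\<close> serves exponents on either side of 1 at
  once.\<close>

lemma enn_powr_add_le:
  assumes "0 < a"
  shows "enn_powr (x + y) a \<le> ennreal (2 powr a) * (enn_powr x a + enn_powr y a)"
proof -
  have "enn_powr (x + y) a \<le> enn_powr (2 * max x y) a"
    using assms by (intro enn_powr_mono) (auto simp: mult_2 max_def intro: add_mono)
  also have "\<dots> = ennreal (2 powr a) * enn_powr (max x y) a"
    using assms enn_powr_ennreal[of 2 a] by (simp add: enn_powr_mult)
  also have "enn_powr (max x y) a \<le> enn_powr x a + enn_powr y a"
    by (auto simp: max_def intro: add_increasing add_increasing2)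
  finally show ?thesis
    by (meson mult_left_mono order_trans zero_le)
qed

section \<open>The inequalities of Young, Hoelder and Jensen and the layer-cake formula in
  [0, infinity]\<close>

lemma enn_powr_young:
  assumes "0 < \<theta>" "\<theta> < 1"
  shows "enn_powr x \<theta> * enn_powr y (1 - \<theta>) \<le> ennreal \<theta> * x + ennreal (1 - \<theta>) * y"
proof (cases "x = 0 \<or> y = 0 \<or> x = top \<or> y = top")
  case True
  then show ?thesis using assms by (auto simp: ennreal_mult_top)
next
  case False
  then obtain a b where "x = ennreal a" "0 < a" "y = ennreal b" "0 < b"
    by (cases x; cases y) (auto simp: ennreal_eq_0_iff less_le)
  with Youngs_inequality_0[of \<theta> "1 - \<theta>" a b] assms show ?thesis
    by (simp add: ennreal_mult[symmetric] ennreal_plus[symmetric] del: ennreal_plus)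
qed

text \<open>With the exponents \<theta> and 1 - \<theta> on the integrands no conjugate exponents
  have to be carried along. Dividing by the integrals A and B reduces the claim to Young's
  inequality under the integral. If A or B is 0, the left side vanishes even when the other one is
  infinite; otherwise an infinite A or B makes the right side infinite.\<close>

lemma nn_integral_holder:
  assumes [measurable]: "f \<in> borel_measurable M" "g \<in> borel_measurable M"
    and \<theta>: "0 < \<theta>" "\<theta> < 1"
  shows "(\<integral>\<^sup>+x. enn_powr (f x) \<theta> * enn_powr (g x) (1 - \<theta>) \<partial>M)
      \<le> enn_powr (\<integral>\<^sup>+x. f x \<partial>M) \<theta> * enn_powr (\<integral>\<^sup>+x. g x \<partial>M) (1 - \<theta>)"
proof -
  define A B where "A = (\<integral>\<^sup>+x. f x \<partial>M)" and "B = (\<integral>\<^sup>+x. g x \<partial>M)"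
  consider "A = 0 \<or> B = 0" | "A \<noteq> 0" "B \<noteq> 0" "A = top \<or> B = top" | "A \<noteq> 0" "B \<noteq> 0" "A \<noteq> top" "B \<noteq> top"
    by blast
  then show ?thesis
  proof cases
    case 1
    then have "AE x in M. enn_powr (f x) \<theta> * enn_powr (g x) (1 - \<theta>) = 0"
      by (auto simp: A_def B_def nn_integral_0_iff_AE)
    then have "(\<integral>\<^sup>+x. enn_powr (f x) \<theta> * enn_powr (g x) (1 - \<theta>) \<partial>M) = 0"
      by (subst nn_integral_0_iff_AE) auto
    then show ?thesis by simp
  next
    case 2
    then show ?thesis by (auto simp: A_def[symmetric] B_def[symmetric] ennreal_mult_top)
  next
    case 3
    let ?C = "enn_powr A \<theta> * enn_powr B (1 - \<theta>)"
    have *: "enn_powr (f x) \<theta> * enn_powr (g x) (1 - \<theta>) \<le> ?C * (ennreal \<theta> * (f x / A) + ennreal (1 - \<theta>) * (g x / B))" for x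
    proof -
      have "f x = A * (f x / A)" "g x = B * (g x / B)"
        using 3 by (simp_all add: ennreal_times_divide mult.commute[of A] mult.commute[of B] ennreal_mult_divide_eq)
      then have "enn_powr (f x) \<theta> = enn_powr A \<theta> * enn_powr (f x / A) \<theta>"
        "enn_powr (g x) (1 - \<theta>) = enn_powr B (1 - \<theta>) * enn_powr (g x / B) (1 - \<theta>)"
        using \<theta> by (metis enn_powr_mult, metis enn_powr_mult diff_gt_0_iff_gt)
      then have "enn_powr (f x) \<theta> * enn_powr (g x) (1 - \<theta>)
        = ?C * (enn_powr (f x / A) \<theta> * enn_powr (g x / B) (1 - \<theta>))"
        by (simp add: mult_ac)
      also have "\<dots> \<le> ?C * (ennreal \<theta> * (f x / A) + ennreal (1 - \<theta>) * (g x / B))"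
        by (intro mult_left_mono enn_powr_young \<theta>) auto
      finally show ?thesis .
    qed
    have "(\<integral>\<^sup>+x. enn_powr (f x) \<theta> * enn_powr (g x) (1 - \<theta>) \<partial>M)
       \<le> (\<integral>\<^sup>+x. ?C * (ennreal \<theta> * (f x / A) + ennreal (1 - \<theta>) * (g x / B)) \<partial>M)"
      by (intro nn_integral_mono *)
    also have "\<dots> = ?C * (ennreal \<theta> * (A / A) + ennreal (1 - \<theta>) * (B / B))"
      by (simp add: nn_integral_cmult nn_integral_add nn_integral_divide A_def B_def)
    also have "\<dots> = ?C"
      using 3 \<theta> by (simp add: ennreal_divide_self less_top ennreal_plus[symmetric] del: ennreal_plus)
    finally show ?thesis by (simp add: A_def B_def)
  qed
qed

text \<open>Jensen's inequality for the measure with density w, whose mass is not normalised and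
  hence appears to the power q - 1. It is Hoelder's inequality applied to
  \<open>enn_powr (h x) q * w x\<close> and \<open>w x\<close> with \<theta> = 1 / q.\<close>

lemma nn_integral_jensen:
  assumes [measurable]: "h \<in> borel_measurable M" "w \<in> borel_measurable M"
    and q: "1 \<le> q" and w: "\<And>x. w x < top"
  shows "enn_powr (\<integral>\<^sup>+x. h x * w x \<partial>M) q
      \<le> enn_powr (\<integral>\<^sup>+x. w x \<partial>M) (q - 1) * (\<integral>\<^sup>+x. enn_powr (h x) q * w x \<partial>M)"
proof (cases "q = 1")
  case True
  show ?thesis
  \<comment> \<open>The factor \<open>enn_powr 0 0\<close> is 0 and not 1, so a weight of total mass
    0 is treated apart.\<close>
  proof (cases "(\<integral>\<^sup>+x. w x \<partial>M) = 0")
    case T: True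
    then have "AE x in M. w x = 0" by (simp add: nn_integral_0_iff_AE)
    then have "(\<integral>\<^sup>+x. h x * w x \<partial>M) = 0" by (subst nn_integral_0_iff_AE) auto
    then show ?thesis by simp
  next
    case F: False
    then have "1 \<le> enn_powr (\<integral>\<^sup>+x. w x \<partial>M) (q - 1)"
      using True by (cases "\<integral>\<^sup>+x. w x \<partial>M") auto
    then have "1 * (\<integral>\<^sup>+x. h x * w x \<partial>M) \<le> enn_powr (\<integral>\<^sup>+x. w x \<partial>M) (q - 1) * (\<integral>\<^sup>+x. h x * w x \<partial>M)"
      by (intro mult_right_mono) auto
    then show ?thesis using True by simp
  qed
next
  case False
  then have q: "1 < q" using q by simp
  define \<theta> where "\<theta> = 1 / q"
  have \<theta>: "0 < \<theta>" "\<theta> < 1" using q by (auto simp: \<theta>_def)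
  have eq: "h x * w x = enn_powr (enn_powr (h x) q * w x) \<theta> * enn_powr (w x) (1 - \<theta>)" for x
  proof -
    have "enn_powr (enn_powr (h x) q * w x) \<theta> * enn_powr (w x) (1 - \<theta>)
      = h x * (enn_powr (w x) \<theta> * enn_powr (w x) (1 - \<theta>))"
      using \<theta> q by (simp add: enn_powr_mult enn_powr_powr \<theta>_def mult.assoc)
    also have "enn_powr (w x) \<theta> * enn_powr (w x) (1 - \<theta>) = w x"
      using enn_powr_add[of \<theta> "1 - \<theta>" "w x"] \<theta> by simp
    finally show ?thesis by simp
  qed
  have "(\<integral>\<^sup>+x. h x * w x \<partial>M) \<le> enn_powr (\<integral>\<^sup>+x. enn_powr (h x) q * w x \<partial>M) \<theta> * enn_powr (\<integral>\<^sup>+x. w x \<partial>M) (1 - \<theta>)"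
    unfolding eq by (intro nn_integral_holder \<theta>) auto
  then have "enn_powr (\<integral>\<^sup>+x. h x * w x \<partial>M) q \<le> enn_powr (enn_powr (\<integral>\<^sup>+x. enn_powr (h x) q * w x \<partial>M) \<theta> * enn_powr (\<integral>\<^sup>+x. w x \<partial>M) (1 - \<theta>)) q"
    using q by (intro enn_powr_mono) auto
  also have "\<dots> = (\<integral>\<^sup>+x. enn_powr (h x) q * w x \<partial>M) * enn_powr (\<integral>\<^sup>+x. w x \<partial>M) (q - 1)"
    using q by (simp add: enn_powr_mult enn_powr_powr \<theta>_def left_diff_distrib)
  finally show ?thesis by (simp add: mult.commute)
qed

text \<open>The layer-cake formula before integration over the underlying space: integrating it in a
  further variable and exchanging the integrals turns distribution functions into L_p norms.
  Phrasing the levels as \<open>ennreal l < y\<close> includes y = infinity.\<close>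

lemma nn_integral_layer:
  assumes "0 < \<alpha>"
  shows "(\<integral>\<^sup>+l. ennreal (\<alpha> * l powr (\<alpha> - 1)) * indicator {l. 0 < l \<and> ennreal l < y} l \<partial>lborel) = enn_powr y \<alpha>"
proof -
  have fin: "(\<integral>\<^sup>+l. ennreal (\<alpha> * l powr (\<alpha> - 1)) * indicator {0<..<r} l \<partial>lborel) = ennreal (r powr \<alpha>)"
    if r: "0 \<le> r" for r :: real
  proof -
    have "((\<lambda>l. \<alpha> * l powr (\<alpha> - 1)) has_integral \<alpha> * (r powr (\<alpha> - 1 + 1) / (\<alpha> - 1 + 1))) {0..r}"
      using assms r by (intro has_integral_mult_right has_integral_powr_from_0) auto
    then have "(\<integral>\<^sup>+l. ennreal (\<alpha> * l powr (\<alpha> - 1)) * indicator {0..r} l \<partial>lborel) = ennreal (r powr \<alpha>)"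
      using assms by (subst nn_integral_has_integral_lebesgue') auto
    moreover have "(\<integral>\<^sup>+l. ennreal (\<alpha> * l powr (\<alpha> - 1)) * indicator {0<..<r} l \<partial>lborel)
      = (\<integral>\<^sup>+l. ennreal (\<alpha> * l powr (\<alpha> - 1)) * indicator {0..r} l \<partial>lborel)"
    proof (rule nn_integral_cong_AE)
      show "AE l in lborel. ennreal (\<alpha> * l powr (\<alpha> - 1)) * indicator {0<..<r} l = ennreal (\<alpha> * l powr (\<alpha> - 1)) * indicator {0..r} l"
        using AE_lborel_singleton[of 0] AE_lborel_singleton[of r]
        by eventually_elim (auto simp: indicator_def)
    qed
    ultimately show ?thesis by simp
  qed
  show ?thesis
  proof (cases y)
    case (real r)
    then have "{l. 0 < l \<and> ennreal l < y} = {0<..<r}"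
      by (auto simp: ennreal_less_iff)
    then show ?thesis using fin[OF real(1)] real by simp
  next
    case top
    have *: "ennreal (n powr \<alpha>) \<le> (\<integral>\<^sup>+l. ennreal (\<alpha> * l powr (\<alpha> - 1)) * indicator {l. 0 < l \<and> ennreal l < y} l \<partial>lborel)" if "0 \<le> n" for n
      unfolding fin[OF that, symmetric] using top by (intro nn_integral_mono) (auto simp: indicator_def)
    then have large: "ennreal x \<le> (\<integral>\<^sup>+l. ennreal (\<alpha> * l powr (\<alpha> - 1)) * indicator {l. 0 < l \<and> ennreal l < y} l \<partial>lborel)" if "0 \<le> x" for x
      using assms that *[of "x powr (1 / \<alpha>)"] by (simp add: powr_powr)
    have "(\<integral>\<^sup>+l. ennreal (\<alpha> * l powr (\<alpha> - 1)) * indicator {l. 0 < l \<and> ennreal l < y} l \<partial>lborel) = top"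
    proof (cases "\<integral>\<^sup>+l. ennreal (\<alpha> * l powr (\<alpha> - 1)) * indicator {l. 0 < l \<and> ennreal l < y} l \<partial>lborel")
      case (real c)
      then show ?thesis using large[of "c + 1"] by simp
    qed
    then show ?thesis using top by simp
  qed
qed

section \<open>The Hardy--Littlewood maximal function\<close>

text \<open>The uncentred maximal function: every ball containing x competes, so superlevel sets are
  unions of open balls and \<open>maximal g\<close> is Borel. Integrals are divided by the radius to
  the power d and not by the volume, hence the factors \<open>unit_ball_vol\<close> below.\<close>

definition maximal :: "('a::euclidean_space \<Rightarrow> ennreal) \<Rightarrow> 'a \<Rightarrow> ennreal" where
  "maximal g x = (SUP (y, \<rho>) \<in> {(y, \<rho>). 0 < \<rho> \<and> x \<in> ball y \<rho>}.
     (\<integral>\<^sup>+z\<in>ball y \<rho>. g z \<partial>lborel) / ennreal (\<rho> ^ DIM('a)))"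

lemma ball_average_le_maximal:
  fixes g :: "'a::euclidean_space \<Rightarrow> ennreal"
  assumes "0 < \<rho>" "x \<in> ball y \<rho>"
  shows "(\<integral>\<^sup>+z\<in>ball y \<rho>. g z \<partial>lborel) \<le> ennreal (\<rho> ^ DIM('a)) * maximal g x"
proof -
  have "(\<integral>\<^sup>+z\<in>ball y \<rho>. g z \<partial>lborel) / ennreal (\<rho> ^ DIM('a)) \<le> maximal g x"
    unfolding maximal_def using assms by (intro SUP_upper2[of "(y, \<rho>)"]) auto
  then have "(\<integral>\<^sup>+z\<in>ball y \<rho>. g z \<partial>lborel) / ennreal (\<rho> ^ DIM('a)) * ennreal (\<rho> ^ DIM('a)) \<le> maximal g x * ennreal (\<rho> ^ DIM('a))"
    by (intro mult_right_mono) auto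
  then have "(\<integral>\<^sup>+z\<in>ball y \<rho>. g z \<partial>lborel) \<le> maximal g x * ennreal (\<rho> ^ DIM('a))"
    using assms by (simp add: ennreal_divide_times ennreal_divide_self)
  then show ?thesis
    by (simp add: mult.commute)
qed

lemma maximal_gt_eq:
  fixes g :: "'a::euclidean_space \<Rightarrow> ennreal"
  shows "{x. l < maximal g x} = (\<Union>(y, \<rho>) \<in> {(y, \<rho>). 0 < \<rho> \<and> l < (\<integral>\<^sup>+z\<in>ball y \<rho>. g z \<partial>lborel) / ennreal (\<rho> ^ DIM('a))}. ball y \<rho>)"
  unfolding maximal_def less_SUP_iff by (auto 4 4 simp: Bex_def)

lemma borel_measurable_maximal [measurable]: "maximal g \<in> borel_measurable borel"
proof (rule borel_measurableI_greater)
  fix l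
  have "open {x. l < maximal g x}"
    unfolding maximal_gt_eq by auto
  then show "{x \<in> space borel. l < maximal g x} \<in> sets borel"
    by simp
qed

lemma maximal_mono: "(\<And>x. g x \<le> h x) \<Longrightarrow> maximal g x \<le> maximal h x"
  unfolding maximal_def
  by (intro SUP_mono) (force intro!: divide_right_mono_ennreal nn_integral_mono mult_right_mono)

lemma maximal_add_le:
  assumes [measurable]: "g \<in> borel_measurable borel" "h \<in> borel_measurable borel"
  shows "maximal (\<lambda>x. g x + h x) x \<le> maximal g x + maximal h x"
  unfolding maximal_def
proof (intro SUP_least, clarsimp simp: distrib_right nn_integral_add add_divide_distrib_ennreal simp del: mem_ball)
  fix y :: 'a and \<rho> :: real assume "0 < \<rho>" "x \<in> ball y \<rho>"
  then show "(\<integral>\<^sup>+z\<in>ball y \<rho>. g z \<partial>lborel) / ennreal (\<rho> ^ DIM('a)) + (\<integral>\<^sup>+z\<in>ball y \<rho>. h z \<partial>lborel) / ennreal (\<rho> ^ DIM('a))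
    \<le> (SUP (y, \<rho>)\<in>{(y, \<rho>). 0 < \<rho> \<and> x \<in> ball y \<rho>}. (\<integral>\<^sup>+z\<in>ball y \<rho>. g z \<partial>lborel) / ennreal (\<rho> ^ DIM('a))) +
       (SUP (y, \<rho>)\<in>{(y, \<rho>). 0 < \<rho> \<and> x \<in> ball y \<rho>}. (\<integral>\<^sup>+z\<in>ball y \<rho>. h z \<partial>lborel) / ennreal (\<rho> ^ DIM('a)))"
    by (intro add_mono SUP_upper2[of "(y, \<rho>)"]) auto
qed

lemma maximal_const_le:
  "maximal (\<lambda>_. c) (x::'a::euclidean_space) \<le> c * ennreal (unit_ball_vol (DIM('a)))"
  unfolding maximal_def
proof (intro SUP_least, clarsimp)
  fix y :: 'a and \<rho> :: real assume "0 < \<rho>"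
  then have "(\<integral>\<^sup>+z\<in>ball y \<rho>. c \<partial>lborel) = c * ennreal (unit_ball_vol (DIM('a))) * ennreal (\<rho> ^ DIM('a))"
    by (subst nn_integral_cmult_indicator) (auto simp: emeasure_ball ennreal_mult mult.assoc)
  then show "(\<integral>\<^sup>+z\<in>ball y \<rho>. c \<partial>lborel) / ennreal (\<rho> ^ DIM('a)) \<le> c * ennreal (unit_ball_vol (DIM('a)))"
    using \<open>0 < \<rho>\<close> by (simp add: ennreal_mult_divide_eq)
qed

text \<open>Vitali covering: each point of the superlevel set lies in a ball of some radius \<rho>
  over which g has integral at least l \<rho>^n. A disjoint subfamily whose fivefold dilates still
  cover the set gives the factor 5^n, and by disjointness the integrals add up to at most the
  integral of g.\<close>

lemma maximal_weak_type:
  fixes g :: "'a::euclidean_space \<Rightarrow> ennreal"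
  assumes [measurable]: "g \<in> borel_measurable borel" and l: "0 < l"
  shows "ennreal l * emeasure lborel {x. ennreal l < maximal g x}
    \<le> ennreal (5 ^ DIM('a) * unit_ball_vol (DIM('a))) * (\<integral>\<^sup>+x. g x \<partial>lborel)"
proof (cases "(\<integral>\<^sup>+x. g x \<partial>lborel) = top")
  case True
  then show ?thesis using unit_ball_vol_pos[of "DIM('a)"] by (simp add: ennreal_mult_top less_le)
next
  case False
  then obtain I where I: "0 \<le> I" "(\<integral>\<^sup>+x. g x \<partial>lborel) = ennreal I"
    by (cases "\<integral>\<^sup>+x. g x \<partial>lborel") auto
  define n where "n = DIM('a)"
  have n: "0 < n" by (simp add: n_def)
  define A where "A = 5 ^ n * unit_ball_vol n"
  have A: "0 \<le> A" by (simp add: A_def)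
  define K where "K = {(y::'a, \<rho>). 0 < \<rho> \<and> ennreal l < (\<integral>\<^sup>+z\<in>ball y \<rho>. g z \<partial>lborel) / ennreal (\<rho> ^ n)}"
  have Kd: "0 < \<rho>" "ennreal (l * \<rho> ^ n) \<le> (\<integral>\<^sup>+z\<in>ball y \<rho>. g z \<partial>lborel)" if "(y, \<rho>) \<in> K" for y \<rho>
  proof -
    show r: "0 < \<rho>" using that by (simp add: K_def)
    from that have "ennreal l < (\<integral>\<^sup>+z\<in>ball y \<rho>. g z \<partial>lborel) / ennreal (\<rho> ^ n)" by (simp add: K_def)
    then have "ennreal l * ennreal (\<rho> ^ n) \<le> (\<integral>\<^sup>+z\<in>ball y \<rho>. g z \<partial>lborel) / ennreal (\<rho> ^ n) * ennreal (\<rho> ^ n)"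
      by (intro mult_right_mono) auto
    also have "\<dots> = (\<integral>\<^sup>+z\<in>ball y \<rho>. g z \<partial>lborel)"
      using r by (simp add: ennreal_divide_times ennreal_divide_self)
    finally show "ennreal (l * \<rho> ^ n) \<le> (\<integral>\<^sup>+z\<in>ball y \<rho>. g z \<partial>lborel)"
      using l r by (simp add: ennreal_mult)
  qed
  \<comment> \<open>The covering lemma asks for bounded radii. The finite integral bounds
    \<open>\<rho> ^ n\<close> by \<open>I / l\<close>, and \<rho> is at most
    \<open>\<rho> ^ n\<close> as soon as it is at least 1.\<close>
  have bnd: "0 < snd i \<and> snd i \<le> max 1 (I / l)" if "i \<in> K" for i
  proof -
    obtain y \<rho> where i: "i = (y, \<rho>)" by force
    from Kd[of y \<rho>] that i have r: "0 < \<rho>" by auto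
    from Kd[of y \<rho>] that i have "ennreal (l * \<rho> ^ n) \<le> (\<integral>\<^sup>+z\<in>ball y \<rho>. g z \<partial>lborel)" by auto
    also have "(\<integral>\<^sup>+z\<in>ball y \<rho>. g z \<partial>lborel) \<le> (\<integral>\<^sup>+x. g x \<partial>lborel)"
      by (intro nn_integral_mono) (auto simp: indicator_def)
    finally have "l * \<rho> ^ n \<le> I" using I l r by simp
    then have "\<rho> ^ n \<le> I / l" using l by (simp add: field_simps)
    moreover have "1 \<le> \<rho> \<Longrightarrow> \<rho> \<le> \<rho> ^ n" using n by (simp add: self_le_power)
    ultimately show ?thesis using r i by (cases "1 \<le> \<rho>") auto
  qed
  obtain C where C: "countable C" "C \<subseteq> K"
     "pairwise (\<lambda>i j. disjnt (ball (fst i) (snd i)) (ball (fst j) (snd j))) C"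
     "{x. ennreal l < maximal g x} \<subseteq> (\<Union>i\<in>C. ball (fst i) (5 * snd i))"
  proof (rule Vitali_covering_lemma_balls[where S = "{x. ennreal l < maximal g x}" and K = K and a = fst and r = snd and B = "max 1 (I / l)"])
    show "{x. ennreal l < maximal g x} \<subseteq> (\<Union>i\<in>K. ball (fst i) (snd i))"
      unfolding maximal_gt_eq K_def n_def by force
  qed (use bnd in auto)
  have "emeasure lborel {x. ennreal l < maximal g x} = (\<integral>\<^sup>+x. indicator {x. ennreal l < maximal g x} x \<partial>lborel)"
    by (subst nn_integral_indicator) auto
  also have "\<dots> \<le> (\<integral>\<^sup>+x. (\<integral>\<^sup>+i. indicator (ball (fst i) (5 * snd i)) x \<partial>count_space C) \<partial>lborel)"
  proof (intro nn_integral_mono)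
    fix x :: 'a
    show "indicator {x. ennreal l < maximal g x} x \<le> (\<integral>\<^sup>+i. indicator (ball (fst i) (5 * snd i)) x \<partial>count_space C)"
    proof (cases "ennreal l < maximal g x")
      case True
      then obtain j where j: "j \<in> C" "x \<in> ball (fst j) (5 * snd j)" using C(4) by auto
      have "1 = (\<integral>\<^sup>+i. indicator {j} i \<partial>count_space C)"
        using j by (subst nn_integral_indicator) auto
      also have "\<dots> \<le> (\<integral>\<^sup>+i. indicator (ball (fst i) (5 * snd i)) x \<partial>count_space C)"
        using j by (intro nn_integral_mono) (auto simp: indicator_def)
      finally show ?thesis using True by simp
    qed simp
  qed
  also have "\<dots> = (\<integral>\<^sup>+i. emeasure lborel (ball (fst i) (5 * snd i)) \<partial>count_space C)"
    using C(1) by (subst nn_integral_count_space_nn_integral) (auto intro!: borel_measurable_indicator)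
  also have "\<dots> = (\<integral>\<^sup>+i. ennreal (A * snd i ^ n) \<partial>count_space C)"
  proof (rule nn_integral_cong)
    fix i assume "i \<in> space (count_space C)"
    then have "0 < snd i" using bnd[of i] subsetD[OF C(2), of i] by simp
    then show "emeasure lborel (ball (fst i) (5 * snd i)) = ennreal (A * snd i ^ n)"
      by (simp add: emeasure_ball A_def n_def power_mult_distrib mult_ac)
  qed
  finally have "ennreal l * emeasure lborel {x. ennreal l < maximal g x} \<le> ennreal l * (\<integral>\<^sup>+i. ennreal (A * snd i ^ n) \<partial>count_space C)"
    by (intro mult_left_mono) auto
  also have "\<dots> = (\<integral>\<^sup>+i. ennreal l * ennreal (A * snd i ^ n) \<partial>count_space C)"
    by (simp add: nn_integral_cmult)
  also have "\<dots> = (\<integral>\<^sup>+i. ennreal A * ennreal (l * snd i ^ n) \<partial>count_space C)"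
  proof (rule nn_integral_cong)
    fix i assume "i \<in> space (count_space C)"
    then have "0 < snd i" using bnd[of i] subsetD[OF C(2), of i] by simp
    then show "ennreal l * ennreal (A * snd i ^ n) = ennreal A * ennreal (l * snd i ^ n)"
      using l A by (simp add: ennreal_mult[symmetric] mult_ac)
  qed
  also have "\<dots> \<le> (\<integral>\<^sup>+i. ennreal A * emeasure (density lborel g) (ball (fst i) (snd i)) \<partial>count_space C)"
  proof (intro nn_integral_mono mult_left_mono)
    fix i assume "i \<in> space (count_space C)"
    then have "i \<in> K" using C(2) by auto
    with Kd[of "fst i" "snd i"] show "ennreal (l * snd i ^ n) \<le> emeasure (density lborel g) (ball (fst i) (snd i))"
      by (simp add: emeasure_density)
  qed auto
  also have "\<dots> = ennreal A * (\<integral>\<^sup>+i. emeasure (density lborel g) (ball (fst i) (snd i)) \<partial>count_space C)"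
    by (simp add: nn_integral_cmult)
  \<comment> \<open>The sum over disjoint balls is the mass that the measure with density
    \<open>g\<close> gives to their union.\<close>
  also have "(\<integral>\<^sup>+i. emeasure (density lborel g) (ball (fst i) (snd i)) \<partial>count_space C)
    = emeasure (density lborel g) (\<Union>i\<in>C. ball (fst i) (snd i))"
  proof (rule emeasure_UN_countable[symmetric])
    show "disjoint_family_on (\<lambda>i. ball (fst i) (snd i)) C"
      using C(3) by (auto simp: disjoint_family_on_def pairwise_def disjnt_def)
  qed (use C in auto)
  also have "\<dots> \<le> emeasure (density lborel g) UNIV"
    by (intro emeasure_mono) auto
  also have "\<dots> = (\<integral>\<^sup>+x. g x \<partial>lborel)"
    by (simp add: emeasure_density)
  finally show ?thesis
    by (simp add: A_def n_def mult_left_mono)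
qed

text \<open>Marcinkiewicz interpolation done by hand: at level l only the part of g above l / (2
  \<omega>) matters. The layer-cake formula is used with exponent v for \<open>maximal g\<close>
  and, after exchanging the integrals, with exponent v - 1 for g; this is where v > 1
  enters.\<close>

lemma maximal_strong_type:
  assumes v: "1 < v"
  obtains C :: real where "0 < C" "\<And>g :: 'a::euclidean_space \<Rightarrow> ennreal. g \<in> borel_measurable borel \<Longrightarrow>
    (\<integral>\<^sup>+x. enn_powr (maximal g x) v \<partial>lborel) \<le> ennreal C * (\<integral>\<^sup>+x. enn_powr (g x) v \<partial>lborel)"
proof -
  define \<omega> where "\<omega> = unit_ball_vol (DIM('a))"
  have \<omega>: "0 < \<omega>" by (simp add: \<omega>_def)
  define A where "A = 5 ^ DIM('a) * \<omega>"
  have A: "0 < A" using \<omega> by (simp add: A_def)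
  define C where "C = 2 * A * v / (v - 1) * (2 * \<omega>) powr (v - 1)"
  have "0 < C" using \<omega> A v by (simp add: C_def)
  moreover have "(\<integral>\<^sup>+x. enn_powr (maximal g x) v \<partial>lborel) \<le> ennreal C * (\<integral>\<^sup>+x. enn_powr (g x) v \<partial>lborel)"
    if [measurable]: "g \<in> borel_measurable borel" for g :: "'a \<Rightarrow> ennreal"
  proof -
    have lev: "ennreal l * emeasure lborel {x. ennreal l < maximal g x}
        \<le> ennreal (2 * A) * (\<integral>\<^sup>+x. g x * indicator {x. ennreal l < ennreal (2 * \<omega>) * g x} x \<partial>lborel)" if l: "0 < l" for l
    proof -
      let ?E = "{x. ennreal l < ennreal (2 * \<omega>) * g x}"
      \<comment> \<open>The discarded part is at most \<open>l / (2 * \<omega>)\<close>, so by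
        \<open>maximal_const_le\<close> its maximal function is at most l / 2, and the retained part
        must reach the other half of the level.\<close>
      have "g x \<le> g x * indicator ?E x + ennreal (l / (2 * \<omega>))" for x
      proof (cases "x \<in> ?E")
        case False
        then have "ennreal (2 * \<omega>) * g x \<le> ennreal l" by simp
        then have "g x \<le> ennreal (l / (2 * \<omega>))"
          using \<omega> l by (cases "g x") (auto simp: ennreal_mult[symmetric] ennreal_mult_top field_simps top_unique)
        then show ?thesis by (simp add: add_increasing)
      qed simp
      then have "maximal g x \<le> maximal (\<lambda>x. g x * indicator ?E x + ennreal (l / (2 * \<omega>))) x" for x
        by (rule maximal_mono)
      also have "\<dots> x \<le> maximal (\<lambda>x. g x * indicator ?E x) x + maximal (\<lambda>x. ennreal (l / (2 * \<omega>))) x" for x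
        by (intro maximal_add_le) auto
      also have "\<dots> x \<le> maximal (\<lambda>x. g x * indicator ?E x) x + ennreal (l / (2 * \<omega>)) * ennreal \<omega>" for x
        unfolding \<omega>_def by (intro add_left_mono maximal_const_le)
      also have "ennreal (l / (2 * \<omega>)) * ennreal \<omega> = ennreal (l / 2)"
        using \<omega> l by (simp add: ennreal_mult[symmetric])
      finally have *: "maximal g x \<le> maximal (\<lambda>x. g x * indicator ?E x) x + ennreal (l / 2)" for x .
      have "{x. ennreal l < maximal g x} \<subseteq> {x. ennreal (l / 2) < maximal (\<lambda>x. g x * indicator ?E x) x}"
      proof safe
        fix x assume "ennreal l < maximal g x"
        show "ennreal (l / 2) < maximal (\<lambda>x. g x * indicator ?E x) x"
        proof (rule ccontr)
          assume "\<not> ?thesis"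
          then have "maximal (\<lambda>x. g x * indicator ?E x) x + ennreal (l / 2) \<le> ennreal (l / 2) + ennreal (l / 2)"
            by (intro add_mono) auto
          also have "\<dots> = ennreal l" using l by (simp add: ennreal_plus[symmetric] del: ennreal_plus)
          finally show False using *[of x] \<open>ennreal l < maximal g x\<close> by auto
        qed
      qed
      then have "emeasure lborel {x. ennreal l < maximal g x} \<le> emeasure lborel {x. ennreal (l / 2) < maximal (\<lambda>x. g x * indicator ?E x) x}"
        by (intro emeasure_mono) auto
      then have "ennreal l * emeasure lborel {x. ennreal l < maximal g x} \<le> 2 * (ennreal (l / 2) * emeasure lborel {x. ennreal (l / 2) < maximal (\<lambda>x. g x * indicator ?E x) x})"
        using l numeral_mult_ennreal[of "l/2" "Num.Bit0 num.One"] by (simp add: mult.assoc[symmetric] mult_left_mono)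
      also have "\<dots> \<le> 2 * (ennreal A * (\<integral>\<^sup>+x. g x * indicator ?E x \<partial>lborel))"
        unfolding A_def \<omega>_def using l by (intro mult_left_mono maximal_weak_type) auto
      also have "\<dots> = ennreal (2 * A) * (\<integral>\<^sup>+x. g x * indicator ?E x \<partial>lborel)"
        using A numeral_mult_ennreal[of A "Num.Bit0 num.One"] by (simp add: mult.assoc[symmetric])
      finally show ?thesis .
    qed
    have "(\<integral>\<^sup>+x. enn_powr (maximal g x) v \<partial>lborel)
      = (\<integral>\<^sup>+x. (\<integral>\<^sup>+l. ennreal (v * l powr (v - 1)) * indicator {l. 0 < l \<and> ennreal l < maximal g x} l \<partial>lborel) \<partial>lborel)"
      using v by (subst nn_integral_layer) auto
    also have "\<dots> = (\<integral>\<^sup>+l. (\<integral>\<^sup>+x. ennreal (v * l powr (v - 1)) * indicator {l. 0 < l \<and> ennreal l < maximal g x} l \<partial>lborel) \<partial>lborel)"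
      by (rule lborel_pair.Fubini') (simp add: split_def indicator_def)
    \<comment> \<open>The bound \<open>lev\<close> consumes one factor l, lowering its power from v
      - 1 to v - 2. The integrand is grouped so that the integral over l is the layer-cake formula
      with exponent v - 1.\<close>
    also have "\<dots> \<le> (\<integral>\<^sup>+l. (\<integral>\<^sup>+x. ennreal (2 * A * v / (v - 1)) * g x * (ennreal ((v - 1) * l powr (v - 1 - 1)) * indicator {l. 0 < l \<and> ennreal l < ennreal (2 * \<omega>) * g x} l) \<partial>lborel) \<partial>lborel)"
    proof (rule nn_integral_mono)
      fix l :: real
      show "(\<integral>\<^sup>+x. ennreal (v * l powr (v - 1)) * indicator {l. 0 < l \<and> ennreal l < maximal g x} l \<partial>lborel) \<le> (\<integral>\<^sup>+x. ennreal (2 * A * v / (v - 1)) * g x * (ennreal ((v - 1) * l powr (v - 1 - 1)) * indicator {l. 0 < l \<and> ennreal l < ennreal (2 * \<omega>) * g x} l) \<partial>lborel)"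
      proof (cases "0 < l")
        case True
        have "(\<integral>\<^sup>+x. ennreal (v * l powr (v - 1)) * indicator {l. 0 < l \<and> ennreal l < maximal g x} l \<partial>lborel)
          = (\<integral>\<^sup>+x. ennreal (v * l powr (v - 1)) * indicator {x. ennreal l < maximal g x} x \<partial>lborel)"
          using True by (intro nn_integral_cong) (auto simp: indicator_def)
        also have "\<dots> = ennreal (v * l powr (v - 1)) * emeasure lborel {x. ennreal l < maximal g x}"
          by (subst nn_integral_cmult) auto
        also have "\<dots> = ennreal (v * l powr (v - 2)) * (ennreal l * emeasure lborel {x. ennreal l < maximal g x})"
        proof -
          have "v * l powr (v - 1) = v * l powr (v - 2) * l"
            using powr_add[of l "v - 2" 1] True by simp
          then show ?thesis using True v by (simp add: ennreal_mult mult.assoc)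
        qed
        also have "\<dots> \<le> ennreal (v * l powr (v - 2)) * (ennreal (2 * A) * (\<integral>\<^sup>+x. g x * indicator {x. ennreal l < ennreal (2 * \<omega>) * g x} x \<partial>lborel))"
          by (intro mult_left_mono lev True) auto
        also have "\<dots> = (\<integral>\<^sup>+x. ennreal (v * l powr (v - 2) * (2 * A)) * (g x * indicator {x. ennreal l < ennreal (2 * \<omega>) * g x} x) \<partial>lborel)"
          using v A by (subst nn_integral_cmult) (auto simp: mult.assoc ennreal_mult)
        also have "\<dots> = (\<integral>\<^sup>+x. ennreal (2 * A * v / (v - 1)) * g x * (ennreal ((v - 1) * l powr (v - 1 - 1)) * indicator {l. 0 < l \<and> ennreal l < ennreal (2 * \<omega>) * g x} l) \<partial>lborel)"
        proof (intro nn_integral_cong)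
          fix x
          have "v * l powr (v - 2) * (2 * A) = 2 * A * v / (v - 1) * ((v - 1) * l powr (v - 1 - 1))"
            using v by simp
          then have "ennreal (v * l powr (v - 2) * (2 * A)) = ennreal (2 * A * v / (v - 1)) * ennreal ((v - 1) * l powr (v - 1 - 1))"
            using v A by (subst ennreal_mult[symmetric]) auto
          then show "ennreal (v * l powr (v - 2) * (2 * A)) * (g x * indicator {x. ennreal l < ennreal (2 * \<omega>) * g x} x) = ennreal (2 * A * v / (v - 1)) * g x * (ennreal ((v - 1) * l powr (v - 1 - 1)) * indicator {l. 0 < l \<and> ennreal l < ennreal (2 * \<omega>) * g x} l)"
            using True by (auto simp: indicator_def mult_ac)
        qed
        finally show ?thesis .
      qed simp
    qed
    also have "\<dots> = (\<integral>\<^sup>+x. (\<integral>\<^sup>+l. ennreal (2 * A * v / (v - 1)) * g x * (ennreal ((v - 1) * l powr (v - 1 - 1)) * indicator {l. 0 < l \<and> ennreal l < ennreal (2 * \<omega>) * g x} l) \<partial>lborel) \<partial>lborel)"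
      by (rule lborel_pair.Fubini') (simp add: split_def indicator_def)
    also have "\<dots> = (\<integral>\<^sup>+x. ennreal (2 * A * v / (v - 1)) * g x * (\<integral>\<^sup>+l. (ennreal ((v - 1) * l powr (v - 1 - 1)) * indicator {l. 0 < l \<and> ennreal l < ennreal (2 * \<omega>) * g x} l) \<partial>lborel) \<partial>lborel)"
      by (subst nn_integral_cmult) auto
    also have "\<dots> = (\<integral>\<^sup>+x. ennreal (2 * A * v / (v - 1)) * g x * enn_powr (ennreal (2 * \<omega>) * g x) (v - 1) \<partial>lborel)"
      using v by (subst nn_integral_layer) auto
    also have "\<dots> = (\<integral>\<^sup>+x. ennreal C * enn_powr (g x) v \<partial>lborel)"
    proof (rule nn_integral_cong)
      fix x
      have "ennreal (2 * A * v / (v - 1)) * g x * enn_powr (ennreal (2 * \<omega>) * g x) (v - 1)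
        = ennreal (2 * A * v / (v - 1)) * ennreal ((2 * \<omega>) powr (v - 1)) * (enn_powr (g x) 1 * enn_powr (g x) (v - 1))"
        using v \<omega> by (simp add: enn_powr_mult mult_ac del: enn_powr_one) (simp add: mult_ac)
      also have "enn_powr (g x) 1 * enn_powr (g x) (v - 1) = enn_powr (g x) v"
        using v by (subst enn_powr_add[symmetric]) auto
      also have "ennreal (2 * A * v / (v - 1)) * ennreal ((2 * \<omega>) powr (v - 1)) = ennreal C"
        unfolding C_def using v A by (intro ennreal_mult[symmetric]) auto
      finally show "ennreal (2 * A * v / (v - 1)) * g x * enn_powr (ennreal (2 * \<omega>) * g x) (v - 1) = ennreal C * enn_powr (g x) v" .
    qed
    also have "\<dots> = ennreal C * (\<integral>\<^sup>+x. enn_powr (g x) v \<partial>lborel)"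
      by (simp add: nn_integral_cmult)
    finally show ?thesis .
  qed
  ultimately show ?thesis by (rule that)
qed

section \<open>A vector-valued inequality for convolutions\<close>

lemma ennreal_le_suminf: "(f i :: ennreal) \<le> (\<Sum>i. f i)"
  using sum_le_suminf[OF summableI, of "{i}" f] by simp

text \<open>The rescaling of (1 + |z|)^(-b) that preserves its integral: for b > d the mass is
  finite and does not depend on \<mu>. It is the common majorant of the kernels at frequency \<mu>
  and the weight of all averages.\<close>

definition decay :: "real \<Rightarrow> real \<Rightarrow> 'a::euclidean_space \<Rightarrow> real" where
  "decay b \<mu> z = \<mu> ^ DIM('a) * (1 + \<mu> * norm z) powr (- b)"

definition decay_conv :: "real \<Rightarrow> real \<Rightarrow> ('a::euclidean_space \<Rightarrow> ennreal) \<Rightarrow> 'a \<Rightarrow> ennreal" where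
  "decay_conv b \<mu> g x = (\<integral>\<^sup>+y. g y * ennreal (decay b \<mu> (y - x)) \<partial>lborel)"

lemma decay_nonneg [simp]: "0 \<le> \<mu> \<Longrightarrow> 0 \<le> decay b \<mu> z"
  by (simp add: decay_def)

lemma decay_minus_commute: "decay b \<mu> (x - y) = decay b \<mu> (y - x)"
  by (simp add: decay_def norm_minus_commute)

lemma borel_measurable_decay [measurable]: "decay b \<mu> \<in> borel_measurable borel"
  unfolding decay_def[abs_def] by measurable

lemma borel_measurable_decay_conv [measurable]:
  assumes [measurable]: "g \<in> borel_measurable borel"
  shows "decay_conv b \<mu> g \<in> borel_measurable borel"
  unfolding decay_conv_def[abs_def] by measurable

lemma decay_conv_mono: "(\<And>x. g x \<le> h x) \<Longrightarrow> decay_conv b \<mu> g x \<le> decay_conv b \<mu> h x"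
  unfolding decay_conv_def by (intro nn_integral_mono mult_right_mono) auto

lemma decay_conv_cmult:
  assumes [measurable]: "g \<in> borel_measurable borel"
  shows "decay_conv b \<mu> (\<lambda>x. c * g x) x = c * decay_conv b \<mu> g x"
  unfolding decay_conv_def by (simp add: mult.assoc nn_integral_cmult)

text \<open>The kernel is even, so Tonelli's theorem moves the averaging from g to w. The duality
  argument below rests on this identity.\<close>

lemma decay_conv_self_adjoint:
  fixes g w :: "'a::euclidean_space \<Rightarrow> ennreal"
  assumes [measurable]: "g \<in> borel_measurable borel" "w \<in> borel_measurable borel"
  shows "(\<integral>\<^sup>+x. decay_conv b \<mu> g x * w x \<partial>lborel) = (\<integral>\<^sup>+x. g x * decay_conv b \<mu> w x \<partial>lborel)"
proof -
  have "(\<integral>\<^sup>+x. decay_conv b \<mu> g x * w x \<partial>lborel) = (\<integral>\<^sup>+x. (\<integral>\<^sup>+y. g y * ennreal (decay b \<mu> (y - x)) * w x \<partial>lborel) \<partial>lborel)"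
    unfolding decay_conv_def by (simp add: nn_integral_multc)
  also have "\<dots> = (\<integral>\<^sup>+y. (\<integral>\<^sup>+x. g y * ennreal (decay b \<mu> (y - x)) * w x \<partial>lborel) \<partial>lborel)"
    by (rule lborel_pair.Fubini') (simp add: split_def)
  also have "\<dots> = (\<integral>\<^sup>+y. (\<integral>\<^sup>+x. g y * (w x * ennreal (decay b \<mu> (x - y))) \<partial>lborel) \<partial>lborel)"
    by (simp add: decay_minus_commute mult_ac)
  also have "\<dots> = (\<integral>\<^sup>+x. g x * decay_conv b \<mu> w x \<partial>lborel)"
    unfolding decay_conv_def by (simp add: nn_integral_cmult)
  finally show ?thesis .
qed

text \<open>A single term, the one with 2^l comparable to 1 + \<mu> |z|, already dominates the left
  side. Sums over dyadic balls make ball averages applicable.\<close>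

lemma decay_le_sum_indicator:
  fixes z :: "'a::euclidean_space"
  assumes \<mu>: "0 < \<mu>" and b: "0 < b"
  shows "ennreal (decay b \<mu> z) \<le> (\<Sum>l. ennreal (\<mu> ^ DIM('a) * 2 powr b * 2 powr (- (real l * b))) * indicator (ball 0 (2 ^ l / \<mu>)) z)"
proof -
  let ?f = "\<lambda>l. ennreal (\<mu> ^ DIM('a) * 2 powr b * 2 powr (- (real l * b))) * indicator (ball 0 (2 ^ l / \<mu>)) z"
  define l where "l = (LEAST l. \<mu> * norm z < 2 ^ l)"
  have ex: "\<exists>l. \<mu> * norm z < 2 ^ l" by (rule real_arch_pow) simp
  have l1: "\<mu> * norm z < 2 ^ l" unfolding l_def using ex by (rule LeastI_ex)
  \<comment> \<open>By minimality of l: either l = 0, or half of \<open>2 ^ l\<close> does not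
    exceed \<open>\<mu> * norm z\<close>.\<close>
  have l2: "2 ^ l \<le> 2 * (1 + \<mu> * norm z)"
  proof (cases l)
    case 0 then show ?thesis using \<mu> by (simp add: mult_nonneg_nonneg)
  next
    case (Suc k)
    then have "\<not> \<mu> * norm z < 2 ^ k" using not_less_Least[of k "\<lambda>l. \<mu> * norm z < 2 ^ l"] l_def by auto
    then show ?thesis using Suc by simp
  qed
  have "(1 + \<mu> * norm z) powr (- b) \<le> (2 ^ l / 2) powr (- b)"
    using l2 b by (intro powr_mono2') auto
  also have "\<dots> = 2 powr b * 2 powr (- (real l * b))"
  proof -
    have "(2::real) ^ l / 2 = 2 powr (real l - 1)"
      by (simp add: powr_diff powr_realpow)
    then have "(2 ^ l / 2) powr (- b) = 2 powr (b + - (real l * b))"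
      by (simp add: powr_powr algebra_simps)
    then show ?thesis by (simp only: powr_add)
  qed
  finally have "decay b \<mu> z \<le> \<mu> ^ DIM('a) * 2 powr b * 2 powr (- (real l * b))"
    unfolding decay_def using \<mu> by (simp add: mult.assoc)
  then have "ennreal (decay b \<mu> z) \<le> ?f l"
    using l1 \<mu> by (auto simp: indicator_def field_simps intro!: ennreal_leI)
  also have "\<dots> \<le> (\<Sum>l. ?f l)"
    by (rule ennreal_le_suminf)
  finally show ?thesis .
qed

text \<open>On the ball of radius 2^l / \<mu> the volume grows like 2^(l n) and the kernel decays
  like 2^(-l b). The powers of \<mu> cancel, and the remaining geometric series has ratio 2^(n - b),
  which is below 1 exactly when b exceeds the dimension. Hence C does not depend on \<mu>.\<close>

lemma decay_conv_le_maximal: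
  assumes b: "real DIM('a) < b"
  obtains C :: real where "0 < C" "\<And>\<mu> (g :: 'a::euclidean_space \<Rightarrow> ennreal) x. 0 < \<mu> \<Longrightarrow> g \<in> borel_measurable borel \<Longrightarrow>
    decay_conv b \<mu> g x \<le> ennreal C * maximal g x"
proof -
  define n where "n = DIM('a)"
  define \<rho> where "\<rho> = 2 powr (real n - b)"
  have \<rho>: "0 < \<rho>" "\<rho> < 1" using b by (auto simp: \<rho>_def n_def powr_less_one)
  define C where "C = 2 powr b * (1 / (1 - \<rho>))"
  have "0 < C" using \<rho> by (simp add: C_def)
  moreover have "decay_conv b \<mu> g x \<le> ennreal C * maximal g x"
    if \<mu>: "0 < \<mu>" and [measurable]: "g \<in> borel_measurable borel" for \<mu> and g :: "'a \<Rightarrow> ennreal" and x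
  proof -
    let ?c = "\<lambda>l. ennreal (\<mu> ^ n * 2 powr b * 2 powr (- (real l * b)))"
    have "decay_conv b \<mu> g x \<le> (\<integral>\<^sup>+y. g y * (\<Sum>l. ?c l * indicator (ball 0 (2 ^ l / \<mu>)) (y - x)) \<partial>lborel)"
      unfolding decay_conv_def n_def using \<mu> b
      by (intro nn_integral_mono mult_left_mono decay_le_sum_indicator) auto
    also have "\<dots> = (\<integral>\<^sup>+y. (\<Sum>l. ?c l * (g y * indicator (ball x (2 ^ l / \<mu>)) y)) \<partial>lborel)"
    proof (intro nn_integral_cong)
      fix y
      have "indicator (ball 0 (2 ^ l / \<mu>)) (y - x) = (indicator (ball x (2 ^ l / \<mu>)) y :: ennreal)" for l
        by (auto simp: indicator_def dist_norm norm_minus_commute)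
      then show "g y * (\<Sum>l. ?c l * indicator (ball 0 (2 ^ l / \<mu>)) (y - x)) = (\<Sum>l. ?c l * (g y * indicator (ball x (2 ^ l / \<mu>)) y))"
        unfolding ennreal_suminf_cmult[symmetric] by (intro suminf_cong) (simp only: mult_ac)
    qed
    also have "\<dots> = (\<Sum>l. ?c l * (\<integral>\<^sup>+y\<in>ball x (2 ^ l / \<mu>). g y \<partial>lborel))"
    proof -
      have [measurable]: "(\<lambda>y. g y * indicator (ball x r) y) \<in> borel_measurable lborel" for r
        by (intro borel_measurable_times_ennreal borel_measurable_indicator) auto
      show ?thesis
        by (subst nn_integral_suminf) (measurable, intro suminf_cong nn_integral_cmult, measurable)
    qed
    also have "\<dots> \<le> (\<Sum>l. ?c l * (ennreal ((2 ^ l / \<mu>) ^ n) * maximal g x))"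
      unfolding n_def using \<mu> by (intro suminf_le mult_left_mono ball_average_le_maximal) (auto simp: summableI)
    also have "\<dots> = (\<Sum>l. ennreal (2 powr b * \<rho> ^ l) * maximal g x)"
    proof (intro suminf_cong)
      fix l
      have "(2::real) ^ (n * l) * 2 powr - (real l * b) = \<rho> ^ l"
      proof -
        have "(2::real) ^ (n * l) = 2 powr (real n * real l)"
          using powr_realpow[of 2 "n * l"] by simp
        moreover have "\<rho> ^ l = 2 powr ((real n - b) * real l)"
          unfolding \<rho>_def by (simp add: powr_realpow[symmetric] powr_powr)
        ultimately show ?thesis
          by (simp only: powr_add[symmetric]) (simp add: algebra_simps)
      qed
      then have e: "\<mu> ^ n * 2 powr b * 2 powr (- (real l * b)) * (2 ^ l / \<mu>) ^ n = 2 powr b * \<rho> ^ l"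
        using \<mu> power_mult[of "2::real" l n] by (simp add: power_divide mult.commute[of n] mult.commute[of "2 powr (- (real l * b))"])
      show "?c l * (ennreal ((2 ^ l / \<mu>) ^ n) * maximal g x) = ennreal (2 powr b * \<rho> ^ l) * maximal g x"
        unfolding e[symmetric] using \<mu> by (subst ennreal_mult) (auto simp: mult.assoc)
    qed
    also have "\<dots> = (\<Sum>l. ennreal (2 powr b * \<rho> ^ l)) * maximal g x"
      by simp
    also have "(\<Sum>l. ennreal (2 powr b * \<rho> ^ l)) = ennreal C"
      unfolding C_def using \<rho> by (intro suminf_ennreal_eq sums_mult geometric_sums) auto
    finally show ?thesis .
  qed
  ultimately show ?thesis by (rule that)
qed

lemma decay_integral_bound:
  assumes b: "real DIM('a) < b"
  obtains C :: real where "0 < C" "\<And>\<mu> (x::'a::euclidean_space). 0 < \<mu> \<Longrightarrow> (\<integral>\<^sup>+y. ennreal (decay b \<mu> (y - x)) \<partial>lborel) \<le> ennreal C"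
proof -
  obtain C where C: "0 < C" "\<And>\<mu> (g :: 'a \<Rightarrow> ennreal) x. 0 < \<mu> \<Longrightarrow> g \<in> borel_measurable borel \<Longrightarrow>
    decay_conv b \<mu> g x \<le> ennreal C * maximal g x" using decay_conv_le_maximal[OF b] by blast
  show ?thesis
  proof (rule that[of "C * unit_ball_vol (DIM('a))"])
    show "0 < C * unit_ball_vol (DIM('a))" using C(1) by simp
    fix \<mu> :: real and x :: 'a assume \<mu>: "0 < \<mu>"
    have "decay_conv b \<mu> (\<lambda>_. 1) x \<le> ennreal C * maximal (\<lambda>_. 1) x" by (rule C(2)) (use \<mu> in auto)
    also have "\<dots> \<le> ennreal C * (1 * ennreal (unit_ball_vol (DIM('a))))"
      by (intro mult_left_mono maximal_const_le) auto
    finally show "(\<integral>\<^sup>+y. ennreal (decay b \<mu> (y - x)) \<partial>lborel) \<le> ennreal (C * unit_ball_vol (DIM('a)))"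
      using C(1) by (simp add: decay_conv_def ennreal_mult)
  qed
qed

text \<open>Jensen's inequality for the measure with density \<open>decay\<close>, whose mass is
  bounded uniformly in \<mu>.\<close>

lemma decay_conv_jensen:
  assumes b: "real DIM('a) < b" and u: "1 \<le> u"
  obtains C :: real where "0 < C" "\<And>\<mu> (g :: 'a::euclidean_space \<Rightarrow> ennreal) x. 0 < \<mu> \<Longrightarrow> g \<in> borel_measurable borel \<Longrightarrow>
    enn_powr (decay_conv b \<mu> g x) u \<le> ennreal C * decay_conv b \<mu> (\<lambda>x. enn_powr (g x) u) x"
proof -
  obtain C where C: "0 < C" "\<And>\<mu> (x::'a). 0 < \<mu> \<Longrightarrow> (\<integral>\<^sup>+y. ennreal (decay b \<mu> (y - x)) \<partial>lborel) \<le> ennreal C"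
    using decay_integral_bound[OF b] by blast
  show ?thesis
  proof (rule that[of "C powr (u - 1)"])
    show "0 < C powr (u - 1)" using C by simp
    fix \<mu> :: real and g :: "'a \<Rightarrow> ennreal" and x
    assume \<mu>: "0 < \<mu>" and [measurable]: "g \<in> borel_measurable borel"
    have "enn_powr (decay_conv b \<mu> g x) u \<le> enn_powr (\<integral>\<^sup>+y. ennreal (decay b \<mu> (y - x)) \<partial>lborel) (u - 1)
      * decay_conv b \<mu> (\<lambda>x. enn_powr (g x) u) x"
      unfolding decay_conv_def by (intro nn_integral_jensen u) auto
    also have "\<dots> \<le> enn_powr (ennreal C) (u - 1) * decay_conv b \<mu> (\<lambda>x. enn_powr (g x) u) x"
      using u by (intro mult_right_mono enn_powr_mono C \<mu>) auto
    finally show "enn_powr (decay_conv b \<mu> g x) u \<le> ennreal (C powr (u - 1)) * decay_conv b \<mu> (\<lambda>x. enn_powr (g x) u) x"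
      using C by simp
  qed
qed

text \<open>After Jensen's inequality the average is moved by self-adjointness to the constant
  function 1, where it is bounded by the mass of the kernel.\<close>

lemma decay_conv_norm_bound:
  assumes b: "real DIM('a) < b" and u: "1 \<le> u"
  obtains C :: real where "0 < C" "\<And>\<mu> (g :: 'a::euclidean_space \<Rightarrow> ennreal). 0 < \<mu> \<Longrightarrow> g \<in> borel_measurable borel \<Longrightarrow>
    (\<integral>\<^sup>+x. enn_powr (decay_conv b \<mu> g x) u \<partial>lborel) \<le> ennreal C * (\<integral>\<^sup>+x. enn_powr (g x) u \<partial>lborel)"
proof -
  obtain C where C: "0 < C" "\<And>\<mu> (g :: 'a \<Rightarrow> ennreal) x. 0 < \<mu> \<Longrightarrow> g \<in> borel_measurable borel \<Longrightarrow>
    enn_powr (decay_conv b \<mu> g x) u \<le> ennreal C * decay_conv b \<mu> (\<lambda>x. enn_powr (g x) u) x"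
    using decay_conv_jensen[OF b u] by blast
  obtain D where D: "0 < D" "\<And>\<mu> (x::'a). 0 < \<mu> \<Longrightarrow> (\<integral>\<^sup>+y. ennreal (decay b \<mu> (y - x)) \<partial>lborel) \<le> ennreal D"
    using decay_integral_bound[OF b] by blast
  show ?thesis
  proof (rule that[of "C * D"])
    show "0 < C * D" using C D by simp
    fix \<mu> :: real and g :: "'a \<Rightarrow> ennreal"
    assume \<mu>: "0 < \<mu>" and [measurable]: "g \<in> borel_measurable borel"
    have "(\<integral>\<^sup>+x. enn_powr (decay_conv b \<mu> g x) u \<partial>lborel) \<le> (\<integral>\<^sup>+x. ennreal C * (decay_conv b \<mu> (\<lambda>x. enn_powr (g x) u) x * 1) \<partial>lborel)"
      using C \<mu> by (intro nn_integral_mono) auto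
    also have "\<dots> = ennreal C * (\<integral>\<^sup>+x. decay_conv b \<mu> (\<lambda>x. enn_powr (g x) u) x * 1 \<partial>lborel)"
      by (intro nn_integral_cmult) auto
    also have "\<dots> = ennreal C * (\<integral>\<^sup>+x. enn_powr (g x) u * decay_conv b \<mu> (\<lambda>_. 1) x \<partial>lborel)"
      by (subst decay_conv_self_adjoint) auto
    also have "\<dots> \<le> ennreal C * (\<integral>\<^sup>+x. enn_powr (g x) u * ennreal D \<partial>lborel)"
      using D \<mu> by (intro mult_left_mono nn_integral_mono) (auto simp: decay_conv_def)
    also have "\<dots> = ennreal (C * D) * (\<integral>\<^sup>+x. enn_powr (g x) u \<partial>lborel)"
      using C D by (subst nn_integral_multc) (auto simp: ennreal_mult mult_ac)
    finally show "(\<integral>\<^sup>+x. enn_powr (decay_conv b \<mu> g x) u \<partial>lborel) \<le> ennreal (C * D) * (\<integral>\<^sup>+x. enn_powr (g x) u \<partial>lborel)" .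
  qed
qed

text \<open>Dual to the maximal inequality: the sum is tested against its own power.\<close>

lemma sum_decay_conv_bound:
  assumes b: "real DIM('a) < b" and t: "1 \<le> t"
  obtains C :: real where "0 < C" "\<And>(g :: nat \<Rightarrow> 'a::euclidean_space \<Rightarrow> ennreal) \<mu>.
    (\<And>j. 0 < \<mu> j) \<Longrightarrow> (\<And>j. g j \<in> borel_measurable borel) \<Longrightarrow>
    (\<integral>\<^sup>+x. enn_powr (\<Sum>j. decay_conv b (\<mu> j) (g j) x) t \<partial>lborel) \<le> ennreal C * (\<integral>\<^sup>+x. enn_powr (\<Sum>j. g j x) t \<partial>lborel)"
\<comment> \<open>For t = 1 the dual exponent would be infinite; there the norm is additive and
  every term is bounded on its own.\<close>
proof (cases "t = 1")
  case True
  obtain C where C: "0 < C" "\<And>\<mu> (g :: 'a \<Rightarrow> ennreal). 0 < \<mu> \<Longrightarrow> g \<in> borel_measurable borel \<Longrightarrow>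
    (\<integral>\<^sup>+x. enn_powr (decay_conv b \<mu> g x) t \<partial>lborel) \<le> ennreal C * (\<integral>\<^sup>+x. enn_powr (g x) t \<partial>lborel)"
    using decay_conv_norm_bound[OF b t] by blast
  show ?thesis
  proof (rule that[OF C(1)])
    fix g :: "nat \<Rightarrow> 'a \<Rightarrow> ennreal" and \<mu> :: "nat \<Rightarrow> real"
    assume \<mu>: "\<And>j. 0 < \<mu> j" and [measurable]: "\<And>j. g j \<in> borel_measurable borel"
    have "(\<integral>\<^sup>+x. (\<Sum>j. decay_conv b (\<mu> j) (g j) x) \<partial>lborel) = (\<Sum>j. \<integral>\<^sup>+x. decay_conv b (\<mu> j) (g j) x \<partial>lborel)"
      by (intro nn_integral_suminf) auto
    also have "\<dots> \<le> (\<Sum>j. ennreal C * (\<integral>\<^sup>+x. g j x \<partial>lborel))"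
      using C(2)[OF \<mu>, of "g _"] True by (intro suminf_le) (auto simp: summableI)
    also have "\<dots> = ennreal C * (\<integral>\<^sup>+x. (\<Sum>j. g j x) \<partial>lborel)"
      by (subst nn_integral_suminf) auto
    finally show "(\<integral>\<^sup>+x. enn_powr (\<Sum>j. decay_conv b (\<mu> j) (g j) x) t \<partial>lborel) \<le> ennreal C * (\<integral>\<^sup>+x. enn_powr (\<Sum>j. g j x) t \<partial>lborel)"
      using True by simp
  qed
next
  case False
  with t have t: "1 < t" by simp
  define t' where "t' = t / (t - 1)"
  have t': "1 < t'" using t by (simp add: t'_def field_simps)
  obtain B where B: "0 < B" "\<And>\<mu> (g :: 'a \<Rightarrow> ennreal) x. 0 < \<mu> \<Longrightarrow> g \<in> borel_measurable borel \<Longrightarrow>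
    decay_conv b \<mu> g x \<le> ennreal B * maximal g x" using decay_conv_le_maximal[OF b] by blast
  obtain M where M: "0 < M" "\<And>g :: 'a \<Rightarrow> ennreal. g \<in> borel_measurable borel \<Longrightarrow>
    (\<integral>\<^sup>+x. enn_powr (maximal g x) t \<partial>lborel) \<le> ennreal M * (\<integral>\<^sup>+x. enn_powr (g x) t \<partial>lborel)"
    using maximal_strong_type[OF t] by blast
  obtain M' where M': "0 < M'" "\<And>g :: 'a \<Rightarrow> ennreal. g \<in> borel_measurable borel \<Longrightarrow>
    (\<integral>\<^sup>+x. enn_powr (maximal g x) t' \<partial>lborel) \<le> ennreal M' * (\<integral>\<^sup>+x. enn_powr (g x) t' \<partial>lborel)"
    using maximal_strong_type[OF t'] by blast
  define C where "C = (B * M' powr (1 - 1 / t)) powr t"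
  show ?thesis
  proof (rule that[of C])
    show "0 < C" using B M' by (simp add: C_def)
    fix g :: "nat \<Rightarrow> 'a \<Rightarrow> ennreal" and \<mu> :: "nat \<Rightarrow> real"
    assume \<mu>: "\<And>j. 0 < \<mu> j" and [measurable]: "\<And>j. g j \<in> borel_measurable borel"
    define G where "G x = (\<Sum>j. g j x)" for x
    have [measurable]: "G \<in> borel_measurable borel" unfolding G_def[abs_def] by measurable
    define H where "H J x = (\<Sum>j<J. decay_conv b (\<mu> j) (g j) x)" for J x
    have [measurable]: "H J \<in> borel_measurable borel" for J unfolding H_def[abs_def] by measurable
    have gG: "g j x \<le> G x" for j x
      unfolding G_def by (rule ennreal_le_suminf)
    define Y where "Y = (\<integral>\<^sup>+x. enn_powr (G x) t \<partial>lborel)"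
    \<comment> \<open>Finitely many terms first: the argument divides by a power of the integral of
      \<open>H J\<close> to the power t, which has to be finite beforehand.\<close>
    have fin: "(\<integral>\<^sup>+x. enn_powr (H J x) t \<partial>lborel) \<le> ennreal C * Y" for J
    proof (cases "Y = top")
      case True
      then show ?thesis using B M' by (simp add: C_def ennreal_mult_top)
    next
      case False
      define X where "X = (\<integral>\<^sup>+x. enn_powr (H J x) t \<partial>lborel)"
      \<comment> \<open>A crude bound whose constant depends on J. Its only purpose is the
        finiteness of X.\<close>
      have "X \<le> (\<integral>\<^sup>+x. enn_powr (ennreal (J * B)) t * enn_powr (maximal G x) t \<partial>lborel)"
      proof (unfold X_def, rule nn_integral_mono)
        fix x
        have "H J x \<le> (\<Sum>j<J. ennreal B * maximal G x)"
          unfolding H_def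
        proof (rule sum_mono)
          fix j
          have "decay_conv b (\<mu> j) (g j) x \<le> ennreal B * maximal (g j) x" by (intro B \<mu>) auto
          also have "\<dots> \<le> ennreal B * maximal G x" by (intro mult_left_mono maximal_mono gG) auto
          finally show "decay_conv b (\<mu> j) (g j) x \<le> ennreal B * maximal G x" .
        qed
        also have "\<dots> = ennreal (J * B) * maximal G x"
          using B by (simp add: ennreal_mult mult.assoc ennreal_of_nat_eq_real_of_nat)
        finally have "enn_powr (H J x) t \<le> enn_powr (ennreal (J * B) * maximal G x) t"
          using t by (intro enn_powr_mono) auto
        then show "enn_powr (H J x) t \<le> enn_powr (ennreal (J * B)) t * enn_powr (maximal G x) t"
          using t by (simp add: enn_powr_mult)
      qed
      also have "\<dots> = enn_powr (ennreal (J * B)) t * (\<integral>\<^sup>+x. enn_powr (maximal G x) t \<partial>lborel)"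
        by (intro nn_integral_cmult) auto
      also have "\<dots> \<le> enn_powr (ennreal (J * B)) t * (ennreal M * Y)"
        unfolding Y_def by (intro mult_left_mono M) auto
      also have "\<dots> < top"
        using False B by (simp add: ennreal_mult_less_top less_top)
      finally have Xfin: "X < top" .
      \<comment> \<open>The extremal function of the duality between the exponents t and t': the
        product \<open>H J x * w x\<close> is \<open>H J x\<close> to the power t, and so is
        \<open>w x\<close> to the power t'.\<close>
      define w where "w x = enn_powr (H J x) (t - 1)" for x
      have [measurable]: "w \<in> borel_measurable borel" unfolding w_def[abs_def] by measurable
      have "X = (\<integral>\<^sup>+x. H J x * w x \<partial>lborel)"
        unfolding X_def w_def using enn_powr_add[of 1 "t - 1"] t by (intro nn_integral_cong) simp
      also have "\<dots> = (\<Sum>j<J. \<integral>\<^sup>+x. decay_conv b (\<mu> j) (g j) x * w x \<partial>lborel)"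
        unfolding H_def sum_distrib_right by (intro nn_integral_sum) auto
      also have "\<dots> = (\<Sum>j<J. \<integral>\<^sup>+x. g j x * decay_conv b (\<mu> j) w x \<partial>lborel)"
        by (intro sum.cong decay_conv_self_adjoint) auto
      also have "\<dots> \<le> (\<Sum>j<J. \<integral>\<^sup>+x. g j x * (ennreal B * maximal w x) \<partial>lborel)"
        by (intro sum_mono nn_integral_mono mult_left_mono B \<mu>) auto
      also have "\<dots> = (\<integral>\<^sup>+x. (\<Sum>j<J. g j x) * (ennreal B * maximal w x) \<partial>lborel)"
        unfolding sum_distrib_right by (intro nn_integral_sum[symmetric]) auto
      also have "\<dots> \<le> (\<integral>\<^sup>+x. G x * (ennreal B * maximal w x) \<partial>lborel)"
        unfolding G_def by (intro nn_integral_mono mult_right_mono sum_le_suminf) (auto simp: summableI)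
      also have "\<dots> = ennreal B * (\<integral>\<^sup>+x. enn_powr (enn_powr (G x) t) (1 / t) * enn_powr (enn_powr (maximal w x) t') (1 - 1 / t) \<partial>lborel)"
      proof -
        have "t' * (1 - 1 / t) = 1" using t by (simp add: t'_def field_simps)
        then show ?thesis using t by (simp add: enn_powr_powr nn_integral_cmult[symmetric] mult_ac)
      qed
      also have "\<dots> \<le> ennreal B * (enn_powr Y (1 / t) * enn_powr (\<integral>\<^sup>+x. enn_powr (maximal w x) t' \<partial>lborel) (1 - 1 / t))"
        unfolding Y_def using t by (intro mult_left_mono nn_integral_holder) auto
      also have "\<dots> \<le> ennreal B * (enn_powr Y (1 / t) * enn_powr (ennreal M' * X) (1 - 1 / t))"
      proof -
        have "(\<integral>\<^sup>+x. enn_powr (maximal w x) t' \<partial>lborel) \<le> ennreal M' * (\<integral>\<^sup>+x. enn_powr (w x) t' \<partial>lborel)"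
          by (intro M') auto
        also have "(\<integral>\<^sup>+x. enn_powr (w x) t' \<partial>lborel) = X"
          unfolding w_def X_def using t by (simp add: enn_powr_powr t'_def)
        finally show ?thesis using t by (intro mult_left_mono enn_powr_mono) auto
      qed
      also have "\<dots> = ennreal (B * M' powr (1 - 1 / t)) * enn_powr Y (1 / t) * enn_powr X (1 - 1 / t)"
        using t B M' by (simp add: enn_powr_mult ennreal_mult mult_ac)
      finally have X: "X \<le> ennreal (B * M' powr (1 - 1 / t)) * enn_powr Y (1 / t) * enn_powr X (1 - 1 / t)" .
      have "X \<le> ennreal C * Y"
      proof (cases "X = 0")
        case False
        have "enn_powr X (1 - 1 / t) * enn_powr X (1 / t) = X"
          using enn_powr_add[of "1 - 1 / t" "1 / t" X] t by simp
        with X have "enn_powr X (1 - 1 / t) * enn_powr X (1 / t) \<le> enn_powr X (1 - 1 / t) * (ennreal (B * M' powr (1 - 1 / t)) * enn_powr Y (1 / t))"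
          by (simp add: mult_ac)
        then have "enn_powr X (1 / t) \<le> ennreal (B * M' powr (1 - 1 / t)) * enn_powr Y (1 / t)"
          using False Xfin by (subst (asm) ennreal_mult_le_mult_iff) auto
        then have "enn_powr (enn_powr X (1 / t)) t \<le> enn_powr (ennreal (B * M' powr (1 - 1 / t)) * enn_powr Y (1 / t)) t"
          using t by (intro enn_powr_mono) auto
        then show ?thesis using t B M' by (simp add: enn_powr_powr enn_powr_mult C_def)
      qed simp
      then show ?thesis by (simp add: X_def)
    qed
    have inc: "incseq (\<lambda>J. H J x)" for x
      by (intro monoI) (auto simp: H_def intro!: sum_mono2)
    have "(\<integral>\<^sup>+x. enn_powr (\<Sum>j. decay_conv b (\<mu> j) (g j) x) t \<partial>lborel) = (\<integral>\<^sup>+x. (SUP J. enn_powr (H J x) t) \<partial>lborel)"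
      using t by (simp add: H_def enn_powr_SUP[symmetric] suminf_eq_SUP)
    also have "\<dots> = (SUP J. \<integral>\<^sup>+x. enn_powr (H J x) t \<partial>lborel)"
      using inc t by (intro nn_integral_monotone_convergence_SUP)
        (auto simp: incseq_def le_fun_def intro!: enn_powr_mono)
    also have "\<dots> \<le> ennreal C * Y"
      by (intro SUP_least fin)
    finally show "(\<integral>\<^sup>+x. enn_powr (\<Sum>j. decay_conv b (\<mu> j) (g j) x) t \<partial>lborel) \<le> ennreal C * (\<integral>\<^sup>+x. enn_powr (\<Sum>j. g j x) t \<partial>lborel)"
      by (simp add: Y_def G_def)
  qed
qed

text \<open>Here the outer exponent P / u is at least 1: Jensen's inequality takes the power u
  inside each average, and the scalar estimate \<open>sum_decay_conv_bound\<close> applies with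
  exponent P / u.\<close>

lemma vector_maximal_le:
  assumes b: "real DIM('a) < b" and u: "1 \<le> u" "u \<le> P"
  obtains C :: real where "0 < C" "\<And>(g :: nat \<Rightarrow> 'a::euclidean_space \<Rightarrow> ennreal) \<mu>.
    (\<And>j. 0 < \<mu> j) \<Longrightarrow> (\<And>j. g j \<in> borel_measurable borel) \<Longrightarrow>
    (\<integral>\<^sup>+x. enn_powr (\<Sum>j. enn_powr (decay_conv b (\<mu> j) (g j) x) u) (P / u) \<partial>lborel)
    \<le> ennreal C * (\<integral>\<^sup>+x. enn_powr (\<Sum>j. enn_powr (g j x) u) (P / u) \<partial>lborel)"
proof -
  obtain A where A: "0 < A" "\<And>\<mu> (g :: 'a \<Rightarrow> ennreal) x. 0 < \<mu> \<Longrightarrow> g \<in> borel_measurable borel \<Longrightarrow>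
    enn_powr (decay_conv b \<mu> g x) u \<le> ennreal A * decay_conv b \<mu> (\<lambda>x. enn_powr (g x) u) x"
    using decay_conv_jensen[OF b u(1)] by blast
  have Pu: "1 \<le> P / u" using u by simp
  obtain C where C: "0 < C" "\<And>(g :: nat \<Rightarrow> 'a \<Rightarrow> ennreal) \<mu>.
    (\<And>j. 0 < \<mu> j) \<Longrightarrow> (\<And>j. g j \<in> borel_measurable borel) \<Longrightarrow>
    (\<integral>\<^sup>+x. enn_powr (\<Sum>j. decay_conv b (\<mu> j) (g j) x) (P / u) \<partial>lborel) \<le> ennreal C * (\<integral>\<^sup>+x. enn_powr (\<Sum>j. g j x) (P / u) \<partial>lborel)"
    using sum_decay_conv_bound[OF b Pu] by blast
  show ?thesis
  proof (rule that[of "A powr (P / u) * C"])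
    show "0 < A powr (P / u) * C" using A C by simp
    fix g :: "nat \<Rightarrow> 'a \<Rightarrow> ennreal" and \<mu> :: "nat \<Rightarrow> real"
    assume \<mu>: "\<And>j. 0 < \<mu> j" and [measurable]: "\<And>j. g j \<in> borel_measurable borel"
    have "(\<integral>\<^sup>+x. enn_powr (\<Sum>j. enn_powr (decay_conv b (\<mu> j) (g j) x) u) (P / u) \<partial>lborel)
      \<le> (\<integral>\<^sup>+x. enn_powr (\<Sum>j. ennreal A * decay_conv b (\<mu> j) (\<lambda>x. enn_powr (g j x) u) x) (P / u) \<partial>lborel)"
      using Pu \<mu> by (intro nn_integral_mono enn_powr_mono suminf_le A) (auto simp: summableI)
    also have "\<dots> = (\<integral>\<^sup>+x. ennreal (A powr (P / u)) * enn_powr (\<Sum>j. decay_conv b (\<mu> j) (\<lambda>x. enn_powr (g j x) u) x) (P / u) \<partial>lborel)"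
      using Pu A u by (simp add: enn_powr_mult)
    also have "\<dots> = ennreal (A powr (P / u)) * (\<integral>\<^sup>+x. enn_powr (\<Sum>j. decay_conv b (\<mu> j) (\<lambda>x. enn_powr (g j x) u) x) (P / u) \<partial>lborel)"
      by (intro nn_integral_cmult) auto
    also have "\<dots> \<le> ennreal (A powr (P / u)) * (ennreal C * (\<integral>\<^sup>+x. enn_powr (\<Sum>j. enn_powr (g j x) u) (P / u) \<partial>lborel))"
      by (intro mult_left_mono C \<mu>) auto
    finally show "(\<integral>\<^sup>+x. enn_powr (\<Sum>j. enn_powr (decay_conv b (\<mu> j) (g j) x) u) (P / u) \<partial>lborel)
      \<le> ennreal (A powr (P / u) * C) * (\<integral>\<^sup>+x. enn_powr (\<Sum>j. enn_powr (g j x) u) (P / u) \<partial>lborel)"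
      using A C by (simp add: ennreal_mult mult.assoc)
  qed
qed

text \<open>With \<open>G = (\<Sum>\<^sub>j g\<^sub>j\<^sup>u)\<^sup>1\<^sup>/\<^sup>u\<close>, Hoelder's inequality splits each convolution into one of
  \<open>g\<^sub>j\<^sup>u G\<^sup>P\<^sup>-\<^sup>u\<close>, whose sum is integrable, and one of a power of \<open>G\<close>, which the maximal function controls.\<close>

lemma vector_maximal_gt:
  assumes b: "real DIM('a) < b" and P: "1 < P" "P < u"
  obtains C :: real where "0 < C" "\<And>(g :: nat \<Rightarrow> 'a::euclidean_space \<Rightarrow> ennreal) \<mu>.
    (\<And>j. 0 < \<mu> j) \<Longrightarrow> (\<And>j. g j \<in> borel_measurable borel) \<Longrightarrow>
    (\<integral>\<^sup>+x. enn_powr (\<Sum>j. enn_powr (decay_conv b (\<mu> j) (g j) x) u) (P / u) \<partial>lborel)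
    \<le> ennreal C * (\<integral>\<^sup>+x. enn_powr (\<Sum>j. enn_powr (g j x) u) (P / u) \<partial>lborel)"
proof -
  \<comment> \<open>Chosen such that \<open>h\<close> below, a power of G, has v-th power equal to G
    to the power P.\<close>
  define v where "v = (u - 1) * P / (u - P)"
  have v: "1 < v" using P by (simp add: v_def field_simps)
  obtain B where B: "0 < B" "\<And>\<mu> (g :: 'a \<Rightarrow> ennreal) x. 0 < \<mu> \<Longrightarrow> g \<in> borel_measurable borel \<Longrightarrow>
    decay_conv b \<mu> g x \<le> ennreal B * maximal g x" using decay_conv_le_maximal[OF b] by blast
  obtain M where M: "0 < M" "\<And>g :: 'a \<Rightarrow> ennreal. g \<in> borel_measurable borel \<Longrightarrow>
    (\<integral>\<^sup>+x. enn_powr (maximal g x) v \<partial>lborel) \<le> ennreal M * (\<integral>\<^sup>+x. enn_powr (g x) v \<partial>lborel)"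
    using maximal_strong_type[OF v] by blast
  obtain D where D: "0 < D" "\<And>(g :: nat \<Rightarrow> 'a \<Rightarrow> ennreal) \<mu>.
    (\<And>j. 0 < \<mu> j) \<Longrightarrow> (\<And>j. g j \<in> borel_measurable borel) \<Longrightarrow>
    (\<integral>\<^sup>+x. enn_powr (\<Sum>j. decay_conv b (\<mu> j) (g j) x) 1 \<partial>lborel) \<le> ennreal D * (\<integral>\<^sup>+x. enn_powr (\<Sum>j. g j x) 1 \<partial>lborel)"
    using sum_decay_conv_bound[OF b, of 1] by auto
  define C where "C = D powr (P / u) * (B powr v * M) powr (1 - P / u)"
  have C: "0 < C" using B D M by (simp add: C_def)
  show ?thesis
  proof (rule that[OF C])
    fix g :: "nat \<Rightarrow> 'a \<Rightarrow> ennreal" and \<mu> :: "nat \<Rightarrow> real"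
    assume \<mu>: "\<And>j. 0 < \<mu> j" and [measurable]: "\<And>j. g j \<in> borel_measurable borel"
    define G where "G x = enn_powr (\<Sum>j. enn_powr (g j x) u) (1 / u)" for x
    have [measurable]: "G \<in> borel_measurable borel" unfolding G_def[abs_def] by measurable
    have Gu: "enn_powr (G x) u = (\<Sum>j. enn_powr (g j x) u)" for x
      unfolding G_def using P by (simp add: enn_powr_powr)
    have gG: "g j x \<le> G x" for j x
    proof -
      have "enn_powr (g j x) u \<le> enn_powr (G x) u"
        unfolding Gu by (rule ennreal_le_suminf)
      then show ?thesis using P by (simp add: enn_powr_le_iff)
    qed
    define Y where "Y = (\<integral>\<^sup>+x. enn_powr (G x) P \<partial>lborel)"
    have Y: "(\<integral>\<^sup>+x. enn_powr (\<Sum>j. enn_powr (g j x) u) (P / u) \<partial>lborel) = Y"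
      unfolding Y_def G_def using P by (simp add: enn_powr_powr)
    have "(\<integral>\<^sup>+x. enn_powr (\<Sum>j. enn_powr (decay_conv b (\<mu> j) (g j) x) u) (P / u) \<partial>lborel) \<le> ennreal C * Y"
    proof (cases "Y = top")
      case True
      then show ?thesis using C by (simp add: ennreal_mult_top)
    next
      case False
      \<comment> \<open>Finiteness of Y makes G finite almost everywhere, which permits division by
        a power of G.\<close>
      then have "AE x in lborel. enn_powr (G x) P \<noteq> \<infinity>"
        unfolding Y_def by (intro nn_integral_PInf_AE) auto
      then have Gfin: "AE x in lborel. G x \<noteq> top"
        by simp
      define k where "k j x = enn_powr (g j x) u * inverse (enn_powr (G x) (u - P))" for j x
      have [measurable]: "k j \<in> borel_measurable borel" for j unfolding k_def[abs_def] by measurable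
      define h where "h x = enn_powr (G x) ((u - P) / (u - 1))" for x
      have [measurable]: "h \<in> borel_measurable borel" unfolding h_def[abs_def] by measurable
      \<comment> \<open>Where 0 < G < infinity this is an equality, because the powers of G in
        \<open>k\<close> and \<open>h\<close> cancel; where G vanishes, so does
        \<open>g j\<close>.\<close>
      have split: "g j x \<le> enn_powr (k j x) (1 / u) * enn_powr (h x) (1 - 1 / u)" if "G x \<noteq> top" for j x
      proof (cases "G x = 0")
        case True
        then show ?thesis using gG[of j x] by simp
      next
        case False
        have "(u - P) / (u - 1) * (1 - 1 / u) = (u - P) / u" using P by (simp add: field_simps)
        then have "enn_powr (k j x) (1 / u) * enn_powr (h x) (1 - 1 / u)
          = g j x * (inverse (enn_powr (G x) ((u - P) / u)) * enn_powr (G x) ((u - P) / u))"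
          unfolding k_def h_def using P
          by (simp add: enn_powr_mult enn_powr_powr enn_powr_inverse mult_ac)
        also have "inverse (enn_powr (G x) ((u - P) / u)) * enn_powr (G x) ((u - P) / u) = 1"
          using that False by (subst mult.commute) (simp add: ennreal_divide_self divide_ennreal_def[symmetric] less_top[symmetric])
        finally show ?thesis by simp
      qed
      have conv: "enn_powr (decay_conv b (\<mu> j) (g j) x) u \<le> decay_conv b (\<mu> j) (k j) x * enn_powr (ennreal B * maximal h x) (u - 1)" for j x
      proof -
        have "decay_conv b (\<mu> j) (g j) x \<le> (\<integral>\<^sup>+y. enn_powr (k j y * ennreal (decay b (\<mu> j) (y - x))) (1 / u) * enn_powr (h y * ennreal (decay b (\<mu> j) (y - x))) (1 - 1 / u) \<partial>lborel)"
          unfolding decay_conv_def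
        proof (rule nn_integral_mono_AE)
          show "AE y in lborel. g j y * ennreal (decay b (\<mu> j) (y - x)) \<le> enn_powr (k j y * ennreal (decay b (\<mu> j) (y - x))) (1 / u) * enn_powr (h y * ennreal (decay b (\<mu> j) (y - x))) (1 - 1 / u)"
            using Gfin
          proof eventually_elim
            case (elim y)
            let ?d = "ennreal (decay b (\<mu> j) (y - x))"
            have "g j y * ?d \<le> enn_powr (k j y) (1 / u) * enn_powr (h y) (1 - 1 / u) * ?d"
              by (intro mult_right_mono split elim) auto
            also have "\<dots> = enn_powr (k j y) (1 / u) * enn_powr (h y) (1 - 1 / u) * (enn_powr ?d (1 / u) * enn_powr ?d (1 - 1 / u))"
              using P enn_powr_add[of "1/u" "1 - 1/u" ?d] by simp
            also have "\<dots> = enn_powr (k j y * ?d) (1 / u) * enn_powr (h y * ?d) (1 - 1 / u)"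
              using P by (simp add: enn_powr_mult mult_ac)
            finally show ?case .
          qed
        qed
        also have "\<dots> \<le> enn_powr (decay_conv b (\<mu> j) (k j) x) (1 / u) * enn_powr (decay_conv b (\<mu> j) h x) (1 - 1 / u)"
          unfolding decay_conv_def using P by (intro nn_integral_holder) auto
        also have "\<dots> \<le> enn_powr (decay_conv b (\<mu> j) (k j) x) (1 / u) * enn_powr (ennreal B * maximal h x) (1 - 1 / u)"
          using P \<mu> by (intro mult_left_mono enn_powr_mono B) auto
        finally have "enn_powr (decay_conv b (\<mu> j) (g j) x) u \<le> enn_powr (enn_powr (decay_conv b (\<mu> j) (k j) x) (1 / u) * enn_powr (ennreal B * maximal h x) (1 - 1 / u)) u"
          using P by (intro enn_powr_mono) auto
        also have "\<dots> = decay_conv b (\<mu> j) (k j) x * enn_powr (ennreal B * maximal h x) (u - 1)"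
        proof -
          have "(1 - 1 / u) * u = u - 1" using P by (simp add: field_simps)
          then show ?thesis using P by (simp add: enn_powr_mult enn_powr_powr)
        qed
        finally show ?thesis .
      qed
      \<comment> \<open>By this identity the outer power P / u of the product becomes a second case
        of Hoelder's inequality, with the weights P / u and 1 - P / u.\<close>
      have vu: "v * (1 - P / u) = (u - 1) * (P / u)"
        using P by (simp add: v_def field_simps)
      have "(\<integral>\<^sup>+x. enn_powr (\<Sum>j. enn_powr (decay_conv b (\<mu> j) (g j) x) u) (P / u) \<partial>lborel)
        \<le> (\<integral>\<^sup>+x. enn_powr (\<Sum>j. decay_conv b (\<mu> j) (k j) x * enn_powr (ennreal B * maximal h x) (u - 1)) (P / u) \<partial>lborel)"
        using P by (intro nn_integral_mono enn_powr_mono suminf_le conv) (auto simp: summableI)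
      also have "\<dots> = (\<integral>\<^sup>+x. enn_powr (\<Sum>j. decay_conv b (\<mu> j) (k j) x) (P / u) * enn_powr (enn_powr (ennreal B * maximal h x) v) (1 - P / u) \<partial>lborel)"
        using P vu by (simp add: enn_powr_mult enn_powr_powr)
      also have "\<dots> \<le> enn_powr (\<integral>\<^sup>+x. (\<Sum>j. decay_conv b (\<mu> j) (k j) x) \<partial>lborel) (P / u) * enn_powr (\<integral>\<^sup>+x. enn_powr (ennreal B * maximal h x) v \<partial>lborel) (1 - P / u)"
        using P by (intro nn_integral_holder) auto
      also have "\<dots> \<le> enn_powr (ennreal D * Y) (P / u) * enn_powr (ennreal (B powr v * M) * Y) (1 - P / u)"
      proof (intro mult_mono enn_powr_mono)
        have "(\<integral>\<^sup>+x. (\<Sum>j. decay_conv b (\<mu> j) (k j) x) \<partial>lborel) \<le> ennreal D * (\<integral>\<^sup>+x. (\<Sum>j. k j x) \<partial>lborel)"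
          using D(2)[of \<mu> k] \<mu> by simp
        also have "(\<integral>\<^sup>+x. (\<Sum>j. k j x) \<partial>lborel) \<le> Y"
          unfolding Y_def
        proof (rule nn_integral_mono_AE)
          show "AE x in lborel. (\<Sum>j. k j x) \<le> enn_powr (G x) P"
            using Gfin
          proof eventually_elim
            case (elim x)
            have "(\<Sum>j. k j x) = enn_powr (G x) (P + (u - P)) * inverse (enn_powr (G x) (u - P))"
              by (simp add: k_def Gu)
            also have "\<dots> = enn_powr (G x) P * (enn_powr (G x) (u - P) * inverse (enn_powr (G x) (u - P)))"
              using P by (subst enn_powr_add) (auto simp: mult_ac)
            also have "\<dots> \<le> enn_powr (G x) P * 1"
            proof (rule mult_left_mono)
              show "enn_powr (G x) (u - P) * inverse (enn_powr (G x) (u - P)) \<le> 1"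
                using elim by (cases "G x = 0")
                  (simp_all add: ennreal_divide_self divide_ennreal_def[symmetric] less_top[symmetric])
            qed simp
            finally show ?case by simp
          qed
        qed
        finally show "(\<integral>\<^sup>+x. (\<Sum>j. decay_conv b (\<mu> j) (k j) x) \<partial>lborel) \<le> ennreal D * Y"
          by (simp add: mult_left_mono)
        have "(\<integral>\<^sup>+x. enn_powr (ennreal B * maximal h x) v \<partial>lborel) = ennreal (B powr v) * (\<integral>\<^sup>+x. enn_powr (maximal h x) v \<partial>lborel)"
          using v B by (simp add: enn_powr_mult nn_integral_cmult)
        also have "\<dots> \<le> ennreal (B powr v) * (ennreal M * (\<integral>\<^sup>+x. enn_powr (h x) v \<partial>lborel))"
          by (intro mult_left_mono M) auto
        also have "(\<integral>\<^sup>+x. enn_powr (h x) v \<partial>lborel) = Y"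
        proof -
          have "(u - P) / (u - 1) * v = P" using P by (simp add: v_def)
          then show ?thesis by (simp add: Y_def h_def enn_powr_powr)
        qed
        finally show "(\<integral>\<^sup>+x. enn_powr (ennreal B * maximal h x) v \<partial>lborel) \<le> ennreal (B powr v * M) * Y"
          using M by (simp add: ennreal_mult mult.assoc)
      qed (use P in auto)
      also have "\<dots> = ennreal C * (enn_powr Y (P / u) * enn_powr Y (1 - P / u))"
        using P B M D enn_powr_mult[of "1 - P / u" "ennreal (B powr v * M)" Y] enn_powr_mult[of "P / u" "ennreal D" Y]
        by (simp add: C_def ennreal_mult'[of "D powr _"] mult_ac)
      also have "enn_powr Y (P / u) * enn_powr Y (1 - P / u) = Y"
        using P enn_powr_add[of "P / u" "1 - P / u" Y] by simp
      finally show ?thesis .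
    qed
    then show "(\<integral>\<^sup>+x. enn_powr (\<Sum>j. enn_powr (decay_conv b (\<mu> j) (g j) x) u) (P / u) \<partial>lborel)
      \<le> ennreal C * (\<integral>\<^sup>+x. enn_powr (\<Sum>j. enn_powr (g j x) u) (P / u) \<partial>lborel)"
      by (simp add: Y)
  qed
qed

text \<open>All entries lie below their supremum G, so every average is dominated by the same
  multiple of \<open>maximal G\<close> and the scalar maximal inequality suffices.\<close>

lemma vector_maximal_sup:
  assumes b: "real DIM('a) < b" and P: "1 < P"
  obtains C :: real where "0 < C" "\<And>(g :: nat \<Rightarrow> 'a::euclidean_space \<Rightarrow> ennreal) \<mu>.
    (\<And>j. 0 < \<mu> j) \<Longrightarrow> (\<And>j. g j \<in> borel_measurable borel) \<Longrightarrow>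
    (\<integral>\<^sup>+x. enn_powr (SUP j. decay_conv b (\<mu> j) (g j) x) P \<partial>lborel)
    \<le> ennreal C * (\<integral>\<^sup>+x. enn_powr (SUP j. g j x) P \<partial>lborel)"
proof -
  obtain B where B: "0 < B" "\<And>\<mu> (g :: 'a \<Rightarrow> ennreal) x. 0 < \<mu> \<Longrightarrow> g \<in> borel_measurable borel \<Longrightarrow>
    decay_conv b \<mu> g x \<le> ennreal B * maximal g x" using decay_conv_le_maximal[OF b] by blast
  obtain M where M: "0 < M" "\<And>g :: 'a \<Rightarrow> ennreal. g \<in> borel_measurable borel \<Longrightarrow>
    (\<integral>\<^sup>+x. enn_powr (maximal g x) P \<partial>lborel) \<le> ennreal M * (\<integral>\<^sup>+x. enn_powr (g x) P \<partial>lborel)"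
    using maximal_strong_type[OF P] by blast
  show ?thesis
  proof (rule that[of "B powr P * M"])
    show "0 < B powr P * M" using B M by simp
    fix g :: "nat \<Rightarrow> 'a \<Rightarrow> ennreal" and \<mu> :: "nat \<Rightarrow> real"
    assume \<mu>: "\<And>j. 0 < \<mu> j" and [measurable]: "\<And>j. g j \<in> borel_measurable borel"
    define G where "G x = (SUP j. g j x)" for x
    have [measurable]: "G \<in> borel_measurable borel" unfolding G_def[abs_def] by measurable
    have "(SUP j. decay_conv b (\<mu> j) (g j) x) \<le> ennreal B * maximal G x" for x
    proof (rule SUP_least)
      fix j
      have "decay_conv b (\<mu> j) (g j) x \<le> decay_conv b (\<mu> j) G x"
        by (intro decay_conv_mono) (auto simp: G_def intro: SUP_upper)
      also have "\<dots> \<le> ennreal B * maximal G x" by (intro B \<mu>) auto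
      finally show "decay_conv b (\<mu> j) (g j) x \<le> ennreal B * maximal G x" .
    qed
    then have "(\<integral>\<^sup>+x. enn_powr (SUP j. decay_conv b (\<mu> j) (g j) x) P \<partial>lborel) \<le> (\<integral>\<^sup>+x. enn_powr (ennreal B * maximal G x) P \<partial>lborel)"
      using P by (intro nn_integral_mono enn_powr_mono) auto
    also have "\<dots> = ennreal (B powr P) * (\<integral>\<^sup>+x. enn_powr (maximal G x) P \<partial>lborel)"
      using P B by (simp add: enn_powr_mult nn_integral_cmult)
    also have "\<dots> \<le> ennreal (B powr P) * (ennreal M * (\<integral>\<^sup>+x. enn_powr (G x) P \<partial>lborel))"
      by (intro mult_left_mono M) auto
    finally show "(\<integral>\<^sup>+x. enn_powr (SUP j. decay_conv b (\<mu> j) (g j) x) P \<partial>lborel)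
      \<le> ennreal (B powr P * M) * (\<integral>\<^sup>+x. enn_powr (SUP j. g j x) P \<partial>lborel)"
      using M by (simp add: G_def ennreal_mult mult.assoc)
  qed
qed

section \<open>Smooth functions of compact support and their Fourier transforms\<close>

definition pd :: "'n::finite \<Rightarrow> (real^'n \<Rightarrow> complex) \<Rightarrow> real^'n \<Rightarrow> complex" where
  "pd i f = (\<lambda>x. frechet_derivative f (at x) (axis i 1))"

text \<open>\<open>iter_partial\<close> keeps the derivative taken last at the head of its list,
  while product and chain rules speak of the one taken first. \<open>ck\<close> recurses on the
  latter, so closure properties follow by induction with the function generalised. The index counts
  so that \<open>ck k\<close> asks for differentiability of all partials of order at most k.\<close>

primrec ck :: "nat \<Rightarrow> (real^'n::finite \<Rightarrow> complex) \<Rightarrow> bool" where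
  "ck 0 f = (\<forall>x. f differentiable (at x))"
| "ck (Suc k) f = ((\<forall>x. f differentiable (at x)) \<and> (\<forall>i. ck k (pd i f)))"

lemma iter_partial_snoc: "iter_partial (\<alpha> @ [i]) f = iter_partial \<alpha> (pd i f)"
  by (induction \<alpha>) (auto simp: pd_def)

lemma ck_iff: "ck k f \<longleftrightarrow> (\<forall>\<alpha> x. length \<alpha> \<le> k \<longrightarrow> iter_partial \<alpha> f differentiable (at x))"
proof (induction k arbitrary: f)
  case (Suc k)
  show ?case
  proof safe
    fix \<alpha> :: "'a list" and x assume *: "ck (Suc k) f" "length \<alpha> \<le> Suc k"
    then show "iter_partial \<alpha> f differentiable (at x)"
      by (cases \<alpha> rule: rev_cases) (auto simp: iter_partial_snoc Suc)
  next
    assume *: "\<forall>\<alpha> x. length \<alpha> \<le> Suc k \<longrightarrow> iter_partial \<alpha> f differentiable (at x)"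
    have "f differentiable (at x)" for x using *[rule_format, of "[]"] by simp
    moreover have "ck k (pd i f)" for i
      unfolding Suc using *[rule_format, of "_ @ [i]"] by (simp add: iter_partial_snoc)
    ultimately show "ck (Suc k) f" by simp
  qed
qed auto

lemma smooth_iff_ck: "smooth f \<longleftrightarrow> (\<forall>k. ck k f)"
  unfolding smooth_def ck_iff by auto

lemma ck_differentiable: "ck k f \<Longrightarrow> f differentiable (at x)"
  by (cases k) auto

lemma ck_Suc_imp: "ck (Suc k) f \<Longrightarrow> ck k f"
  unfolding ck_iff by auto

lemma pd_eq: "(f has_derivative f') (at x) \<Longrightarrow> pd i f x = f' (axis i 1)"
  unfolding pd_def by (metis frechet_derivative_at)

lemma has_derivative_pd:
  "f differentiable (at x) \<Longrightarrow> \<exists>f'. (f has_derivative f') (at x) \<and> (\<forall>i. f' (axis i 1) = pd i f x)"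
  by (metis differentiable_def pd_eq)

lemma pd_mult:
  assumes "\<And>x. f differentiable (at x)" "\<And>x. g differentiable (at x)"
  shows "pd i (\<lambda>x. f x * g x) = (\<lambda>x. f x * pd i g x + pd i f x * g x)"
proof
  fix x
  obtain f' g' where f: "(f has_derivative f') (at x)" "f' (axis i 1) = pd i f x"
    and g: "(g has_derivative g') (at x)" "g' (axis i 1) = pd i g x"
    using has_derivative_pd assms by meson
  show "pd i (\<lambda>x. f x * g x) x = f x * pd i g x + pd i f x * g x"
    using pd_eq[OF has_derivative_mult[OF f(1) g(1)], of i] f g by simp
qed

lemma pd_add:
  assumes "\<And>x. f differentiable (at x)" "\<And>x. g differentiable (at x)"
  shows "pd i (\<lambda>x. f x + g x) = (\<lambda>x. pd i f x + pd i g x)"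
proof
  fix x
  obtain f' g' where f: "(f has_derivative f') (at x)" "f' (axis i 1) = pd i f x"
    and g: "(g has_derivative g') (at x)" "g' (axis i 1) = pd i g x"
    using has_derivative_pd assms by meson
  show "pd i (\<lambda>x. f x + g x) x = pd i f x + pd i g x"
    using pd_eq[OF has_derivative_add[OF f(1) g(1)], of i] f g by simp
qed

lemma pd_affine:
  assumes "\<And>x. f differentiable (at x)"
  shows "pd i (\<lambda>x. f (c *\<^sub>R x + a)) = (\<lambda>x. of_real c * pd i f (c *\<^sub>R x + a))"
proof
  fix x
  obtain f' where f: "(f has_derivative f') (at (c *\<^sub>R x + a))" "f' (axis i 1) = pd i f (c *\<^sub>R x + a)"
    using has_derivative_pd assms by meson
  have "((\<lambda>x. c *\<^sub>R x + a) has_derivative (\<lambda>h. c *\<^sub>R h)) (at x)"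
    by (auto intro!: derivative_eq_intros)
  from has_derivative_compose[OF this f(1)]
  have "pd i (\<lambda>x. f (c *\<^sub>R x + a)) x = f' (c *\<^sub>R axis i 1)" by (rule pd_eq)
  then show "pd i (\<lambda>x. f (c *\<^sub>R x + a)) x = of_real c * pd i f (c *\<^sub>R x + a)"
    using f linear_scale[OF has_derivative_linear[OF f(1)], of c "axis i 1"] by (simp add: scaleR_conv_of_real)
qed

lemma pd_cnj:
  assumes "\<And>x. f differentiable (at x)"
  shows "pd i (\<lambda>x. cnj (f x)) = (\<lambda>x. cnj (pd i f x))"
proof
  fix x
  obtain f' where f: "(f has_derivative f') (at x)" "f' (axis i 1) = pd i f x"
    using has_derivative_pd assms by meson
  from pd_eq[OF has_derivative_cnj[OF f(1)], of i] f
  show "pd i (\<lambda>x. cnj (f x)) x = cnj (pd i f x)" by simp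
qed

lemma ck_add: "ck k f \<Longrightarrow> ck k g \<Longrightarrow> ck k (\<lambda>x. f x + g x)"
  by (induction k arbitrary: f g) (auto simp: pd_add)

lemma ck_mult: "ck k f \<Longrightarrow> ck k g \<Longrightarrow> ck k (\<lambda>x. f x * g x)"
proof (induction k arbitrary: f g)
  case (Suc k)
  then have "ck k f" "ck k g" by (auto intro: ck_Suc_imp)
  with Suc show ?case by (auto simp: pd_mult intro!: ck_add)
qed auto

lemma ck_const: "ck k (\<lambda>_::real^'n::finite. c)"
proof -
  have "pd i (\<lambda>_::real^'n. d) = (\<lambda>_. 0)" for i and d :: complex
    by (rule ext, rule pd_eq[OF has_derivative_const])
  then show ?thesis by (induction k arbitrary: c) auto
qed

lemma differentiable_affine:
  assumes "f differentiable (at (c *\<^sub>R x + a))"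
  shows "(\<lambda>x. f (c *\<^sub>R x + a)) differentiable (at x)"
proof -
  have "((\<lambda>x. c *\<^sub>R x + a) has_derivative (\<lambda>h. c *\<^sub>R h)) (at x)"
    by (auto intro!: derivative_eq_intros)
  with assms show ?thesis
    unfolding differentiable_def using has_derivative_compose by blast
qed

lemma ck_affine: "ck k f \<Longrightarrow> ck k (\<lambda>x. f (c *\<^sub>R x + a))"
proof (induction k arbitrary: f)
  case 0
  then show ?case by (auto intro: differentiable_affine)
next
  case (Suc k)
  then show ?case by (auto simp: pd_affine intro: ck_mult ck_const differentiable_affine)
qed

lemma differentiable_cnj: "f differentiable F \<Longrightarrow> (\<lambda>x. cnj (f x)) differentiable F"
  unfolding differentiable_def using has_derivative_cnj by blast

lemma ck_cnj: "ck k f \<Longrightarrow> ck k (\<lambda>x. cnj (f x))"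
  by (induction k arbitrary: f) (auto simp: pd_cnj intro: differentiable_cnj)

lemma ck_coord: "ck k (\<lambda>x. complex_of_real (x $ j))"
proof -
  have d: "((\<lambda>x. complex_of_real (x $ j)) has_derivative (\<lambda>h. complex_of_real (h $ j))) (at x)" for x
    by (intro bounded_linear_imp_has_derivative bounded_linear_compose[OF bounded_linear_of_real] bounded_linear_vec_nth)
  have "pd i (\<lambda>x. complex_of_real (x $ j)) = (\<lambda>_. of_real (axis i 1 $ j))" for i
    by (rule ext, rule pd_eq[OF d])
  then show ?thesis using d ck_const by (cases k) (auto simp: differentiable_def)
qed

section \<open>Smooth functions supported in a ball\<close>

definition test :: "real \<Rightarrow> (real^'n::finite \<Rightarrow> complex) \<Rightarrow> bool" where
  "test R u \<longleftrightarrow> smooth u \<and> (\<forall>x. R < norm x \<longrightarrow> u x = 0)"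

lemma test_differentiable: "test R u \<Longrightarrow> u differentiable (at x)"
  unfolding test_def smooth_iff_ck using ck_differentiable by blast

lemma test_continuous: "test R u \<Longrightarrow> continuous_on S u"
  using test_differentiable differentiable_imp_continuous_on differentiable_on_def
  by (metis differentiable_at_withinI)

lemma test_measurable: "test R u \<Longrightarrow> u \<in> borel_measurable borel"
  by (intro borel_measurable_continuous_onI test_continuous)

lemma test_bounded:
  assumes "test R u"
  obtains B where "0 < B" "\<And>x. norm (u x) \<le> B"
proof -
  have "compact (u ` cball 0 R)"
    by (intro compact_continuous_image test_continuous[OF assms]) auto
  then obtain B where B: "0 < B" "\<And>y. y \<in> u ` cball 0 R \<Longrightarrow> norm y \<le> B"
    using bounded_pos compact_imp_bounded by metis
  have "norm (u x) \<le> B" for x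
    using B assms by (cases "norm x \<le> R") (auto simp: test_def)
  with B that show ?thesis by blast
qed

lemma test_pd:
  fixes u :: "real^'n::finite \<Rightarrow> complex"
  assumes "test R u"
  shows "test R (pd i u)"
  unfolding test_def
proof safe
  have "ck (Suc k) u" for k using assms by (auto simp: test_def smooth_iff_ck)
  then show "smooth (pd i u)" unfolding smooth_iff_ck by simp
  fix x :: "real^'n" assume x: "R < norm x"
  have "((\<lambda>_. 0 :: complex) has_derivative (\<lambda>_. 0)) (at x)" by simp
  then have "(u has_derivative (\<lambda>_. 0)) (at x)"
  proof (rule has_derivative_transform_within_open)
    show "open {y. R < norm y}" by (intro open_Collect_less continuous_intros)
    show "x \<in> {y. R < norm y}" using x by simp
    show "\<And>y. y \<in> {y. R < norm y} \<Longrightarrow> 0 = u y" using assms by (auto simp: test_def)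
  qed
  then show "pd i u x = 0" by (simp add: pd_eq)
qed

lemma test_mult: "smooth f \<Longrightarrow> test R u \<Longrightarrow> test R (\<lambda>x. f x * u x)"
  unfolding test_def smooth_iff_ck by (auto intro: ck_mult)

lemma test_integrable:
  fixes u :: "real^'n::finite \<Rightarrow> complex"
  assumes "test R u"
  shows "integrable lborel u"
proof -
  obtain B where B: "0 < B" "\<And>x. norm (u x) \<le> B" using test_bounded[OF assms] by blast
  show ?thesis
  proof (rule Bochner_Integration.integrable_bound)
    show "integrable lborel (\<lambda>x. B * indicator (cball (0::real^'n) R) x)"
      using emeasure_lborel_cball_finite[of "0::real^'n" R] by (intro integrable_mult_right integrable_real_indicator) auto
    show "u \<in> borel_measurable lborel" using test_measurable[OF assms] by simp
    show "AE x in lborel. norm (u x) \<le> norm (B * indicator (cball 0 R) x)"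
      using B assms by (auto simp: test_def indicator_def less_imp_le)
  qed
qed

lemma norm_cis_mult [simp]: "cmod (cis a * x) = cmod x"
  by (simp add: norm_mult)

lemma borel_measurable_cis [measurable]: "f \<in> borel_measurable M \<Longrightarrow> (\<lambda>x. cis (f x)) \<in> borel_measurable M"
  by (rule borel_measurable_continuous_on[where f = cis])
    (auto simp: cis_conv_exp intro!: continuous_intros)

lemma integrable_cis_mult:
  fixes u :: "'a \<Rightarrow> complex"
  assumes "integrable M u" and [measurable]: "f \<in> borel_measurable M"
  shows "integrable M (\<lambda>x. cis (f x) * u x)"
  by (rule Bochner_Integration.integrable_bound[OF assms(1)]) (use assms(1) in auto)

section \<open>Affine substitutions and Fourier transforms of test functions\<close>

lemma lborel_integral_affine:
  fixes f :: "'a::euclidean_space \<Rightarrow> 'b::{banach, second_countable_topology}"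
  assumes [measurable]: "f \<in> borel_measurable borel" and c: "c \<noteq> 0"
  shows "(LINT x|lborel. f x) = \<bar>c\<bar> ^ DIM('a) *\<^sub>R (LINT x|lborel. f (t + c *\<^sub>R x))"
  by (subst lborel_affine[OF c, of t]) (simp add: integral_density integral_distr)

lemma lborel_integral_translate:
  fixes f :: "'a::euclidean_space \<Rightarrow> 'b::{banach, second_countable_topology}"
  assumes [measurable]: "f \<in> borel_measurable borel"
  shows "(LINT x|lborel. f (x + t)) = (LINT x|lborel. f x)"
  using lborel_integral_affine[OF assms, of 1 t] by (simp add: add.commute)

lemma lborel_nn_integral_affine:
  fixes f :: "'a::euclidean_space \<Rightarrow> ennreal"
  assumes [measurable]: "f \<in> borel_measurable borel" and c: "c \<noteq> 0"
  shows "(\<integral>\<^sup>+x. f x \<partial>lborel) = ennreal (\<bar>c\<bar> ^ DIM('a)) * (\<integral>\<^sup>+x. f (t + c *\<^sub>R x) \<partial>lborel)"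
  by (subst lborel_affine[OF c, of t]) (simp add: nn_integral_density nn_integral_distr nn_integral_cmult)

text \<open>The Fourier transform without its normalising factor and against the Borel measure; the
  powers of 2 pi are put into the kernels instead.\<close>

definition hat :: "(real^'n::finite \<Rightarrow> complex) \<Rightarrow> real^'n \<Rightarrow> complex" where
  "hat u z = (LINT x|lborel. cis (- (x \<bullet> z)) * u x)"

lemma hat_bound: "cmod (hat u z) \<le> (LINT x|lborel. cmod (u x))"
  unfolding hat_def using integral_norm_bound[of lborel "\<lambda>x. cis (- (x \<bullet> z)) * u x"] by simp

lemma test_increment:
  fixes u :: "real^'n::finite \<Rightarrow> complex"
  assumes u: "test R u" and B: "\<And>x. norm (pd i u x) \<le> B"
  shows "((\<lambda>t. u (x + t *\<^sub>R axis i 1)) has_vector_derivative pd i u (x + t *\<^sub>R axis i 1)) (at t)"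
    and "norm (u (x + t *\<^sub>R axis i 1) - u x) \<le> B * \<bar>t\<bar>"
proof -
  show *: "((\<lambda>t. u (x + t *\<^sub>R axis i 1)) has_vector_derivative pd i u (x + t *\<^sub>R axis i 1)) (at t)" for t
  proof -
    obtain u' where u': "(u has_derivative u') (at (x + t *\<^sub>R axis i 1))" "u' (axis i 1) = pd i u (x + t *\<^sub>R axis i 1)"
      using has_derivative_pd test_differentiable[OF u] by meson
    have "((\<lambda>t. x + t *\<^sub>R axis i 1) has_derivative (\<lambda>h. h *\<^sub>R axis i 1)) (at t)"
      by (auto intro!: derivative_eq_intros)
    from has_derivative_compose[OF this u'(1)] show ?thesis
      using u'(2) linear_scale[OF has_derivative_linear[OF u'(1)]] by (simp add: has_vector_derivative_def)
  qed
  have "norm (u (x + t *\<^sub>R axis i 1) - u (x + 0 *\<^sub>R axis i 1)) \<le> B * norm (t - 0)"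
  proof (rule differentiable_bound[where S = UNIV and f' = "\<lambda>t h. h *\<^sub>R pd i u (x + t *\<^sub>R axis i 1)"])
    show "onorm (\<lambda>h. h *\<^sub>R pd i u (x + t *\<^sub>R axis i 1)) \<le> B" for t
      by (rule onorm_le) (auto simp: mult.commute[of _ "norm (pd i u _)"] intro!: mult_right_mono B)
  qed (use * in \<open>auto simp: has_vector_derivative_def\<close>)
  then show "norm (u (x + t *\<^sub>R axis i 1) - u x) \<le> B * \<bar>t\<bar>" by simp
qed

lemma vector_derivative_quotient:
  assumes "(f has_vector_derivative D) (at 0)"
  shows "((\<lambda>t. (f t - f 0) /\<^sub>R t) \<longlongrightarrow> D) (at 0)"
proof -
  have "((\<lambda>h. norm (f (0 + h) - f 0 - h *\<^sub>R D) / norm h) \<longlongrightarrow> 0) (at 0)"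
    using assms unfolding has_vector_derivative_def has_derivative_at by blast
  then have "((\<lambda>t. norm ((f t - f 0) /\<^sub>R t - D)) \<longlongrightarrow> 0) (at 0)"
  proof (rule Lim_transform_eventually)
    show "\<forall>\<^sub>F h in at 0. norm (f (0 + h) - f 0 - h *\<^sub>R D) / norm h = norm ((f h - f 0) /\<^sub>R h - D)"
      unfolding eventually_at_filter
    proof (intro always_eventually allI impI)
      fix h :: real assume "h \<noteq> 0"
      then have "(f h - f 0) /\<^sub>R h - D = (f h - f 0 - h *\<^sub>R D) /\<^sub>R h"
        by (simp add: scaleR_diff_right)
      then show "norm (f (0 + h) - f 0 - h *\<^sub>R D) / norm h = norm ((f h - f 0) /\<^sub>R h - D)"
        by (simp add: divide_inverse mult.commute)
    qed
  qed
  then show ?thesis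
    by (rule LIM_zero_cancel[OF tendsto_norm_zero_cancel])
qed

text \<open>Translating u multiplies its transform by a character. The transforms of difference
  quotients therefore converge to the right side, and dominated convergence identifies their limit
  as the transform of the derivative.\<close>

lemma hat_pd:
  fixes u :: "real^'n::finite \<Rightarrow> complex"
  assumes u: "test R u"
  shows "hat (pd i u) z = \<i> * of_real (z $ i) * hat u z"
proof -
  let ?e = "axis i 1 :: real^'n"
  note [measurable] = test_measurable[OF u] test_measurable[OF test_pd[OF u]]
  obtain B where B: "0 < B" "\<And>x. norm (pd i u x) \<le> B" using test_bounded[OF test_pd[OF u]] by blast
  \<comment> \<open>Steps of length at most 1 keep the supports of all difference quotients in the
    ball of radius R + 1, which supplies the integrable majorant.\<close>
  define s where "s n = 1 / real (Suc n)" for n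
  have s: "s n > 0" "s n \<le> 1" for n by (auto simp: s_def)
  have s0: "s \<longlonglongrightarrow> 0" unfolding s_def by (rule LIMSEQ_Suc[OF lim_1_over_n])
  have s0': "filterlim s (at 0) sequentially"
    using s0 s(1) unfolding filterlim_at by (auto intro!: eventuallyI simp: less_imp_neq[symmetric])
  have trans: "(LINT x|lborel. cis (- (x \<bullet> z)) * u (x + t *\<^sub>R ?e)) = cis (t * z $ i) * hat u z" for t
  proof -
    have "(LINT x|lborel. cis (- (x \<bullet> z)) * u (x + t *\<^sub>R ?e))
      = (LINT x|lborel. (\<lambda>x. cis (- ((x - t *\<^sub>R ?e) \<bullet> z)) * u x) (x + t *\<^sub>R ?e))" by simp
    also have "\<dots> = (LINT x|lborel. cis (- ((x - t *\<^sub>R ?e) \<bullet> z)) * u x)"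
      by (rule lborel_integral_translate) measurable
    also have "\<dots> = (LINT x|lborel. cis (t * z $ i) * (cis (- (x \<bullet> z)) * u x))"
    proof -
      have "cis (- ((x - t *\<^sub>R ?e) \<bullet> z)) = cis (t * z $ i) * cis (- (x \<bullet> z))" for x
        by (simp add: inner_diff_left inner_axis' cis_mult)
      then show ?thesis by (simp only: mult.assoc)
    qed
    finally show ?thesis by (simp add: hat_def)
  qed
  have int: "integrable lborel (\<lambda>x. cis (- (x \<bullet> z)) * u (x + t *\<^sub>R ?e))" for t
  proof (rule integrable_cis_mult)
    have "integrable (distr lborel borel ((+) (t *\<^sub>R ?e))) u"
      using test_integrable[OF u] by (simp add: lborel_distr_plus)
    then show "integrable lborel (\<lambda>x. u (x + t *\<^sub>R ?e))"
      by (subst (asm) integrable_distr_eq) (auto simp: add.commute)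
  qed measurable
  define q where "q n x = cis (- (x \<bullet> z)) * ((u (x + s n *\<^sub>R ?e) - u x) /\<^sub>R s n)" for n x
  have q: "(LINT x|lborel. q n x) = ((cis (s n * z $ i) - 1) / of_real (s n)) * hat u z" for n
  proof -
    have "(LINT x|lborel. q n x) = (LINT x|lborel. (cis (- (x \<bullet> z)) * u (x + s n *\<^sub>R ?e) - cis (- (x \<bullet> z)) * u (x + 0 *\<^sub>R ?e)) / of_real (s n))"
      unfolding q_def using s[of n] by (intro Bochner_Integration.integral_cong) (auto simp: scaleR_conv_of_real field_simps)
    also have "\<dots> = (cis (s n * z $ i) * hat u z - cis (0 * z $ i) * hat u z) / of_real (s n)"
      by (simp only: integral_divide_zero Bochner_Integration.integral_diff[OF int int] trans)
    finally show ?thesis by (simp add: left_diff_distrib)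
  qed
  have "(\<lambda>n. LINT x|lborel. q n x) \<longlonglongrightarrow> hat (pd i u) z"
    unfolding hat_def
  proof (rule integral_dominated_convergence)
    show "integrable lborel (\<lambda>x. B * indicator (cball (0::real^'n) (R + 1)) x)"
      using emeasure_lborel_cball_finite[of "0::real^'n" "R + 1"] by (intro integrable_mult_right integrable_real_indicator) auto
    show "AE x in lborel. norm (q n x) \<le> B * indicator (cball 0 (R + 1)) x" for n
    proof (rule AE_I2)
      fix x
      show "norm (q n x) \<le> B * indicator (cball 0 (R + 1)) x"
      proof (cases "norm x \<le> R + 1")
        case True
        have "norm (q n x) = norm (u (x + s n *\<^sub>R ?e) - u x) / s n"
          unfolding q_def norm_cis_mult norm_scaleR using s(1)[of n] by (simp add: divide_inverse mult.commute)
        also have "\<dots> \<le> B"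
          using test_increment(2)[OF u B(2), of x "s n"] s[of n] by (simp add: divide_le_eq)
        finally show ?thesis using True by simp
      next
        case False
        have "norm x \<le> norm (x + s n *\<^sub>R ?e) + norm (s n *\<^sub>R ?e)"
          using norm_triangle_ineq4[of "x + s n *\<^sub>R ?e" "s n *\<^sub>R ?e"] by simp
        then have "R < norm (x + s n *\<^sub>R ?e)" using False s[of n] by simp
        then have "u (x + s n *\<^sub>R ?e) = 0" "u x = 0" using u False by (auto simp: test_def)
        then show ?thesis using False by (simp add: q_def)
      qed
    qed
    show "AE x in lborel. (\<lambda>n. q n x) \<longlonglongrightarrow> cis (- (x \<bullet> z)) * pd i u x"
    proof (rule AE_I2)
      fix x
      from test_increment(1)[OF u B(2), where x = x and t = 0]
      have "((\<lambda>t. (u (x + t *\<^sub>R ?e) - u x) /\<^sub>R t) \<longlongrightarrow> pd i u x) (at 0)"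
        using vector_derivative_quotient by fastforce
      then show "(\<lambda>n. q n x) \<longlonglongrightarrow> cis (- (x \<bullet> z)) * pd i u x"
        unfolding q_def by (intro tendsto_intros filterlim_compose[OF _ s0'])
    qed
  qed (auto simp: q_def)
  moreover have "(\<lambda>n. LINT x|lborel. q n x) \<longlonglongrightarrow> \<i> * of_real (z $ i) * hat u z"
    unfolding q
  proof (intro tendsto_mult_right)
    have "((\<lambda>t. cis (t * z $ i)) has_vector_derivative (\<i> * of_real (z $ i))) (at 0)"
    proof -
      have "(\<lambda>t. cis (t * z $ i)) = (\<lambda>t. exp (t *\<^sub>R (\<i> * of_real (z $ i))))"
        by (simp add: fun_eq_iff cis_conv_exp scaleR_conv_of_real mult_ac)
      then show ?thesis
        using exp_scaleR_has_vector_derivative_right[of "\<i> * of_real (z $ i)" 0 UNIV] by simp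
    qed
    from filterlim_compose[OF vector_derivative_quotient[OF this] s0']
    show "(\<lambda>n. (cis (s n * z $ i) - 1) / of_real (s n)) \<longlonglongrightarrow> \<i> * of_real (z $ i)"
      by (simp add: scaleR_conv_of_real divide_inverse mult.commute)
  qed
  ultimately show ?thesis by (rule LIMSEQ_unique)
qed

lemma test_funpow_pd: "test R u \<Longrightarrow> test R ((pd i ^^ k) u)"
  by (induction k) (auto intro: test_pd)

lemma hat_funpow_pd: "test R u \<Longrightarrow> hat ((pd i ^^ k) u) z = (\<i> * of_real (z $ i)) ^ k * hat u z"
  by (induction k) (auto simp: hat_pd[OF test_funpow_pd] mult.assoc)

lemma decay_one: "decay b 1 z = (1 + norm z) powr (- b)"
  by (simp add: decay_def)

lemma decay_one_antimono: "b \<le> c \<Longrightarrow> decay c 1 z \<le> decay b 1 z"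
  unfolding decay_one by (intro powr_mono) auto

lemma decay_one_shift_le:
  assumes "norm (z - w) \<le> 1" "0 \<le> b"
  shows "decay b 1 w \<le> 2 powr b * decay b 1 z"
proof -
  have "1 + norm z \<le> 2 * (1 + norm w)"
    using norm_triangle_ineq2[of z w] assms norm_ge_zero[of w] unfolding distrib_left by linarith
  then have "(2 * (1 + norm w)) powr - b \<le> (1 + norm z) powr - b"
    using assms by (intro powr_mono2') (auto intro: add_pos_nonneg)
  then have "2 powr b * (2 powr - b * (1 + norm w) powr - b) \<le> 2 powr b * (1 + norm z) powr - b"
    by (subst powr_mult[symmetric]) (auto intro: mult_left_mono)
  then show ?thesis
    unfolding decay_one by (simp add: mult.assoc[symmetric] powr_add[symmetric])
qed

text \<open>N derivatives in direction i multiply the transform by the N-th power of i z_i, and some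
  coordinate satisfies |z| \<le> n |z_i|. That direction depends on z, hence the sum over all
  directions in the constant.\<close>

lemma hat_decay:
  assumes u: "test R u"
  shows "\<exists>C>0. \<forall>z. cmod (hat u z) \<le> C * decay b 1 z"
proof -
  define N where "N = nat \<lceil>max b 0\<rceil>"
  have N: "b \<le> real N" by (simp add: N_def) linarith
  define n where "n = real CARD('a)"
  have n: "1 \<le> n" by (simp add: n_def Suc_leI)
  define I where "I i = (LINT x|lborel. cmod ((pd i ^^ N) u x))" for i
  have I: "\<bar>z $ i\<bar> ^ N * cmod (hat u z) \<le> I i" for i z
    using hat_bound[of "(pd i ^^ N) u" z] by (simp add: hat_funpow_pd[OF u] norm_mult norm_power I_def)
  define I0 where "I0 = (LINT x|lborel. cmod (u x))"
  have I0: "0 \<le> I0" by (simp add: I0_def)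
  have Ipos: "0 \<le> I i" for i by (simp add: I_def)
  define C where "C = (2 ^ N * I0 + (2 * n) ^ N * (\<Sum>i\<in>UNIV. I i)) + 1"
  have C: "0 < C" unfolding C_def using n I0 by (intro add_nonneg_pos add_nonneg_nonneg mult_nonneg_nonneg sum_nonneg Ipos) auto
  have "cmod (hat u z) \<le> C * decay b 1 z" for z
  proof -
    have "\<exists>i. norm z \<le> n * \<bar>z $ i\<bar>"
    proof (rule ccontr)
      assume "\<not> ?thesis"
      then have "(\<Sum>i\<in>UNIV. \<bar>z $ i\<bar>) < (\<Sum>i\<in>(UNIV::'a set). norm z / n)"
        using n by (intro sum_strict_mono) (auto simp: not_le field_simps)
      then show False using norm_le_l1_cart[of z] n by (simp add: n_def)
    qed
    then obtain i where i: "norm z \<le> n * \<bar>z $ i\<bar>" by blast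
    have "(1 + norm z) ^ N \<le> 2 ^ N + (2 * n) ^ N * \<bar>z $ i\<bar> ^ N"
    proof (cases "norm z \<le> 1")
      case True
      then have "(1 + norm z) ^ N \<le> 2 ^ N" by (intro power_mono) auto
      moreover have "0 \<le> (2 * n) ^ N * \<bar>z $ i\<bar> ^ N" using n by simp
      ultimately show ?thesis by linarith
    next
      case False
      then have "(1 + norm z) ^ N \<le> (2 * n * \<bar>z $ i\<bar>) ^ N" using i by (intro power_mono) auto
      also have "\<dots> = (2 * n) ^ N * \<bar>z $ i\<bar> ^ N" by (rule power_mult_distrib)
      finally have "(1 + norm z) ^ N \<le> (2 * n) ^ N * \<bar>z $ i\<bar> ^ N" .
      moreover have "(0::real) \<le> 2 ^ N" by simp
      ultimately show ?thesis by linarith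
    qed
    then have "(1 + norm z) ^ N * cmod (hat u z) \<le> (2 ^ N + (2 * n) ^ N * \<bar>z $ i\<bar> ^ N) * cmod (hat u z)"
      by (intro mult_right_mono) auto
    also have "\<dots> = 2 ^ N * cmod (hat u z) + (2 * n) ^ N * (\<bar>z $ i\<bar> ^ N * cmod (hat u z))"
      by (simp add: algebra_simps)
    also have "\<dots> \<le> 2 ^ N * I0 + (2 * n) ^ N * I i"
      unfolding I0_def using n by (intro add_mono mult_left_mono hat_bound I) auto
    also have "\<dots> \<le> 2 ^ N * I0 + (2 * n) ^ N * (\<Sum>i\<in>UNIV. I i)"
      using n Ipos by (intro add_left_mono mult_left_mono member_le_sum) auto
    also have "\<dots> \<le> C" by (simp add: C_def)
    finally have "cmod (hat u z) \<le> C * decay (real N) 1 z"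
      by (simp add: decay_one powr_minus powr_realpow add_pos_nonneg field_simps)
    also have "\<dots> \<le> C * decay b 1 z"
      using C N by (intro mult_left_mono decay_one_antimono) auto
    finally show ?thesis .
  qed
  with C show ?thesis by blast
qed

lemma cis_taylor: "cmod (cis (a + b) - cis a - \<i> * of_real b * cis a) \<le> b\<^sup>2 / 2"
proof -
  have "cis (a + b) - cis a - \<i> * of_real b * cis a = cis a * (cis b - (\<Sum>k\<le>1. (\<i> * b) ^ k / fact k))"
    by (simp add: cis_mult[symmetric] algebra_simps)
  also have "cmod \<dots> = cmod (cis b - (\<Sum>k\<le>1. (\<i> * b) ^ k / fact k))" by (rule norm_cis_mult)
  also have "\<dots> \<le> \<bar>b\<bar> ^ (Suc 1) / fact (Suc 1)"
    using iexp_approx1[of b 1] by (simp only: cis_conv_exp)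
  finally show ?thesis by (simp add: power2_eq_square)
qed

text \<open>A mean value inequality that asks for no derivative: on m + 1 equal pieces the quadratic
  errors add up to C / (m + 1), which vanishes in the limit.\<close>

lemma increment_le_of_taylor:
  fixes \<phi> :: "real \<Rightarrow> complex"
  assumes *: "\<And>s t. 0 \<le> s \<Longrightarrow> s \<le> 1 \<Longrightarrow> cmod (\<phi> (s + t) - \<phi> s) \<le> \<bar>t\<bar> * D + t\<^sup>2 * C"
  shows "cmod (\<phi> 1 - \<phi> 0) \<le> D"
proof -
  have "cmod (\<phi> 1 - \<phi> 0) \<le> D + C / real (Suc m)" for m
  proof -
    let ?n = "real (Suc m)"
    have "\<phi> 1 - \<phi> 0 = (\<Sum>k<Suc m. \<phi> (real (Suc k) / ?n) - \<phi> (real k / ?n))"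
      by (subst sum_lessThan_telescope) simp
    also have "cmod \<dots> \<le> (\<Sum>k<Suc m. cmod (\<phi> (real (Suc k) / ?n) - \<phi> (real k / ?n)))"
      by (rule norm_sum)
    also have "\<dots> \<le> (\<Sum>k<Suc m. (1 / ?n) * D + (1 / ?n)\<^sup>2 * C)"
    proof (rule sum_mono)
      fix k assume "k \<in> {..<Suc m}"
      then have "cmod (\<phi> (real k / ?n + 1 / ?n) - \<phi> (real k / ?n)) \<le> \<bar>1 / ?n\<bar> * D + (1 / ?n)\<^sup>2 * C"
        by (intro *) (auto simp: field_simps)
      moreover have "real k / ?n + 1 / ?n = real (Suc k) / ?n" by (simp add: add_divide_distrib)
      ultimately show "cmod (\<phi> (real (Suc k) / ?n) - \<phi> (real k / ?n)) \<le> (1 / ?n) * D + (1 / ?n)\<^sup>2 * C"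
        by simp
    qed
    also have "\<dots> = D + C / ?n"
    proof -
      have "(\<Sum>k<Suc m. (1 / ?n) * D + (1 / ?n)\<^sup>2 * C) = ?n * ((1 / ?n) * D + (1 / ?n)\<^sup>2 * C)"
        by simp
      also have "\<dots> = D + C / ?n"
        unfolding distrib_left power2_eq_square by simp
      finally show ?thesis .
    qed
    finally show ?thesis .
  qed
  moreover have "(\<lambda>m. D + C / real (Suc m)) \<longlonglongrightarrow> D + 0"
    by (intro tendsto_intros LIMSEQ_Suc[OF lim_const_over_n])
  ultimately show ?thesis
    by (intro Lim_bounded2[of "\<lambda>m. D + C / real (Suc m)" D 0]) auto
qed

lemma hat_diff: "integrable lborel u \<Longrightarrow> integrable lborel v \<Longrightarrow> hat (\<lambda>x. u x - v x) z = hat u z - hat v z"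
  unfolding hat_def right_diff_distrib
  by (intro Bochner_Integration.integral_diff integrable_cis_mult) measurable

lemma hat_cmult: "hat (\<lambda>x. c * u x) z = c * hat u z"
  unfolding hat_def by (simp add: mult.left_commute)

lemma hat_sum: "(\<And>i. i \<in> A \<Longrightarrow> integrable lborel (u i)) \<Longrightarrow> hat (\<lambda>x. \<Sum>i\<in>A. u i x) z = (\<Sum>i\<in>A. hat (u i) z)"
  unfolding hat_def sum_distrib_left
  by (intro Bochner_Integration.integral_sum integrable_cis_mult) (assumption, measurable)

text \<open>The derivative of the transform in direction h would be the transform of
  \<open>w\<close>, a combination of the test functions x_j u, whose transforms decay. The Taylor
  bound for \<open>cis\<close> leaves a remainder of second order, measured by the moment E, so
  \<open>increment_le_of_taylor\<close> applies. The bound \<open>norm h \<le> 1\<close> allows the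
  weight to be taken at z along the whole segment.\<close>

lemma hat_lipschitz:
  fixes u :: "real^'n::finite \<Rightarrow> complex"
  assumes u: "test R u" and b: "0 \<le> b"
  shows "\<exists>C>0. \<forall>z h. norm h \<le> 1 \<longrightarrow> cmod (hat u (z + h) - hat u z) \<le> C * norm h * decay b 1 z"
proof -
  note [measurable] = test_measurable[OF u]
  define v where "v j x = complex_of_real (x $ j) * u x" for j x
  have v: "test R (v j)" for j
    unfolding v_def by (intro test_mult u) (simp add: smooth_iff_ck ck_coord)
  have "\<forall>j. \<exists>C>0. \<forall>z. cmod (hat (v j) z) \<le> C * decay b 1 z"
    using hat_decay[OF v] by blast
  then obtain C where C: "\<And>j. 0 < C j" "\<And>j z. cmod (hat (v j) z) \<le> C j * decay b 1 z"
    by metis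
  define D where "D = (\<Sum>j\<in>UNIV. C j) * 2 powr b"
  have "0 < D" unfolding D_def using C by (intro mult_pos_pos sum_pos) auto
  moreover have "cmod (hat u (z + h) - hat u z) \<le> D * norm h * decay b 1 z" if h: "norm h \<le> 1" for z h
  proof -
    define w where "w x = \<i> * of_real (- (x \<bullet> h)) * u x" for x
    have w: "w x = (\<Sum>j\<in>UNIV. (- \<i> * of_real (h $ j)) * v j x)" for x
      by (simp add: w_def v_def inner_vec_def sum_distrib_left sum_distrib_right sum_negf mult_ac)
    have hw: "hat w y = (\<Sum>j\<in>UNIV. (- \<i> * of_real (h $ j)) * hat (v j) y)" for y
      unfolding w using test_integrable[OF v] by (subst hat_sum) (auto simp: hat_cmult[of "- _", simplified] hat_cmult[of "\<i> * _"])
    have wi: "integrable lborel w"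
      unfolding w by (intro Bochner_Integration.integrable_sum integrable_mult_right test_integrable[OF v])
    have hwb: "cmod (hat w (z + s *\<^sub>R h)) \<le> D * norm h * decay b 1 z" if s: "0 \<le> s" "s \<le> 1" for s
    proof -
      have sh: "norm (s *\<^sub>R h) \<le> 1" using s h by (simp add: mult_le_one)
      have "cmod (hat w (z + s *\<^sub>R h)) \<le> (\<Sum>j\<in>UNIV. cmod ((- \<i> * of_real (h $ j)) * hat (v j) (z + s *\<^sub>R h)))"
        unfolding hw by (rule norm_sum)
      also have "\<dots> \<le> (\<Sum>j\<in>UNIV. norm h * (C j * (2 powr b * decay b 1 z)))"
      proof (rule sum_mono)
        fix j
        have "cmod (hat (v j) (z + s *\<^sub>R h)) \<le> C j * decay b 1 (z + s *\<^sub>R h)" by (rule C)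
        also have "\<dots> \<le> C j * (2 powr b * decay b 1 z)"
          using C(1)[of j] sh b by (intro mult_left_mono decay_one_shift_le) auto
        finally show "cmod ((- \<i> * of_real (h $ j)) * hat (v j) (z + s *\<^sub>R h)) \<le> norm h * (C j * (2 powr b * decay b 1 z))"
          by (simp add: norm_mult mult_mono component_le_norm_cart)
      qed
      also have "\<dots> = D * norm h * decay b 1 z"
        by (simp add: D_def sum_distrib_left sum_distrib_right mult_ac)
      finally show ?thesis .
    qed
    define E where "E = (LINT x|lborel. (x \<bullet> h)\<^sup>2 / 2 * cmod (u x))"
    have Ei: "integrable lborel (\<lambda>x. (x \<bullet> h)\<^sup>2 / 2 * cmod (u x))"
    proof -
      have "integrable lborel (\<lambda>x. \<Sum>j\<in>UNIV. \<Sum>i\<in>UNIV. of_real (h $ j * h $ i / 2) * (complex_of_real (x $ i) * (complex_of_real (x $ j) * u x)))"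
        by (intro Bochner_Integration.integrable_sum integrable_mult_right test_integrable[of R] test_mult u)
          (simp_all add: smooth_iff_ck ck_coord)
      also have "(\<lambda>x. \<Sum>j\<in>UNIV. \<Sum>i\<in>UNIV. of_real (h $ j * h $ i / 2) * (complex_of_real (x $ i) * (complex_of_real (x $ j) * u x)))
        = (\<lambda>x. of_real ((x \<bullet> h)\<^sup>2 / 2) * u x)"
        by (simp add: fun_eq_iff inner_vec_def power2_eq_square sum_product sum_distrib_left sum_distrib_right sum_divide_distrib mult_ac)
      finally have "integrable lborel (\<lambda>x. norm (of_real ((x \<bullet> h)\<^sup>2 / 2) * u x))" by (rule integrable_norm)
      then show ?thesis by (simp add: norm_mult norm_divide norm_power)
    qed
    have incr: "cmod (hat u (z + (s + t) *\<^sub>R h) - hat u (z + s *\<^sub>R h)) \<le> \<bar>t\<bar> * (D * norm h * decay b 1 z) + t\<^sup>2 * E"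
      if s: "0 \<le> s" "s \<le> 1" for s t
    proof -
      let ?c = "\<lambda>r x. cis (- (x \<bullet> (z + r *\<^sub>R h)))"
      let ?d = "\<lambda>x. ?c (s + t) x * u x - ?c s x * u x - of_real t * (?c s x * w x)"
      have i1: "integrable lborel (\<lambda>x. ?c (s + t) x * u x)" and i2: "integrable lborel (\<lambda>x. ?c s x * u x)"
        by (intro integrable_cis_mult test_integrable[OF u]; measurable)+
      have i3: "integrable lborel (\<lambda>x. of_real t * (?c s x * w x))"
        by (intro integrable_mult_right integrable_cis_mult wi) measurable
      have eq: "hat u (z + (s + t) *\<^sub>R h) - hat u (z + s *\<^sub>R h) - of_real t * hat w (z + s *\<^sub>R h) = (LINT x|lborel. ?d x)"
        unfolding hat_def
        by (simp only: Bochner_Integration.integral_diff[OF Bochner_Integration.integrable_diff[OF i1 i2] i3]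
            Bochner_Integration.integral_diff[OF i1 i2] integral_mult_right_zero)
      have "cmod (LINT x|lborel. ?d x) \<le> (LINT x|lborel. t\<^sup>2 * ((x \<bullet> h)\<^sup>2 / 2 * cmod (u x)))"
      proof (rule order_trans[OF integral_norm_bound], rule integral_mono)
        show "integrable lborel (\<lambda>x. cmod (?d x))"
          by (intro integrable_norm Bochner_Integration.integrable_diff i1 i2 i3)
        show "integrable lborel (\<lambda>x. t\<^sup>2 * ((x \<bullet> h)\<^sup>2 / 2 * cmod (u x)))" using Ei by (rule integrable_mult_right)
        fix x
        let ?a = "- (x \<bullet> (z + s *\<^sub>R h))" and ?b = "- (t * (x \<bullet> h))"
        have "?d x = (cis (?a + ?b) - cis ?a - \<i> * of_real ?b * cis ?a) * u x"
          by (simp add: w_def inner_add_right algebra_simps)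
        then have "cmod (?d x) \<le> ?b\<^sup>2 / 2 * cmod (u x)"
          by (simp only: norm_mult) (intro mult_right_mono cis_taylor norm_ge_zero)
        then show "cmod (?d x) \<le> t\<^sup>2 * ((x \<bullet> h)\<^sup>2 / 2 * cmod (u x))"
          by (simp add: power_mult_distrib)
      qed
      also have "\<dots> = t\<^sup>2 * E" by (simp add: E_def)
      finally have "cmod (hat u (z + (s + t) *\<^sub>R h) - hat u (z + s *\<^sub>R h) - of_real t * hat w (z + s *\<^sub>R h)) \<le> t\<^sup>2 * E"
        unfolding eq .
      moreover have "cmod (of_real t * hat w (z + s *\<^sub>R h)) \<le> \<bar>t\<bar> * (D * norm h * decay b 1 z)"
        using hwb[OF s] by (simp add: norm_mult mult_left_mono)
      ultimately show ?thesis
        using norm_triangle_sub[of "hat u (z + (s + t) *\<^sub>R h) - hat u (z + s *\<^sub>R h)" "of_real t * hat w (z + s *\<^sub>R h)"]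
        by linarith
    qed
    from increment_le_of_taylor[of "\<lambda>s. hat u (z + s *\<^sub>R h)", OF incr] show ?thesis by simp
  qed
  ultimately show ?thesis by blast
qed

section \<open>Fourier inversion\<close>

lemma integrable_decay:
  assumes "real DIM('a) < b" "0 < \<mu>"
  shows "integrable lborel (decay b \<mu> :: 'a::euclidean_space \<Rightarrow> real)"
proof -
  obtain C :: real where C: "0 < C" "\<And>\<mu> (x::'a). 0 < \<mu> \<Longrightarrow> (\<integral>\<^sup>+y. ennreal (decay b \<mu> (y - x)) \<partial>lborel) \<le> ennreal C"
    using decay_integral_bound[OF assms(1)] by blast
  have "(\<integral>\<^sup>+y. ennreal (decay b \<mu> (y::'a)) \<partial>lborel) \<le> ennreal C"
    using C(2)[OF assms(2), of 0] by simp
  also have "\<dots> < \<infinity>" by simp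
  finally show ?thesis
    using assms by (intro integrableI_nonneg) auto
qed

text \<open>Provides the integrability for Fubini's theorem when the integrand is a product of
  functions of one variable up to an oscillating factor of modulus 1.\<close>

lemma integrable_pair_mult:
  fixes f :: "'a::euclidean_space \<Rightarrow> complex" and g :: "'b::euclidean_space \<Rightarrow> complex"
  assumes f: "integrable lborel f" and g: "integrable lborel g"
    and [measurable]: "h \<in> borel_measurable (lborel \<Otimes>\<^sub>M lborel)"
    and h: "\<And>x y. cmod (h (x, y)) \<le> cmod (f x * g y)"
  shows "integrable (lborel \<Otimes>\<^sub>M lborel) h"
proof (rule lborel_pair.Fubini_integrable)
  have bnd: "integrable lborel (\<lambda>y. h (x, y))" for x
    by (rule Bochner_Integration.integrable_bound[OF integrable_mult_right[OF g, of "f x"]]) (use h in auto)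
  show "AE x in lborel. integrable lborel (\<lambda>y. h (x, y))"
    using bnd by simp
  show "integrable lborel (\<lambda>x. LINT y|lborel. norm (h (x, y)))"
  proof (rule Bochner_Integration.integrable_bound)
    show "integrable lborel (\<lambda>x. cmod (f x) * (LINT y|lborel. cmod (g y)))"
      using f by (intro integrable_mult_left integrable_norm)
    show "AE x in lborel. norm (LINT y|lborel. norm (h (x, y))) \<le> norm (cmod (f x) * (LINT y|lborel. cmod (g y)))"
    proof (rule AE_I2)
      fix x
      have "(LINT y|lborel. norm (h (x, y))) \<le> (LINT y|lborel. cmod (f x) * cmod (g y))"
        using h by (intro integral_mono integrable_norm bnd integrable_mult_right g) (simp add: norm_mult)
      then show "norm (LINT y|lborel. norm (h (x, y))) \<le> norm (cmod (f x) * (LINT y|lborel. cmod (g y)))"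
        by simp
    qed
  qed measurable
qed measurable

lemma lborel_integral_prod_Basis:
  fixes F :: "'a::euclidean_space \<Rightarrow> real \<Rightarrow> complex"
  assumes F: "\<And>b. b \<in> Basis \<Longrightarrow> integrable lborel (F b)"
  shows "integrable lborel (\<lambda>x. \<Prod>b\<in>Basis. F b (x \<bullet> b))"
    and "(LINT x|lborel. (\<Prod>b\<in>Basis. F b (x \<bullet> b))) = (\<Prod>b\<in>Basis. LINT t|lborel. F b t)"
proof -
  have P: "product_sigma_finite (\<lambda>_::'a. lborel :: real measure)"
    unfolding product_sigma_finite_def by (intro allI sigma_finite_lborel)
  have Fm: "(\<lambda>x::'a. F b (x \<bullet> b)) \<in> borel_measurable borel" if "b \<in> Basis" for b
  proof -
    have "F b \<in> borel_measurable borel" using borel_measurable_integrable[OF F[OF that]] by simp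
    then show ?thesis
      using measurable_compose[of "\<lambda>x::'a. x \<bullet> b" borel borel "F b" borel] by simp
  qed
  have m: "(\<lambda>f. \<Sum>b\<in>Basis. f b *\<^sub>R b) \<in> (\<Pi>\<^sub>M b\<in>(Basis::'a set). lborel) \<rightarrow>\<^sub>M (borel :: 'a measure)"
    by measurable
  have eq: "(\<Prod>b\<in>Basis. F b ((\<Sum>b\<in>Basis. f b *\<^sub>R b) \<bullet> b)) = (\<Prod>b\<in>Basis. F b (f b))" for f
    by (intro prod.cong refl) simp
  have mm: "(\<lambda>x. \<Prod>b\<in>Basis. F b (x \<bullet> b)) \<in> borel_measurable (borel :: 'a measure)"
    by (intro borel_measurable_prod Fm)
  show "integrable lborel (\<lambda>x. \<Prod>b\<in>Basis. F b (x \<bullet> b))"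
    unfolding lborel_eq[where 'a = 'a] using product_sigma_finite.product_integrable_prod[OF P, of Basis F] F
    by (subst integrable_distr_eq[OF m mm]) (simp add: eq)
  show "(LINT x|lborel. (\<Prod>b\<in>Basis. F b (x \<bullet> b))) = (\<Prod>b\<in>Basis. LINT t|lborel. F b t)"
    unfolding lborel_eq[where 'a = 'a] using product_sigma_finite.product_integral_prod[OF P, of Basis F] F
    by (subst integral_distr[OF m mm]) (simp add: eq lborel_eq[where 'a = 'a, symmetric])
qed

definition gauss :: "'a::euclidean_space \<Rightarrow> real" where
  "gauss x = exp (- (norm x)\<^sup>2 / 2)"

lemma borel_measurable_gauss [measurable]: "gauss \<in> borel_measurable borel"
  unfolding gauss_def[abs_def] by measurable

lemma gauss_bounds: "0 < gauss x" "gauss x \<le> 1"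
  by (auto simp: gauss_def)

lemma abs_gauss [simp]: "\<bar>gauss x\<bar> = gauss x"
  by (simp add: gauss_def)

text \<open>The integral is, up to the factor sqrt (2 pi), the characteristic function of the
  standard normal distribution at -c.\<close>

lemma gauss_1d:
  "integrable lborel (\<lambda>t. cis (- (t * c)) * complex_of_real (exp (- t\<^sup>2 / 2)))"
  "(LINT t|lborel. cis (- (t * c)) * complex_of_real (exp (- t\<^sup>2 / 2))) = complex_of_real (sqrt (2 * pi) * exp (- c\<^sup>2 / 2))"
proof -
  have dens: "exp (- t\<^sup>2 / 2) = sqrt (2 * pi) * std_normal_density t" for t
    by (simp add: std_normal_density_def)
  have i: "integrable lborel (\<lambda>t. complex_of_real (exp (- t\<^sup>2 / 2)))"
    unfolding dens using integrable_normal_density[of 1 0]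
    by (intro integrable_of_real integrable_mult_right) auto
  show "integrable lborel (\<lambda>t. cis (- (t * c)) * complex_of_real (exp (- t\<^sup>2 / 2)))"
    by (rule integrable_cis_mult[OF i]) measurable
  have "char std_normal_distribution (- c) = (LINT t|lborel. std_normal_density t *\<^sub>R iexp (- c * t))"
    unfolding char_def by (subst integral_density) auto
  then have "(LINT t|lborel. std_normal_density t *\<^sub>R iexp (- c * t)) = complex_of_real (exp (- (c\<^sup>2) / 2))"
    by (simp add: char_std_normal_distribution)
  moreover have "(LINT t|lborel. cis (- (t * c)) * complex_of_real (exp (- t\<^sup>2 / 2)))
    = (LINT t|lborel. complex_of_real (sqrt (2 * pi)) * (std_normal_density t *\<^sub>R iexp (- c * t)))"
    unfolding dens by (intro Bochner_Integration.integral_cong refl) (simp add: cis_conv_exp scaleR_conv_of_real[where 'a = complex] mult_ac)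
  ultimately show "(LINT t|lborel. cis (- (t * c)) * complex_of_real (exp (- t\<^sup>2 / 2))) = complex_of_real (sqrt (2 * pi) * exp (- c\<^sup>2 / 2))"
    by (simp only: integral_mult_right_zero) simp
qed

lemma gauss_fourier:
  fixes w :: "'a::euclidean_space"
  shows "integrable lborel (\<lambda>x. cis (- (x \<bullet> w)) * complex_of_real (gauss x))"
    and "(LINT x|lborel. cis (- (x \<bullet> w)) * complex_of_real (gauss x)) = complex_of_real (sqrt (2 * pi) ^ DIM('a) * gauss w)"
proof -
  let ?F = "\<lambda>b t. cis (- (t * (w \<bullet> b))) * complex_of_real (exp (- t\<^sup>2 / 2))"
  have norm: "(norm x)\<^sup>2 = (\<Sum>b\<in>Basis. (x \<bullet> b)\<^sup>2)" for x :: 'a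
    unfolding power2_norm_eq_inner by (subst euclidean_inner) (simp add: power2_eq_square)
  have g: "gauss x = (\<Prod>b\<in>Basis. exp (- (x \<bullet> b)\<^sup>2 / 2))" for x :: 'a
    unfolding gauss_def norm by (subst exp_sum[symmetric]) (auto simp: sum_negf sum_divide_distrib)
  have c: "cis (- (x \<bullet> w)) = (\<Prod>b\<in>Basis. cis (- ((x \<bullet> b) * (w \<bullet> b))))" for x
    unfolding cis_conv_exp by (subst exp_sum[symmetric]) (auto simp: sum_negf sum_distrib_left[symmetric] euclidean_inner[of x w])
  have eq: "cis (- (x \<bullet> w)) * complex_of_real (gauss x) = (\<Prod>b\<in>Basis. ?F b (x \<bullet> b))" for x
    unfolding g c by (simp add: prod.distrib)
  show "integrable lborel (\<lambda>x. cis (- (x \<bullet> w)) * complex_of_real (gauss x))"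
    unfolding eq by (intro lborel_integral_prod_Basis gauss_1d)
  have "(LINT x|lborel. cis (- (x \<bullet> w)) * complex_of_real (gauss x)) = (\<Prod>b\<in>Basis. LINT t|lborel. ?F b t)"
    unfolding eq by (intro lborel_integral_prod_Basis gauss_1d)
  also have "\<dots> = (\<Prod>b\<in>(Basis::'a set). complex_of_real (sqrt (2 * pi) * exp (- (w \<bullet> b)\<^sup>2 / 2)))"
    by (simp only: gauss_1d)
  also have "\<dots> = complex_of_real (sqrt (2 * pi) ^ DIM('a) * gauss w)"
    by (simp only: of_real_prod[symmetric] prod.distrib prod_constant g)
  finally show "(LINT x|lborel. cis (- (x \<bullet> w)) * complex_of_real (gauss x)) = complex_of_real (sqrt (2 * pi) ^ DIM('a) * gauss w)" .
qed

lemma borel_measurable_hat [measurable]: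
  assumes [measurable]: "u \<in> borel_measurable borel"
  shows "hat u \<in> borel_measurable borel"
  unfolding hat_def[abs_def] by measurable

lemma hat_integrable:
  fixes u :: "real^'n::finite \<Rightarrow> complex"
  assumes u: "test R u"
  shows "integrable lborel (hat u)"
proof -
  note [measurable] = test_measurable[OF u]
  obtain C where C: "0 < C" "\<And>z. cmod (hat u z) \<le> C * decay (real CARD('n) + 1) 1 z"
    using hat_decay[OF u] by blast
  show ?thesis
  proof (rule Bochner_Integration.integrable_bound)
    show "integrable lborel (\<lambda>z::real^'n. C * decay (real CARD('n) + 1) 1 z)"
      by (intro integrable_mult_right integrable_decay) auto
    show "AE z in lborel. norm (hat u z) \<le> norm (C * decay (real CARD('n) + 1) 1 z)"
      using C by (auto intro!: AE_I2 order_trans[OF C(2)])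
  qed measurable
qed

text \<open>The Gaussian factor makes the double integral absolutely convergent. Exchanging the
  integrals moves the transform to the Gaussian, which up to a constant is its own transform, and
  substituting x = \<xi> + e t leaves an average of u near \<xi>.\<close>

lemma hat_inversion_gauss:
  fixes u :: "real^'n::finite \<Rightarrow> complex"
  assumes u: "test R u" and e: "0 < e"
  shows "(LINT y|lborel. cis (y \<bullet> \<xi>) * hat u y * complex_of_real (gauss (e *\<^sub>R y)))
    = complex_of_real (sqrt (2 * pi) ^ CARD('n)) * (LINT t|lborel. u (\<xi> + e *\<^sub>R t) * complex_of_real (gauss t))"
proof -
  note [measurable] = test_measurable[OF u]
  let ?n = "CARD('n)"
  have gi: "integrable lborel (\<lambda>y::real^'n. complex_of_real (gauss (e *\<^sub>R y)))"
  proof -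
    have "integrable lborel (\<lambda>y::real^'n. complex_of_real (gauss y))"
      using gauss_fourier(1)[where w = "0::real^'n"] by simp
    then have "integrable (density (distr lborel borel (\<lambda>x::real^'n. 0 + e *\<^sub>R x)) (\<lambda>_. \<bar>e\<bar> ^ DIM(real^'n))) (\<lambda>y. complex_of_real (gauss y))"
      using e by (subst lborel_affine[symmetric]) auto
    then show ?thesis
      using e integrable_scaleR_right[of "1 / e ^ CARD('n)" lborel "\<lambda>y::real^'n. e ^ CARD('n) *\<^sub>R complex_of_real (gauss (e *\<^sub>R y))"]
      by (simp add: integrable_density integrable_distr_eq)
  qed
  have int: "integrable (lborel \<Otimes>\<^sub>M lborel) (\<lambda>(x, y). u x * (cis (- (y \<bullet> (x - \<xi>))) * complex_of_real (gauss (e *\<^sub>R y))))"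
    by (rule integrable_pair_mult[OF test_integrable[OF u] gi]) (auto simp: split_def norm_mult)
  have "(LINT y|lborel. cis (y \<bullet> \<xi>) * hat u y * complex_of_real (gauss (e *\<^sub>R y)))
    = (LINT y|lborel. (LINT x|lborel. u x * (cis (- (y \<bullet> (x - \<xi>))) * complex_of_real (gauss (e *\<^sub>R y)))))"
  proof (intro Bochner_Integration.integral_cong refl)
    fix y
    have "cis (y \<bullet> \<xi>) * hat u y * complex_of_real (gauss (e *\<^sub>R y)) = (LINT x|lborel. (cis (y \<bullet> \<xi>) * complex_of_real (gauss (e *\<^sub>R y))) * (cis (- (x \<bullet> y)) * u x))"
      by (simp add: hat_def)
    also have "\<dots> = (LINT x|lborel. u x * (cis (- (y \<bullet> (x - \<xi>))) * complex_of_real (gauss (e *\<^sub>R y))))"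
    proof (intro Bochner_Integration.integral_cong refl)
      fix x
      have "cis (- (y \<bullet> (x - \<xi>))) = cis (y \<bullet> \<xi>) * cis (- (x \<bullet> y))"
        by (simp add: cis_mult inner_diff_right inner_commute)
      then show "(cis (y \<bullet> \<xi>) * complex_of_real (gauss (e *\<^sub>R y))) * (cis (- (x \<bullet> y)) * u x) = u x * (cis (- (y \<bullet> (x - \<xi>))) * complex_of_real (gauss (e *\<^sub>R y)))"
        by simp
    qed
    finally show "cis (y \<bullet> \<xi>) * hat u y * complex_of_real (gauss (e *\<^sub>R y)) = (LINT x|lborel. u x * (cis (- (y \<bullet> (x - \<xi>))) * complex_of_real (gauss (e *\<^sub>R y))))" .
  qed
  also have "\<dots> = (LINT x|lborel. (LINT y|lborel. u x * (cis (- (y \<bullet> (x - \<xi>))) * complex_of_real (gauss (e *\<^sub>R y)))))"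
    by (rule lborel_pair.Fubini_integral[OF int])
  also have "\<dots> = (LINT x|lborel. u x * (complex_of_real (sqrt (2 * pi) ^ ?n) * complex_of_real (gauss ((1 / e) *\<^sub>R (x - \<xi>)) / e ^ ?n)))"
  proof (intro Bochner_Integration.integral_cong refl)
    fix x
    have "complex_of_real (sqrt (2 * pi) ^ ?n * gauss ((1 / e) *\<^sub>R (x - \<xi>))) = (LINT y|lborel. cis (- (y \<bullet> ((1 / e) *\<^sub>R (x - \<xi>)))) * complex_of_real (gauss y))"
      using gauss_fourier(2)[of "(1 / e) *\<^sub>R (x - \<xi>)"] by simp
    also have "\<dots> = \<bar>e\<bar> ^ DIM(real^'n) *\<^sub>R (LINT y|lborel. cis (- ((0 + e *\<^sub>R y) \<bullet> ((1 / e) *\<^sub>R (x - \<xi>)))) * complex_of_real (gauss (0 + e *\<^sub>R y)))"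
      using e by (intro lborel_integral_affine) auto
    also have "\<dots> = e ^ ?n *\<^sub>R (LINT y|lborel. cis (- (y \<bullet> (x - \<xi>))) * complex_of_real (gauss (e *\<^sub>R y)))"
      using e by simp
    finally have "(LINT y|lborel. cis (- (y \<bullet> (x - \<xi>))) * complex_of_real (gauss (e *\<^sub>R y))) = complex_of_real (sqrt (2 * pi) ^ ?n * gauss ((1 / e) *\<^sub>R (x - \<xi>))) / e ^ ?n"
      using e by (simp add: scaleR_conv_of_real[where 'a = complex])
    then show "(LINT y|lborel. u x * (cis (- (y \<bullet> (x - \<xi>))) * complex_of_real (gauss (e *\<^sub>R y)))) = u x * (complex_of_real (sqrt (2 * pi) ^ ?n) * complex_of_real (gauss ((1 / e) *\<^sub>R (x - \<xi>)) / e ^ ?n))"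
      by simp
  qed
  also have "\<dots> = \<bar>e\<bar> ^ DIM(real^'n) *\<^sub>R (LINT t|lborel. u (\<xi> + e *\<^sub>R t) * (complex_of_real (sqrt (2 * pi) ^ ?n) * complex_of_real (gauss ((1 / e) *\<^sub>R (\<xi> + e *\<^sub>R t - \<xi>)) / e ^ ?n)))"
    using e by (intro lborel_integral_affine) auto
  also have "\<dots> = (LINT t|lborel. complex_of_real (sqrt (2 * pi) ^ ?n) * (u (\<xi> + e *\<^sub>R t) * complex_of_real (gauss t)))"
    using e by (subst integral_scaleR_right[symmetric]) (auto simp: scaleR_conv_of_real[where 'a = complex] mult_ac simp del: integral_mult_right_zero integral_mult_left_zero intro!: Bochner_Integration.integral_cong)
  also have "\<dots> = complex_of_real (sqrt (2 * pi) ^ ?n) * (LINT t|lborel. u (\<xi> + e *\<^sub>R t) * complex_of_real (gauss t))"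
    by (rule integral_mult_right_zero)
  finally show ?thesis .
qed

text \<open>The parameter of the Gaussian regularisation tends to 0. One factor sqrt (2 pi)^n comes
  from transforming the Gaussian, the other from its integral.\<close>

lemma hat_inversion:
  fixes u :: "real^'n::finite \<Rightarrow> complex"
  assumes u: "test R u"
  shows "(LINT y|lborel. cis (y \<bullet> \<xi>) * hat u y) = complex_of_real ((2 * pi) ^ CARD('n)) * u \<xi>"
proof -
  note [measurable] = test_measurable[OF u]
  let ?n = "CARD('n)"
  obtain B where B: "0 < B" "\<And>x. norm (u x) \<le> B" using test_bounded[OF u] by blast
  define s where "s k = 1 / real (Suc k)" for k
  have s: "0 < s k" for k by (simp add: s_def)
  have s0: "s \<longlonglongrightarrow> 0" unfolding s_def by (rule LIMSEQ_Suc[OF lim_1_over_n])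
  have gc: "(\<lambda>k. gauss (s k *\<^sub>R y)) \<longlonglongrightarrow> 1" for y :: "real^'n"
    unfolding gauss_def using s0 by (auto intro!: tendsto_eq_intros)
  have "(\<lambda>k. LINT y|lborel. cis (y \<bullet> \<xi>) * hat u y * complex_of_real (gauss (s k *\<^sub>R y))) \<longlonglongrightarrow> (LINT y|lborel. cis (y \<bullet> \<xi>) * hat u y)"
  proof (rule integral_dominated_convergence)
    show "integrable lborel (\<lambda>y. cmod (hat u y))" using hat_integrable[OF u] by (rule integrable_norm)
    show "AE y in lborel. (\<lambda>k. cis (y \<bullet> \<xi>) * hat u y * complex_of_real (gauss (s k *\<^sub>R y))) \<longlonglongrightarrow> cis (y \<bullet> \<xi>) * hat u y"
    proof (rule AE_I2)
      fix y
      show "(\<lambda>k. cis (y \<bullet> \<xi>) * hat u y * complex_of_real (gauss (s k *\<^sub>R y))) \<longlonglongrightarrow> cis (y \<bullet> \<xi>) * hat u y"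
        using tendsto_mult_left[OF tendsto_of_real[OF gc[of y]], of "cis (y \<bullet> \<xi>) * hat u y"] by simp
    qed
    show "AE y in lborel. norm (cis (y \<bullet> \<xi>) * hat u y * complex_of_real (gauss (s k *\<^sub>R y))) \<le> cmod (hat u y)" for k
      using gauss_bounds(2) by (auto simp: norm_mult intro!: AE_I2 mult_left_le)
  qed measurable
  moreover have "(\<lambda>k. LINT t|lborel. u (\<xi> + s k *\<^sub>R t) * complex_of_real (gauss t)) \<longlonglongrightarrow> (LINT t|lborel. u \<xi> * complex_of_real (gauss (t::real^'n)))"
  proof (rule integral_dominated_convergence)
    show "integrable lborel (\<lambda>t::real^'n. B * gauss t)"
      using integrable_norm[OF gauss_fourier(1)[where w = "0::real^'n"]]
      by (intro integrable_mult_right) simp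
    show "AE t in lborel. (\<lambda>k. u (\<xi> + s k *\<^sub>R t) * complex_of_real (gauss t)) \<longlonglongrightarrow> u \<xi> * complex_of_real (gauss t)"
    proof (intro AE_I2 tendsto_mult_right)
      fix t :: "real^'n"
      have "(\<lambda>k. \<xi> + s k *\<^sub>R t) \<longlonglongrightarrow> \<xi> + 0 *\<^sub>R t" by (intro tendsto_intros s0)
      moreover have "isCont u \<xi>" using test_continuous[OF u, of UNIV] by (simp add: continuous_on_eq_continuous_at)
      ultimately show "(\<lambda>k. u (\<xi> + s k *\<^sub>R t)) \<longlonglongrightarrow> u \<xi>" by (auto intro: isCont_tendsto_compose)
    qed
    show "AE t in lborel. norm (u (\<xi> + s k *\<^sub>R t) * complex_of_real (gauss t)) \<le> B * gauss t" for k
      using B by (auto simp: norm_mult intro!: AE_I2 mult_right_mono less_imp_le[OF gauss_bounds(1)])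
  qed measurable
  then have "(\<lambda>k. complex_of_real (sqrt (2 * pi) ^ ?n) * (LINT t|lborel. u (\<xi> + s k *\<^sub>R t) * complex_of_real (gauss t)))
    \<longlonglongrightarrow> complex_of_real (sqrt (2 * pi) ^ ?n) * (LINT t|lborel. u \<xi> * complex_of_real (gauss (t::real^'n)))"
    by (rule tendsto_mult_left)
  ultimately have "(LINT y|lborel. cis (y \<bullet> \<xi>) * hat u y) = complex_of_real (sqrt (2 * pi) ^ ?n) * (LINT t|lborel. u \<xi> * complex_of_real (gauss (t::real^'n)))"
    unfolding hat_inversion_gauss[OF u s] by (rule LIMSEQ_unique)
  also have "(LINT t|lborel. u \<xi> * complex_of_real (gauss (t::real^'n))) = u \<xi> * complex_of_real (sqrt (2 * pi) ^ ?n)"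
    using gauss_fourier(2)[where w = "0::real^'n"] by (simp add: gauss_def)
  also have "complex_of_real (sqrt (2 * pi) ^ ?n) * (u \<xi> * complex_of_real (sqrt (2 * pi) ^ ?n)) = complex_of_real ((sqrt (2 * pi) * sqrt (2 * pi)) ^ ?n) * u \<xi>"
    by (simp only: power_mult_distrib of_real_mult mult_ac)
  finally show ?thesis by simp
qed

section \<open>The kernels of the dyadic partial sums\<close>

text \<open>Correlation with this kernel applies the Fourier multiplier
  \<open>\<lambda>x. \<psi> ((1/2) ^ j *\<^sub>R x)\<close>. The forward transform appears because
  \<open>corr\<close> evaluates the kernel at x - y, the reflection of the usual
  convolution.\<close>

definition ker :: "(real^'n::finite \<Rightarrow> complex) \<Rightarrow> nat \<Rightarrow> real^'n \<Rightarrow> complex" where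
  "ker \<psi> j z = complex_of_real (1 / (2 * pi) ^ CARD('n)) * hat (\<lambda>x. \<psi> ((1/2) ^ j *\<^sub>R x)) z"

context
  fixes \<psi> :: "real^'n::finite \<Rightarrow> complex"
  assumes \<psi>: "resolution_generator \<psi>"
begin

lemma test_scaled: "test (2 * 2 ^ j) (\<lambda>x. \<psi> ((1/2) ^ j *\<^sub>R x))"
  unfolding test_def smooth_iff_ck
proof (intro conjI allI impI)
  show "ck k (\<lambda>x. \<psi> ((1/2) ^ j *\<^sub>R x))" for k
    using ck_affine[of k \<psi> "(1/2)^j" 0] \<psi> by (simp add: resolution_generator_def smooth_iff_ck)
  show "\<psi> ((1/2) ^ j *\<^sub>R x) = 0" if "2 * 2 ^ j < norm x" for x
    using \<psi> that unfolding resolution_generator_def by (auto simp: power_divide field_simps)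
qed

lemma test_psi: "test 2 \<psi>"
  using test_scaled[of 0] by simp

lemma borel_measurable_psi [measurable]: "\<psi> \<in> borel_measurable borel"
  by (rule test_measurable[OF test_psi])

lemma borel_measurable_ker [measurable]: "ker \<psi> j \<in> borel_measurable borel"
  unfolding ker_def[abs_def] by measurable

lemma ker_integrable: "integrable lborel (ker \<psi> j)"
  unfolding ker_def[abs_def] by (intro integrable_mult_right hat_integrable[OF test_scaled])

lemma ker_scale: "ker \<psi> j z = complex_of_real ((2 ^ j) ^ CARD('n)) * ker \<psi> 0 (2 ^ j *\<^sub>R z)"
proof -
  have "hat (\<lambda>x. \<psi> ((1/2) ^ j *\<^sub>R x)) z = \<bar>2 ^ j\<bar> ^ DIM(real^'n) *\<^sub>R (LINT x|lborel. cis (- ((0 + (2 ^ j) *\<^sub>R x) \<bullet> z)) * \<psi> ((1/2) ^ j *\<^sub>R (0 + 2 ^ j *\<^sub>R x)))"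
    unfolding hat_def by (rule lborel_integral_affine) auto
  also have "\<dots> = complex_of_real ((2 ^ j) ^ CARD('n)) * hat \<psi> (2 ^ j *\<^sub>R z)"
    by (simp add: hat_def scaleR_conv_of_real[where 'a = complex] power_divide)
  finally show ?thesis by (simp add: ker_def)
qed

text \<open>All kernels are rescalings of the one with j = 0, so a single constant serves every
  j.\<close>

lemma ker_decay: "\<exists>C>0. \<forall>j z. cmod (ker \<psi> j z) \<le> C * decay b (2 ^ j) z"
proof -
  obtain C where C: "0 < C" "\<And>z. cmod (hat \<psi> z) \<le> C * decay b 1 z"
    using hat_decay[OF test_psi] by blast
  let ?D = "C / (2 * pi) ^ CARD('n)"
  have "cmod (ker \<psi> j z) \<le> ?D * decay b (2 ^ j) z" for j z
  proof -
    have "cmod (ker \<psi> j z) = (2 ^ j) ^ CARD('n) * (cmod (hat \<psi> (2 ^ j *\<^sub>R z)) / (2 * pi) ^ CARD('n))"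
      by (subst ker_scale) (simp add: ker_def norm_mult norm_divide norm_power)
    also have "\<dots> \<le> (2 ^ j) ^ CARD('n) * ((C * decay b 1 (2 ^ j *\<^sub>R z)) / (2 * pi) ^ CARD('n))"
      by (intro mult_left_mono divide_right_mono C) auto
    also have "\<dots> = ?D * decay b (2 ^ j) z"
      by (simp add: decay_def)
    finally show ?thesis .
  qed
  moreover have "0 < ?D" using C by simp
  ultimately show ?thesis by blast
qed

lemma ker_lipschitz:
  assumes b: "0 \<le> b"
  shows "\<exists>C>0. \<forall>j z h. 2 ^ j * norm h \<le> 1 \<longrightarrow> cmod (ker \<psi> j (z + h) - ker \<psi> j z) \<le> C * (2 ^ j * norm h) * decay b (2 ^ j) z"
proof -
  obtain C where C: "0 < C" "\<And>z h. norm h \<le> 1 \<Longrightarrow> cmod (hat \<psi> (z + h) - hat \<psi> z) \<le> C * norm h * decay b 1 z"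
    using hat_lipschitz[OF test_psi b] by blast
  let ?D = "C / (2 * pi) ^ CARD('n)"
  have "cmod (ker \<psi> j (z + h) - ker \<psi> j z) \<le> ?D * (2 ^ j * norm h) * decay b (2 ^ j) z" if h: "2 ^ j * norm h \<le> 1" for j z h
  proof -
    have "ker \<psi> j (z + h) - ker \<psi> j z = complex_of_real ((2 ^ j) ^ CARD('n) / (2 * pi) ^ CARD('n)) * (hat \<psi> (2 ^ j *\<^sub>R z + 2 ^ j *\<^sub>R h) - hat \<psi> (2 ^ j *\<^sub>R z))"
      unfolding ker_scale[of j z] ker_scale[of j "z + h"] by (simp add: ker_def scaleR_add_right right_diff_distrib)
    then have "cmod (ker \<psi> j (z + h) - ker \<psi> j z) = (2 ^ j) ^ CARD('n) * (cmod (hat \<psi> (2 ^ j *\<^sub>R z + 2 ^ j *\<^sub>R h) - hat \<psi> (2 ^ j *\<^sub>R z)) / (2 * pi) ^ CARD('n))"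
      by (simp add: norm_mult norm_divide norm_power)
    also have "\<dots> \<le> (2 ^ j) ^ CARD('n) * ((C * norm (2 ^ j *\<^sub>R h) * decay b 1 (2 ^ j *\<^sub>R z)) / (2 * pi) ^ CARD('n))"
      using h by (intro mult_left_mono divide_right_mono C) auto
    also have "\<dots> = ?D * (2 ^ j * norm h) * decay b (2 ^ j) z"
      by (simp add: decay_def)
    finally show ?thesis .
  qed
  moreover have "0 < ?D" using C by simp
  ultimately show ?thesis by blast
qed

lemma ker_inversion: "(LINT y|lborel. cis (y \<bullet> \<xi>) * ker \<psi> j y) = \<psi> ((1/2) ^ j *\<^sub>R \<xi>)"
proof -
  have "(LINT y|lborel. cis (y \<bullet> \<xi>) * ker \<psi> j y) = (LINT y|lborel. complex_of_real (1 / (2 * pi) ^ CARD('n)) * (cis (y \<bullet> \<xi>) * hat (\<lambda>x. \<psi> ((1/2) ^ j *\<^sub>R x)) y))"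
    by (simp add: ker_def mult.left_commute)
  also have "\<dots> = complex_of_real (1 / (2 * pi) ^ CARD('n)) * (complex_of_real ((2 * pi) ^ CARD('n)) * \<psi> ((1/2) ^ j *\<^sub>R \<xi>))"
    by (simp only: integral_mult_right_zero hat_inversion[OF test_scaled])
  finally show ?thesis by (simp add: mult.assoc[symmetric] of_real_mult[symmetric] del: of_real_mult of_real_power of_real_divide)
qed

lemma ker_integral: "(LINT y|lborel. ker \<psi> j y) = 1"
  using ker_inversion[of 0 j] \<psi> by (simp add: resolution_generator_def)

text \<open>For j < i the multiplier of index i equals 1 wherever the multiplier of index j does not
  vanish, so convolving with the finer kernel changes nothing.\<close>

lemma ker_reproducing:
  assumes ij: "j < i"
  shows "(LINT y|lborel. ker \<psi> i (x - y) * ker \<psi> j y) = ker \<psi> j x"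
proof -
  define c where "c = complex_of_real (1 / (2 * pi) ^ CARD('n))"
  define u where "u j x = \<psi> ((1/2) ^ j *\<^sub>R x)" for j x
  have [measurable]: "u j \<in> borel_measurable borel" for j unfolding u_def[abs_def] by measurable
  have uu: "u i \<xi> * u j \<xi> = u j \<xi>" for \<xi>
  proof (cases "norm ((1/2) ^ i *\<^sub>R \<xi>) \<le> 1")
    case True
    then show ?thesis using \<psi> by (simp add: u_def resolution_generator_def)
  next
    case False
    then have "2 ^ i < norm \<xi>" by (simp add: power_divide field_simps)
    moreover have "(2::real) ^ (Suc j) \<le> 2 ^ i" using ij by (intro power_increasing) auto
    ultimately have "2 \<le> norm ((1/2) ^ j *\<^sub>R \<xi>)" by (simp add: power_divide field_simps)
    then show ?thesis using \<psi> by (simp add: u_def resolution_generator_def)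
  qed
  have int: "integrable (lborel \<Otimes>\<^sub>M lborel) (\<lambda>(\<xi>, y). c * (u i \<xi> * (cis (- (\<xi> \<bullet> (x - y))) * ker \<psi> j y)))"
  proof (rule integrable_pair_mult)
    show "integrable lborel (\<lambda>\<xi>. c * u i \<xi>)" using test_integrable[OF test_scaled[of i]] unfolding u_def by (rule integrable_mult_right)
    show "integrable lborel (ker \<psi> j)" by (rule ker_integrable)
  qed (auto simp: split_def norm_mult)
  have "(LINT y|lborel. ker \<psi> i (x - y) * ker \<psi> j y) = (LINT y|lborel. (LINT \<xi>|lborel. c * (u i \<xi> * (cis (- (\<xi> \<bullet> (x - y))) * ker \<psi> j y))))"
  proof (intro Bochner_Integration.integral_cong refl)
    fix y
    have "ker \<psi> i (x - y) * ker \<psi> j y = (LINT \<xi>|lborel. (c * ker \<psi> j y) * (cis (- (\<xi> \<bullet> (x - y))) * u i \<xi>))"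
      by (simp only: integral_mult_right_zero) (simp add: ker_def[of _ i] hat_def c_def u_def)
    also have "\<dots> = (LINT \<xi>|lborel. c * (u i \<xi> * (cis (- (\<xi> \<bullet> (x - y))) * ker \<psi> j y)))"
      by (simp only: mult_ac)
    finally show "ker \<psi> i (x - y) * ker \<psi> j y = (LINT \<xi>|lborel. c * (u i \<xi> * (cis (- (\<xi> \<bullet> (x - y))) * ker \<psi> j y)))" .
  qed
  also have "\<dots> = (LINT \<xi>|lborel. (LINT y|lborel. c * (u i \<xi> * (cis (- (\<xi> \<bullet> (x - y))) * ker \<psi> j y))))"
    by (rule lborel_pair.Fubini_integral[OF int])
  also have "\<dots> = (LINT \<xi>|lborel. c * (cis (- (\<xi> \<bullet> x)) * (u i \<xi> * u j \<xi>)))"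
  proof (intro Bochner_Integration.integral_cong refl)
    fix \<xi>
    have "(LINT y|lborel. c * (u i \<xi> * (cis (- (\<xi> \<bullet> (x - y))) * ker \<psi> j y))) = (LINT y|lborel. (c * u i \<xi> * cis (- (\<xi> \<bullet> x))) * (cis (y \<bullet> \<xi>) * ker \<psi> j y))"
    proof (intro Bochner_Integration.integral_cong refl)
      fix y
      have "cis (- (\<xi> \<bullet> (x - y))) = cis (- (\<xi> \<bullet> x)) * cis (y \<bullet> \<xi>)"
        by (simp add: cis_mult inner_diff_right inner_commute)
      then show "c * (u i \<xi> * (cis (- (\<xi> \<bullet> (x - y))) * ker \<psi> j y)) = (c * u i \<xi> * cis (- (\<xi> \<bullet> x))) * (cis (y \<bullet> \<xi>) * ker \<psi> j y)"
        by (simp only: mult_ac)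
    qed
    also have "\<dots> = (c * u i \<xi> * cis (- (\<xi> \<bullet> x))) * u j \<xi>"
      by (simp only: integral_mult_right_zero ker_inversion u_def)
    finally show "(LINT y|lborel. c * (u i \<xi> * (cis (- (\<xi> \<bullet> (x - y))) * ker \<psi> j y))) = c * (cis (- (\<xi> \<bullet> x)) * (u i \<xi> * u j \<xi>))"
      by (simp only: mult_ac)
  qed
  also have "\<dots> = ker \<psi> j x"
    unfolding uu by (simp add: ker_def hat_def c_def u_def)
  finally show ?thesis .
qed

end

section \<open>The dyadic blocks of a function\<close>

lemma schwartz_continuous: "\<eta> \<in> schwartz \<Longrightarrow> continuous_on S \<eta>"
  unfolding schwartz_def smooth_iff_ck
  by (auto intro!: continuous_at_imp_continuous_on differentiable_imp_continuous_within dest!: spec[of _ 0])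

lemma schwartz_measurable: "\<eta> \<in> schwartz \<Longrightarrow> \<eta> \<in> borel_measurable borel"
  by (intro borel_measurable_continuous_onI schwartz_continuous)

lemma le_mult_decay_one:
  assumes "(1 + norm x) ^ N * a \<le> M"
  shows "a \<le> M * decay (real N) 1 x"
proof -
  have pos: "0 < 1 + norm x" by (simp add: add_pos_nonneg)
  then have d: "decay (real N) 1 x = 1 / (1 + norm x) ^ N"
    by (simp add: decay_one powr_minus powr_realpow inverse_eq_divide)
  show ?thesis unfolding d using assms pos by (simp add: pos_le_divide_eq mult.commute)
qed

lemma schwartz_decay:
  assumes "\<eta> \<in> schwartz"
  shows "\<exists>C>0. \<forall>x. cmod (\<eta> x) \<le> C * decay b 1 x"
proof -
  define N where "N = nat \<lceil>max b 0\<rceil>"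
  have N: "b \<le> real N" by (simp add: N_def) linarith
  have "bounded (range (\<lambda>x. (1 + norm x) ^ N * cmod (iter_partial [] \<eta> x)))"
    using assms unfolding schwartz_def by blast
  then obtain C where C: "0 < C" "\<And>x. (1 + norm x) ^ N * cmod (\<eta> x) \<le> C"
    unfolding bounded_pos by (auto simp: abs_mult)
  have "cmod (\<eta> x) \<le> C * decay b 1 x" for x
  proof -
    have "cmod (\<eta> x) \<le> C * decay (real N) 1 x"
      by (rule le_mult_decay_one[OF C(2)])
    also have "\<dots> \<le> C * decay b 1 x"
      using C N by (intro mult_left_mono decay_one_antimono) auto
    finally show ?thesis .
  qed
  with C(1) show ?thesis by blast
qed

lemma schwartz_integrable:
  fixes \<eta> :: "real^'n::finite \<Rightarrow> complex"
  assumes "\<eta> \<in> schwartz"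
  shows "integrable lborel \<eta>"
proof -
  note [measurable] = schwartz_measurable[OF assms]
  obtain C where C: "0 < C" "\<And>x. cmod (\<eta> x) \<le> C * decay (real CARD('n) + 1) 1 x"
    using schwartz_decay[OF assms] by blast
  show ?thesis
  proof (rule Bochner_Integration.integrable_bound)
    show "integrable lborel (\<lambda>z::real^'n. C * decay (real CARD('n) + 1) 1 z)"
      by (intro integrable_mult_right integrable_decay) auto
    show "AE z in lborel. norm (\<eta> z) \<le> norm (C * decay (real CARD('n) + 1) 1 z)"
      using C by (auto intro!: AE_I2 order_trans[OF C(2)])
  qed measurable
qed

lemma test_iter_partial: "test R u \<Longrightarrow> test R (iter_partial \<alpha> u)"
proof (induction \<alpha>)
  case (Cons i \<alpha>)
  then have "test R (pd i (iter_partial \<alpha> u))" by (intro test_pd) auto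
  then show ?case by (simp add: pd_def)
qed simp

lemma test_in_schwartz:
  assumes u: "test R u"
  shows "u \<in> schwartz"
proof -
  have "bounded (range (\<lambda>x. (1 + norm x) ^ N * cmod (iter_partial \<alpha> u x)))" for N \<alpha>
  proof -
    obtain B where B: "0 < B" "\<And>x. norm (iter_partial \<alpha> u x) \<le> B"
      using test_bounded[OF test_iter_partial[OF u]] by blast
    have "norm ((1 + norm x) ^ N * cmod (iter_partial \<alpha> u x)) \<le> (1 + \<bar>R\<bar>) ^ N * B" for x
    proof (cases "norm x \<le> R")
      case True
      then show ?thesis
        unfolding norm_mult by (intro mult_mono) (use B in \<open>auto simp: power_abs[symmetric] intro!: power_mono\<close>)
    next
      case False
      then have "iter_partial \<alpha> u x = 0" using test_iter_partial[OF u] by (simp add: test_def)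
      then show ?thesis using B by simp
    qed
    then show ?thesis unfolding bounded_iff by blast
  qed
  then show ?thesis using u by (simp add: schwartz_def test_def)
qed

lemma decay_one_le: "0 \<le> b \<Longrightarrow> decay b 1 z \<le> 1"
  by (simp add: decay_one powr_minus inverse_le_1_iff ge_one_powr_ge_zero)

text \<open>The weight is at most 1, so |f| times the weight is at most the weight plus |f|^p. Both
  integrals are bounded independently of y; this stands in for Hoelder's inequality.\<close>

lemma Lp_decay_bound:
  fixes f :: "real^'n::finite \<Rightarrow> complex"
  assumes [measurable]: "f \<in> borel_measurable borel"
    and f: "(\<integral>\<^sup>+x. ennreal (cmod (f x) powr p) \<partial>lborel) < \<infinity>" and p: "1 \<le> p" and b: "real CARD('n) < b"
  shows "\<exists>B>0. \<forall>y. (\<integral>\<^sup>+x. ennreal (cmod (f x) * decay b 1 (x - y)) \<partial>lborel) \<le> ennreal B"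
proof -
  obtain C where C: "0 < C" "\<And>\<mu> x. 0 < \<mu> \<Longrightarrow> (\<integral>\<^sup>+y. ennreal (decay b \<mu> (y - x)) \<partial>(lborel :: (real^'n) measure)) \<le> ennreal C"
    using decay_integral_bound[where 'a = "real^'n" and b = b] b by auto
  obtain I where I: "0 \<le> I" "(\<integral>\<^sup>+x. ennreal (cmod (f x) powr p) \<partial>lborel) = ennreal I"
    using f by (cases "\<integral>\<^sup>+x. ennreal (cmod (f x) powr p) \<partial>lborel") auto
  have "(\<integral>\<^sup>+x. ennreal (cmod (f x) * decay b 1 (x - y)) \<partial>lborel) \<le> ennreal (C + I)" for y
  proof -
    have le: "cmod (f x) * decay b 1 (x - y) \<le> decay b 1 (x - y) + cmod (f x) powr p" for x
    proof (cases "cmod (f x) \<le> 1")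
      case True
      then have "cmod (f x) * decay b 1 (x - y) \<le> 1 * decay b 1 (x - y)" by (intro mult_right_mono) auto
      then show ?thesis by (simp add: add_increasing2)
    next
      case False
      have "decay b 1 (x - y) \<le> 1"
        using b by (intro decay_one_le) simp
      then have "cmod (f x) * decay b 1 (x - y) \<le> cmod (f x) * 1" by (intro mult_left_mono) auto
      also have "\<dots> \<le> cmod (f x) powr p" using False p powr_mono[of 1 p "cmod (f x)"] by simp
      finally show ?thesis by (simp add: add_increasing)
    qed
    have "(\<integral>\<^sup>+x. ennreal (cmod (f x) * decay b 1 (x - y)) \<partial>lborel) \<le> (\<integral>\<^sup>+x. ennreal (decay b 1 (x - y)) + ennreal (cmod (f x) powr p) \<partial>lborel)"
      by (intro nn_integral_mono) (simp add: le ennreal_plus[symmetric] del: ennreal_plus)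
    also have "\<dots> = (\<integral>\<^sup>+x. ennreal (decay b 1 (x - y)) \<partial>lborel) + ennreal I"
      by (subst nn_integral_add) (auto simp: I)
    also have "\<dots> \<le> ennreal C + ennreal I"
      by (intro add_right_mono C) simp
    finally show ?thesis using C I by simp
  qed
  moreover have "0 < C + I" using C I by simp
  ultimately show ?thesis by blast
qed

lemma dist_of_eq:
  assumes "f \<in> borel_measurable lebesgue" and [measurable]: "f0 \<in> borel_measurable borel" and ae: "AE x in lebesgue. f x = f0 x"
    and [measurable]: "\<theta> \<in> borel_measurable borel"
  shows "dist_of f \<theta> = (LINT x|lborel. f0 x * \<theta> x)"
proof -
  have "(LINT x|lebesgue. f x * \<theta> x) = (LINT x|lebesgue. f0 x * \<theta> x)"
  proof (rule integral_cong_AE)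
    show "(\<lambda>x. f x * \<theta> x) \<in> borel_measurable lebesgue"
      by (intro borel_measurable_times assms(1) measurable_completion) measurable
    show "(\<lambda>x. f0 x * \<theta> x) \<in> borel_measurable lebesgue"
      by (intro measurable_completion) measurable
    show "AE x in lebesgue. f x * \<theta> x = f0 x * \<theta> x" using ae by eventually_elim simp
  qed
  also have "\<dots> = (LINT x|lborel. f0 x * \<theta> x)"
    by (intro integral_completion) measurable
  finally show ?thesis by (simp add: dist_of_def)
qed

section \<open>Fourier multipliers as correlations with a kernel\<close>

definition corr :: "(real^'n::finite \<Rightarrow> complex) \<Rightarrow> (real^'n \<Rightarrow> complex) \<Rightarrow> real^'n \<Rightarrow> complex" where
  "corr f K y = (LINT x|lborel. f x * K (x - y))"

text \<open>Multiplying the transform of T by \<phi> and transforming back amounts to applying T to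
  this function of \<eta>, so the kernel is computed on the side of the Schwartz function. The two
  normalising factors multiply to (2 pi)^(-n).\<close>

lemma multiplier_kernel:
  fixes \<phi> :: "real^'n::finite \<Rightarrow> complex"
  assumes \<phi>: "test R \<phi>" and \<eta>: "\<eta> \<in> schwartz"
  shows "fourier (\<lambda>x. \<phi> x * inv_fourier \<eta> x) \<xi> = (LINT y|lborel. \<eta> y * (complex_of_real (1 / (2 * pi) ^ CARD('n)) * hat \<phi> (\<xi> - y)))"
    and "fourier (\<lambda>x. \<phi> x * inv_fourier \<eta> x) \<in> borel_measurable borel"
proof -
  note [measurable] = test_measurable[OF \<phi>] schwartz_measurable[OF \<eta>]
  define c where "c = complex_of_real ((2 * pi) powr (- real CARD('n) / 2))"
  have cc: "c * c = complex_of_real (1 / (2 * pi) ^ CARD('n))"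
    unfolding c_def of_real_mult[symmetric] powr_add[symmetric] by (simp add: powr_minus powr_realpow inverse_eq_divide)
  have inv: "inv_fourier \<eta> = (\<lambda>x. c * (LINT y|lborel. cis (x \<bullet> y) * \<eta> y))"
    unfolding inv_fourier_def c_def by (intro ext arg_cong2[of _ _ _ _ "(*)"] refl integral_completion) measurable
  have [measurable]: "inv_fourier \<eta> \<in> borel_measurable borel" unfolding inv by measurable
  have four: "fourier (\<lambda>x. \<phi> x * inv_fourier \<eta> x) = (\<lambda>\<xi>. c * (LINT x|lborel. cis (- (x \<bullet> \<xi>)) * (\<phi> x * inv_fourier \<eta> x)))"
    unfolding fourier_def c_def by (intro ext arg_cong2[of _ _ _ _ "(*)"] refl integral_completion) measurable
  show "fourier (\<lambda>x. \<phi> x * inv_fourier \<eta> x) \<in> borel_measurable borel"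
    unfolding four by measurable
  have int: "integrable (lborel \<Otimes>\<^sub>M lborel) (\<lambda>(x, y). c * c * (\<phi> x * (cis (- (x \<bullet> (\<xi> - y))) * \<eta> y)))"
  proof (rule integrable_pair_mult)
    show "integrable lborel (\<lambda>x. c * c * \<phi> x)" by (intro integrable_mult_right test_integrable[OF \<phi>])
    show "integrable lborel \<eta>" by (rule schwartz_integrable[OF \<eta>])
  qed (auto simp: split_def norm_mult)
  have "fourier (\<lambda>x. \<phi> x * inv_fourier \<eta> x) \<xi> = (LINT x|lborel. c * (cis (- (x \<bullet> \<xi>)) * (\<phi> x * inv_fourier \<eta> x)))"
    unfolding four by (rule integral_mult_right_zero[symmetric])
  also have "\<dots> = (LINT x|lborel. (LINT y|lborel. c * c * (\<phi> x * (cis (- (x \<bullet> (\<xi> - y))) * \<eta> y))))"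
  proof (intro Bochner_Integration.integral_cong refl)
    fix x
    have "c * (cis (- (x \<bullet> \<xi>)) * (\<phi> x * inv_fourier \<eta> x)) = (LINT y|lborel. (c * c * cis (- (x \<bullet> \<xi>)) * \<phi> x) * (cis (x \<bullet> y) * \<eta> y))"
      by (simp only: integral_mult_right_zero inv) (simp only: mult_ac)
    also have "\<dots> = (LINT y|lborel. c * c * (\<phi> x * (cis (- (x \<bullet> (\<xi> - y))) * \<eta> y)))"
    proof (intro Bochner_Integration.integral_cong refl)
      fix y
      have "cis (- (x \<bullet> (\<xi> - y))) = cis (- (x \<bullet> \<xi>)) * cis (x \<bullet> y)"
        by (simp add: cis_mult inner_diff_right)
      then show "(c * c * cis (- (x \<bullet> \<xi>)) * \<phi> x) * (cis (x \<bullet> y) * \<eta> y) = c * c * (\<phi> x * (cis (- (x \<bullet> (\<xi> - y))) * \<eta> y))"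
        by (simp only: mult_ac)
    qed
    finally show "c * (cis (- (x \<bullet> \<xi>)) * (\<phi> x * inv_fourier \<eta> x)) = (LINT y|lborel. c * c * (\<phi> x * (cis (- (x \<bullet> (\<xi> - y))) * \<eta> y)))" .
  qed
  also have "\<dots> = (LINT y|lborel. (LINT x|lborel. c * c * (\<phi> x * (cis (- (x \<bullet> (\<xi> - y))) * \<eta> y))))"
    by (rule lborel_pair.Fubini_integral[OF int, symmetric])
  also have "\<dots> = (LINT y|lborel. \<eta> y * (c * c * hat \<phi> (\<xi> - y)))"
  proof (intro Bochner_Integration.integral_cong refl)
    fix y
    have "(LINT x|lborel. c * c * (\<phi> x * (cis (- (x \<bullet> (\<xi> - y))) * \<eta> y))) = (LINT x|lborel. (\<eta> y * (c * c)) * (cis (- (x \<bullet> (\<xi> - y))) * \<phi> x))"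
      by (simp only: mult_ac)
    also have "\<dots> = \<eta> y * (c * c * hat \<phi> (\<xi> - y))"
      unfolding hat_def by (simp only: integral_mult_right_zero mult.assoc)
    finally show "(LINT x|lborel. c * c * (\<phi> x * (cis (- (x \<bullet> (\<xi> - y))) * \<eta> y))) = \<eta> y * (c * c * hat \<phi> (\<xi> - y))" .
  qed
  finally show "fourier (\<lambda>x. \<phi> x * inv_fourier \<eta> x) \<xi> = (LINT y|lborel. \<eta> y * (complex_of_real (1 / (2 * pi) ^ CARD('n)) * hat \<phi> (\<xi> - y)))"
    by (simp only: cc)
qed

text \<open>Supplies the uniqueness behind the \<open>THE\<close> in \<open>lp_block\<close>. If D
  x0 were not 0, then D would stay within |D x0| / 2 of this value near x0, and its integral against
  a nonnegative bump there could not vanish.\<close>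

lemma continuous_zero_of_test_orthogonal:
  fixes D \<psi> :: "real^'n::finite \<Rightarrow> complex"
  assumes \<psi>: "resolution_generator \<psi>" and D: "continuous_on UNIV D"
    and int: "\<And>\<eta>. \<eta> \<in> schwartz \<Longrightarrow> integrable lborel (\<lambda>x. D x * \<eta> x)"
    and zero: "\<And>\<eta>. \<eta> \<in> schwartz \<Longrightarrow> (LINT x|lborel. D x * \<eta> x) = 0"
  shows "D x0 = 0"
proof (rule ccontr)
  assume nz: "D x0 \<noteq> 0"
  have "isCont D x0" using D by (simp add: continuous_on_eq_continuous_at)
  then obtain d where d: "0 < d" "\<And>x. dist x x0 < d \<Longrightarrow> dist (D x) (D x0) < cmod (D x0) / 2"
    unfolding continuous_at using nz by (metis dist_norm half_gt_zero_iff zero_less_norm_iff Lim_at continuous_at_eps_delta isCont_def)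
  define e where "e = d / 3"
  have e: "0 < e" using d by (simp add: e_def)
  \<comment> \<open>As \<psi> is complex valued, the bump is \<psi> times its conjugate. It is
    rescaled to equal 1 on the ball of radius e and 0 from distance 2 e on, which is less than
    d.\<close>
  define \<eta> where "\<eta> x = \<psi> ((1/e) *\<^sub>R x + - (1/e) *\<^sub>R x0) * cnj (\<psi> ((1/e) *\<^sub>R x + - (1/e) *\<^sub>R x0))" for x
  have arg: "(1/e) *\<^sub>R x + - (1/e) *\<^sub>R x0 = (1/e) *\<^sub>R (x - x0)" for x by (simp add: scaleR_diff_right)
  have \<eta>_eq: "\<eta> x = complex_of_real ((cmod (\<psi> ((1/e) *\<^sub>R (x - x0))))\<^sup>2)" for x
    unfolding \<eta>_def arg by (rule complex_norm_square[symmetric])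
  have supp: "\<eta> x = 0" if "2 * e \<le> dist x x0" for x
  proof -
    have "2 \<le> norm ((1/e) *\<^sub>R (x - x0))"
      unfolding norm_scaleR using that e by (simp add: dist_norm field_simps)
    then show ?thesis using \<psi> by (simp add: \<eta>_eq resolution_generator_def)
  qed
  have test: "test (norm x0 + 2 * e) \<eta>"
    unfolding test_def smooth_iff_ck
  proof (intro conjI allI impI)
    have "ck k \<psi>" for k using \<psi> by (simp add: resolution_generator_def smooth_iff_ck)
    then show "ck k \<eta>" for k unfolding \<eta>_def by (intro ck_mult ck_cnj ck_affine)
    show "\<eta> x = 0" if "norm x0 + 2 * e < norm x" for x
      using that norm_triangle_ineq2[of x x0] by (intro supp) (simp add: dist_norm)
  qed
  have \<eta>: "\<eta> \<in> schwartz" by (rule test_in_schwartz[OF test])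
  define m where "m x = (cmod (\<psi> ((1/e) *\<^sub>R (x - x0))))\<^sup>2" for x
  have im: "integrable lborel m"
  proof -
    have "m = (\<lambda>x. cmod (\<eta> x))" by (simp add: fun_eq_iff m_def \<eta>_eq norm_power)
    then show ?thesis using integrable_norm[OF test_integrable[OF test]] by simp
  qed
  have pos: "0 < (LINT x|lborel. m x)"
  proof -
    have "(LINT x|lborel. indicator (ball x0 e) x) \<le> (LINT x|lborel. m x)"
    proof (intro integral_mono im)
      show "integrable lborel (\<lambda>x. indicator (ball x0 e) x :: real)"
        using emeasure_lborel_ball_finite[of x0 e] by (intro integrable_real_indicator) auto
      show "indicator (ball x0 e) x \<le> m x" for x
      proof (cases "x \<in> ball x0 e")
        case True
        then have "norm ((1/e) *\<^sub>R (x - x0)) \<le> 1"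
          unfolding norm_scaleR using e by (simp add: dist_norm norm_minus_commute field_simps)
        then show ?thesis using \<psi> by (simp add: m_def resolution_generator_def indicator_def)
      qed (simp add: m_def)
    qed
    moreover have "0 < (LINT x|lborel. indicator (ball x0 e) x :: real)"
      using e by (simp add: content_ball)
    ultimately show ?thesis by linarith
  qed
  have "D x0 * complex_of_real (LINT x|lborel. m x) = (LINT x|lborel. D x0 * \<eta> x)"
  proof -
    have "(LINT x|lborel. \<eta> x) = complex_of_real (LINT x|lborel. m x)"
      unfolding \<eta>_eq m_def by (rule integral_complex_of_real)
    then show ?thesis by simp
  qed
  also have "\<dots> = (LINT x|lborel. D x0 * \<eta> x) - (LINT x|lborel. D x * \<eta> x)" using zero[OF \<eta>] by simp
  also have "\<dots> = (LINT x|lborel. D x0 * \<eta> x - D x * \<eta> x)"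
    by (intro Bochner_Integration.integral_diff[symmetric] int \<eta> integrable_mult_right test_integrable[OF test])
  finally have "cmod (D x0) * (LINT x|lborel. m x) = cmod (LINT x|lborel. D x0 * \<eta> x - D x * \<eta> x)"
    using pos by (metis abs_of_pos norm_mult norm_of_real)
  also have "\<dots> \<le> (LINT x|lborel. cmod (D x0 * \<eta> x - D x * \<eta> x))"
    by (rule integral_norm_bound)
  also have "\<dots> \<le> (LINT x|lborel. cmod (D x0) / 2 * m x)"
  proof (intro integral_mono integrable_norm Bochner_Integration.integrable_diff int \<eta> integrable_mult_right test_integrable[OF test] im)
    fix x
    show "cmod (D x0 * \<eta> x - D x * \<eta> x) \<le> cmod (D x0) / 2 * m x"
    proof (cases "dist x x0 < d")
      case True
      have "cmod (D x0 * \<eta> x - D x * \<eta> x) = cmod (D x - D x0) * m x"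
        by (simp add: left_diff_distrib[symmetric] norm_mult \<eta>_eq m_def norm_minus_commute norm_power)
      also have "\<dots> \<le> cmod (D x0) / 2 * m x"
        using d(2)[OF True] by (intro mult_right_mono) (auto simp: dist_norm m_def)
      finally show ?thesis .
    next
      case False
      then have "\<eta> x = 0" using e by (intro supp) (simp add: e_def)
      then show ?thesis by (simp add: m_def)
    qed
  qed
  also have "\<dots> = cmod (D x0) / 2 * (LINT x|lborel. m x)" by simp
  finally show False using pos nz by (simp add: mult_le_cancel_right)
qed

lemma dyadic_test:
  fixes \<psi> :: "real^'n::finite \<Rightarrow> complex"
  assumes \<psi>: "resolution_generator \<psi>"
  shows "\<exists>R. test R (dyadic \<psi> j)"
proof (cases j)
  case 0
  then show ?thesis using test_psi[OF \<psi>] by auto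
next
  case (Suc k)
  have eq: "dyadic \<psi> j = (\<lambda>x. \<psi> ((1/2) ^ Suc k *\<^sub>R x) + (-1) * \<psi> ((1/2) ^ k *\<^sub>R x))"
    by (simp add: Suc fun_eq_iff)
  have 1: "test (2 * 2 ^ Suc k) (\<lambda>x. \<psi> ((1/2) ^ Suc k *\<^sub>R x))" and 2: "test (2 * 2 ^ k) (\<lambda>x. \<psi> ((1/2) ^ k *\<^sub>R x))"
    by (rule test_scaled[OF \<psi>])+
  have "test (2 * 2 ^ Suc k) (\<lambda>x. \<psi> ((1/2) ^ Suc k *\<^sub>R x) + (-1) * \<psi> ((1/2) ^ k *\<^sub>R x))"
    unfolding test_def smooth_iff_ck
  proof (intro conjI allI impI)
    show "ck n (\<lambda>x. \<psi> ((1/2) ^ Suc k *\<^sub>R x) + (-1) * \<psi> ((1/2) ^ k *\<^sub>R x))" for n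
      using 1 2 unfolding test_def smooth_iff_ck by (intro ck_add ck_mult ck_const) auto
    fix x :: "real^'n" assume x: "2 * 2 ^ Suc k < norm x"
    then have "2 * 2 ^ k < norm x" by (rule order_le_less_trans[rotated]) simp
    then show "\<psi> ((1/2) ^ Suc k *\<^sub>R x) + (-1) * \<psi> ((1/2) ^ k *\<^sub>R x) = 0"
      using 1 2 x unfolding test_def by auto
  qed
  then show ?thesis unfolding eq by blast
qed

lemma schwartz_seminorm_upper:
  fixes \<eta> :: "real^'n::finite \<Rightarrow> complex"
  assumes "\<eta> \<in> schwartz"
  shows "(1 + norm x) ^ N * cmod (\<eta> x) \<le> schwartz_seminorm N \<eta>"
proof -
  let ?F = "\<lambda>(\<alpha>, x). (1 + norm x) ^ N * cmod (iter_partial \<alpha> \<eta> x)"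
  have eq: "?F ` ({\<alpha>::'n list. length \<alpha> \<le> N} \<times> UNIV) = (\<Union>\<alpha>\<in>{\<alpha>. length \<alpha> \<le> N}. range (\<lambda>x. (1 + norm x) ^ N * cmod (iter_partial \<alpha> \<eta> x)))"
    by auto
  have "finite {\<alpha>::'n list. length \<alpha> \<le> N}"
    using finite_lists_length_le[of "UNIV :: 'n set" N] by simp
  then have "bounded (?F ` ({\<alpha>::'n list. length \<alpha> \<le> N} \<times> UNIV))"
    unfolding eq using assms by (intro bounded_UN) (auto simp: schwartz_def)
  then have "bdd_above (?F ` ({\<alpha>::'n list. length \<alpha> \<le> N} \<times> UNIV))" by (rule bounded_imp_bdd_above)
  then show ?thesis
    unfolding schwartz_seminorm_def by (rule cSUP_upper2[where x = "([], x)"]) auto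
qed

text \<open>For j > 0 the multiplier is a difference of two consecutive scalings of \<psi>; written
  through \<open>ker\<close>, the blocks telescope.\<close>

definition blockker :: "(real^'n::finite \<Rightarrow> complex) \<Rightarrow> nat \<Rightarrow> real^'n \<Rightarrow> complex" where
  "blockker \<psi> j z = (case j of 0 \<Rightarrow> ker \<psi> 0 z | Suc k \<Rightarrow> ker \<psi> (Suc k) z - ker \<psi> k z)"

lemma blockker_hat:
  fixes \<psi> :: "real^'n::finite \<Rightarrow> complex"
  assumes \<psi>: "resolution_generator \<psi>"
  shows "complex_of_real (1 / (2 * pi) ^ CARD('n)) * hat (dyadic \<psi> j) z = blockker \<psi> j z"
proof (cases j)
  case 0
  then show ?thesis by (simp add: blockker_def ker_def)
next
  case (Suc k)
  have "dyadic \<psi> j = (\<lambda>x. \<psi> ((1/2) ^ Suc k *\<^sub>R x) - \<psi> ((1/2) ^ k *\<^sub>R x))"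
    by (simp add: Suc fun_eq_iff)
  then have "hat (dyadic \<psi> j) z = hat (\<lambda>x. \<psi> ((1/2) ^ Suc k *\<^sub>R x)) z - hat (\<lambda>x. \<psi> ((1/2) ^ k *\<^sub>R x)) z"
    by (simp only: hat_diff[OF test_integrable[OF test_scaled[OF \<psi>]] test_integrable[OF test_scaled[OF \<psi>]]])
  then show ?thesis by (simp only: Suc blockker_def ker_def nat.case right_diff_distrib)
qed

lemma decay_le_decay_one:
  assumes "1 \<le> \<mu>" "0 \<le> b"
  shows "decay b \<mu> (z::'a::euclidean_space) \<le> \<mu> ^ DIM('a) * decay b 1 z"
  unfolding decay_def using assms
  by (auto intro!: mult_left_mono powr_mono2' add_pos_nonneg simp: mult_le_cancel_right1)

section \<open>Blocks of an L_p function, computed from a Borel representative\<close>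

context
  fixes f f0 \<psi> :: "real^'n::finite \<Rightarrow> complex" and p :: real
  assumes \<psi>: "resolution_generator \<psi>" and p: "1 \<le> p"
    and fL: "f \<in> borel_measurable lebesgue" and f0 [measurable]: "f0 \<in> borel_measurable borel"
    and ff0: "AE x in lebesgue. f x = f0 x"
    and fp: "(\<integral>\<^sup>+x. ennreal (cmod (f0 x) powr p) \<partial>lborel) < \<infinity>"
begin

lemma f_mult_decay_integrable:
  assumes "real CARD('n) < b"
  shows "integrable lborel (\<lambda>x. cmod (f0 x) * decay b 1 (x - y))"
proof -
  obtain B where "0 < B" "\<And>y. (\<integral>\<^sup>+x. ennreal (cmod (f0 x) * decay b 1 (x - y)) \<partial>lborel) \<le> ennreal B"
    using Lp_decay_bound[OF f0 fp p assms] by blast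
  from this(2)[of y] have "(\<integral>\<^sup>+x. ennreal (cmod (f0 x) * decay b 1 (x - y)) \<partial>lborel) < \<infinity>"
    using ennreal_less_top[of B] by (auto intro: order_le_less_trans)
  then show ?thesis by (intro integrableI_nonneg) auto
qed

lemma corr_integrable:
  assumes [measurable]: "K \<in> borel_measurable borel" and K: "\<And>z. cmod (K z) \<le> C * decay (real CARD('n) + 1) 1 z"
  shows "integrable lborel (\<lambda>x. f0 x * K (x - y))"
proof (rule Bochner_Integration.integrable_bound)
  show "integrable lborel (\<lambda>x. C * (cmod (f0 x) * decay (real CARD('n) + 1) 1 (x - y)))"
    by (intro integrable_mult_right f_mult_decay_integrable) simp
  show "AE x in lborel. norm (f0 x * K (x - y)) \<le> norm (C * (cmod (f0 x) * decay (real CARD('n) + 1) 1 (x - y)))"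
  proof (rule AE_I2)
    fix x
    have "norm (f0 x * K (x - y)) \<le> cmod (f0 x) * (C * decay (real CARD('n) + 1) 1 (x - y))"
      unfolding norm_mult by (intro mult_left_mono K) auto
    then show "norm (f0 x * K (x - y)) \<le> norm (C * (cmod (f0 x) * decay (real CARD('n) + 1) 1 (x - y)))"
      by (simp add: mult.left_commute)
  qed
qed measurable

lemma corr_bound:
  assumes [measurable]: "K \<in> borel_measurable borel" and K: "\<And>z. cmod (K z) \<le> C * decay (real CARD('n) + 1) 1 z" and C: "0 < C"
  shows "\<exists>B>0. \<forall>y. (LINT x|lborel. cmod (f0 x * K (x - y))) \<le> B"
proof -
  let ?b = "real CARD('n) + 1"
  obtain B where B: "0 < B" "\<And>y. (\<integral>\<^sup>+x. ennreal (cmod (f0 x) * decay ?b 1 (x - y)) \<partial>lborel) \<le> ennreal B"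
    using Lp_decay_bound[OF f0 fp p, of ?b] by auto
  have "(LINT x|lborel. cmod (f0 x * K (x - y))) \<le> C * B" for y
  proof -
    have "(LINT x|lborel. cmod (f0 x * K (x - y))) \<le> (LINT x|lborel. C * (cmod (f0 x) * decay ?b 1 (x - y)))"
    proof (intro integral_mono integrable_norm corr_integrable[OF _ K] integrable_mult_right f_mult_decay_integrable)
      fix x
      have "cmod (f0 x * K (x - y)) \<le> cmod (f0 x) * (C * decay ?b 1 (x - y))"
        unfolding norm_mult by (intro mult_left_mono K) auto
      then show "cmod (f0 x * K (x - y)) \<le> C * (cmod (f0 x) * decay ?b 1 (x - y))" by (simp add: mult.left_commute)
    qed auto
    also have "\<dots> = C * (LINT x|lborel. cmod (f0 x) * decay ?b 1 (x - y))" by simp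
    also have "\<dots> \<le> C * B"
    proof -
      have "ennreal (LINT x|lborel. cmod (f0 x) * decay ?b 1 (x - y)) = (\<integral>\<^sup>+x. ennreal (cmod (f0 x) * decay ?b 1 (x - y)) \<partial>lborel)"
        by (intro nn_integral_eq_integral[symmetric] f_mult_decay_integrable) auto
      with B(2)[of y] have "ennreal (LINT x|lborel. cmod (f0 x) * decay ?b 1 (x - y)) \<le> ennreal B"
        by simp
      then have "(LINT x|lborel. cmod (f0 x) * decay ?b 1 (x - y)) \<le> B"
        using B(1) by (simp add: ennreal_le_iff)
      then show ?thesis using C by simp
    qed
    finally show ?thesis .
  qed
  moreover have "0 < C * B" using B C by simp
  ultimately show ?thesis by blast
qed

text \<open>Continuity comes from the Lipschitz estimate for the kernel, integrated against |f0|.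
  For the representation the operators are moved to the Schwartz function, and Fubini's theorem
  brings the kernel back to f0; the majorant is the bound of \<open>corr_bound\<close>, uniform in
  y.\<close>

lemma corr_hat_represents:
  assumes \<phi>: "test R \<phi>"
  defines "K \<equiv> \<lambda>z. complex_of_real (1 / (2 * pi) ^ CARD('n)) * hat \<phi> z"
  shows "continuous_on UNIV (corr f0 K)"
    and "represented_by (dist_inv_fourier (dist_mult \<phi> (dist_fourier (dist_of f)))) (corr f0 K)"
proof -
  let ?b = "real CARD('n) + 1"
  let ?c = "1 / (2 * pi) ^ CARD('n)"
  have c: "0 < ?c" by simp
  note [measurable] = test_measurable[OF \<phi>]
  have Km [measurable]: "K \<in> borel_measurable borel" unfolding K_def by measurable
  have Kn: "cmod (K z) = ?c * cmod (hat \<phi> z)" for z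
    by (simp add: K_def norm_mult norm_divide norm_power)
  obtain A where A: "0 < A" "\<And>z. cmod (hat \<phi> z) \<le> A * decay ?b 1 z" using hat_decay[OF \<phi>] by blast
  have K: "cmod (K z) \<le> (?c * A) * decay ?b 1 z" for z
    unfolding Kn mult.assoc using c by (intro mult_left_mono A) auto
  have b0: "0 \<le> ?b" by simp
  obtain L where L: "0 < L" "\<And>z h. norm h \<le> 1 \<Longrightarrow> cmod (hat \<phi> (z + h) - hat \<phi> z) \<le> L * norm h * decay ?b 1 z"
    using hat_lipschitz[OF \<phi> b0] by blast
  show cont: "continuous_on UNIV (corr f0 K)"
    unfolding continuous_on_eq_continuous_within
  proof
    fix y0
    define M where "M = ?c * L * (LINT x|lborel. cmod (f0 x) * decay ?b 1 (x - y0))"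
    have bd: "cmod (corr f0 K y - corr f0 K y0) \<le> M * norm (y - y0)" if "norm (y - y0) \<le> 1" for y
    proof -
      have "corr f0 K y - corr f0 K y0 = (LINT x|lborel. f0 x * K (x - y) - f0 x * K (x - y0))"
        unfolding corr_def by (intro Bochner_Integration.integral_diff[symmetric] corr_integrable[OF Km K])
      also have "cmod \<dots> \<le> (LINT x|lborel. cmod (f0 x * K (x - y) - f0 x * K (x - y0)))"
        by (rule integral_norm_bound)
      also have "\<dots> \<le> (LINT x|lborel. (?c * L * norm (y - y0)) * (cmod (f0 x) * decay ?b 1 (x - y0)))"
      proof (intro integral_mono integrable_norm Bochner_Integration.integrable_diff corr_integrable[OF Km K] integrable_mult_right f_mult_decay_integrable)
        fix x
        have "cmod (hat \<phi> (x - y0 + (y0 - y)) - hat \<phi> (x - y0)) \<le> L * norm (y0 - y) * decay ?b 1 (x - y0)"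
          using that by (intro L) (simp add: norm_minus_commute)
        then have "?c * cmod (hat \<phi> (x - y) - hat \<phi> (x - y0)) \<le> ?c * (L * norm (y - y0) * decay ?b 1 (x - y0))"
          using c by (intro mult_left_mono) (auto simp: norm_minus_commute)
        moreover have "cmod (K (x - y) - K (x - y0)) = ?c * cmod (hat \<phi> (x - y) - hat \<phi> (x - y0))"
          unfolding K_def right_diff_distrib[symmetric] by (simp add: norm_mult norm_divide norm_power)
        ultimately have "cmod (f0 x) * cmod (K (x - y) - K (x - y0)) \<le> cmod (f0 x) * (?c * (L * norm (y - y0) * decay ?b 1 (x - y0)))"
          by (intro mult_left_mono) auto
        then show "cmod (f0 x * K (x - y) - f0 x * K (x - y0)) \<le> (?c * L * norm (y - y0)) * (cmod (f0 x) * decay ?b 1 (x - y0))"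
          unfolding right_diff_distrib[symmetric] norm_mult by (simp only: mult_ac)
      qed auto
      also have "\<dots> = M * norm (y - y0)" by (simp add: M_def)
      finally show ?thesis .
    qed
    have "((\<lambda>y. corr f0 K y - corr f0 K y0) \<longlongrightarrow> 0) (at y0)"
    proof (rule Lim_null_comparison)
      show "\<forall>\<^sub>F y in at y0. norm (corr f0 K y - corr f0 K y0) \<le> M * norm (y - y0)"
        unfolding eventually_at using bd by (intro exI[of _ 1]) (auto simp: dist_norm)
      have "((\<lambda>y. M * norm (y - y0)) \<longlongrightarrow> M * norm (y0 - y0)) (at y0)" by (intro tendsto_intros)
      then show "((\<lambda>y. M * norm (y - y0)) \<longlongrightarrow> 0) (at y0)" by simp
    qed
    then show "continuous (at y0 within UNIV) (corr f0 K)"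
      unfolding continuous_within by (simp add: LIM_zero_cancel)
  qed
  show "represented_by (dist_inv_fourier (dist_mult \<phi> (dist_fourier (dist_of f)))) (corr f0 K)"
    unfolding represented_by_def
  proof
    fix \<eta> :: "real^'n \<Rightarrow> complex" assume \<eta>: "\<eta> \<in> schwartz"
    note [measurable] = schwartz_measurable[OF \<eta>]
    have [measurable]: "corr f0 K \<in> borel_measurable borel" using cont by (rule borel_measurable_continuous_onI)
    obtain B where B: "0 < B" "\<And>y. (LINT x|lborel. cmod (f0 x * K (x - y))) \<le> B"
      using corr_bound[OF Km K] c A by auto
    have hb: "cmod (corr f0 K y) \<le> B" for y
      unfolding corr_def by (rule order_trans[OF integral_norm_bound B(2)])
    have i1: "integrable lborel (\<lambda>x. corr f0 K x * \<eta> x)"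
    proof (rule Bochner_Integration.integrable_bound)
      show "integrable lborel (\<lambda>x. B * cmod (\<eta> x))" using schwartz_integrable[OF \<eta>] by (intro integrable_mult_right integrable_norm)
      show "AE x in lborel. norm (corr f0 K x * \<eta> x) \<le> norm (B * cmod (\<eta> x))"
        using hb B by (auto simp: norm_mult intro!: AE_I2 mult_right_mono)
    qed measurable
    then have "integrable lebesgue (\<lambda>x. corr f0 K x * \<eta> x)"
      by (subst integrable_completion) auto
    moreover have "dist_inv_fourier (dist_mult \<phi> (dist_fourier (dist_of f))) \<eta> = dist_of (corr f0 K) \<eta>"
    proof -
      have "dist_inv_fourier (dist_mult \<phi> (dist_fourier (dist_of f))) \<eta> = (LINT x|lborel. f0 x * fourier (\<lambda>x. \<phi> x * inv_fourier \<eta> x) x)"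
        unfolding dist_inv_fourier_def dist_mult_def dist_fourier_def
        by (intro dist_of_eq[OF fL f0 ff0] multiplier_kernel[OF \<phi> \<eta>])
      also have "\<dots> = (LINT x|lborel. f0 x * (LINT y|lborel. \<eta> y * K (x - y)))"
        by (simp only: multiplier_kernel(1)[OF \<phi> \<eta>] K_def)
      also have "\<dots> = (LINT x|lborel. (LINT y|lborel. \<eta> y * (f0 x * K (x - y))))"
        by (simp only: integral_mult_right_zero[symmetric] mult.left_commute)
      also have "\<dots> = (LINT y|lborel. (LINT x|lborel. \<eta> y * (f0 x * K (x - y))))"
      proof (rule lborel_pair.Fubini_integral)
        show "integrable (lborel \<Otimes>\<^sub>M lborel) (\<lambda>(y, x). \<eta> y * (f0 x * K (x - y)))"
        proof (rule lborel_pair.Fubini_integrable)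
          show "AE y in lborel. integrable lborel (\<lambda>x. case (y, x) of (y, x) \<Rightarrow> \<eta> y * (f0 x * K (x - y)))"
            by (auto intro!: AE_I2 integrable_mult_right corr_integrable[OF Km K])
          show "integrable lborel (\<lambda>y. LINT x|lborel. norm (case (y, x) of (y, x) \<Rightarrow> \<eta> y * (f0 x * K (x - y))))"
          proof (rule Bochner_Integration.integrable_bound)
            show "integrable lborel (\<lambda>x. B * cmod (\<eta> x))" using schwartz_integrable[OF \<eta>] by (intro integrable_mult_right integrable_norm)
            show "AE y in lborel. norm (LINT x|lborel. norm (case (y, x) of (y, x) \<Rightarrow> \<eta> y * (f0 x * K (x - y)))) \<le> norm (B * cmod (\<eta> y))"
            proof (rule AE_I2)
              fix y
              have "(LINT x|lborel. cmod (\<eta> y * (f0 x * K (x - y)))) = cmod (\<eta> y) * (LINT x|lborel. cmod (f0 x * K (x - y)))"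
                by (simp only: norm_mult[of "\<eta> y"] integral_mult_right_zero)
              also have "\<dots> \<le> cmod (\<eta> y) * B" by (intro mult_left_mono B) auto
              finally have "(LINT x|lborel. cmod (\<eta> y * (f0 x * K (x - y)))) \<le> B * cmod (\<eta> y)" by (simp only: mult.commute)
              then show "norm (LINT x|lborel. norm (case (y, x) of (y, x) \<Rightarrow> \<eta> y * (f0 x * K (x - y)))) \<le> norm (B * cmod (\<eta> y))"
                using B(1) by simp
            qed
          qed measurable
        qed measurable
      qed
      also have "\<dots> = (LINT y|lborel. corr f0 K y * \<eta> y)"
        by (simp only: integral_mult_right_zero corr_def mult.commute)
      also have "\<dots> = dist_of (corr f0 K) \<eta>"
        unfolding dist_of_def by (intro integral_completion[symmetric]) measurable
      finally show ?thesis .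
    qed
    ultimately show "integrable lebesgue (\<lambda>x. corr f0 K x * \<eta> x) \<and> dist_inv_fourier (dist_mult \<phi> (dist_fourier (dist_of f))) \<eta> = dist_of (corr f0 K) \<eta>"
      by blast
  qed
qed

text \<open>Eliminates the description operator: existence is \<open>corr_hat_represents\<close>,
  and two continuous representatives coincide because they have the same integrals against all
  Schwartz functions.\<close>

lemma lp_block_eq: "lp_block \<psi> j (dist_of f) = corr f0 (blockker \<psi> j)"
  unfolding lp_block_def
proof (rule the_equality)
  obtain R where R: "test R (dyadic \<psi> j)" using dyadic_test[OF \<psi>] by blast
  show *: "continuous_on UNIV (corr f0 (blockker \<psi> j)) \<and>
    represented_by (dist_inv_fourier (dist_mult (dyadic \<psi> j) (dist_fourier (dist_of f)))) (corr f0 (blockker \<psi> j))"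
    using corr_hat_represents[OF R] unfolding blockker_hat[OF \<psi>] by blast
  fix h assume h: "continuous_on UNIV h \<and> represented_by (dist_inv_fourier (dist_mult (dyadic \<psi> j) (dist_fourier (dist_of f)))) h"
  define k where "k = corr f0 (blockker \<psi> j)"
  have [measurable]: "h \<in> borel_measurable borel" "k \<in> borel_measurable borel"
    using h * by (auto simp: k_def intro: borel_measurable_continuous_onI)
  have ih: "integrable lborel (\<lambda>x. h x * \<eta> x)" and ik: "integrable lborel (\<lambda>x. k x * \<eta> x)"
    and hk: "(LINT x|lborel. h x * \<eta> x) = (LINT x|lborel. k x * \<eta> x)" if \<eta>: "\<eta> \<in> schwartz" for \<eta>
  proof -
    note [measurable] = schwartz_measurable[OF \<eta>]
    have "integrable lebesgue (\<lambda>x. h x * \<eta> x)" "integrable lebesgue (\<lambda>x. k x * \<eta> x)"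
      using h * \<eta> by (auto simp: represented_by_def k_def)
    moreover have m: "(\<lambda>x. h x * \<eta> x) \<in> borel_measurable lborel" "(\<lambda>x. k x * \<eta> x) \<in> borel_measurable lborel"
      by measurable
    ultimately show "integrable lborel (\<lambda>x. h x * \<eta> x)" "integrable lborel (\<lambda>x. k x * \<eta> x)"
      by (simp_all only: integrable_completion[OF m(1)] integrable_completion[OF m(2)])
    have "dist_of h \<eta> = dist_of k \<eta>" using h * \<eta> by (simp add: represented_by_def k_def)
    then show "(LINT x|lborel. h x * \<eta> x) = (LINT x|lborel. k x * \<eta> x)"
      unfolding dist_of_def by (simp only: integral_completion[OF m(1)] integral_completion[OF m(2)])
  qed
  have "h x - k x = 0" for x
  proof (rule continuous_zero_of_test_orthogonal[OF \<psi>])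
    show "continuous_on UNIV (\<lambda>x. h x - k x)" using h * by (auto simp: k_def intro: continuous_on_diff)
    show "integrable lborel (\<lambda>x. (h x - k x) * \<eta> x)" if "\<eta> \<in> schwartz" for \<eta>
      using ih[OF that] ik[OF that] by (simp add: left_diff_distrib)
    show "(LINT x|lborel. (h x - k x) * \<eta> x) = 0" if "\<eta> \<in> schwartz" for \<eta>
      using ih[OF that] ik[OF that] hk[OF that] by (simp add: left_diff_distrib)
  qed
  then show "h = corr f0 (blockker \<psi> j)" by (auto simp: k_def)
qed

lemma tempered_dist_of: "tempered (dist_of f)"
proof -
  let ?N = "CARD('n) + 1"
  let ?I = "LINT x|lborel. cmod (f0 x) * decay (real ?N) 1 (x - 0)"
  have int: "integrable lborel (\<lambda>x. f0 x * \<eta> x)" if \<eta>: "\<eta> \<in> schwartz" for \<eta>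
  proof -
    note [measurable] = schwartz_measurable[OF \<eta>]
    obtain C where "0 < C" "\<And>x. cmod (\<eta> x) \<le> C * decay (real CARD('n) + 1) 1 x" using schwartz_decay[OF \<eta>] by blast
    then show ?thesis using corr_integrable[of \<eta> C 0] by simp
  qed
  have add: "dist_of f (\<lambda>x. \<eta> x + \<theta> x) = dist_of f \<eta> + dist_of f \<theta>" if \<eta>: "\<eta> \<in> schwartz" and \<theta>: "\<theta> \<in> schwartz" for \<eta> \<theta>
  proof -
    note [measurable] = schwartz_measurable[OF \<eta>] schwartz_measurable[OF \<theta>]
    show ?thesis
      using int[OF \<eta>] int[OF \<theta>] by (simp add: dist_of_eq[OF fL f0 ff0] distrib_left)
  qed
  have mult: "dist_of f (\<lambda>x. c * \<eta> x) = c * dist_of f \<eta>" if \<eta>: "\<eta> \<in> schwartz" for \<eta> c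
  proof -
    note [measurable] = schwartz_measurable[OF \<eta>]
    show ?thesis
      by (simp add: dist_of_eq[OF fL f0 ff0] mult.left_commute)
  qed
  have bound: "cmod (dist_of f \<eta>) \<le> ?I * schwartz_seminorm ?N \<eta>" if \<eta>: "\<eta> \<in> schwartz" for \<eta>
  proof -
    note [measurable] = schwartz_measurable[OF \<eta>]
    have "cmod (dist_of f \<eta>) = cmod (LINT x|lborel. f0 x * \<eta> x)" by (simp add: dist_of_eq[OF fL f0 ff0])
    also have "\<dots> \<le> (LINT x|lborel. cmod (f0 x * \<eta> x))" by (rule integral_norm_bound)
    also have "\<dots> \<le> (LINT x|lborel. schwartz_seminorm ?N \<eta> * (cmod (f0 x) * decay (real ?N) 1 (x - 0)))"
    proof (intro integral_mono integrable_norm int \<eta> integrable_mult_right f_mult_decay_integrable)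
      fix x
      have "cmod (\<eta> x) \<le> schwartz_seminorm ?N \<eta> * decay (real ?N) 1 x"
        by (rule le_mult_decay_one[OF schwartz_seminorm_upper[OF \<eta>]])
      then have "cmod (f0 x) * cmod (\<eta> x) \<le> cmod (f0 x) * (schwartz_seminorm ?N \<eta> * decay (real ?N) 1 x)" by (intro mult_left_mono) auto
      then show "cmod (f0 x * \<eta> x) \<le> schwartz_seminorm ?N \<eta> * (cmod (f0 x) * decay (real ?N) 1 (x - 0))"
        by (simp add: norm_mult mult_ac)
    qed auto
    also have "\<dots> = ?I * schwartz_seminorm ?N \<eta>" by (simp only: integral_mult_right_zero mult.commute)
    finally show ?thesis .
  qed
  show ?thesis unfolding tempered_def using add mult bound by blast
qed

end

section \<open>Polar coordinates\<close>

text \<open>The two measures agree on half-lines: one side gives the volume of a ball, the other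
  integrates the derivative of that volume in the radius. For radial functions this is all of polar
  coordinates, and the surface measure of the sphere does not enter.\<close>

lemma distr_norm_lborel:
  "distr (lborel :: 'a::euclidean_space measure) borel norm =
    density lborel (\<lambda>r. ennreal (unit_ball_vol (DIM('a)) * (DIM('a) * r ^ (DIM('a) - 1))) * indicator {0..} r)"
  (is "?M = ?N")
proof (rule measure_eqI_generator_eq[where E = "range (\<lambda>a::real. {..a})" and \<Omega> = UNIV and A = "\<lambda>i. {..real i}"])
  show "Int_stable (range (\<lambda>a::real. {..a}))" by (auto simp: Int_stable_def)
  show "sets ?M = sigma_sets UNIV (range (\<lambda>a::real. {..a}))" "sets ?N = sigma_sets UNIV (range (\<lambda>a::real. {..a}))"
    by (simp_all add: borel_eq_atMost)
  have dist: "emeasure ?M {..a} = (if 0 \<le> a then ennreal (unit_ball_vol (DIM('a)) * a ^ DIM('a)) else 0)" for a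
  proof -
    have "emeasure ?M {..a} = emeasure lborel (norm -` {..a} :: 'a set)"
      by (subst emeasure_distr) auto
    also have "norm -` {..a} = (if 0 \<le> a then cball (0::'a) a else {})"
      by (auto simp: dest: order_trans[OF norm_ge_zero])
    finally show ?thesis by (simp add: emeasure_cball)
  qed
  show "(\<Union>i. {..real i}) = UNIV" by (auto simp: real_arch_simple)
  show "emeasure ?M {..real i} \<noteq> \<infinity>" for i unfolding dist by simp
  show "emeasure ?M X = emeasure ?N X" if "X \<in> range (\<lambda>a::real. {..a})" for X
  proof -
    obtain a where X: "X = {..a}" using \<open>X \<in> range (\<lambda>a::real. {..a})\<close> by auto
    show ?thesis
    proof (cases "0 \<le> a")
      case True
      have "emeasure ?N X = (\<integral>\<^sup>+r. ennreal (unit_ball_vol (DIM('a)) * (DIM('a) * r ^ (DIM('a) - 1))) * indicator {0..a} r \<partial>lborel)"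
        unfolding X by (subst emeasure_density) (auto intro!: nn_integral_cong simp: indicator_def)
      also have "\<dots> = ennreal (unit_ball_vol (DIM('a)) * a ^ DIM('a) - unit_ball_vol (DIM('a)) * 0 ^ DIM('a))"
        using True by (intro nn_integral_FTC_Icc) (auto intro!: derivative_eq_intros)
      finally show ?thesis using True dist[of a] X by simp
    next
      case False
      have "emeasure ?N X = (\<integral>\<^sup>+r. 0 \<partial>(lborel :: real measure))"
        unfolding X using False by (subst emeasure_density, simp, simp, intro nn_integral_cong) (auto simp: indicator_def)
      then show ?thesis using False dist[of a] X by simp
    qed
  qed
qed auto

lemma AE_norm_of_AE:
  assumes "AE t in lborel. P t"
  shows "AE x in (lborel :: 'a::euclidean_space measure). P (norm x)"
proof -
  have "AE t in distr (lborel :: 'a measure) borel norm. P t"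
    unfolding distr_norm_lborel using assms by (subst AE_density) auto
  then show ?thesis by (rule AE_distrD[rotated]) simp
qed

text \<open>Radii fill only one half-line; evenness of h doubles the integral over it, whence the
  factor 1/2.\<close>

lemma nn_integral_polar_even:
  fixes h :: "real \<Rightarrow> ennreal"
  assumes [measurable]: "h \<in> borel_measurable borel" and even: "\<And>r. h (- r) = h r"
  shows "(\<integral>\<^sup>+x. h (norm x) \<partial>(lborel :: 'a::euclidean_space measure))
    = ennreal (DIM('a) * unit_ball_vol (DIM('a)) / 2) * (\<integral>\<^sup>+r. ennreal (\<bar>r\<bar> ^ (DIM('a) - 1)) * h r \<partial>lborel)"
proof -
  let ?n = "DIM('a)" and ?\<omega> = "unit_ball_vol (DIM('a))"
  let ?k = "\<lambda>r. ennreal (\<bar>r\<bar> ^ (?n - 1)) * h r"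
  let ?I = "\<integral>\<^sup>+r. ?k r * indicator {0..} r \<partial>lborel"
  have "(\<integral>\<^sup>+x. h (norm x) \<partial>(lborel :: 'a measure)) = (\<integral>\<^sup>+r. h r \<partial>distr (lborel :: 'a measure) borel norm)"
    by (subst nn_integral_distr) auto
  also have "\<dots> = (\<integral>\<^sup>+r. ennreal (?\<omega> * (?n * r ^ (?n - 1))) * indicator {0..} r * h r \<partial>lborel)"
    unfolding distr_norm_lborel by (subst nn_integral_density) auto
  also have "\<dots> = (\<integral>\<^sup>+r. ennreal (?n * ?\<omega>) * (?k r * indicator {0..} r) \<partial>lborel)"
  proof (rule nn_integral_cong)
    fix r :: real
    have "0 \<le> r \<Longrightarrow> ennreal (?\<omega> * (?n * r ^ (?n - 1))) = ennreal (?n * ?\<omega>) * ennreal (\<bar>r\<bar> ^ (?n - 1))"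
      by (subst ennreal_mult[symmetric]) (auto simp: mult_ac)
    then show "ennreal (?\<omega> * (?n * r ^ (?n - 1))) * indicator {0..} r * h r = ennreal (?n * ?\<omega>) * (?k r * indicator {0..} r)"
      by (auto simp: indicator_def mult_ac)
  qed
  also have "\<dots> = ennreal (?n * ?\<omega>) * ?I"
    by (rule nn_integral_cmult) measurable
  finally have 1: "(\<integral>\<^sup>+x. h (norm x) \<partial>(lborel :: 'a measure)) = ennreal (?n * ?\<omega>) * ?I" .
  have "(\<integral>\<^sup>+r. ?k r \<partial>lborel) = (\<integral>\<^sup>+r. ?k r * indicator {0..} r + ?k r * indicator {..0} r \<partial>lborel)"
    by (rule nn_integral_cong_AE, use AE_lborel_singleton[of 0] in eventually_elim) (auto simp: indicator_def)
  also have "\<dots> = ?I + (\<integral>\<^sup>+r. ?k r * indicator {..0} r \<partial>lborel)"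
    by (rule nn_integral_add) measurable
  also have "(\<integral>\<^sup>+r. ?k r * indicator {..0} r \<partial>lborel) = ?I"
    by (subst nn_integral_real_affine[where c = "-1" and t = 0]) (auto simp: even indicator_def intro!: nn_integral_cong)
  finally have 2: "(\<integral>\<^sup>+r. ?k r \<partial>lborel) = 2 * ?I" by (simp add: mult_2)
  have "ennreal (?n * ?\<omega> / 2) * (2 * ?I) = ennreal (?n * ?\<omega>) * ?I"
    using numeral_mult_ennreal[of "?n * ?\<omega> / 2" "Num.Bit0 num.One"] by (simp add: mult.assoc[symmetric] mult.commute[of _ 2])
  then show ?thesis unfolding 1 2 by simp
qed

section \<open>The one-dimensional oscillation\<close>

lemma AE_lebesgue_on:
  assumes "S \<in> sets borel"
  shows "(AE w in lebesgue_on S. P w) \<longleftrightarrow> (AE w in lborel. w \<in> S \<longrightarrow> P w)"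
  using assms by (subst AE_restrict_space_iff) (auto simp: AE_completion_iff)

text \<open>In [0, infinity] the value 0 is least, so extending by 0 off S leaves the essential
  supremum unchanged. This trades an interval that varies with t for one fixed measure, as
  \<open>borel_measurable_esssup\<close> demands.\<close>

lemma esssup_lebesgue_on_eq:
  fixes F :: "real \<Rightarrow> ennreal"
  assumes [measurable]: "F \<in> borel_measurable borel" "S \<in> sets borel"
  shows "esssup (lebesgue_on S) F = esssup lborel (\<lambda>w. F w * indicator S w)"
proof (rule antisym)
  have F: "F \<in> borel_measurable (lebesgue_on S)"
    by (intro measurable_restrict_space1 measurable_completion) simp
  show "esssup (lebesgue_on S) F \<le> esssup lborel (\<lambda>w. F w * indicator S w)"
  proof (rule esssup_I[OF F])
    show "AE w in lebesgue_on S. F w \<le> esssup lborel (\<lambda>w. F w * indicator S w)"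
      unfolding AE_lebesgue_on[OF assms(2)]
      using esssup_AE[of "\<lambda>w. F w * indicator S w" lborel] by eventually_elim auto
  qed
  show "esssup lborel (\<lambda>w. F w * indicator S w) \<le> esssup (lebesgue_on S) F"
  proof (rule esssup_I)
    have "AE w in lborel. w \<in> S \<longrightarrow> F w \<le> esssup (lebesgue_on S) F"
      using esssup_AE[of F "lebesgue_on S"] unfolding AE_lebesgue_on[OF assms(2)] .
    then show "AE w in lborel. F w * indicator S w \<le> esssup (lebesgue_on S) F"
      by eventually_elim (auto simp: indicator_def)
  qed simp
qed

text \<open>The essential supremum exceeds z exactly when the section of the set where F > z has
  positive measure, and measures of sections depend measurably on the parameter.\<close>

lemma borel_measurable_esssup:
  fixes F :: "'a \<Rightarrow> real \<Rightarrow> ennreal"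
  assumes [measurable]: "case_prod F \<in> borel_measurable (M \<Otimes>\<^sub>M lborel)"
  shows "(\<lambda>x. esssup lborel (F x)) \<in> borel_measurable M"
proof (rule borel_measurableI_greater)
  fix z :: ennreal
  define Q where "Q = {y \<in> space (M \<Otimes>\<^sub>M lborel). z < case_prod F y}"
  have Q: "Q \<in> sets (M \<Otimes>\<^sub>M (lborel :: real measure))" unfolding Q_def by measurable
  have "{x \<in> space M. z < esssup lborel (F x)} = {x \<in> space M. 0 < emeasure lborel (Pair x -` Q)}"
  proof (intro Collect_cong conj_cong refl)
    fix x assume x: "x \<in> space M"
    have [measurable]: "F x \<in> borel_measurable lborel"
      using measurable_Pair2[OF assms x] by simp
    have "Pair x -` Q = {w \<in> space lborel. \<not> F x w \<le> z}"
      using x by (auto simp: Q_def space_pair_measure not_le)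
    then have "emeasure lborel (Pair x -` Q) = 0 \<longleftrightarrow> (AE w in lborel. F x w \<le> z)"
      by (subst AE_iff_measurable[OF _ refl]) auto
    also have "\<dots> \<longleftrightarrow> esssup lborel (F x) \<le> z"
    proof
      assume "AE w in lborel. F x w \<le> z"
      then show "esssup lborel (F x) \<le> z" by (intro esssup_I) auto
    next
      assume "esssup lborel (F x) \<le> z"
      then show "AE w in lborel. F x w \<le> z"
        using esssup_AE[of "F x" lborel] by (auto elim!: eventually_mono)
    qed
    finally show "z < esssup lborel (F x) \<longleftrightarrow> 0 < emeasure lborel (Pair x -` Q)"
      by (auto simp: not_le[symmetric] zero_less_iff_neq_zero)
  qed
  also have "\<dots> \<in> sets M"
    using sigma_finite_measure.measurable_emeasure_Pair[OF sigma_finite_lborel Q] by measurable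
  finally show "{x \<in> space M. z < esssup lborel (F x)} \<in> sets M" .
qed

lemma esssup_enn_powr:
  assumes [measurable]: "F \<in> borel_measurable M" and q: "0 < q"
  shows "esssup M (\<lambda>w. enn_powr (F w) q) = enn_powr (esssup M F) q"
proof (rule antisym)
  show "esssup M (\<lambda>w. enn_powr (F w) q) \<le> enn_powr (esssup M F) q"
  proof (rule esssup_I)
    show "AE w in M. enn_powr (F w) q \<le> enn_powr (esssup M F) q"
      using esssup_AE[of F M] by eventually_elim (use q in \<open>auto intro: enn_powr_mono\<close>)
  qed simp
  have "esssup M F \<le> enn_powr (esssup M (\<lambda>w. enn_powr (F w) q)) (1 / q)"
  proof (rule esssup_I)
    show "AE w in M. F w \<le> enn_powr (esssup M (\<lambda>w. enn_powr (F w) q)) (1 / q)"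
      using esssup_AE[of "\<lambda>w. enn_powr (F w) q" M]
    proof eventually_elim
      case (elim w)
      then have "enn_powr (enn_powr (F w) q) (1 / q) \<le> enn_powr (esssup M (\<lambda>w. enn_powr (F w) q)) (1 / q)"
        using q by (intro enn_powr_mono) auto
      then show ?case using q by (simp add: enn_powr_powr)
    qed
  qed simp
  then have "enn_powr (esssup M F) q \<le> enn_powr (enn_powr (esssup M (\<lambda>w. enn_powr (F w) q)) (1 / q)) q"
    using q by (intro enn_powr_mono) auto
  then show "enn_powr (esssup M F) q \<le> esssup M (\<lambda>w. enn_powr (F w) q)"
    using q by (simp add: enn_powr_powr)
qed

definition osc :: "(real \<Rightarrow> complex) \<Rightarrow> real \<Rightarrow> real \<Rightarrow> ennreal" where
  "osc g r t = esssup lborel (\<lambda>w. ennreal (cmod (g (r + w) - g r)) * indicator {-t..t} w)"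

text \<open>The bracket of the quasi-norm with outer exponent 1 / q instead of p / q, so that
  \<open>local_osc_pow\<close> is its p-th power for every q, infinity included.\<close>

definition osc_norm :: "real \<Rightarrow> ereal \<Rightarrow> (real \<Rightarrow> complex) \<Rightarrow> real \<Rightarrow> ennreal" where
  "osc_norm s q g r =
    (if q = \<infinity> then esssup lborel (\<lambda>t. ennreal (t powr (- s)) * osc g r t * indicator {0<..<1} t)
     else enn_powr (\<integral>\<^sup>+t. ennreal (t powr (- s * real_of_ereal q)) * enn_powr (osc g r t) (real_of_ereal q)
        * ennreal (1 / t) * indicator {0<..<1} t \<partial>lborel) (1 / real_of_ereal q))"

context
  fixes g :: "real \<Rightarrow> complex"
  assumes g [measurable]: "g \<in> borel_measurable borel"
begin

lemma borel_measurable_osc_pair [measurable]: "case_prod (osc g) \<in> borel_measurable (borel \<Otimes>\<^sub>M borel)"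
proof -
  let ?F = "\<lambda>x w. ennreal (cmod (g (fst x + w) - g (fst x))) * indicator {- snd x..snd x} w"
  have eq: "case_prod ?F = (\<lambda>y. ennreal (cmod (g (fst (fst y) + snd y) - g (fst (fst y)))) * (if - snd (fst y) \<le> snd y \<and> snd y \<le> snd (fst y) then 1 else 0))"
    by (auto simp: fun_eq_iff indicator_def)
  have "case_prod ?F \<in> borel_measurable ((borel \<Otimes>\<^sub>M borel) \<Otimes>\<^sub>M lborel)"
    unfolding eq by measurable
  from borel_measurable_esssup[OF this] show ?thesis
    by (simp add: osc_def[abs_def] split_def)
qed

lemma borel_measurable_osc [measurable]:
  "f1 \<in> borel_measurable M \<Longrightarrow> f2 \<in> borel_measurable M \<Longrightarrow> (\<lambda>x. osc g (f1 x) (f2 x)) \<in> borel_measurable M"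
  using measurable_compose[OF measurable_Pair borel_measurable_osc_pair] by simp

lemma AE_le_osc: "AE w in lborel. w \<in> {-t..t} \<longrightarrow> ennreal (cmod (g (r + w) - g r)) \<le> osc g r t"
  using esssup_AE[of "\<lambda>w. ennreal (cmod (g (r + w) - g r)) * indicator {-t..t} w" lborel]
  unfolding osc_def[symmetric] by eventually_elim auto

lemma osc_le:
  assumes "AE w in lborel. w \<in> {-t..t} \<longrightarrow> ennreal (cmod (g (r + w) - g r)) \<le> c"
  shows "osc g r t \<le> c"
  unfolding osc_def
proof (rule esssup_I)
  show "AE w in lborel. ennreal (cmod (g (r + w) - g r)) * indicator {-t..t} w \<le> c"
    using assms by eventually_elim (auto simp: indicator_def)
qed measurable

lemma osc_mono:
  assumes "t \<le> t'"
  shows "osc g r t \<le> osc g r t'"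
proof (rule osc_le)
  show "AE w in lborel. w \<in> {-t..t} \<longrightarrow> ennreal (cmod (g (r + w) - g r)) \<le> osc g r t'"
    using AE_le_osc[of t' r] by eventually_elim (use assms in auto)
qed

lemma osc_even:
  assumes even: "\<And>t. g (- t) = g t"
  shows "osc g (- r) t = osc g r t"
proof -
  have le: "osc g (- r) t \<le> osc g r t" for r
  proof (rule osc_le)
    have "AE w in lborel. - w \<in> {-t..t} \<longrightarrow> ennreal (cmod (g (r + - w) - g r)) \<le> osc g r t"
      using AE_borel_affine[of "-1" "\<lambda>w. w \<in> {-t..t} \<longrightarrow> ennreal (cmod (g (r + w) - g r)) \<le> osc g r t" 0] AE_le_osc[of t r]
      by simp
    then show "AE w in lborel. w \<in> {-t..t} \<longrightarrow> ennreal (cmod (g (- r + w) - g (- r))) \<le> osc g r t"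
    proof eventually_elim
      case (elim w)
      have "g (- r + w) = g (r + - w)" using even[of "r + - w"] by simp
      with elim show ?case by (auto simp: even)
    qed
  qed
  from le[of r] le[of "- r"] show ?thesis by (simp add: antisym)
qed

lemma borel_measurable_osc_norm [measurable]: "osc_norm s q g \<in> borel_measurable borel"
proof (cases "q = \<infinity>")
  case True
  have "case_prod (\<lambda>r t. ennreal (t powr (- s)) * osc g r t * indicator {0<..<1} t) \<in> borel_measurable (borel \<Otimes>\<^sub>M lborel)"
    by measurable
  from borel_measurable_esssup[OF this] show ?thesis
    using True by (simp add: osc_norm_def[abs_def])
next
  case False
  then show ?thesis unfolding osc_norm_def[abs_def] by simp
qed

lemma osc_norm_even: "(\<And>t. g (- t) = g t) \<Longrightarrow> osc_norm s q g (- r) = osc_norm s q g r"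
  by (simp add: osc_norm_def osc_even)

lemma local_osc_pow_eq:
  assumes q: "0 < q"
  shows "local_osc_pow s p q g r = enn_powr (osc_norm s q g r) p"
proof (cases "q = \<infinity>")
  case True
  have "esssup (lebesgue_on {-t..t}) (\<lambda>w. ennreal (cmod (g (r + w) - g r))) = osc g r t" for t
    unfolding osc_def by (rule esssup_lebesgue_on_eq) measurable
  then show ?thesis
    using True by (simp add: local_osc_pow_def osc_norm_def esssup_lebesgue_on_eq)
next
  case False
  then obtain q' where q': "q = ereal q'" "0 < q'" using q by (cases q) auto
  have "esssup (lebesgue_on {-t..t}) (\<lambda>w. ennreal (cmod (g (r + w) - g r) powr q')) = enn_powr (osc g r t) q'" for t
  proof -
    have "esssup (lebesgue_on {-t..t}) (\<lambda>w. ennreal (cmod (g (r + w) - g r) powr q'))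
      = esssup lborel (\<lambda>w. ennreal (cmod (g (r + w) - g r) powr q') * indicator {-t..t} w)"
      by (rule esssup_lebesgue_on_eq) measurable
    also have "(\<lambda>w. ennreal (cmod (g (r + w) - g r) powr q') * indicator {-t..t} w) = (\<lambda>w. enn_powr (ennreal (cmod (g (r + w) - g r)) * indicator {-t..t} w) q')"
      by (auto simp: fun_eq_iff indicator_def)
    also have "esssup lborel \<dots> = enn_powr (osc g r t) q'"
      unfolding osc_def using q' by (intro esssup_enn_powr) auto
    finally show ?thesis .
  qed
  then show ?thesis
    using q' by (simp add: local_osc_pow_def osc_norm_def enn_powr_powr nn_integral_restrict_space nn_integral_completion)
qed

end

section \<open>Sequence norms\<close>

definition lqn :: "ereal \<Rightarrow> (nat \<Rightarrow> ennreal) \<Rightarrow> ennreal" where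
  "lqn q A = (if q = \<infinity> then (SUP j. A j)
     else enn_powr (\<Sum>j. enn_powr (A j) (real_of_ereal q)) (1 / real_of_ereal q))"

lemma lq_seq_eq: "lq_seq s q a = lqn q (\<lambda>j. ennreal (2 powr (real j * s) * cmod (a j)))"
proof -
  have "2 powr (real j * s * r) * cmod (a j) powr r = (2 powr (real j * s) * cmod (a j)) powr r" for j r
    by (simp add: powr_mult powr_powr)
  then show ?thesis by (simp add: lq_seq_def lqn_def Let_def)
qed

lemma borel_measurable_lqn [measurable]:
  "(\<And>j. f j \<in> borel_measurable M) \<Longrightarrow> (\<lambda>x. lqn q (\<lambda>j. f j x)) \<in> borel_measurable M"
  unfolding lqn_def by (cases "q = \<infinity>") simp_all

lemma lqn_mono:
  assumes "0 < q" "\<And>j. A j \<le> B j"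
  shows "lqn q A \<le> lqn q B"
proof (cases "q = \<infinity>")
  case False
  then obtain q' where "q = ereal q'" "0 < q'" using assms by (cases q) auto
  then show ?thesis
    using assms by (auto simp: lqn_def summableI intro!: enn_powr_mono suminf_le)
qed (use assms in \<open>auto simp: lqn_def intro!: SUP_mono\<close>)

lemma lqn_cmult:
  assumes "0 < q"
  shows "lqn q (\<lambda>j. c * A j) = c * lqn q A"
proof (cases "q = \<infinity>")
  case False
  then obtain q' where "q = ereal q'" "0 < q'" using assms by (cases q) auto
  then show ?thesis by (simp add: lqn_def enn_powr_mult enn_powr_powr)
qed (simp add: lqn_def SUP_mult_left_ennreal)

lemma lqn_upper:
  assumes "0 < q"
  shows "A j \<le> lqn q A"
proof (cases "q = \<infinity>")
  case False
  then obtain q' where q': "q = ereal q'" "0 < q'" using assms by (cases q) auto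
  have "enn_powr (enn_powr (A j) q') (1 / q') \<le> enn_powr (\<Sum>j. enn_powr (A j) q') (1 / q')"
    using q' ennreal_le_suminf[of "\<lambda>j. enn_powr (A j) q'" j] by (intro enn_powr_mono) auto
  then show ?thesis using q' by (simp add: lqn_def enn_powr_powr)
qed (auto simp: lqn_def intro: SUP_upper)

text \<open>Separates entry 0, which will carry size, from the later entries, which will carry
  oscillation.\<close>

lemma lqn_Suc_le:
  assumes q: "0 < q"
  obtains C :: real where "0 < C" "\<And>A. lqn q A \<le> ennreal C * (A 0 + lqn q (\<lambda>k. A (Suc k)))"
proof (cases "q = \<infinity>")
  case True
  have "A j \<le> A 0 + (SUP k. A (Suc k))" for A :: "nat \<Rightarrow> ennreal" and j
  proof (cases j)
    case (Suc k)
    have "A (Suc k) \<le> (SUP k. A (Suc k))" by (rule SUP_upper) simp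
    then show ?thesis using Suc by (simp add: add_increasing)
  qed (simp add: add_increasing2)
  then have "lqn q A \<le> ennreal 1 * (A 0 + lqn q (\<lambda>k. A (Suc k)))" for A
    using True by (auto simp: lqn_def intro: SUP_least)
  then show ?thesis using that[of 1] by auto
next
  case False
  then obtain q' where q': "q = ereal q'" "0 < q'" using q by (cases q) auto
  have "lqn q A \<le> ennreal (2 powr (1 / q')) * (A 0 + lqn q (\<lambda>k. A (Suc k)))" for A
  proof -
    have "(\<Sum>j. enn_powr (A j) q') = (\<Sum>j. enn_powr (A (Suc j)) q') + enn_powr (A 0) q'"
      using suminf_offset[of "\<lambda>j. enn_powr (A j) q'" 1] by (simp add: add.commute summableI)
    then have "lqn q A = enn_powr (enn_powr (A 0) q' + (\<Sum>j. enn_powr (A (Suc j)) q')) (1 / q')"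
      using q' by (simp add: lqn_def add.commute)
    also have "\<dots> \<le> ennreal (2 powr (1 / q')) * (enn_powr (enn_powr (A 0) q') (1 / q') + enn_powr (\<Sum>j. enn_powr (A (Suc j)) q') (1 / q'))"
      using q' by (intro enn_powr_add_le) simp
    also have "\<dots> = ennreal (2 powr (1 / q')) * (A 0 + lqn q (\<lambda>k. A (Suc k)))"
      using q' by (simp add: lqn_def enn_powr_powr)
    finally show ?thesis .
  qed
  then show ?thesis using that[of "2 powr (1 / q')"] by auto
qed

text \<open>\<rho> to the power |j - k|; the case distinction avoids truncated subtraction.\<close>

definition geo :: "real \<Rightarrow> nat \<Rightarrow> nat \<Rightarrow> real" where
  "geo \<rho> j k = \<rho> ^ (if j \<le> k then k - j else j - k)"

lemma geo_commute: "geo \<rho> j k = geo \<rho> k j"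
  by (auto simp: geo_def)

lemma geo_sum:
  assumes "0 < \<rho>" "\<rho> < 1"
  shows "(\<Sum>j. ennreal (geo \<rho> j k)) \<le> ennreal (2 / (1 - \<rho>))"
proof -
  have g: "(\<Sum>i. ennreal (\<rho> ^ i)) = ennreal (1 / (1 - \<rho>))"
    using assms by (intro suminf_ennreal_eq geometric_sums) auto
  have "(\<Sum>j. ennreal (geo \<rho> j k)) = (\<Sum>j. ennreal (geo \<rho> (j + k) k)) + (\<Sum>j<k. ennreal (geo \<rho> j k))"
    by (rule suminf_offset[symmetric, THEN sym]) (simp add: summableI)
  also have "(\<Sum>j. ennreal (geo \<rho> (j + k) k)) = ennreal (1 / (1 - \<rho>))"
    unfolding g[symmetric] by (intro suminf_cong) (auto simp: geo_def)
  also have "(\<Sum>j<k. ennreal (geo \<rho> j k)) = (\<Sum>i<k. ennreal (\<rho> ^ Suc i))"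
    by (rule sum.reindex_bij_witness[of _ "\<lambda>i. k - Suc i" "\<lambda>j. k - Suc j"]) (auto simp: geo_def Suc_diff_Suc simp del: power_Suc)
  also have "\<dots> \<le> (\<Sum>i<k. ennreal (\<rho> ^ i))"
    using assms by (intro sum_mono ennreal_leI) (auto simp: mult_left_le_one_le)
  also have "\<dots> \<le> ennreal (1 / (1 - \<rho>))"
    unfolding g[symmetric] by (rule sum_le_suminf) (auto simp: summableI)
  finally show ?thesis
    using assms by (simp add: ennreal_plus[symmetric] del: ennreal_plus)
qed

text \<open>Convolution of an l_q sequence with a two-sided geometric one. D bounds row and column
  sums alike: Jensen's inequality costs D to the power q - 1, and exchanging the sums costs one more
  D.\<close>

lemma lqn_young:
  assumes q: "1 \<le> q" and \<rho>: "0 < \<rho>" "\<rho> < 1"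
  obtains C :: real where "0 < C" "\<And>A. lqn q (\<lambda>k. \<Sum>j. ennreal (geo \<rho> j k) * A j) \<le> ennreal C * lqn q A"
proof -
  define D where "D = 2 / (1 - \<rho>)"
  have D: "0 < D" using \<rho> by (simp add: D_def)
  note G = geo_sum[OF \<rho>, folded D_def]
  show ?thesis
  proof (cases "q = \<infinity>")
    case True
    have "(\<Sum>j. ennreal (geo \<rho> j k) * A j) \<le> ennreal D * (SUP j. A j)" for k A
    proof -
      have "(\<Sum>j. ennreal (geo \<rho> j k) * A j) \<le> (\<Sum>j. ennreal (geo \<rho> j k) * (SUP j. A j))"
        by (intro suminf_le mult_left_mono SUP_upper) (auto simp: summableI)
      also have "\<dots> = (\<Sum>j. ennreal (geo \<rho> j k)) * (SUP j. A j)" by simp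
      also have "\<dots> \<le> ennreal D * (SUP j. A j)" by (intro mult_right_mono G) simp
      finally show ?thesis .
    qed
    then show ?thesis using that[OF D] True by (auto simp: lqn_def intro: SUP_least)
  next
    case False
    then obtain q' where q': "q = ereal q'" "1 \<le> q'" using q by (cases q) (auto simp: one_ereal_def)
    have "lqn q (\<lambda>k. \<Sum>j. ennreal (geo \<rho> j k) * A j) \<le> ennreal D * lqn q A" for A
    proof -
      have jen: "enn_powr (\<Sum>j. ennreal (geo \<rho> j k) * A j) q' \<le> ennreal (D powr (q' - 1)) * (\<Sum>j. ennreal (geo \<rho> j k) * enn_powr (A j) q')" for k
      proof -
        have "enn_powr (\<integral>\<^sup>+j. A j * ennreal (geo \<rho> j k) \<partial>count_space UNIV) q'
          \<le> enn_powr (\<integral>\<^sup>+j. ennreal (geo \<rho> j k) \<partial>count_space UNIV) (q' - 1) * (\<integral>\<^sup>+j. enn_powr (A j) q' * ennreal (geo \<rho> j k) \<partial>count_space UNIV)"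
          by (intro nn_integral_jensen q') auto
        also have "\<dots> \<le> enn_powr (ennreal D) (q' - 1) * (\<integral>\<^sup>+j. enn_powr (A j) q' * ennreal (geo \<rho> j k) \<partial>count_space UNIV)"
          using q' G by (intro mult_right_mono enn_powr_mono) (auto simp: nn_integral_count_space_nat)
        finally show ?thesis using D by (simp add: nn_integral_count_space_nat mult.commute)
      qed
      have "(\<Sum>k. enn_powr (\<Sum>j. ennreal (geo \<rho> j k) * A j) q') \<le> (\<Sum>k. ennreal (D powr (q' - 1)) * (\<Sum>j. ennreal (geo \<rho> j k) * enn_powr (A j) q'))"
        by (intro suminf_le jen) (auto simp: summableI)
      also have "\<dots> = ennreal (D powr (q' - 1)) * (\<Sum>k. \<Sum>j. ennreal (geo \<rho> j k) * enn_powr (A j) q')"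
        by simp
      also have "(\<Sum>k. \<Sum>j. ennreal (geo \<rho> j k) * enn_powr (A j) q') = (\<Sum>j. \<Sum>k. ennreal (geo \<rho> j k) * enn_powr (A j) q')"
        unfolding nn_integral_count_space_nat[symmetric]
        by (rule nn_integral_count_space_nn_integral) auto
      also have "\<dots> \<le> (\<Sum>j. ennreal D * enn_powr (A j) q')"
        using G by (intro suminf_le) (auto simp: summableI geo_commute[of \<rho> _ j for j] intro!: mult_right_mono)
      also have "\<dots> = ennreal D * (\<Sum>j. enn_powr (A j) q')" by simp
      also have "ennreal (D powr (q' - 1)) * (ennreal D * (\<Sum>j. enn_powr (A j) q')) = ennreal (D powr q') * (\<Sum>j. enn_powr (A j) q')"
      proof -
        have "D powr (q' - 1) * D = D powr q'" using D powr_add[of D "q' - 1" 1] by simp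
        then show ?thesis using D by (simp add: mult.assoc[symmetric] ennreal_mult[symmetric])
      qed
      finally have "enn_powr (\<Sum>k. enn_powr (\<Sum>j. ennreal (geo \<rho> j k) * A j) q') (1 / q') \<le> enn_powr (ennreal (D powr q') * (\<Sum>j. enn_powr (A j) q')) (1 / q')"
        using q' by (intro enn_powr_mono) (auto simp: mult_left_mono)
      then show ?thesis using q' D by (simp add: lqn_def enn_powr_mult powr_powr)
    qed
    then show ?thesis using that[OF D] by blast
  qed
qed

section \<open>Discretisation of the oscillation norm\<close>

text \<open>Allows a point of an open interval to be chosen outside a given null set.\<close>

lemma not_AE_notin_Ioo:
  assumes "a < (b::real)"
  shows "\<not> (AE t in lborel. t \<notin> {a<..<b})"
proof
  assume "AE t in lborel. t \<notin> {a<..<b}"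
  moreover have "{t \<in> space lborel. \<not> t \<notin> {a<..<b}} = {a<..<b}" by auto
  ultimately have "emeasure lborel {a<..<b} = 0"
    using AE_iff_measurable[of "{a<..<b}" lborel "\<lambda>t. t \<notin> {a<..<b}"] by simp
  then show False using assms by simp
qed

lemma dyadic_annulus:
  assumes t: "0 < t" "t < (1::real)"
  obtains k :: nat where "(1/2) ^ Suc k \<le> t" "t < (1/2) ^ k"
proof -
  define k where "k = (LEAST k. (1/2) ^ k \<le> t)"
  have "\<exists>k. (1/2::real) ^ k \<le> t" using real_arch_pow_inv[OF t(1), of "1/2"] less_imp_le by auto
  then have k: "(1/2) ^ k \<le> t" unfolding k_def by (rule LeastI_ex)
  obtain i where i: "k = Suc i" using k t by (cases k) auto
  have "\<not> (1/2) ^ i \<le> t" using not_less_Least[of i "\<lambda>k. (1/2) ^ k \<le> t"] i unfolding k_def by auto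
  then show ?thesis using that[of i] k i by auto
qed

lemma osc_norm_le_lqn:
  assumes q: "0 < q" and s: "0 < s"
  obtains C :: real where "0 < C" "\<And>g r B. g \<in> borel_measurable borel \<Longrightarrow> (\<And>k. osc g r ((1/2) ^ k) \<le> B k) \<Longrightarrow>
    osc_norm s q g r \<le> ennreal C * lqn q (\<lambda>k. ennreal (2 powr (real k * s)) * B k)"
proof -
  have pw: "t powr (- a) \<le> 2 powr a * 2 powr (real k * a)" if "(1/2) ^ Suc k \<le> t" "0 < a" for t a :: real and k
  proof -
    have "t powr (- a) \<le> ((1/2) ^ Suc k) powr (- a)" using that by (intro powr_mono2') auto
    also have "((1/2) ^ Suc k :: real) = 2 powr (- real (Suc k))"
      by (simp only: powr_minus powr_realpow) (simp add: power_divide inverse_eq_divide)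
    also have "\<dots> powr (- a) = 2 powr a * 2 powr (real k * a)"
      by (simp add: powr_powr powr_add[symmetric] algebra_simps)
    finally show ?thesis .
  qed
  show ?thesis
  proof (cases "q = \<infinity>")
    case True
    show ?thesis
    proof (rule that[of "2 powr s"])
      fix g :: "real \<Rightarrow> complex" and r B assume g [measurable]: "g \<in> borel_measurable borel" and B: "\<And>k. osc g r ((1/2) ^ k) \<le> B k"
      let ?S = "SUP k. ennreal (2 powr (real k * s)) * B k"
      have "osc_norm s q g r \<le> ennreal (2 powr s) * ?S"
        unfolding osc_norm_def using True
      proof (simp, intro esssup_I AE_I2)
        fix t :: real
        show "ennreal (t powr (- s)) * osc g r t * indicator {0<..<1} t \<le> ennreal (2 powr s) * ?S"
        proof (cases "0 < t \<and> t < 1")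
          case t: True
          obtain k where k: "(1/2) ^ Suc k \<le> t" "t < (1/2) ^ k" using dyadic_annulus t by blast
          have "ennreal (t powr (- s)) * osc g r t \<le> ennreal (2 powr s * 2 powr (real k * s)) * B k"
            using pw[OF k(1) s] osc_mono[OF g, of t "(1/2) ^ k" r] k B[of k]
            by (intro mult_mono ennreal_leI) (auto intro: order_trans)
          also have "\<dots> = ennreal (2 powr s) * (ennreal (2 powr (real k * s)) * B k)"
            by (simp add: ennreal_mult mult.assoc)
          also have "\<dots> \<le> ennreal (2 powr s) * ?S" by (intro mult_left_mono SUP_upper) auto
          finally show ?thesis using t by simp
        qed simp
      qed measurable
      then show "osc_norm s q g r \<le> ennreal (2 powr s) * lqn q (\<lambda>k. ennreal (2 powr (real k * s)) * B k)"
        using True by (simp add: lqn_def)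
    qed simp
  next
    case False
    then obtain q' where q': "q = ereal q'" "0 < q'" using q by (cases q) auto
    have sq: "0 < s * q'" using s q' by simp
    show ?thesis
    proof (rule that[of "2 powr s"])
      fix g :: "real \<Rightarrow> complex" and r B assume g [measurable]: "g \<in> borel_measurable borel" and B: "\<And>k. osc g r ((1/2) ^ k) \<le> B k"
      let ?c = "\<lambda>k. ennreal (2 powr (s * q') * 2 powr (real k * (s * q'))) * enn_powr (B k) q'"
      let ?J = "\<lambda>k. {(1/2::real) ^ Suc k..<(1/2) ^ k}"
      have "(\<integral>\<^sup>+t. ennreal (t powr (- s * q')) * enn_powr (osc g r t) q' * ennreal (1 / t) * indicator {0<..<1} t \<partial>lborel)
        \<le> (\<integral>\<^sup>+t. (\<Sum>k. ?c k * (ennreal (2 ^ Suc k) * indicator (?J k) t)) \<partial>lborel)"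
      proof (rule nn_integral_mono)
        fix t :: real
        show "ennreal (t powr (- s * q')) * enn_powr (osc g r t) q' * ennreal (1 / t) * indicator {0<..<1} t \<le> (\<Sum>k. ?c k * (ennreal (2 ^ Suc k) * indicator (?J k) t))"
        proof (cases "0 < t \<and> t < 1")
          case t: True
          obtain k where k: "(1/2) ^ Suc k \<le> t" "t < (1/2) ^ k" using dyadic_annulus t by blast
          have "1 / t \<le> 2 ^ Suc k" using k(1) t by (simp add: field_simps power_divide)
          then have "ennreal (t powr (- s * q')) * enn_powr (osc g r t) q' * ennreal (1 / t) \<le> ?c k * ennreal (2 ^ Suc k)"
            using pw[OF k(1) sq] osc_mono[OF g, of t "(1/2) ^ k" r] k B[of k] q'
            by (intro mult_mono ennreal_leI enn_powr_mono) (auto intro: order_trans)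
          also have "\<dots> = ?c k * (ennreal (2 ^ Suc k) * indicator (?J k) t)"
            using k by simp
          also have "\<dots> \<le> (\<Sum>k. ?c k * (ennreal (2 ^ Suc k) * indicator (?J k) t))"
            by (rule ennreal_le_suminf)
          finally show ?thesis using t by simp
        qed simp
      qed
      also have "\<dots> = (\<Sum>k. \<integral>\<^sup>+t. ?c k * (ennreal (2 ^ Suc k) * indicator (?J k) t) \<partial>lborel)"
        by (rule nn_integral_suminf) measurable
      also have "\<dots> = (\<Sum>k. ?c k)"
      proof (rule suminf_cong)
        fix k
        have "(\<integral>\<^sup>+t. ?c k * (ennreal (2 ^ Suc k) * indicator (?J k) t) \<partial>lborel) = ?c k * (ennreal (2 ^ Suc k) * ennreal ((1/2) ^ k - (1/2) ^ Suc k))"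
        proof -
          have "emeasure lborel (?J k) = ennreal ((1/2) ^ k - (1/2) ^ Suc k)"
            by (rule emeasure_lborel_Ico) (simp add: power_decreasing)
          then have "(\<integral>\<^sup>+t. ennreal (2 ^ Suc k) * indicator (?J k) t \<partial>lborel) = ennreal (2 ^ Suc k) * ennreal ((1/2) ^ k - (1/2) ^ Suc k)"
            by (subst nn_integral_cmult_indicator) auto
          then show ?thesis by (subst nn_integral_cmult) auto
        qed
        also have "ennreal (2 ^ Suc k) * ennreal ((1/2) ^ k - (1/2) ^ Suc k) = 1"
        proof -
          have "(2::real) ^ Suc k * ((1/2) ^ k - (1/2) ^ Suc k) = 1" by (simp add: power_divide field_simps)
          then show ?thesis by (subst ennreal_mult[symmetric]) (auto simp: power_decreasing)
        qed
        finally show "(\<integral>\<^sup>+t. ?c k * (ennreal (2 ^ Suc k) * indicator (?J k) t) \<partial>lborel) = ?c k" by simp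
      qed
      also have "\<dots> = ennreal (2 powr (s * q')) * (\<Sum>k. enn_powr (ennreal (2 powr (real k * s)) * B k) q')"
        using q' by (simp add: ennreal_suminf_cmult[symmetric] enn_powr_mult powr_powr ennreal_mult mult.assoc del: ennreal_suminf_cmult)
      finally have "enn_powr (\<integral>\<^sup>+t. ennreal (t powr (- s * q')) * enn_powr (osc g r t) q' * ennreal (1 / t) * indicator {0<..<1} t \<partial>lborel) (1 / q')
        \<le> enn_powr (ennreal (2 powr (s * q')) * (\<Sum>k. enn_powr (ennreal (2 powr (real k * s)) * B k) q')) (1 / q')"
        using q' by (intro enn_powr_mono) auto
      then show "osc_norm s q g r \<le> ennreal (2 powr s) * lqn q (\<lambda>k. ennreal (2 powr (real k * s)) * B k)"
        using q' by (simp add: osc_norm_def lqn_def enn_powr_mult powr_powr)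
    qed simp
  qed
qed

text \<open>The converse comparison, with the value at the left end of each annulus. As t runs
  through (0, 1) only, scale 1 is not reached and the sequence starts with scale 1/2.\<close>

lemma lqn_le_osc_norm:
  assumes q: "0 < q" and s: "0 < s"
  obtains C :: real where "0 < C" "\<And>g r. g \<in> borel_measurable borel \<Longrightarrow> lqn q (\<lambda>k. ennreal (2 powr (real (Suc k) * s)) * osc g r ((1/2) ^ Suc k)) \<le> ennreal C * osc_norm s q g r"
proof -
  have pw: "2 powr (real (Suc k) * a) \<le> 2 powr a * t powr (- a)" if "0 < t" "t < (1/2) ^ k" "0 < a" for t a :: real and k
  proof -
    have "((1/2) ^ k) powr (- a) \<le> t powr (- a)" using that by (intro powr_mono2') auto
    moreover have "((1/2) ^ k :: real) = 2 powr (- real k)"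
      by (simp only: powr_minus powr_realpow) (simp add: power_divide inverse_eq_divide)
    then have "((1/2) ^ k :: real) powr (- a) = 2 powr (real k * a)"
      by (simp add: powr_powr)
    moreover have "2 powr (real (Suc k) * a) = 2 powr a * 2 powr (real k * a)"
      by (simp add: powr_add[symmetric] algebra_simps)
    ultimately show ?thesis by (simp add: mult_left_mono)
  qed
  show ?thesis
  proof (cases "q = \<infinity>")
    case True
    show ?thesis
    proof (rule that[of "2 powr s"])
      fix g :: "real \<Rightarrow> complex" and r assume g [measurable]: "g \<in> borel_measurable borel"
      let ?E = "esssup lborel (\<lambda>t. ennreal (t powr (- s)) * osc g r t * indicator {0<..<1} t)"
      have "ennreal (2 powr (real (Suc k) * s)) * osc g r ((1/2) ^ Suc k) \<le> ennreal (2 powr s) * ?E" for k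
      proof -
        have "AE t in lborel. ennreal (t powr (- s)) * osc g r t * indicator {0<..<1} t \<le> ?E" by (rule esssup_AE)
        \<comment> \<open>The bound by the essential supremum holds for almost every t only; the
          open annulus has positive measure and so contains an admissible t.\<close>
        moreover have "\<not> (AE t in lborel. t \<notin> {(1/2::real) ^ Suc k<..<(1/2) ^ k})"
          by (rule not_AE_notin_Ioo) simp
        ultimately obtain t where t: "t \<in> {(1/2::real) ^ Suc k<..<(1/2) ^ k}" "ennreal (t powr (- s)) * osc g r t * indicator {0<..<1} t \<le> ?E"
          by (metis (no_types, lifting) eventually_mono)
        have t0: "0 < t" using t(1) order_less_trans[of 0 "(1/2) ^ Suc k" t] by simp
        have t1: "t < 1" using t(1) power_le_one[of "1/2::real" k] by auto
        have "ennreal (2 powr (real (Suc k) * s)) * osc g r ((1/2) ^ Suc k) \<le> ennreal (2 powr s * t powr (- s)) * osc g r t"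
          using pw[of t k s] t0 t(1) s osc_mono[OF g, of "(1/2) ^ Suc k" t r] by (intro mult_mono ennreal_leI) auto
        also have "\<dots> = ennreal (2 powr s) * (ennreal (t powr (- s)) * osc g r t * indicator {0<..<1} t)"
          using t0 t1 by (simp add: ennreal_mult mult.assoc)
        also have "\<dots> \<le> ennreal (2 powr s) * ?E" by (intro mult_left_mono t) simp
        finally show ?thesis .
      qed
      then show "lqn q (\<lambda>k. ennreal (2 powr (real (Suc k) * s)) * osc g r ((1/2) ^ Suc k)) \<le> ennreal (2 powr s) * osc_norm s q g r"
        using True by (auto simp: lqn_def osc_norm_def intro: SUP_least)
    qed simp
  next
    case False
    then obtain q' where q': "q = ereal q'" "0 < q'" using q by (cases q) auto
    have sq: "0 < s * q'" using s q' by simp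
    show ?thesis
    proof (rule that[of "(2 * 2 powr (s * q')) powr (1 / q')"])
      fix g :: "real \<Rightarrow> complex" and r assume g [measurable]: "g \<in> borel_measurable borel"
      let ?f = "\<lambda>t. ennreal (t powr (- s * q')) * enn_powr (osc g r t) q' * ennreal (1 / t)"
      let ?J = "\<lambda>k. {(1/2::real) ^ Suc k..<(1/2) ^ k}"
      have trm: "enn_powr (ennreal (2 powr (real (Suc k) * s)) * osc g r ((1/2) ^ Suc k)) q' \<le> ennreal (2 * 2 powr (s * q')) * (\<integral>\<^sup>+t. ?f t * indicator (?J k) t \<partial>lborel)" for k
      proof -
        let ?v = "enn_powr (ennreal (2 powr (real (Suc k) * s)) * osc g r ((1/2) ^ Suc k)) q'"
        have v: "?v = ennreal (2 powr (real (Suc k) * (s * q'))) * enn_powr (osc g r ((1/2) ^ Suc k)) q'"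
          using q' by (simp add: enn_powr_mult powr_powr mult.assoc)
        \<comment> \<open>The annulus has length 2^(-k-1); times the lower bound 2^k for 1 / t this
          is 1/2, whence the factor 2 in \<open>trm\<close>.\<close>
        have len: "ennreal (2 ^ k) * emeasure lborel (?J k) = ennreal (1/2)"
        proof -
          have "(2::real) ^ k * ((1/2) ^ k - (1/2) ^ Suc k) = 1/2" by (simp add: power_divide field_simps)
          then show ?thesis by (subst emeasure_lborel_Ico) (auto simp: power_decreasing ennreal_mult[symmetric])
        qed
        have "?v = 2 * (?v * ennreal (1/2))"
          by (simp add: mult.left_commute[of 2] mult.commute[of 2] ennreal_mult_divide_eq divide_ennreal_def[symmetric] ennreal_divide_self mult.assoc inverse_eq_divide ennreal_divide_times)
        also have "\<dots> = 2 * (\<integral>\<^sup>+t. ?v * ennreal (2 ^ k) * indicator (?J k) t \<partial>lborel)"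
          unfolding len[symmetric] by (subst nn_integral_cmult_indicator) (auto simp: mult.assoc)
        also have "\<dots> \<le> 2 * (\<integral>\<^sup>+t. ennreal (2 powr (s * q')) * (?f t * indicator (?J k) t) \<partial>lborel)"
        proof (intro mult_left_mono nn_integral_mono)
          fix t
          show "?v * ennreal (2 ^ k) * indicator (?J k) t \<le> ennreal (2 powr (s * q')) * (?f t * indicator (?J k) t)"
          proof (cases "t \<in> ?J k")
            case True
            then have t0: "0 < t" using order_less_le_trans[of 0 "(1/2) ^ Suc k" t] by simp
            have "2 ^ k \<le> 1 / t" using True t0 by (simp add: field_simps power_divide)
            then have "?v * ennreal (2 ^ k) \<le> ennreal (2 powr (s * q') * t powr (- (s * q'))) * enn_powr (osc g r t) q' * ennreal (1 / t)"
              unfolding v using pw[of t k "s * q'"] t0 True sq q' osc_mono[OF g, of "(1/2) ^ Suc k" t r]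
              by (intro mult_mono ennreal_leI enn_powr_mono) auto
            then show ?thesis using True by (simp add: ennreal_mult mult.assoc)
          qed simp
        qed simp
        also have "\<dots> = 2 * (ennreal (2 powr (s * q')) * (\<integral>\<^sup>+t. ?f t * indicator (?J k) t \<partial>lborel))"
          by (subst nn_integral_cmult) auto
        also have "\<dots> = ennreal (2 * 2 powr (s * q')) * (\<integral>\<^sup>+t. ?f t * indicator (?J k) t \<partial>lborel)"
          by (simp add: ennreal_mult mult.assoc)
        finally show ?thesis .
      qed
      have "(\<Sum>k. enn_powr (ennreal (2 powr (real (Suc k) * s)) * osc g r ((1/2) ^ Suc k)) q') \<le> (\<Sum>k. ennreal (2 * 2 powr (s * q')) * (\<integral>\<^sup>+t. ?f t * indicator (?J k) t \<partial>lborel))"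
        by (intro suminf_le trm) (auto simp: summableI)
      also have "\<dots> = ennreal (2 * 2 powr (s * q')) * (\<integral>\<^sup>+t. (\<Sum>k. ?f t * indicator (?J k) t) \<partial>lborel)"
        by (subst nn_integral_suminf) auto
      also have "\<dots> \<le> ennreal (2 * 2 powr (s * q')) * (\<integral>\<^sup>+t. ?f t * indicator {0<..<1} t \<partial>lborel)"
      proof (intro mult_left_mono nn_integral_mono)
        fix t :: real
        have disj: "disjoint_family ?J"
        proof -
          have "?J i \<inter> ?J j = {}" if "i < j" for i j
          proof -
            have "(1/2::real) ^ j \<le> (1/2) ^ Suc i" using that by (intro power_decreasing) auto
            then show ?thesis by auto
          qed
          then show ?thesis unfolding disjoint_family_on_def by (metis Int_commute linorder_neqE_nat)
        qed
        have "(\<Sum>k. ?f t * indicator (?J k) t) = ?f t * (\<Sum>k. indicator (?J k) t)" by simp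
        also have "(\<Sum>k. indicator (?J k) t :: ennreal) = indicator (\<Union>k. ?J k) t"
          by (rule suminf_indicator[OF disj])
        also have "?f t * \<dots> \<le> ?f t * indicator {0<..<1} t"
        proof (intro mult_left_mono)
          have "t \<in> {0<..<1}" if "t \<in> ?J k" for k
            using that order_less_le_trans[of 0 "(1/2) ^ Suc k" t] power_le_one[of "1/2::real" k] by auto
          then show "indicator (\<Union>k. ?J k) t \<le> (indicator {0<..<1} t :: ennreal)"
            by (auto simp: indicator_def simp del: atLeastLessThan_iff)
        qed simp
        finally show "(\<Sum>k. ?f t * indicator (?J k) t) \<le> ?f t * indicator {0<..<1} t" .
      qed simp
      finally have "enn_powr (\<Sum>k. enn_powr (ennreal (2 powr (real (Suc k) * s)) * osc g r ((1/2) ^ Suc k)) q') (1 / q')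
        \<le> enn_powr (ennreal (2 * 2 powr (s * q')) * (\<integral>\<^sup>+t. ?f t * indicator {0<..<1} t \<partial>lborel)) (1 / q')"
        using q' by (intro enn_powr_mono) auto
      then show "lqn q (\<lambda>k. ennreal (2 powr (real (Suc k) * s)) * osc g r ((1/2) ^ Suc k)) \<le> ennreal ((2 * 2 powr (s * q')) powr (1 / q')) * osc_norm s q g r"
        using q' by (simp add: osc_norm_def lqn_def enn_powr_mult)
    qed simp
  qed
qed

section \<open>Blocks and oscillation\<close>

definition borel_Lp :: "real \<Rightarrow> (real^'n::finite \<Rightarrow> complex) \<Rightarrow> bool" where
  "borel_Lp p f \<longleftrightarrow> f \<in> borel_measurable borel \<and> (\<integral>\<^sup>+x. ennreal (cmod (f x) powr p) \<partial>lborel) < \<infinity>"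

abbreviation block :: "(real^'n::finite \<Rightarrow> complex) \<Rightarrow> (real^'n \<Rightarrow> complex) \<Rightarrow> nat \<Rightarrow> real^'n \<Rightarrow> complex" where
  "block \<psi> f j \<equiv> corr f (blockker \<psi> j)"

text \<open>Compares neighbouring dyadic scales: a block kernel is a difference of two scales, and a
  block is reproduced by the kernel of the next one.\<close>

lemma decay_double:
  assumes "0 < \<mu>" "0 \<le> b"
  shows "decay b \<mu> (z::'a::euclidean_space) \<le> 2 powr b * decay b (2 * \<mu>) z"
    and "decay b (2 * \<mu>) z \<le> 2 ^ DIM('a) * decay b \<mu> z"
proof -
  have "(2 * (1 + \<mu> * norm z)) powr - b \<le> (1 + 2 * \<mu> * norm z) powr - b"
    using assms by (intro powr_mono2') (auto intro: add_pos_nonneg)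
  then have "2 powr b * (2 powr - b * (1 + \<mu> * norm z) powr - b) \<le> 2 powr b * (1 + 2 * \<mu> * norm z) powr - b"
    using assms by (subst powr_mult[symmetric]) (auto intro: mult_left_mono)
  then have 1: "(1 + \<mu> * norm z) powr - b \<le> 2 powr b * (1 + 2 * \<mu> * norm z) powr - b"
    by (simp add: mult.assoc[symmetric] powr_add[symmetric])
  have "\<mu> ^ DIM('a) * (1 + \<mu> * norm z) powr - b \<le> (2 * \<mu>) ^ DIM('a) * (2 powr b * (1 + 2 * \<mu> * norm z) powr - b)"
    using assms by (intro mult_mono 1 power_mono) auto
  then show "decay b \<mu> z \<le> 2 powr b * decay b (2 * \<mu>) z"
    by (simp add: decay_def mult.left_commute)
  have "(1 + 2 * \<mu> * norm z) powr - b \<le> (1 + \<mu> * norm z) powr - b"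
    using assms by (intro powr_mono2') (auto intro: add_pos_nonneg)
  then show "decay b (2 * \<mu>) z \<le> 2 ^ DIM('a) * decay b \<mu> z"
    using assms by (simp add: decay_def power_mult_distrib mult.assoc mult_left_mono)
qed

text \<open>For a nonintegrable \<open>f\<close> the Bochner integral has the default value 0, so
  the inequality holds for every function.\<close>

lemma cmod_integral_le: "ennreal (cmod (integral\<^sup>L M f)) \<le> (\<integral>\<^sup>+x. ennreal (cmod (f x)) \<partial>M)"
  by (cases "integrable M f") (auto simp: not_integrable_integral_eq intro: integral_norm_bound_ennreal)

lemma blockker_decay:
  fixes \<psi> :: "real^'n::finite \<Rightarrow> complex"
  assumes \<psi>: "resolution_generator \<psi>" and b: "0 \<le> b"
  shows "\<exists>C>0. \<forall>j z. cmod (blockker \<psi> j z) \<le> C * decay b (2 ^ j) z"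
proof -
  obtain C where C: "0 < C" "\<And>j z. cmod (ker \<psi> j z) \<le> C * decay b (2 ^ j) z"
    using ker_decay[OF \<psi>] by blast
  have "cmod (blockker \<psi> j z) \<le> C * (1 + 2 powr b) * decay b (2 ^ j) z" for j z
  proof (cases j)
    case 0
    have "C * decay b 1 z \<le> C * (1 + 2 powr b) * decay b 1 z"
      using C by (intro mult_right_mono) auto
    then show ?thesis using C(2)[of 0 z] 0 by (simp add: blockker_def)
  next
    case (Suc k)
    have "cmod (ker \<psi> k z) \<le> C * (2 powr b * decay b (2 * 2 ^ k) z)"
      using C decay_double(1)[of "2 ^ k" b z] b by (intro order_trans[OF C(2)] mult_left_mono) auto
    moreover have "cmod (ker \<psi> (Suc k) z) \<le> C * decay b (2 ^ Suc k) z" by (rule C)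
    ultimately show ?thesis
      using norm_triangle_ineq4[of "ker \<psi> (Suc k) z" "ker \<psi> k z"] Suc by (simp add: blockker_def algebra_simps)
  qed
  moreover have "0 < C * (1 + 2 powr b)" using C by (simp add: add_pos_pos)
  ultimately show ?thesis by blast
qed

lemma blockker_measurable:
  fixes \<psi> :: "real^'n::finite \<Rightarrow> complex"
  assumes \<psi>: "resolution_generator \<psi>"
  shows "blockker \<psi> j \<in> borel_measurable borel"
  using borel_measurable_ker[OF \<psi>] by (cases j) (auto simp: blockker_def[abs_def])

lemma blockker_integrable:
  fixes \<psi> :: "real^'n::finite \<Rightarrow> complex"
  assumes \<psi>: "resolution_generator \<psi>"
  shows "integrable lborel (blockker \<psi> j)"
  using ker_integrable[OF \<psi>] by (cases j) (auto simp: blockker_def[abs_def])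

lemma blockker_Suc_integral:
  fixes \<psi> :: "real^'n::finite \<Rightarrow> complex"
  assumes \<psi>: "resolution_generator \<psi>"
  shows "(LINT z|lborel. blockker \<psi> (Suc k) z) = 0"
  using ker_integrable[OF \<psi>] ker_integral[OF \<psi>] by (simp add: blockker_def)

text \<open>Each z is charged to one ball of radius \<open>(1/2) ^ Suc k\<close>: to the index j - 1
  if |z| < 2^(-j), otherwise to the index whose outer dyadic annulus contains z. There the kernel
  has decayed by 2^(-(j - Suc k) b), up to the factor 2^b. \<open>W k\<close> is the bound for d
  that is available inside that ball.\<close>

lemma decay_annuli:
  fixes z :: "'a::euclidean_space" and W :: "nat \<Rightarrow> ennreal"
  assumes b: "0 \<le> b" and z: "norm z < 1 / 2"
    and d: "\<And>k. k < j \<Longrightarrow> norm z < (1/2) ^ Suc k \<Longrightarrow> d \<le> W k" and j: "0 < j"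
  shows "d * ennreal (decay b (2 ^ j) z) \<le>
    (\<Sum>k<j. ennreal ((2 ^ j) ^ DIM('a) * 2 powr b * 2 powr (- (real (j - Suc k) * b))) * indicator (ball 0 ((1/2) ^ Suc k)) z * W k)"
proof -
  let ?w = "\<lambda>k. (2 ^ j) ^ DIM('a) * 2 powr b * 2 powr (- (real (j - Suc k) * b))"
  obtain k where k: "k < j" "norm z < (1/2) ^ Suc k" "decay b (2 ^ j) z \<le> ?w k"
  proof (cases "norm z < (1/2) ^ j")
    case True
    have "(1 + 2 ^ j * norm z) powr - b \<le> 1 powr - b" using b by (intro powr_mono2') auto
    also have "\<dots> \<le> 2 powr b" using b by (simp add: ge_one_powr_ge_zero)
    finally have "decay b (2 ^ j) z \<le> ?w (j - 1)" using j by (simp add: decay_def)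
    then show ?thesis using that[of "j - 1"] True j by simp
  next
    case False
    then have "0 < norm z" using order_less_le_trans[of 0 "(1/2) ^ j" "norm z"] by simp
    then obtain m where m: "(1/2) ^ Suc m \<le> norm z" "norm z < (1/2) ^ m"
      using dyadic_annulus[of "norm z"] z by auto
    \<comment> \<open>The restriction |z| < 1/2 excludes the outermost annulus, so the index can be
      lowered by one.\<close>
    have "m \<noteq> 0" using m z by (intro notI) simp
    then obtain k where mk: "m = Suc k" by (cases m) auto
    have mj: "m < j"
    proof (rule ccontr)
      assume "\<not> m < j"
      then have "(1/2::real) ^ m \<le> (1/2) ^ j" by (intro power_decreasing) auto
      then show False using m False by linarith
    qed
    have "2 powr (real j - real (Suc m)) \<le> 1 + 2 ^ j * norm z"
    proof -
      have "2 powr (real j - real (Suc m)) = 2 ^ j * (1/2) ^ Suc m"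
        by (simp only: powr_diff powr_realpow) (simp add: power_divide)
      also have "\<dots> \<le> 2 ^ j * norm z" by (intro mult_left_mono m) simp
      finally show ?thesis by simp
    qed
    then have "(1 + 2 ^ j * norm z) powr - b \<le> (2 powr (real j - real (Suc m))) powr - b"
      using b by (intro powr_mono2') auto
    also have "\<dots> = 2 powr b * 2 powr (- (real (j - Suc k) * b))"
      using mj mk by (simp add: powr_powr powr_add[symmetric] of_nat_diff algebra_simps)
    finally have "decay b (2 ^ j) z \<le> ?w k"
      by (simp add: decay_def mult.assoc)
    then show ?thesis using that[of k] mj m mk by simp
  qed
  have "d * ennreal (decay b (2 ^ j) z) \<le> W k * ennreal (?w k)"
    using k d[OF k(1,2)] by (intro mult_mono ennreal_leI) auto
  also have "\<dots> = ennreal (?w k) * indicator (ball 0 ((1/2) ^ Suc k)) z * W k"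
    using k by (simp add: mult.commute)
  also have "\<dots> \<le> (\<Sum>k<j. ennreal (?w k) * indicator (ball 0 ((1/2) ^ Suc k)) z * W k)"
    using k by (intro member_le_sum) auto
  finally show ?thesis .
qed

text \<open>|z| \<ge> 1/2 gives |z| \<ge> (1 + |z|) / 3. With b = n + 2 the factor 2^(j n) of the
  kernel is cancelled and 4^(-j) remains.\<close>

lemma decay_far:
  fixes z :: "'a::euclidean_space"
  assumes z: "1 / 2 \<le> norm z" and b: "b = real DIM('a) + 2"
  shows "decay b (2 ^ j) z \<le> 3 powr b * (1/4) ^ j * decay b 1 z"
proof -
  have b0: "0 \<le> b" using b by simp
  have "2 ^ j * ((1 + norm z) / 3) \<le> 2 ^ j * norm z" using z by (intro mult_left_mono) auto
  also have "\<dots> \<le> 1 + 2 ^ j * norm z" by simp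
  finally have "(1 + 2 ^ j * norm z) powr - b \<le> (2 ^ j * ((1 + norm z) / 3)) powr - b"
    using b0 by (intro powr_mono2') (auto intro!: mult_pos_pos divide_pos_pos add_pos_nonneg)
  also have "\<dots> = 3 powr b * ((2 ^ j) powr - b) * (1 + norm z) powr - b"
  proof -
    have "(2 ^ j * ((1 + norm z) / 3)) powr - b = (2 ^ j) powr - b * ((1 + norm z) powr - b / 3 powr - b)"
      by (subst powr_mult) (auto simp: powr_divide add_nonneg_nonneg)
    then show ?thesis by (simp add: powr_minus field_simps)
  qed
  finally have "decay b (2 ^ j) z \<le> (2 ^ j) ^ DIM('a) * (3 powr b * ((2 ^ j) powr - b) * (1 + norm z) powr - b)"
    by (simp add: decay_def)
  also have "\<dots> = 3 powr b * ((2 ^ j) ^ DIM('a) * (2 ^ j) powr - b) * decay b 1 z"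
    by (simp add: decay_def mult_ac)
  also have "(2 ^ j) ^ DIM('a) * (2 ^ j) powr - b = (1/4 :: real) ^ j"
  proof -
    have "(2 ^ j) ^ DIM('a) = (2 ^ j :: real) powr (real DIM('a))" by (simp add: powr_realpow)
    then have "(2 ^ j) ^ DIM('a) * (2 ^ j) powr - b = (2 ^ j :: real) powr (- 2)"
      by (simp add: powr_add[symmetric] b)
    also have "\<dots> = inverse ((2 ^ j)\<^sup>2)" by (simp add: powr_minus powr_realpow[of "2 ^ j" 2, simplified])
    also have "\<dots> = (1/4) ^ j" by (simp add: power_mult[symmetric] mult.commute[of j] power_mult power_divide inverse_eq_divide)
    finally show ?thesis .
  qed
  finally show ?thesis .
qed

text \<open>The zeroth entry collects the global size, the later ones the oscillation at dyadic scales.\<close>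

definition osc_seq :: "real \<Rightarrow> (real \<Rightarrow> complex) \<Rightarrow> real^'n::finite \<Rightarrow> nat \<Rightarrow> ennreal" where
  "osc_seq s g x k = (case k of
     0 \<Rightarrow> ennreal (cmod (g (norm x))) + decay_conv (real CARD('n) + 2) 1 (\<lambda>y. ennreal (cmod (g (norm y)))) x
   | Suc i \<Rightarrow> ennreal (2 powr (real (Suc i) * s)) * osc g (norm x) ((1/2) ^ Suc i))"

text \<open>Because b exceeds the dimension by 2, integration over a ball of radius 2^(-k-1) leaves
  the weight 4^(-(j-k-1)). Times 2^(j s) this is the power j - k - 1 of 2^(s-2), times the factor
  2^((k+1) s) stored in the entry. Distances of at least 1/2 are estimated by size alone and go into
  entry 0.\<close>

lemma block_le_osc:
  fixes \<psi> :: "real^'n::finite \<Rightarrow> complex"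
  assumes \<psi>: "resolution_generator \<psi>" and s: "s < 1" and p: "1 \<le> p"
  obtains C :: real where "0 < C" "\<And>g j x. g \<in> borel_measurable borel \<Longrightarrow> borel_Lp p (\<lambda>x::real^'n. g (norm x)) \<Longrightarrow>
    ennreal (2 powr (real j * s) * cmod (block \<psi> (\<lambda>x. g (norm x)) j x)) \<le> ennreal C * (\<Sum>k. ennreal (geo (2 powr (s - 2)) k j) * osc_seq s g x k)"
proof -
  let ?n = "CARD('n)"
  let ?\<rho> = "2 powr (s - 2)"
  define b where "b = real ?n + 2"
  have b0: "0 \<le> b" by (simp add: b_def)
  obtain C0 where C0: "0 < C0" "\<And>j z. cmod (blockker \<psi> j z) \<le> C0 * decay b (2 ^ j) z"
    using blockker_decay[OF \<psi> b0] by blast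
  obtain D where D: "0 < D" "\<And>\<mu> x. 0 < \<mu> \<Longrightarrow> (\<integral>\<^sup>+y. ennreal (decay b \<mu> (y - x)) \<partial>(lborel :: (real^'n) measure)) \<le> ennreal D"
    using decay_integral_bound[where 'a = "real^'n" and b = b] by (auto simp: b_def)
  define \<omega> where "\<omega> = unit_ball_vol (real ?n)"
  have \<omega>: "0 < \<omega>" by (simp add: \<omega>_def)
  \<comment> \<open>Entry 0 of \<open>osc_seq\<close> adds the value at x and the average around x;
    L is a common bound for their coefficients D and 1.\<close>
  define L where "L = max 1 D"
  define C where "C = C0 * (2 powr b * \<omega> + 3 powr b * L)"
  have C: "0 < C" unfolding C_def using C0 \<omega> by (intro mult_pos_pos add_pos_pos) (auto simp: L_def)
  show ?thesis
  proof (rule that[OF C])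
    fix g :: "real \<Rightarrow> complex" and j and x :: "real^'n"
    assume g [measurable]: "g \<in> borel_measurable borel" and Lp: "borel_Lp p (\<lambda>x::real^'n. g (norm x))"
    define F where "F x = g (norm x)" for x :: "real^'n"
    have F [measurable]: "F \<in> borel_measurable borel" unfolding F_def[abs_def] by measurable
    have Fp: "(\<integral>\<^sup>+x. ennreal (cmod (F x) powr p) \<partial>lborel) < \<infinity>" using Lp by (simp add: borel_Lp_def F_def)
    note [measurable] = blockker_measurable[OF \<psi>]
    define bi :: "nat \<Rightarrow> real^'n \<Rightarrow> ennreal" where "bi k = indicator (ball x ((1/2) ^ Suc k))" for k
    have [measurable]: "bi k \<in> borel_measurable borel" for k
      unfolding bi_def by (rule borel_measurable_indicator) simp
    let ?A = "osc_seq s g x"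
    let ?E = "decay_conv b 1 (\<lambda>y. ennreal (cmod (F y))) x"
    have A0: "?A 0 = ennreal (cmod (F x)) + ?E" by (simp add: osc_seq_def F_def b_def)
    have bl: "ennreal (cmod (blockker \<psi> j z)) \<le> ennreal C0 * ennreal (decay b (2 ^ j) z)" for j z
      using C0 by (simp add: ennreal_mult[symmetric] ennreal_leI)
    show "ennreal (2 powr (real j * s) * cmod (block \<psi> (\<lambda>x. g (norm x)) j x)) \<le> ennreal C * (\<Sum>k. ennreal (geo ?\<rho> k j) * ?A k)"
    proof (cases j)
      \<comment> \<open>The zeroth kernel has integral 1 and not 0, so only the averaged size is
        available.\<close>
      case 0
      have "ennreal (cmod (block \<psi> F 0 x)) \<le> (\<integral>\<^sup>+y. ennreal (cmod (F y * blockker \<psi> 0 (y - x))) \<partial>lborel)"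
        unfolding corr_def by (rule cmod_integral_le)
      also have "\<dots> \<le> (\<integral>\<^sup>+y. ennreal C0 * (ennreal (cmod (F y)) * ennreal (decay b 1 (y - x))) \<partial>lborel)"
      proof (rule nn_integral_mono)
        fix y
        have "ennreal (cmod (F y)) * ennreal (cmod (blockker \<psi> 0 (y - x))) \<le> ennreal (cmod (F y)) * (ennreal C0 * ennreal (decay b (2 ^ 0) (y - x)))"
          by (intro mult_left_mono bl) simp
        then show "ennreal (cmod (F y * blockker \<psi> 0 (y - x))) \<le> ennreal C0 * (ennreal (cmod (F y)) * ennreal (decay b 1 (y - x)))"
          by (simp add: norm_mult ennreal_mult mult.left_commute)
      qed
      also have "\<dots> = ennreal C0 * ?E"
        unfolding decay_conv_def by (rule nn_integral_cmult) measurable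
      also have "\<dots> \<le> ennreal C * ?A 0"
      proof (intro mult_mono)
        have "C0 * 1 \<le> C" unfolding C_def
        proof (intro mult_left_mono)
          have "1 * 1 \<le> 3 powr b * L" using b0 by (intro mult_mono) (auto simp: L_def ge_one_powr_ge_zero)
          then show "1 \<le> 2 powr b * \<omega> + 3 powr b * L" using \<omega> by (simp add: add_increasing)
        qed (use C0 in simp)
        then show "ennreal C0 \<le> ennreal C" by (simp add: ennreal_leI)
      qed (auto simp: A0)
      also have "\<dots> = ennreal C * (ennreal (geo ?\<rho> 0 0) * ?A 0)" by (simp add: geo_def)
      also have "\<dots> \<le> ennreal C * (\<Sum>k. ennreal (geo ?\<rho> k 0) * ?A k)"
        by (intro mult_left_mono ennreal_le_suminf) auto
      finally show ?thesis using 0 by (simp add: F_def[abs_def])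
    next
      case (Suc j')
      then have j: "0 < j" by simp
      let ?K = "blockker \<psi> j"
      have FK: "integrable lborel (\<lambda>y. F y * ?K (y - x))"
      proof -
        obtain C1 where C1: "0 < C1" "\<And>j z. cmod (blockker \<psi> j z) \<le> C1 * decay (real ?n + 1) (2 ^ j) z"
          using blockker_decay[OF \<psi>, of "real ?n + 1"] by auto
        show ?thesis
        proof (rule corr_integrable[OF \<psi> p _ F _ Fp])
          show "F \<in> borel_measurable lebesgue" by (intro measurable_completion) simp
          show "cmod (?K z) \<le> (C1 * (2 ^ j) ^ ?n) * decay (real ?n + 1) 1 z" for z
          proof -
            have "cmod (?K z) \<le> C1 * decay (real ?n + 1) (2 ^ j) z" by (rule C1)
            also have "\<dots> \<le> C1 * ((2 ^ j) ^ DIM(real^'n) * decay (real ?n + 1) 1 z)"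
              using C1 by (intro mult_left_mono decay_le_decay_one) auto
            finally show ?thesis by (simp add: mult.assoc)
          qed
        qed auto
      qed
      have Kint: "(LINT y|lborel. F x * ?K (y - x)) = 0"
      proof -
        have "(LINT y|lborel. ?K (y + - x)) = (LINT y|lborel. ?K y)"
          by (rule lborel_integral_translate) measurable
        then show ?thesis using blockker_Suc_integral[OF \<psi>, of j'] Suc by simp
      qed
      have Ki: "integrable lborel (\<lambda>y. F x * ?K (y - x))"
      proof -
        have "integrable (distr lborel borel ((+) (- x))) ?K"
          using blockker_integrable[OF \<psi>] by (simp add: lborel_distr_plus)
        then have "integrable lborel (\<lambda>y. ?K (- x + y))"
          by (subst (asm) integrable_distr_eq) auto
        then show ?thesis by (intro integrable_mult_right) simp
      qed
      \<comment> \<open>Subtracting \<open>F x\<close> times the vanishing integral of the kernel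
        turns \<open>F y\<close> into \<open>F y - F x\<close>.\<close>
      have "block \<psi> F j x = (LINT y|lborel. F y * ?K (y - x)) - (LINT y|lborel. F x * ?K (y - x))"
        unfolding Kint corr_def by simp
      also have "\<dots> = (LINT y|lborel. F y * ?K (y - x) - F x * ?K (y - x))"
        by (rule Bochner_Integration.integral_diff[OF FK Ki, symmetric])
      finally have "ennreal (cmod (block \<psi> F j x)) \<le> (\<integral>\<^sup>+y. ennreal (cmod (F y * ?K (y - x) - F x * ?K (y - x))) \<partial>lborel)"
        by (simp only: cmod_integral_le)
      let ?w = "\<lambda>k. ennreal ((2 ^ j) ^ ?n * 2 powr b * 2 powr (- (real (j - Suc k) * b)))"
      let ?O = "\<lambda>k. osc g (norm x) ((1/2) ^ Suc k)"
      let ?R = "\<lambda>y. (\<Sum>k<j. ?w k * bi k y * ?O k)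
        + ennreal (3 powr b * (1/4) ^ j) * (ennreal (cmod (F y)) * ennreal (decay b 1 (y - x)) + ennreal (cmod (F x)) * ennreal (decay b 1 (y - x)))"
      \<comment> \<open>For fixed x the oscillation bound may fail on a null set of radii, which
        pulls back to a null set of points y; all the countably many scales are treated
        together.\<close>
      have "AE y in lborel. \<forall>k<j. norm (y - x) < (1/2) ^ Suc k \<longrightarrow> ennreal (cmod (F y - F x)) \<le> ?O k"
      proof -
        have "AE y::real^'n in lborel. norm y - norm x \<in> {- t..t} \<longrightarrow> ennreal (cmod (g (norm y) - g (norm x))) \<le> osc g (norm x) t" for t
        proof (rule AE_norm_of_AE)
          have "AE w in lborel. w \<in> {-t..t} \<longrightarrow> ennreal (cmod (g (norm x + w) - g (norm x))) \<le> osc g (norm x) t"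
            by (rule AE_le_osc[OF g])
          then have "AE r in lborel. (- norm x + 1 * r) \<in> {-t..t} \<longrightarrow> ennreal (cmod (g (norm x + (- norm x + 1 * r)) - g (norm x))) \<le> osc g (norm x) t"
            by (intro AE_borel_affine[where P = "\<lambda>w. w \<in> {-t..t} \<longrightarrow> ennreal (cmod (g (norm x + w) - g (norm x))) \<le> osc g (norm x) t"]) auto
          then show "AE r in lborel. r - norm x \<in> {-t..t} \<longrightarrow> ennreal (cmod (g r - g (norm x))) \<le> osc g (norm x) t"
            by simp
        qed
        then have "AE y::real^'n in lborel. \<forall>k. norm y - norm x \<in> {- ((1/2) ^ Suc k)..(1/2) ^ Suc k} \<longrightarrow> ennreal (cmod (g (norm y) - g (norm x))) \<le> ?O k"
          unfolding AE_all_countable by blast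
        then show ?thesis
        proof eventually_elim
          case (elim y)
          show ?case
          proof (intro allI impI)
            fix k assume "k < j" "norm (y - x) < (1/2) ^ Suc k"
            moreover have "\<bar>norm y - norm x\<bar> \<le> norm (y - x)" by (rule norm_triangle_ineq3)
            ultimately have "norm y - norm x \<in> {- ((1/2) ^ Suc k)..(1/2) ^ Suc k}" by (simp add: abs_le_iff)
            then show "ennreal (cmod (F y - F x)) \<le> ?O k" using elim unfolding F_def by blast
          qed
        qed
      qed
      then have pt: "AE y in lborel. ennreal (cmod (F y * ?K (y - x) - F x * ?K (y - x))) \<le> ennreal C0 * ?R y"
      proof eventually_elim
        case (elim y)
        have "ennreal (cmod (F y * ?K (y - x) - F x * ?K (y - x))) = ennreal (cmod (F y - F x)) * ennreal (cmod (?K (y - x)))"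
          by (simp add: left_diff_distrib[symmetric] norm_mult ennreal_mult)
        also have "\<dots> \<le> ennreal (cmod (F y - F x)) * (ennreal C0 * ennreal (decay b (2 ^ j) (y - x)))"
          by (intro mult_left_mono bl) simp
        also have "\<dots> = ennreal C0 * (ennreal (cmod (F y - F x)) * ennreal (decay b (2 ^ j) (y - x)))"
          by (rule mult.left_commute)
        also have "ennreal (cmod (F y - F x)) * ennreal (decay b (2 ^ j) (y - x)) \<le> ?R y"
        proof (cases "norm (y - x) < 1 / 2")
          case True
          have "ennreal (cmod (F y - F x)) * ennreal (decay b (2 ^ j) (y - x)) \<le> (\<Sum>k<j. ennreal ((2 ^ j) ^ DIM(real^'n) * 2 powr b * 2 powr (- (real (j - Suc k) * b))) * indicator (ball 0 ((1/2) ^ Suc k)) (y - x) * ?O k)"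
            using elim True j b0 by (intro decay_annuli) auto
          also have "\<dots> = (\<Sum>k<j. ?w k * bi k y * ?O k)"
            by (intro sum.cong refl) (simp add: bi_def indicator_def dist_norm norm_minus_commute)
          also have "\<dots> \<le> ?R y" by simp
          finally show ?thesis .
        next
          case False
          have "ennreal (cmod (F y - F x)) * ennreal (decay b (2 ^ j) (y - x)) \<le> (ennreal (cmod (F y)) + ennreal (cmod (F x))) * ennreal (3 powr b * (1/4) ^ j * decay b 1 (y - x))"
          proof (intro mult_mono ennreal_leI decay_far)
            show "ennreal (cmod (F y - F x)) \<le> ennreal (cmod (F y)) + ennreal (cmod (F x))"
              by (simp add: ennreal_plus[symmetric] norm_triangle_ineq4 ennreal_leI del: ennreal_plus)
          qed (use False in \<open>auto simp: b_def\<close>)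
          also have "\<dots> = ennreal (3 powr b * (1/4) ^ j) * (ennreal (cmod (F y)) * ennreal (decay b 1 (y - x)) + ennreal (cmod (F x)) * ennreal (decay b 1 (y - x)))"
            by (simp add: ennreal_mult distrib_left distrib_right mult_ac)
          also have "\<dots> \<le> ?R y" by simp
          finally show ?thesis .
        qed
        finally show ?case by (simp add: mult_left_mono)
      qed
      have "ennreal (cmod (block \<psi> F j x)) \<le> (\<integral>\<^sup>+y. ennreal C0 * ?R y \<partial>lborel)"
        using \<open>ennreal (cmod (block \<psi> F j x)) \<le> _\<close> nn_integral_mono_AE[OF pt] by (rule order_trans)
      also have "\<dots> = ennreal C0 * (\<integral>\<^sup>+y. ?R y \<partial>lborel)"
        by (rule nn_integral_cmult) measurable
      also have "(\<integral>\<^sup>+y. ?R y \<partial>lborel) = (\<Sum>k<j. ?w k * ennreal (\<omega> * ((1/2) ^ Suc k) ^ ?n) * ?O k)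
        + ennreal (3 powr b * (1/4) ^ j) * (?E + ennreal (cmod (F x)) * (\<integral>\<^sup>+y. ennreal (decay b 1 (y - x)) \<partial>lborel))"
      proof -
        have m: "(\<lambda>y. ?w k * bi k y * ?O k) \<in> borel_measurable lborel" for k
          by measurable
        have i: "(\<integral>\<^sup>+y. ?w k * bi k y * ?O k \<partial>lborel) = ?w k * ennreal (\<omega> * ((1/2) ^ Suc k) ^ ?n) * ?O k" for k
        proof -
          have "(\<integral>\<^sup>+y. ?w k * bi k y * ?O k \<partial>lborel) = (\<integral>\<^sup>+y. (?w k * ?O k) * bi k y \<partial>lborel)"
            by (simp only: mult_ac)
          also have "\<dots> = (?w k * ?O k) * emeasure lborel (ball x ((1/2) ^ Suc k))"
            unfolding bi_def by (rule nn_integral_cmult_indicator) simp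
          also have "emeasure lborel (ball x ((1/2) ^ Suc k)) = ennreal (\<omega> * ((1/2) ^ Suc k) ^ ?n)"
            by (subst emeasure_ball) (auto simp: \<omega>_def)
          finally show ?thesis by (simp only: mult_ac)
        qed
        have "(\<integral>\<^sup>+y. ?R y \<partial>lborel) = (\<integral>\<^sup>+y. (\<Sum>k<j. ?w k * bi k y * ?O k) \<partial>lborel)
          + (\<integral>\<^sup>+y. ennreal (3 powr b * (1/4) ^ j) * (ennreal (cmod (F y)) * ennreal (decay b 1 (y - x)) + ennreal (cmod (F x)) * ennreal (decay b 1 (y - x))) \<partial>lborel)"
          by (rule nn_integral_add) measurable
        also have "(\<integral>\<^sup>+y. (\<Sum>k<j. ?w k * bi k y * ?O k) \<partial>lborel) = (\<Sum>k<j. ?w k * ennreal (\<omega> * ((1/2) ^ Suc k) ^ ?n) * ?O k)"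
          using m by (subst nn_integral_sum) (auto simp only: i)
        also have "(\<integral>\<^sup>+y. ennreal (3 powr b * (1/4) ^ j) * (ennreal (cmod (F y)) * ennreal (decay b 1 (y - x)) + ennreal (cmod (F x)) * ennreal (decay b 1 (y - x))) \<partial>lborel)
          = ennreal (3 powr b * (1/4) ^ j) * (?E + ennreal (cmod (F x)) * (\<integral>\<^sup>+y. ennreal (decay b 1 (y - x)) \<partial>lborel))"
          unfolding decay_conv_def by (subst nn_integral_cmult nn_integral_add; simp add: nn_integral_add nn_integral_cmult)+
        finally show ?thesis .
      qed
      also have "\<dots> \<le> (\<Sum>k<j. ennreal (2 powr b * \<omega> * (1/4) ^ (j - Suc k)) * ?O k) + ennreal (3 powr b * L * (1/4) ^ j) * ?A 0"
      proof (intro add_mono)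
        have "(2 ^ j) ^ ?n * 2 powr b * 2 powr (- (real (j - Suc k) * b)) * (\<omega> * ((1/2) ^ Suc k) ^ ?n) = 2 powr b * \<omega> * (1/4) ^ (j - Suc k)" if k: "k < j" for k
        proof -
          define i where "i = j - Suc k"
          have ji: "j = i + Suc k" using k by (simp add: i_def)
          have "(2 ^ j :: real) ^ ?n * ((1/2) ^ Suc k) ^ ?n = (2 ^ i) ^ ?n"
            unfolding power_mult_distrib[symmetric] ji by (simp add: power_add power_divide)
          also have "\<dots> = 2 powr (real i * real ?n)" by (simp add: powr_realpow[symmetric] powr_powr)
          finally have "(2 ^ j :: real) ^ ?n * ((1/2) ^ Suc k) ^ ?n * 2 powr (- (real i * b)) = 2 powr (- 2 * real i)"
            by (simp only: powr_add[symmetric]) (simp add: b_def algebra_simps)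
          also have "\<dots> = (1/4) ^ i"
          proof -
            have "2 powr (- 2 * real i) = (2 powr (- 2)) powr real i" by (simp add: powr_powr)
            also have "(2::real) powr (- 2) = 1/4" by (simp add: powr_minus)
            finally show ?thesis by (simp add: powr_realpow)
          qed
          finally have e: "(2 ^ j :: real) ^ ?n * ((1/2) ^ Suc k) ^ ?n * 2 powr (- (real i * b)) = (1/4) ^ i" .
          show ?thesis unfolding i_def[symmetric] e[symmetric] by (simp only: mult_ac)
        qed
        then have "?w k * ennreal (\<omega> * ((1/2) ^ Suc k) ^ ?n) = ennreal (2 powr b * \<omega> * (1/4) ^ (j - Suc k))" if "k < j" for k
          using that \<omega> by (subst ennreal_mult[symmetric]) auto
        then show "(\<Sum>k<j. ?w k * ennreal (\<omega> * ((1/2) ^ Suc k) ^ ?n) * ?O k) \<le> (\<Sum>k<j. ennreal (2 powr b * \<omega> * (1/4) ^ (j - Suc k)) * ?O k)"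
          by (intro sum_mono) simp
        have "?E + ennreal (cmod (F x)) * (\<integral>\<^sup>+y. ennreal (decay b 1 (y - x)) \<partial>lborel) \<le> ennreal L * ?E + ennreal (cmod (F x)) * ennreal L"
        proof (intro add_mono mult_left_mono)
          have "1 * ?E \<le> ennreal L * ?E" by (intro mult_right_mono) (auto simp: L_def)
          then show "?E \<le> ennreal L * ?E" by simp
          show "(\<integral>\<^sup>+y. ennreal (decay b 1 (y - x)) \<partial>lborel) \<le> ennreal L"
            using D(2)[of 1 x] by (auto simp: L_def intro: order_trans ennreal_leI)
        qed simp
        also have "\<dots> = ennreal L * ?A 0" by (simp add: A0 distrib_left add.commute mult.commute)
        finally have "ennreal (3 powr b * (1/4) ^ j) * (?E + ennreal (cmod (F x)) * (\<integral>\<^sup>+y. ennreal (decay b 1 (y - x)) \<partial>lborel)) \<le> ennreal (3 powr b * (1/4) ^ j) * (ennreal L * ?A 0)"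
          by (rule mult_left_mono) simp
        also have "\<dots> = ennreal (3 powr b * L * (1/4) ^ j) * ?A 0"
        proof -
          have "ennreal (3 powr b * L * (1/4) ^ j) = ennreal (3 powr b * (1/4) ^ j) * ennreal L"
            by (subst ennreal_mult[symmetric]) (auto simp: L_def mult_ac)
          then show ?thesis by (simp only: mult.assoc)
        qed
        finally show "ennreal (3 powr b * (1/4) ^ j) * (?E + ennreal (cmod (F x)) * (\<integral>\<^sup>+y. ennreal (decay b 1 (y - x)) \<partial>lborel)) \<le> ennreal (3 powr b * L * (1/4) ^ j) * ?A 0" .
      qed
      also have "ennreal C0 * \<dots> \<le> ennreal C0 * (ennreal (2 powr b * \<omega> + 3 powr b * L) * ((\<Sum>k<j. ennreal ((1/4) ^ (j - Suc k)) * ?O k) + ennreal ((1/4) ^ j) * ?A 0))"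
      proof (intro mult_left_mono)
        have L0: "0 \<le> L" by (simp add: L_def)
        have "(\<Sum>k<j. ennreal (2 powr b * \<omega> * (1/4) ^ (j - Suc k)) * ?O k) + ennreal (3 powr b * L * (1/4) ^ j) * ?A 0
          = ennreal (2 powr b * \<omega>) * (\<Sum>k<j. ennreal ((1/4) ^ (j - Suc k)) * ?O k) + ennreal (3 powr b * L) * (ennreal ((1/4) ^ j) * ?A 0)"
          using \<omega> L0 by (simp add: sum_distrib_left ennreal_mult mult.assoc)
        also have "\<dots> \<le> ennreal (2 powr b * \<omega> + 3 powr b * L) * (\<Sum>k<j. ennreal ((1/4) ^ (j - Suc k)) * ?O k) + ennreal (2 powr b * \<omega> + 3 powr b * L) * (ennreal ((1/4) ^ j) * ?A 0)"
          using \<omega> L0 by (intro add_mono mult_right_mono ennreal_leI) auto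
        finally show "(\<Sum>k<j. ennreal (2 powr b * \<omega> * (1/4) ^ (j - Suc k)) * ?O k) + ennreal (3 powr b * L * (1/4) ^ j) * ?A 0
          \<le> ennreal (2 powr b * \<omega> + 3 powr b * L) * ((\<Sum>k<j. ennreal ((1/4) ^ (j - Suc k)) * ?O k) + ennreal ((1/4) ^ j) * ?A 0)"
          by (simp add: distrib_left)
      qed simp
      also have "\<dots> = ennreal C * ((\<Sum>k<j. ennreal ((1/4) ^ (j - Suc k)) * ?O k) + ennreal ((1/4) ^ j) * ?A 0)"
      proof -
        have "0 \<le> 2 powr b * \<omega> + 3 powr b * L" using \<omega> by (simp add: L_def)
        then show ?thesis unfolding C_def using C0 by (subst ennreal_mult) (auto simp: mult.assoc)
      qed
      finally have "ennreal (2 powr (real j * s)) * ennreal (cmod (block \<psi> F j x)) \<le> ennreal (2 powr (real j * s)) * (ennreal C * ((\<Sum>k<j. ennreal ((1/4) ^ (j - Suc k)) * ?O k) + ennreal ((1/4) ^ j) * ?A 0))"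
        by (simp add: mult_left_mono)
      also have "\<dots> = ennreal C * ((\<Sum>k<j. ennreal (2 powr (real j * s)) * ennreal ((1/4) ^ (j - Suc k)) * ?O k) + ennreal (2 powr (real j * s)) * ennreal ((1/4) ^ j) * ?A 0)"
        by (simp add: distrib_left sum_distrib_left mult_ac)
      also have "(\<Sum>k<j. ennreal (2 powr (real j * s)) * ennreal ((1/4) ^ (j - Suc k)) * ?O k) = (\<Sum>k<j. ennreal (geo ?\<rho> (Suc k) j) * ?A (Suc k))"
      proof (rule sum.cong[OF refl])
        fix k assume "k \<in> {..<j}"
        then have k: "Suc k \<le> j" by simp
        have "geo ?\<rho> (Suc k) j * 2 powr (real (Suc k) * s) = 2 powr ((s - 2) * real (j - Suc k) + real (Suc k) * s)"
          using k by (simp add: geo_def powr_realpow[symmetric] powr_powr powr_add)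
        also have "\<dots> = 2 powr (real j * s + - 2 * real (j - Suc k))"
          using k by (simp add: of_nat_diff algebra_simps)
        also have "\<dots> = 2 powr (real j * s) * (1/4) ^ (j - Suc k)"
        proof -
          have "2 powr (- 2 * real i) = (1/4) ^ i" for i
          proof -
            have "2 powr (- 2 * real i) = (2 powr (- 2)) powr real i" by (simp add: powr_powr)
            also have "(2::real) powr (- 2) = 1/4" by (simp add: powr_minus)
            finally show ?thesis by (simp add: powr_realpow)
          qed
          then show ?thesis by (simp only: powr_add)
        qed
        finally have e: "geo ?\<rho> (Suc k) j * 2 powr (real (Suc k) * s) = 2 powr (real j * s) * (1/4) ^ (j - Suc k)" .
        have "ennreal (geo ?\<rho> (Suc k) j) * ?A (Suc k) = ennreal (geo ?\<rho> (Suc k) j * 2 powr (real (Suc k) * s)) * ?O k"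
          by (simp add: osc_seq_def ennreal_mult geo_def mult.assoc del: of_nat_Suc power_Suc)
        then show "ennreal (2 powr (real j * s)) * ennreal ((1/4) ^ (j - Suc k)) * ?O k = ennreal (geo ?\<rho> (Suc k) j) * ?A (Suc k)"
          unfolding e by (simp add: ennreal_mult)
      qed
      also have "ennreal (2 powr (real j * s)) * ennreal ((1/4) ^ j) * ?A 0 = ennreal (geo ?\<rho> 0 j) * ?A 0"
      proof -
        have "geo ?\<rho> 0 j = (2 powr s * (1/4)) ^ j"
          by (simp add: geo_def powr_diff)
        also have "\<dots> = 2 powr (real j * s) * (1/4) ^ j"
        proof -
          have "(2 powr s) ^ j = 2 powr (real j * s)" by (simp add: powr_realpow[symmetric] powr_powr mult.commute)
          then show ?thesis by (simp only: power_mult_distrib)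
        qed
        finally show ?thesis by (simp add: ennreal_mult)
      qed
      \<comment> \<open>Scales sit in the entries \<open>Suc k\<close> with k < j and the size in
        entry 0; together these are the first \<open>Suc j\<close> entries.\<close>
      also have "(\<Sum>k<j. ennreal (geo ?\<rho> (Suc k) j) * ?A (Suc k)) + ennreal (geo ?\<rho> 0 j) * ?A 0 = (\<Sum>k<Suc j. ennreal (geo ?\<rho> k j) * ?A k)"
        by (subst sum.lessThan_Suc_shift) (simp add: add.commute)
      also have "ennreal C * \<dots> \<le> ennreal C * (\<Sum>k. ennreal (geo ?\<rho> k j) * ?A k)"
        by (intro mult_left_mono sum_le_suminf) (auto simp: summableI)
      finally show ?thesis by (simp add: F_def[abs_def] ennreal_mult)
    qed
  qed
qed

text \<open>Young's inequality and the discretisation work at each x separately. Only the average in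
  entry 0 of \<open>osc_seq\<close> needs an estimate in L_p, and with the value at x it accounts
  for the first integral on the right.\<close>

lemma F_le_sharp:
  fixes \<psi> :: "real^'n::finite \<Rightarrow> complex"
  assumes \<psi>: "resolution_generator \<psi>" and s: "0 < s" "s < 1" and p: "1 \<le> p" and q: "1 \<le> q"
  obtains C :: real where "0 < C" "\<And>g. g \<in> borel_measurable borel \<Longrightarrow> borel_Lp p (\<lambda>x::real^'n. g (norm x)) \<Longrightarrow>
    (\<integral>\<^sup>+x. enn_powr (lq_seq s q (\<lambda>j. block \<psi> (\<lambda>x. g (norm x)) j x)) p \<partial>lborel)
    \<le> ennreal C * ((\<integral>\<^sup>+x. ennreal (cmod (g (norm x)) powr p) \<partial>(lborel :: (real^'n) measure)) + (\<integral>\<^sup>+x. enn_powr (osc_norm s q g (norm x)) p \<partial>(lborel :: (real^'n) measure)))"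
proof -
  have q0: "0 < q" using q by (rule order_less_le_trans[rotated]) simp
  have p0: "0 < p" using p by simp
  have \<rho>: "0 < 2 powr (s - 2)" "2 powr (s - 2) < 1" using s by (auto intro: powr_less_one)
  let ?b = "real CARD('n) + 2"
  obtain C1 where C1: "0 < C1" "\<And>g j x. g \<in> borel_measurable borel \<Longrightarrow> borel_Lp p (\<lambda>x::real^'n. g (norm x)) \<Longrightarrow>
    ennreal (2 powr (real j * s) * cmod (block \<psi> (\<lambda>x. g (norm x)) j x)) \<le> ennreal C1 * (\<Sum>k. ennreal (geo (2 powr (s - 2)) k j) * osc_seq s g x k)"
    using block_le_osc[OF \<psi> s(2) p] by blast
  obtain C2 where C2: "0 < C2" "\<And>A. lqn q (\<lambda>k. \<Sum>j. ennreal (geo (2 powr (s - 2)) j k) * A j) \<le> ennreal C2 * lqn q A"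
    using lqn_young[OF q \<rho>] by blast
  obtain C3 where C3: "0 < C3" "\<And>A. lqn q A \<le> ennreal C3 * (A 0 + lqn q (\<lambda>k. A (Suc k)))"
    using lqn_Suc_le[OF q0] by blast
  obtain C4 where C4: "0 < C4" "\<And>g r. g \<in> borel_measurable borel \<Longrightarrow> lqn q (\<lambda>k. ennreal (2 powr (real (Suc k) * s)) * osc g r ((1/2) ^ Suc k)) \<le> ennreal C4 * osc_norm s q g r"
    using lqn_le_osc_norm[OF q0 s(1)] by blast
  obtain C5 where C5: "0 < C5" "\<And>\<mu> (h :: real^'n \<Rightarrow> ennreal). 0 < \<mu> \<Longrightarrow> h \<in> borel_measurable borel \<Longrightarrow>
    (\<integral>\<^sup>+x. enn_powr (decay_conv ?b \<mu> h x) p \<partial>lborel) \<le> ennreal C5 * (\<integral>\<^sup>+x. enn_powr (h x) p \<partial>lborel)"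
    using decay_conv_norm_bound[where 'a = "real^'n" and b = ?b and u = p] p by auto
  define K where "K = C1 * C2 * C3 * (1 + C4)"
  have K: "0 < K" using C1 C2 C3 C4 by (simp add: K_def)
  define C where "C = K powr p * 2 powr p * (2 powr p * (1 + C5) + 1)"
  have C: "0 < C" unfolding C_def using K C5 by (intro mult_pos_pos add_pos_pos) auto
  show ?thesis
  proof (rule that[OF C])
    fix g :: "real \<Rightarrow> complex" assume g [measurable]: "g \<in> borel_measurable borel" and Lp: "borel_Lp p (\<lambda>x::real^'n. g (norm x))"
    let ?N = "\<integral>\<^sup>+x. ennreal (cmod (g (norm x)) powr p) \<partial>(lborel :: (real^'n) measure)"
    let ?O = "\<integral>\<^sup>+x. enn_powr (osc_norm s q g (norm x)) p \<partial>(lborel :: (real^'n) measure)"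
    let ?h = "\<lambda>y::real^'n. ennreal (cmod (g (norm y)))"
    let ?E = "decay_conv ?b 1 ?h"
    have pt: "enn_powr (lq_seq s q (\<lambda>j. block \<psi> (\<lambda>x. g (norm x)) j x)) p
      \<le> ennreal (K powr p * 2 powr p) * (ennreal (2 powr p) * (enn_powr (?h x) p + enn_powr (?E x) p) + enn_powr (osc_norm s q g (norm x)) p)" for x
    proof -
      have "lq_seq s q (\<lambda>j. block \<psi> (\<lambda>x. g (norm x)) j x) \<le> lqn q (\<lambda>j. ennreal C1 * (\<Sum>k. ennreal (geo (2 powr (s - 2)) k j) * osc_seq s g x k))"
        unfolding lq_seq_eq by (intro lqn_mono q0 C1(2) g Lp)
      also have "\<dots> \<le> ennreal C1 * (ennreal C2 * lqn q (osc_seq s g x))"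
        unfolding lqn_cmult[OF q0] by (intro mult_left_mono C2) simp
      also have "\<dots> \<le> ennreal C1 * (ennreal C2 * (ennreal C3 * (osc_seq s g x 0 + ennreal C4 * osc_norm s q g (norm x))))"
      proof (intro mult_left_mono)
        have "lqn q (\<lambda>k. osc_seq s g x (Suc k)) \<le> ennreal C4 * osc_norm s q g (norm x)"
          using C4(2)[OF g, of "norm x"] by (simp add: osc_seq_def)
        then show "lqn q (osc_seq s g x) \<le> ennreal C3 * (osc_seq s g x 0 + ennreal C4 * osc_norm s q g (norm x))"
          by (intro order_trans[OF C3(2)[of "osc_seq s g x"]] mult_left_mono add_left_mono) auto
      qed auto
      also have "\<dots> \<le> ennreal C1 * (ennreal C2 * (ennreal C3 * (ennreal (1 + C4) * osc_seq s g x 0 + ennreal (1 + C4) * osc_norm s q g (norm x))))"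
      proof (intro mult_left_mono add_mono mult_right_mono ennreal_leI)
        have "1 * osc_seq s g x 0 \<le> ennreal (1 + C4) * osc_seq s g x 0" using C4 by (intro mult_right_mono) auto
        then show "osc_seq s g x 0 \<le> ennreal (1 + C4) * osc_seq s g x 0" by simp
      qed auto
      also have "\<dots> = ennreal K * (osc_seq s g x 0 + osc_norm s q g (norm x))"
      proof -
        have "0 \<le> C1 * C2" "0 \<le> C1 * C2 * C3" "0 \<le> 1 + C4" using C1 C2 C3 C4 by auto
        then have "ennreal K = ennreal C1 * ennreal C2 * ennreal C3 * ennreal (1 + C4)"
          unfolding K_def using C1 C2 C3 by (simp only: ennreal_mult less_imp_le)
        then show ?thesis by (simp only: distrib_left mult.assoc)
      qed
      finally have "enn_powr (lq_seq s q (\<lambda>j. block \<psi> (\<lambda>x. g (norm x)) j x)) p \<le> enn_powr (ennreal K * (osc_seq s g x 0 + osc_norm s q g (norm x))) p"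
        using p0 by (intro enn_powr_mono) auto
      also have "\<dots> = ennreal (K powr p) * enn_powr (osc_seq s g x 0 + osc_norm s q g (norm x)) p"
        using K p0 by (simp add: enn_powr_mult)
      also have "\<dots> \<le> ennreal (K powr p) * (ennreal (2 powr p) * (enn_powr (osc_seq s g x 0) p + enn_powr (osc_norm s q g (norm x)) p))"
        by (intro mult_left_mono enn_powr_add_le p0) simp
      also have "\<dots> \<le> ennreal (K powr p) * (ennreal (2 powr p) * (ennreal (2 powr p) * (enn_powr (?h x) p + enn_powr (?E x) p) + enn_powr (osc_norm s q g (norm x)) p))"
        using enn_powr_add_le[OF p0, of "?h x" "?E x"]
        by (intro mult_left_mono add_right_mono) (auto simp: osc_seq_def)
      finally show ?thesis by (simp add: ennreal_mult mult.assoc)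
    qed
    have "(\<integral>\<^sup>+x. enn_powr (lq_seq s q (\<lambda>j. block \<psi> (\<lambda>x. g (norm x)) j x)) p \<partial>lborel)
      \<le> (\<integral>\<^sup>+x. ennreal (K powr p * 2 powr p) * (ennreal (2 powr p) * (enn_powr (?h x) p + enn_powr (?E x) p) + enn_powr (osc_norm s q g (norm x)) p) \<partial>lborel)"
      by (intro nn_integral_mono pt)
    also have "\<dots> = ennreal (K powr p * 2 powr p) * (ennreal (2 powr p) * ((\<integral>\<^sup>+x. enn_powr (?h x) p \<partial>lborel) + (\<integral>\<^sup>+x. enn_powr (?E x) p \<partial>lborel)) + ?O)"
    proof -
      note [measurable] = borel_measurable_osc_norm[OF g]
      have [measurable]: "?h \<in> borel_measurable borel" "?E \<in> borel_measurable borel" by measurable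
      show ?thesis
        by (simp add: nn_integral_cmult nn_integral_add del: enn_powr_ennreal)
    qed
    also have "\<dots> \<le> ennreal (K powr p * 2 powr p) * (ennreal (2 powr p) * (?N + ennreal C5 * ?N) + ?O)"
      using C5(2)[of 1 ?h] by (intro mult_left_mono add_mono add_left_mono) auto
    also have "\<dots> \<le> ennreal (K powr p * 2 powr p) * (ennreal (2 powr p * (1 + C5) + 1) * ?N + ennreal (2 powr p * (1 + C5) + 1) * ?O)"
    proof (intro mult_left_mono add_mono)
      have "ennreal (2 powr p) * (?N + ennreal C5 * ?N) = ennreal (2 powr p * (1 + C5)) * ?N"
        using C5 by (simp add: ennreal_mult distrib_left distrib_right mult.assoc)
      also have "\<dots> \<le> ennreal (2 powr p * (1 + C5) + 1) * ?N" by (intro mult_right_mono ennreal_leI) auto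
      finally show "ennreal (2 powr p) * (?N + ennreal C5 * ?N) \<le> ennreal (2 powr p * (1 + C5) + 1) * ?N" .
      have "1 * ?O \<le> ennreal (2 powr p * (1 + C5) + 1) * ?O"
        using C5 by (intro mult_right_mono) auto
      then show "?O \<le> ennreal (2 powr p * (1 + C5) + 1) * ?O" by simp
    qed simp
    also have "\<dots> = ennreal C * (?N + ?O)"
    proof -
      have "ennreal C = ennreal (K powr p * 2 powr p) * ennreal (2 powr p * (1 + C5) + 1)"
        unfolding C_def using C5 by (intro ennreal_mult) auto
      then show ?thesis by (simp only: distrib_left mult.assoc)
    qed
    finally show "(\<integral>\<^sup>+x. enn_powr (lq_seq s q (\<lambda>j. block \<psi> (\<lambda>x. g (norm x)) j x)) p \<partial>lborel) \<le> ennreal C * (?N + ?O)" .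
  qed
qed

section \<open>Local increments of the blocks\<close>

text \<open>Peetre's inequality: 1 + \<mu> |z| is at most the product of 1 + \<mu> |h| and 1 + \<mu>
  |z - h|. The loss of order b in \<mu> |h| is what later forces s above b / r.\<close>

lemma decay_shift:
  fixes z h :: "'a::euclidean_space"
  assumes "0 \<le> \<mu>" "0 \<le> b"
  shows "decay b \<mu> (z - h) \<le> (1 + \<mu> * norm h) powr b * decay b \<mu> z"
proof -
  have p1: "0 < 1 + \<mu> * norm h" and p2: "0 < 1 + \<mu> * norm (z - h)" and p3: "0 < 1 + \<mu> * norm z"
    using assms by (auto intro: add_pos_nonneg)
  have "norm z \<le> norm (z - h) + norm h" using norm_triangle_ineq[of "z - h" h] by simp
  then have "\<mu> * norm z \<le> \<mu> * (norm (z - h) + norm h)" using assms by (intro mult_left_mono)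
  moreover have "0 \<le> (\<mu> * norm h) * (\<mu> * norm (z - h))" using assms by simp
  ultimately have "1 + \<mu> * norm z \<le> (1 + \<mu> * norm h) * (1 + \<mu> * norm (z - h))"
    by (simp add: algebra_simps)
  then have "((1 + \<mu> * norm h) * (1 + \<mu> * norm (z - h))) powr - b \<le> (1 + \<mu> * norm z) powr - b"
    using p3 assms by (intro powr_mono2') auto
  then have "(1 + \<mu> * norm h) powr - b * (1 + \<mu> * norm (z - h)) powr - b \<le> (1 + \<mu> * norm z) powr - b"
    using p1 p2 by (simp add: powr_mult)
  then have "(1 + \<mu> * norm h) powr b * ((1 + \<mu> * norm h) powr - b * (1 + \<mu> * norm (z - h)) powr - b) \<le> (1 + \<mu> * norm h) powr b * (1 + \<mu> * norm z) powr - b"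
    by (intro mult_left_mono) auto
  then have "(1 + \<mu> * norm (z - h)) powr - b \<le> (1 + \<mu> * norm h) powr b * (1 + \<mu> * norm z) powr - b"
    using p1 by (simp add: mult.assoc[symmetric] powr_add[symmetric])
  then have "\<mu> ^ DIM('a) * (1 + \<mu> * norm (z - h)) powr - b \<le> \<mu> ^ DIM('a) * ((1 + \<mu> * norm h) powr b * (1 + \<mu> * norm z) powr - b)"
    using assms by (intro mult_left_mono) auto
  then show ?thesis by (simp add: decay_def mult_ac)
qed

lemma decay_conv_shift:
  fixes g :: "'a::euclidean_space \<Rightarrow> ennreal"
  assumes [measurable]: "g \<in> borel_measurable borel" and "0 \<le> \<mu>" "0 \<le> b"
  shows "decay_conv b \<mu> g (x + h) \<le> ennreal ((1 + \<mu> * norm h) powr b) * decay_conv b \<mu> g x"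
proof -
  have "decay_conv b \<mu> g (x + h) \<le> (\<integral>\<^sup>+y. ennreal ((1 + \<mu> * norm h) powr b) * (g y * ennreal (decay b \<mu> (y - x))) \<partial>lborel)"
    unfolding decay_conv_def
  proof (rule nn_integral_mono)
    fix y
    have "g y * ennreal (decay b \<mu> (y - (x + h))) \<le> g y * ennreal ((1 + \<mu> * norm h) powr b * decay b \<mu> (y - x))"
      using decay_shift[OF assms(2,3), of "y - x" h] by (intro mult_left_mono ennreal_leI) (auto simp: diff_diff_eq)
    then show "g y * ennreal (decay b \<mu> (y - (x + h))) \<le> ennreal ((1 + \<mu> * norm h) powr b) * (g y * ennreal (decay b \<mu> (y - x)))"
      using assms by (simp add: ennreal_mult mult_ac)
  qed
  also have "\<dots> = ennreal ((1 + \<mu> * norm h) powr b) * decay_conv b \<mu> g x"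
    unfolding decay_conv_def by (rule nn_integral_cmult) measurable
  finally show ?thesis .
qed

lemma borel_LpD:
  assumes "borel_Lp p f"
  shows "f \<in> borel_measurable borel" "f \<in> borel_measurable lebesgue" "(\<integral>\<^sup>+x. ennreal (cmod (f x) powr p) \<partial>lborel) < \<infinity>"
  using assms by (auto simp: borel_Lp_def intro: measurable_completion)

section \<open>Correlations of a Borel L_p function with the kernels, and its blocks\<close>

context
  fixes \<psi> f :: "real^'n::finite \<Rightarrow> complex" and p :: real
  assumes \<psi>: "resolution_generator \<psi>" and p: "1 \<le> p" and f: "borel_Lp p f"
begin

lemmas f_setup = \<psi> p borel_LpD(2)[OF f] borel_LpD(1)[OF f] AE_I2[of lebesgue "\<lambda>x. f x = f x", OF refl] borel_LpD(3)[OF f]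

lemma ker_decay_one: "\<exists>C>0. \<forall>z. cmod (ker \<psi> j z) \<le> C * decay (real CARD('n) + 1) 1 z"
proof -
  obtain C where C: "0 < C" "\<And>j z. cmod (ker \<psi> j z) \<le> C * decay (real CARD('n) + 1) (2 ^ j) z"
    using ker_decay[OF \<psi>] by blast
  have "cmod (ker \<psi> j z) \<le> (C * (2 ^ j) ^ CARD('n)) * decay (real CARD('n) + 1) 1 z" for z
  proof -
    have "C * decay (real CARD('n) + 1) (2 ^ j) z \<le> C * ((2 ^ j) ^ DIM(real^'n) * decay (real CARD('n) + 1) 1 z)"
      using C by (intro mult_left_mono decay_le_decay_one) auto
    with C(2)[of j z] show ?thesis by (simp add: mult.assoc)
  qed
  moreover have "0 < C * (2 ^ j) ^ CARD('n)" using C by simp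
  ultimately show ?thesis by blast
qed

lemma corr_ker_integrable: "integrable lborel (\<lambda>x. f x * ker \<psi> j (x - y))"
  using ker_decay_one[of j] corr_integrable[OF f_setup borel_measurable_ker[OF \<psi>]] by blast

lemma corr_ker_abs_bound: "\<exists>B>0. \<forall>y. (LINT x|lborel. cmod (f x * ker \<psi> j (x - y))) \<le> B"
  using ker_decay_one[of j] corr_bound[OF f_setup borel_measurable_ker[OF \<psi>]] by blast

lemma corr_ker_bounded: "\<exists>B>0. \<forall>y. cmod (corr f (ker \<psi> j) y) \<le> B"
proof -
  obtain B where "0 < B" "\<And>y. (LINT x|lborel. cmod (f x * ker \<psi> j (x - y))) \<le> B"
    using corr_ker_abs_bound by blast
  moreover have "cmod (corr f (ker \<psi> j) y) \<le> (LINT x|lborel. cmod (f x * ker \<psi> j (x - y)))" for y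
    unfolding corr_def by (rule integral_norm_bound)
  ultimately show ?thesis by (meson order_trans)
qed

lemma corr_ker_measurable [measurable]: "corr f (ker \<psi> j) \<in> borel_measurable borel"
proof -
  have "continuous_on UNIV (corr f (\<lambda>z. complex_of_real (1 / (2 * pi) ^ CARD('n)) * hat (\<lambda>x. \<psi> ((1/2) ^ j *\<^sub>R x)) z))"
    by (rule corr_hat_represents(1)[OF f_setup test_scaled[OF \<psi>]])
  then have "continuous_on UNIV (corr f (ker \<psi> j))"
    by (simp add: ker_def[abs_def])
  then show ?thesis by (rule borel_measurable_continuous_onI)
qed

lemma block_eq:
  "block \<psi> f 0 y = corr f (ker \<psi> 0) y"
  "block \<psi> f (Suc k) y = corr f (ker \<psi> (Suc k)) y - corr f (ker \<psi> k) y"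
  using corr_ker_integrable by (simp_all add: corr_def blockker_def right_diff_distrib)

lemma block_measurable [measurable]: "block \<psi> f j \<in> borel_measurable borel"
proof (cases j)
  case 0
  then show ?thesis using corr_ker_measurable[of 0] by (simp add: block_eq cong: measurable_cong)
next
  case (Suc k)
  have "(\<lambda>y. corr f (ker \<psi> (Suc k)) y - corr f (ker \<psi> k) y) \<in> borel_measurable borel" by measurable
  then show ?thesis using Suc by (simp add: block_eq cong: measurable_cong)
qed

lemma sum_block: "(\<Sum>j<Suc J. block \<psi> f j y) = corr f (ker \<psi> J) y"
  by (induction J) (auto simp: block_eq)

lemma ker_translate_integrable: "integrable lborel (\<lambda>x. ker \<psi> m (x - y))"
proof -
  have "integrable (distr lborel borel ((+) (- y))) (ker \<psi> m)"
    using ker_integrable[OF \<psi>] by (simp add: lborel_distr_plus)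
  then show ?thesis
    using borel_measurable_ker[OF \<psi>] by (subst (asm) integrable_distr_eq) auto
qed

text \<open>Fubini's theorem makes the two correlations associative; the reflection x = u - v turns
  the inner integral into \<open>ker_reproducing\<close>.\<close>

lemma corr_ker_reproducing:
  assumes im: "i < m"
  shows "corr (corr f (ker \<psi> i)) (ker \<psi> m) y = corr f (ker \<psi> i) y"
proof -
  note [measurable] = borel_measurable_ker[OF \<psi>] borel_LpD(1)[OF f]
  obtain B where B: "0 < B" "\<And>y. (LINT x|lborel. cmod (f x * ker \<psi> i (x - y))) \<le> B"
    using corr_ker_abs_bound by blast
  have "corr (corr f (ker \<psi> i)) (ker \<psi> m) y = (LINT x|lborel. (LINT u|lborel. f u * ker \<psi> i (u - x) * ker \<psi> m (x - y)))"
    by (simp add: corr_def)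
  also have "\<dots> = (LINT u|lborel. (LINT x|lborel. f u * ker \<psi> i (u - x) * ker \<psi> m (x - y)))"
  proof (rule lborel_pair.Fubini_integral[symmetric])
    show "integrable (lborel \<Otimes>\<^sub>M lborel) (\<lambda>(x, u). f u * ker \<psi> i (u - x) * ker \<psi> m (x - y))"
    proof (rule lborel_pair.Fubini_integrable)
      show "AE x in lborel. integrable lborel (\<lambda>u. case (x, u) of (x, u) \<Rightarrow> f u * ker \<psi> i (u - x) * ker \<psi> m (x - y))"
        using corr_ker_integrable by (auto intro!: AE_I2 integrable_mult_left)
      show "integrable lborel (\<lambda>x. LINT u|lborel. norm (case (x, u) of (x, u) \<Rightarrow> f u * ker \<psi> i (u - x) * ker \<psi> m (x - y)))"
      proof (rule Bochner_Integration.integrable_bound)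
        show "integrable lborel (\<lambda>x. B * cmod (ker \<psi> m (x - y)))"
          by (intro integrable_mult_right integrable_norm ker_translate_integrable)
        show "AE x in lborel. norm (LINT u|lborel. norm (case (x, u) of (x, u) \<Rightarrow> f u * ker \<psi> i (u - x) * ker \<psi> m (x - y))) \<le> norm (B * cmod (ker \<psi> m (x - y)))"
        proof (rule AE_I2)
          fix x
          have "(LINT u|lborel. cmod (f u * ker \<psi> i (u - x) * ker \<psi> m (x - y))) = (LINT u|lborel. cmod (f u * ker \<psi> i (u - x))) * cmod (ker \<psi> m (x - y))"
            by (simp only: norm_mult[of _ "ker \<psi> m (x - y)"] integral_mult_left_zero)
          also have "\<dots> \<le> B * cmod (ker \<psi> m (x - y))" by (intro mult_right_mono B) auto
          finally show "norm (LINT u|lborel. norm (case (x, u) of (x, u) \<Rightarrow> f u * ker \<psi> i (u - x) * ker \<psi> m (x - y))) \<le> norm (B * cmod (ker \<psi> m (x - y)))"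
            using B(1) by simp
        qed
      qed measurable
    qed measurable
  qed
  also have "\<dots> = (LINT u|lborel. f u * ker \<psi> i (u - y))"
  proof (intro Bochner_Integration.integral_cong refl)
    fix u
    have "(LINT x|lborel. ker \<psi> m (x - y) * ker \<psi> i (u - x)) = \<bar>-1\<bar> ^ DIM(real^'n) *\<^sub>R (LINT v|lborel. ker \<psi> m (u + (-1) *\<^sub>R v - y) * ker \<psi> i (u - (u + (-1) *\<^sub>R v)))"
      by (rule lborel_integral_affine) (auto, measurable)
    also have "\<dots> = (LINT v|lborel. ker \<psi> m ((u - y) - v) * ker \<psi> i v)"
      by (simp add: algebra_simps)
    also have "\<dots> = ker \<psi> i (u - y)" by (rule ker_reproducing[OF \<psi> im])
    finally have "(LINT x|lborel. ker \<psi> m (x - y) * ker \<psi> i (u - x)) = ker \<psi> i (u - y)" .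
    moreover have "(LINT x|lborel. f u * ker \<psi> i (u - x) * ker \<psi> m (x - y)) = (LINT x|lborel. f u * (ker \<psi> m (x - y) * ker \<psi> i (u - x)))"
      by (simp only: mult_ac)
    ultimately show "(LINT x|lborel. f u * ker \<psi> i (u - x) * ker \<psi> m (x - y)) = f u * ker \<psi> i (u - y)"
      by (simp only: integral_mult_right_zero)
  qed
  finally show ?thesis by (simp add: corr_def)
qed

lemma bounded_mult_ker_integrable:
  assumes [measurable]: "A \<in> borel_measurable borel" and A: "\<And>x. cmod (A x) \<le> B"
  shows "integrable lborel (\<lambda>x. A x * ker \<psi> m (x - y))"
proof (rule Bochner_Integration.integrable_bound)
  note [measurable] = borel_measurable_ker[OF \<psi>]
  show "integrable lborel (\<lambda>x. B * cmod (ker \<psi> m (x - y)))"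
    by (intro integrable_mult_right integrable_norm ker_translate_integrable)
  show "(\<lambda>x. A x * ker \<psi> m (x - y)) \<in> borel_measurable lborel" by measurable
  have "0 \<le> B" using A[of 0] norm_ge_zero order_trans by blast
  then show "AE x in lborel. norm (A x * ker \<psi> m (x - y)) \<le> norm (B * cmod (ker \<psi> m (x - y)))"
    using A by (auto simp: norm_mult intro!: AE_I2 mult_right_mono)
qed

lemma block_bounded: "\<exists>B. \<forall>y. cmod (block \<psi> f j y) \<le> B"
proof (cases j)
  case 0
  then show ?thesis using corr_ker_bounded[of 0] by (auto simp: block_eq)
next
  case (Suc k)
  obtain B1 B2 where "\<And>y. cmod (corr f (ker \<psi> (Suc k)) y) \<le> B1" "\<And>y. cmod (corr f (ker \<psi> k) y) \<le> B2"
    using corr_ker_bounded by metis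
  then have "cmod (block \<psi> f j y) \<le> B1 + B2" for y
    unfolding Suc block_eq by (intro order_trans[OF norm_triangle_ineq4] add_mono)
  then show ?thesis by blast
qed

text \<open>The multipliers in block j are untouched by the multiplier of index
  \<open>Suc j\<close>. The block is thereby expressed through its own values, which converts kernel
  estimates into estimates by averages of the block.\<close>

lemma block_reproducing: "corr (block \<psi> f j) (ker \<psi> (Suc j)) y = block \<psi> f j y"
proof (cases j)
  case 0
  then show ?thesis
    using corr_ker_reproducing[of 0 "Suc 0" y] by (simp add: corr_def[of "block \<psi> f 0"] corr_def[of "corr f (ker \<psi> 0)"] block_eq)
next
  case (Suc k)
  obtain B1 B2 where B: "\<And>y. cmod (corr f (ker \<psi> (Suc k)) y) \<le> B1" "\<And>y. cmod (corr f (ker \<psi> k) y) \<le> B2"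
    using corr_ker_bounded by metis
  have "corr (block \<psi> f j) (ker \<psi> (Suc j)) y = (LINT x|lborel. corr f (ker \<psi> (Suc k)) x * ker \<psi> (Suc j) (x - y) - corr f (ker \<psi> k) x * ker \<psi> (Suc j) (x - y))"
    unfolding Suc by (simp add: corr_def[of "block \<psi> f (Suc k)"] block_eq left_diff_distrib)
  also have "\<dots> = corr (corr f (ker \<psi> (Suc k))) (ker \<psi> (Suc j)) y - corr (corr f (ker \<psi> k)) (ker \<psi> (Suc j)) y"
    unfolding corr_def[of "corr _ _"]
    by (intro Bochner_Integration.integral_diff bounded_mult_ker_integrable[OF _ B(1)] bounded_mult_ker_integrable[OF _ B(2)]) measurable
  also have "\<dots> = block \<psi> f j y"
    using Suc by (simp add: corr_ker_reproducing block_eq)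
  finally show ?thesis .
qed

end

text \<open>An integral form of the Peetre maximal function: the weighted supremum of |f_j| around x
  is replaced by an L_r mean with weight \<open>decay b (2 ^ j)\<close>. Being a mean, it falls
  under the vector-valued inequality.\<close>

definition peetre :: "(real^'n::finite \<Rightarrow> complex) \<Rightarrow> real \<Rightarrow> real \<Rightarrow> (real^'n \<Rightarrow> complex) \<Rightarrow> nat \<Rightarrow> real^'n \<Rightarrow> ennreal" where
  "peetre \<psi> b r f j x = enn_powr (decay_conv b (2 ^ j) (\<lambda>y. enn_powr (ennreal (cmod (block \<psi> f j y))) r) x) (1 / r)"

text \<open>The gain or loss for increments over distance 2^(-k) of a block of frequency 2^j: a gain
  for j < k, where the block is smooth at that distance, a loss of exponent a for j > k.\<close>

definition wt :: "real \<Rightarrow> nat \<Rightarrow> nat \<Rightarrow> real" where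
  "wt a j k = (if j \<le> k then (1/2) ^ (k - j) else 2 powr (real (j - k) * a))"

text \<open>Two regimes. For a displacement small against 2^(-j), the Lipschitz bound of the
  reproducing kernel gains the factor 2^j |h|. Otherwise both values are bounded separately, and
  Peetre's inequality moves the average from x + h back to x at the cost of exponent b / r.\<close>

lemma block_increment:
  fixes \<psi> :: "real^'n::finite \<Rightarrow> complex"
  assumes \<psi>: "resolution_generator \<psi>" and p: "1 \<le> p" and b: "real CARD('n) < b" and r: "1 \<le> r"
  obtains C :: real where "0 < C" "\<And>f j k x h. borel_Lp p f \<Longrightarrow> norm h \<le> (1/2) ^ k \<Longrightarrow>
    ennreal (cmod (block \<psi> f j (x + h) - block \<psi> f j x)) \<le> ennreal (C * wt (b / r) j k) * peetre \<psi> b r f j x"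
proof -
  let ?n = "CARD('n)"
  define a where "a = b / r"
  have b0: "0 < b" using b by (rule order_le_less_trans[rotated]) simp
  have a0: "0 < a" using b0 r by (simp add: a_def)
  obtain C1 where C1: "0 < C1" "\<And>j z. cmod (ker \<psi> j z) \<le> C1 * decay b (2 ^ j) z"
    using ker_decay[OF \<psi>] by blast
  obtain C2 where C2: "0 < C2" "\<And>\<mu> (g :: real^'n \<Rightarrow> ennreal) x. 0 < \<mu> \<Longrightarrow> g \<in> borel_measurable borel \<Longrightarrow>
    enn_powr (decay_conv b \<mu> g x) r \<le> ennreal C2 * decay_conv b \<mu> (\<lambda>x. enn_powr (g x) r) x"
    using decay_conv_jensen[where 'a = "real^'n" and b = b and u = r] b r by auto
  obtain C3 where C3: "0 < C3" "\<And>j z h. 2 ^ j * norm h \<le> 1 \<Longrightarrow> cmod (ker \<psi> j (z + h) - ker \<psi> j z) \<le> C3 * (2 ^ j * norm h) * decay b (2 ^ j) z"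
    using ker_lipschitz[OF \<psi>, of b] b0 by auto
  define K1 where "K1 = C1 * 2 ^ ?n * C2 powr (1 / r)"
  define K2 where "K2 = C3 * 2 * 2 ^ ?n * C2 powr (1 / r)"
  define C where "C = K1 * (2 powr a + 1) + K2"
  have K: "0 < K1" "0 < K2" using C1 C2 C3 by (auto simp: K1_def K2_def)
  have C: "0 < C" unfolding C_def using K by (intro add_pos_pos mult_pos_pos) (auto simp: add_pos_pos)
  show ?thesis
  proof (rule that[OF C], fold a_def)
    fix f :: "real^'n \<Rightarrow> complex" and j k and x h :: "real^'n"
    assume f: "borel_Lp p f" and hk: "norm h \<le> (1/2) ^ k"
    note S = \<psi> p f
    note [measurable] = block_measurable[OF S] borel_measurable_ker[OF \<psi>]
    define G where "G = block \<psi> f j"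
    have [measurable]: "G \<in> borel_measurable borel" by (simp add: G_def)
    define \<mu> :: real where "\<mu> = 2 ^ j"
    have \<mu>: "0 < \<mu>" by (simp add: \<mu>_def)
    have \<mu>2: "2 ^ Suc j = 2 * \<mu>" by (simp add: \<mu>_def)
    let ?g = "\<lambda>y. ennreal (cmod (G y))"
    let ?P = "peetre \<psi> b r f j"
    \<comment> \<open>Jensen's inequality passes from the plain average to the average of order r;
      here r \<ge> 1 enters.\<close>
    have P: "decay_conv b \<mu> ?g x \<le> ennreal (C2 powr (1 / r)) * ?P x" for x
    proof -
      have "enn_powr (enn_powr (decay_conv b \<mu> ?g x) r) (1 / r) \<le> enn_powr (ennreal C2 * decay_conv b \<mu> (\<lambda>x. enn_powr (?g x) r) x) (1 / r)"
        using r \<mu> by (intro enn_powr_mono C2) auto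
      then show ?thesis
        using r C2 by (simp add: enn_powr_powr enn_powr_mult peetre_def G_def \<mu>_def)
    qed
    have rep: "G y = (LINT u|lborel. G u * ker \<psi> (Suc j) (u - y))" for y
      using block_reproducing[OF S, of j y] by (simp add: corr_def[of "block \<psi> f j"] G_def)
    have size: "?g y \<le> ennreal K1 * ?P y" for y
    proof -
      have "?g y \<le> (\<integral>\<^sup>+u. ennreal (cmod (G u * ker \<psi> (Suc j) (u - y))) \<partial>lborel)"
        unfolding rep[of y] by (rule cmod_integral_le)
      also have "\<dots> \<le> (\<integral>\<^sup>+u. ennreal (C1 * 2 ^ ?n) * (?g u * ennreal (decay b \<mu> (u - y))) \<partial>lborel)"
      proof (rule nn_integral_mono)
        fix u
        have "cmod (ker \<psi> (Suc j) (u - y)) \<le> C1 * (2 ^ DIM(real^'n) * decay b \<mu> (u - y))"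
          using C1(2)[of "Suc j" "u - y"] C1(1) decay_double(2)[OF \<mu>, of b "u - y"] b0 unfolding \<mu>2
          by (meson less_imp_le mult_left_mono order_trans)
        then have "cmod (G u) * cmod (ker \<psi> (Suc j) (u - y)) \<le> cmod (G u) * (C1 * (2 ^ DIM(real^'n) * decay b \<mu> (u - y)))"
          by (intro mult_left_mono) auto
        then have "cmod (G u * ker \<psi> (Suc j) (u - y)) \<le> (C1 * 2 ^ ?n) * (cmod (G u) * decay b \<mu> (u - y))"
          by (simp add: norm_mult mult_ac)
        then show "ennreal (cmod (G u * ker \<psi> (Suc j) (u - y))) \<le> ennreal (C1 * 2 ^ ?n) * (?g u * ennreal (decay b \<mu> (u - y)))"
          using C1 \<mu> by (simp add: ennreal_mult[symmetric] ennreal_leI)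
      qed
      also have "\<dots> = ennreal (C1 * 2 ^ ?n) * decay_conv b \<mu> ?g y"
        unfolding decay_conv_def by (rule nn_integral_cmult) measurable
      also have "\<dots> \<le> ennreal (C1 * 2 ^ ?n) * (ennreal (C2 powr (1 / r)) * ?P y)"
        by (intro mult_left_mono P) simp
      also have "\<dots> = ennreal K1 * ?P y"
        unfolding K1_def using C1 by (subst ennreal_mult) (auto simp: mult.assoc)
      finally show ?thesis .
    qed
    have shift: "?P (x + h) \<le> ennreal ((1 + \<mu> * norm h) powr a) * ?P x"
    proof -
      have "?P (x + h) \<le> enn_powr (ennreal ((1 + \<mu> * norm h) powr b) * decay_conv b \<mu> (\<lambda>y. enn_powr (?g y) r) x) (1 / r)"
        unfolding peetre_def G_def[symmetric] \<mu>_def[symmetric]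
        using r \<mu> b0 by (intro enn_powr_mono decay_conv_shift) auto
      also have "\<dots> = ennreal ((1 + \<mu> * norm h) powr a) * ?P x"
        using r by (simp add: enn_powr_mult powr_powr peetre_def a_def G_def \<mu>_def)
      finally show ?thesis .
    qed
    have tri: "ennreal (cmod (G (x + h) - G x)) \<le> ?g (x + h) + ?g x"
      by (simp add: ennreal_plus[symmetric] norm_triangle_ineq4 ennreal_leI del: ennreal_plus)
    have coarse: "ennreal (cmod (G (x + h) - G x)) \<le> ennreal (C * T powr a) * ?P x" if T: "1 \<le> T" "\<mu> * norm h \<le> T" for T
    proof -
      note tri
      also have "?g (x + h) + ?g x \<le> ennreal K1 * (ennreal ((2 * T) powr a) * ?P x) + ennreal K1 * (ennreal (T powr a) * ?P x)"
      proof (intro add_mono order_trans[OF size] mult_left_mono)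
        have "(1 + \<mu> * norm h) powr a \<le> (2 * T) powr a" using T a0 \<mu> by (intro powr_mono2) auto
        then show "?P (x + h) \<le> ennreal ((2 * T) powr a) * ?P x"
          by (intro order_trans[OF shift] mult_right_mono ennreal_leI) auto
        have "1 * ?P x \<le> ennreal (T powr a) * ?P x"
          using T a0 by (intro mult_right_mono) (auto simp: ge_one_powr_ge_zero)
        then show "?P x \<le> ennreal (T powr a) * ?P x" by simp
      qed auto
      also have "\<dots> = ennreal (K1 * (2 powr a + 1) * T powr a) * ?P x"
      proof -
        have "ennreal (K1 * (2 powr a + 1) * T powr a) = ennreal (K1 * (2 * T) powr a + K1 * T powr a)"
          using T by (simp add: powr_mult algebra_simps)
        also have "\<dots> = ennreal K1 * ennreal ((2 * T) powr a) + ennreal K1 * ennreal (T powr a)"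
          using K by (simp add: ennreal_mult)
        finally show ?thesis by (simp only: distrib_right mult.assoc)
      qed
      also have "\<dots> \<le> ennreal (C * T powr a) * ?P x"
        using K by (intro mult_right_mono ennreal_leI) (auto simp: C_def)
      finally show ?thesis .
    qed
    \<comment> \<open>The factor 2 stems from the reproducing kernel, whose index is
      \<open>Suc j\<close>.\<close>
    have fine: "ennreal (cmod (G (x + h) - G x)) \<le> ennreal (C * (\<mu> * norm h)) * ?P x" if h1: "2 * \<mu> * norm h \<le> 1"
    proof -
      obtain B where B: "\<And>y. cmod (G y) \<le> B" using block_bounded[OF S] unfolding G_def by blast
      have int: "integrable lborel (\<lambda>u. G u * ker \<psi> (Suc j) (u - y))" for y
        by (rule bounded_mult_ker_integrable[OF S _ B]) measurable
      have "G (x + h) - G x = (LINT u|lborel. G u * ker \<psi> (Suc j) (u - (x + h)) - G u * ker \<psi> (Suc j) (u - x))"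
        unfolding rep[of "x + h"] rep[of x] by (rule Bochner_Integration.integral_diff[OF int int, symmetric])
      then have "ennreal (cmod (G (x + h) - G x)) \<le> (\<integral>\<^sup>+u. ennreal (cmod (G u * ker \<psi> (Suc j) (u - (x + h)) - G u * ker \<psi> (Suc j) (u - x))) \<partial>lborel)"
        by (simp only: cmod_integral_le)
      also have "\<dots> \<le> (\<integral>\<^sup>+u. ennreal (C3 * 2 * 2 ^ ?n * (\<mu> * norm h)) * (?g u * ennreal (decay b \<mu> (u - x))) \<partial>lborel)"
      proof (rule nn_integral_mono)
        fix u
        have "cmod (ker \<psi> (Suc j) (u - x + - h) - ker \<psi> (Suc j) (u - x)) \<le> C3 * (2 ^ Suc j * norm (- h)) * decay b (2 ^ Suc j) (u - x)"
          using h1 by (intro C3(2)) (simp add: \<mu>_def mult.assoc)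
        also have "\<dots> \<le> C3 * (2 * \<mu> * norm h) * (2 ^ DIM(real^'n) * decay b \<mu> (u - x))"
          unfolding \<mu>2 norm_minus_cancel using C3 \<mu> b0 by (intro mult_left_mono decay_double(2)) auto
        finally have "cmod (G u) * cmod (ker \<psi> (Suc j) (u - x + - h) - ker \<psi> (Suc j) (u - x)) \<le> cmod (G u) * (C3 * (2 * \<mu> * norm h) * (2 ^ DIM(real^'n) * decay b \<mu> (u - x)))"
          by (intro mult_left_mono) auto
        then have "cmod (G u * ker \<psi> (Suc j) (u - (x + h)) - G u * ker \<psi> (Suc j) (u - x)) \<le> (C3 * 2 * 2 ^ ?n * (\<mu> * norm h)) * (cmod (G u) * decay b \<mu> (u - x))"
          by (simp add: norm_mult right_diff_distrib[symmetric] mult_ac diff_diff_eq)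
        then show "ennreal (cmod (G u * ker \<psi> (Suc j) (u - (x + h)) - G u * ker \<psi> (Suc j) (u - x))) \<le> ennreal (C3 * 2 * 2 ^ ?n * (\<mu> * norm h)) * (?g u * ennreal (decay b \<mu> (u - x)))"
          using C3 \<mu> by (simp add: ennreal_mult[symmetric] ennreal_leI)
      qed
      also have "\<dots> = ennreal (C3 * 2 * 2 ^ ?n * (\<mu> * norm h)) * decay_conv b \<mu> ?g x"
        unfolding decay_conv_def by (rule nn_integral_cmult) measurable
      also have "\<dots> \<le> ennreal (C3 * 2 * 2 ^ ?n * (\<mu> * norm h)) * (ennreal (C2 powr (1 / r)) * ?P x)"
        by (intro mult_left_mono P) simp
      also have "\<dots> = ennreal (C3 * 2 * 2 ^ ?n * (\<mu> * norm h) * C2 powr (1 / r)) * ?P x"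
        using C3 \<mu> by (subst ennreal_mult) (auto simp: mult.assoc)
      also have "\<dots> \<le> ennreal (C * (\<mu> * norm h)) * ?P x"
      proof (intro mult_right_mono ennreal_leI)
        have "C3 * 2 * 2 ^ ?n * (\<mu> * norm h) * C2 powr (1 / r) = K2 * (\<mu> * norm h)" by (simp add: K2_def mult_ac)
        also have "\<dots> \<le> C * (\<mu> * norm h)" using K \<mu> by (intro mult_right_mono) (auto simp: C_def)
        finally show "C3 * 2 * 2 ^ ?n * (\<mu> * norm h) * C2 powr (1 / r) \<le> C * (\<mu> * norm h)" .
      qed simp
      finally show ?thesis .
    qed
    have "ennreal (cmod (G (x + h) - G x)) \<le> ennreal (C * wt a j k) * ?P x"
    proof (cases "j \<le> k")
      case True
      have le: "\<mu> * norm h \<le> (1/2) ^ (k - j)"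
      proof -
        have "\<mu> * norm h \<le> \<mu> * (1/2) ^ k" using hk \<mu> by (intro mult_left_mono) auto
        also have "\<mu> * (1/2) ^ k = (1/2) ^ (k - j)"
          using True power_add[of "1/2::real" j "k - j"] by (simp add: \<mu>_def power_divide)
        finally show ?thesis .
      qed
      show ?thesis
      proof (cases "2 * \<mu> * norm h \<le> 1")
        case h1: True
        have "ennreal (C * (\<mu> * norm h)) * ?P x \<le> ennreal (C * wt a j k) * ?P x"
          using le C True by (intro mult_right_mono ennreal_leI mult_left_mono) (auto simp: wt_def)
        with fine[OF h1] show ?thesis by (rule order_trans)
      next
        case False
        \<comment> \<open>For j < k the product 2^j |h| is at most 1/2 and the fine regime would
          apply.\<close>
        have "j = k"
        proof (rule ccontr)
          assume "j \<noteq> k"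
          then have "(1/2::real) ^ (k - j) \<le> (1/2) ^ 1" using True by (intro power_decreasing) auto
          then show False using le False by simp
        qed
        then have "\<mu> * norm h \<le> 1" using le by simp
        from coarse[of 1, OF _ this] show ?thesis using \<open>j = k\<close> by (simp add: wt_def)
      qed
    next
      case False
      have "\<mu> * norm h \<le> \<mu> * (1/2) ^ k" using hk \<mu> by (intro mult_left_mono) auto
      also have "\<mu> * (1/2) ^ k = 2 ^ (j - k)"
        using False power_add[of "2::real" "j - k" k] by (simp add: \<mu>_def power_divide)
      finally have "\<mu> * norm h \<le> 2 ^ (j - k)" .
      from coarse[OF _ this] have "ennreal (cmod (G (x + h) - G x)) \<le> ennreal (C * (2 ^ (j - k)) powr a) * ?P x" by simp
      also have "(2 ^ (j - k)) powr a = 2 powr (real (j - k) * a)"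
        by (simp add: powr_realpow[symmetric] powr_powr)
      finally show ?thesis using False by (simp add: wt_def)
    qed
    then show "ennreal (cmod (block \<psi> f j (x + h) - block \<psi> f j x)) \<le> ennreal (C * wt a j k) * ?P x"
      by (simp only: G_def)
  qed
qed

section \<open>Almost everywhere convergence of the block series\<close>

text \<open>The positive and the negative part of u are densities of measures that agree on boxes.
  Boxes are stable under intersection and generate the Borel sets, so the measures and hence the
  densities coincide.\<close>

lemma AE_eq_0_of_box_integrals_real:
  fixes u :: "'a::euclidean_space \<Rightarrow> real"
  assumes [measurable]: "u \<in> borel_measurable borel"
    and int: "\<And>a b. integrable lborel (\<lambda>x. u x * indicator (box a b) x)"
    and zero: "\<And>a b. (LINT x|lborel. u x * indicator (box a b) x) = 0"
  shows "AE x in lborel. u x = 0"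
proof -
  let ?M = "density lborel (\<lambda>x. ennreal (u x))" and ?N = "density lborel (\<lambda>x. ennreal (- u x))"
  let ?E = "range (\<lambda>(a, b). box a b::'a set)"
  have em: "emeasure ?M (box a b) = (\<integral>\<^sup>+x. ennreal (u x * indicator (box a b) x) \<partial>lborel)"
    and en: "emeasure ?N (box a b) = (\<integral>\<^sup>+x. ennreal (- (u x * indicator (box a b) x)) \<partial>lborel)" for a b
    by (simp_all add: emeasure_density) (auto intro!: nn_integral_cong simp: indicator_def)
  have fin: "emeasure ?M (box a b) \<noteq> \<infinity>" "emeasure ?N (box a b) \<noteq> \<infinity>" for a b
    unfolding em en using int[of a b] by (simp_all add: real_integrable_def)
  have eq: "emeasure ?M (box a b) = emeasure ?N (box a b)" for a b
  proof -
    have "enn2real (emeasure ?M (box a b)) - enn2real (emeasure ?N (box a b)) = 0"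
      using zero[of a b] unfolding em en real_lebesgue_integral_def[OF int] .
    then show ?thesis
      using fin[of a b] by (cases "emeasure ?M (box a b)"; cases "emeasure ?N (box a b)") auto
  qed
  have "?M = ?N"
  proof (rule measure_eqI_generator_eq)
    show "Int_stable ?E" by (auto simp: Int_stable_def box_Int_box)
    show "?E \<subseteq> Pow UNIV" "sets ?M = sigma_sets UNIV ?E" "sets ?N = sigma_sets UNIV ?E"
      by (simp_all add: borel_eq_box)
    let ?A = "\<lambda>n::nat. box (- (real n *\<^sub>R One)) (real n *\<^sub>R One) :: 'a set"
    show "range ?A \<subseteq> ?E" "(\<Union>i. ?A i) = UNIV"
      unfolding UN_box_eq_UNIV by auto
    show "emeasure ?M (?A i) \<noteq> \<infinity>" for i by (rule fin)
    show "emeasure ?M X = emeasure ?N X" if "X \<in> ?E" for X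
      using that eq by auto
  qed
  then have "AE x in lborel. ennreal (u x) = ennreal (- u x)"
    by (subst sigma_finite_measure.density_unique_iff[OF sigma_finite_lborel, symmetric]) auto
  then show ?thesis
  proof eventually_elim
    case (elim x)
    then show ?case by (cases "0 \<le> u x") (auto simp: ennreal_neg ennreal_eq_0_iff)
  qed
qed

lemma AE_eq_of_box_integrals:
  fixes u v :: "'a::euclidean_space \<Rightarrow> complex"
  assumes [measurable]: "u \<in> borel_measurable borel" "v \<in> borel_measurable borel"
    and int: "\<And>a b. integrable lborel (\<lambda>x. u x * indicator (box a b) x)" "\<And>a b. integrable lborel (\<lambda>x. v x * indicator (box a b) x)"
    and eq: "\<And>a b. (LINT x|lborel. u x * indicator (box a b) x) = (LINT x|lborel. v x * indicator (box a b) x)"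
  shows "AE x in lborel. u x = v x"
proof -
  define d where "d a b x = (u x - v x) * indicator (box a b) x" for a b x
  have d: "integrable lborel (d a b)" "(LINT x|lborel. d a b x) = 0" for a b
    using int eq unfolding d_def left_diff_distrib by auto
  have Re: "Re (u x - v x) * indicator (box a b) x = Re (d a b x)" and Im: "Im (u x - v x) * indicator (box a b) x = Im (d a b x)" for a b x
    by (auto simp: d_def indicator_def)
  have "AE x in lborel. Re (u x - v x) = 0"
  proof (rule AE_eq_0_of_box_integrals_real)
    show "integrable lborel (\<lambda>x. Re (u x - v x) * indicator (box a b) x)" for a b
      unfolding Re by (rule integrable_Re[OF d(1)])
    show "(LINT x|lborel. Re (u x - v x) * indicator (box a b) x) = 0" for a b
      unfolding Re using integral_Re[OF d(1)] d(2) by simp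
  qed measurable
  moreover have "AE x in lborel. Im (u x - v x) = 0"
  proof (rule AE_eq_0_of_box_integrals_real)
    show "integrable lborel (\<lambda>x. Im (u x - v x) * indicator (box a b) x)" for a b
      unfolding Im by (rule integrable_Im[OF d(1)])
    show "(LINT x|lborel. Im (u x - v x) * indicator (box a b) x) = 0" for a b
      unfolding Im using integral_Im[OF d(1)] d(2) by simp
  qed measurable
  ultimately show ?thesis by eventually_elim (simp add: complex_eq_iff)
qed

text \<open>Each term is at most 2^(-j s) times the norm, and s > 0 makes these factors summable;
  the sequence exponent q does not matter.\<close>

lemma suminf_le_lq_seq:
  assumes q: "0 < q" and s: "0 < s"
  obtains C :: real where "0 < C" "\<And>a. (\<Sum>j. ennreal (cmod (a j))) \<le> ennreal C * lq_seq s q a"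
proof -
  define \<rho> where "\<rho> = 2 powr (- s)"
  have \<rho>: "0 < \<rho>" "\<rho> < 1" using s by (auto simp: \<rho>_def intro: powr_less_one)
  show ?thesis
  proof (rule that[of "1 / (1 - \<rho>)"])
    show "0 < 1 / (1 - \<rho>)" using \<rho> by simp
    fix a :: "nat \<Rightarrow> complex"
    have "ennreal (cmod (a j)) \<le> ennreal (\<rho> ^ j) * lq_seq s q a" for j
    proof -
      have "\<rho> ^ j * 2 powr (real j * s) = 1"
        by (simp add: \<rho>_def powr_realpow[symmetric] powr_powr powr_add[symmetric])
      then have "ennreal (cmod (a j)) = ennreal (\<rho> ^ j) * ennreal (2 powr (real j * s) * cmod (a j))"
        using \<rho> by (simp add: ennreal_mult'[symmetric] mult.assoc[symmetric])
      also have "\<dots> \<le> ennreal (\<rho> ^ j) * lq_seq s q a"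
        unfolding lq_seq_eq by (intro mult_left_mono lqn_upper q) simp
      finally show ?thesis .
    qed
    then have "(\<Sum>j. ennreal (cmod (a j))) \<le> (\<Sum>j. ennreal (\<rho> ^ j) * lq_seq s q a)"
      by (intro suminf_le) (auto simp: summableI)
    also have "\<dots> = (\<Sum>j. ennreal (\<rho> ^ j)) * lq_seq s q a" by simp
    also have "(\<Sum>j. ennreal (\<rho> ^ j)) = ennreal (1 / (1 - \<rho>))"
      using \<rho> by (intro suminf_ennreal_eq geometric_sums) auto
    finally show "(\<Sum>j. ennreal (cmod (a j))) \<le> ennreal (1 / (1 - \<rho>)) * lq_seq s q a" .
  qed
qed

text \<open>Makes a function with integrable p-th power integrable over boxes.\<close>

lemma ennreal_le_one_add_powr: "1 \<le> p \<Longrightarrow> x \<le> 1 + enn_powr x p"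
proof (cases x)
  case (real r)
  assume p: "1 \<le> p"
  have "r \<le> 1 + r powr p"
  proof (cases "r \<le> 1")
    case False
    then have "r powr 1 \<le> r powr p" using p by (intro powr_mono) auto
    then show ?thesis using False by simp
  qed (simp add: add_increasing2)
  then show ?thesis using real by (simp add: ennreal_leI ennreal_1[symmetric] ennreal_plus[symmetric] del: ennreal_1 ennreal_plus)
qed simp

lemma ennreal_norm_sums_le:
  fixes a :: "nat \<Rightarrow> complex"
  assumes "a sums l"
  shows "ennreal (cmod l) \<le> (\<Sum>j. ennreal (cmod (a j)))"
proof (cases "(\<Sum>j. ennreal (cmod (a j))) = top")
  case False
  then have sm: "summable (\<lambda>j. cmod (a j))"
    using summable_iff_suminf_neq_top[of "\<lambda>j. cmod (a j)"] by auto
  then have "cmod (\<Sum>j. a j) \<le> (\<Sum>j. cmod (a j))" by (rule summable_norm)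
  moreover have "(\<Sum>j. ennreal (cmod (a j))) = ennreal (\<Sum>j. cmod (a j))"
    by (rule suminf_ennreal2[OF _ sm]) simp
  ultimately show ?thesis using sums_unique[OF assms] by (simp add: ennreal_leI)
qed simp

text \<open>The majorant for dominated convergence against f. The kernel is taken with twice the
  required decay exponent: one half pays for moving the weight from x to u by Peetre's inequality,
  the other half for integrability in x uniformly in J.\<close>

lemma ker_box_average_bound:
  fixes \<psi> :: "real^'n::finite \<Rightarrow> complex"
  assumes \<psi>: "resolution_generator \<psi>"
  shows "\<exists>C>0. \<forall>J u. cmod (LINT x|lborel. indicator (box a b) x * ker \<psi> J (u - x)) \<le> C * decay (real CARD('n) + 1) 1 u"
proof -
  define d where "d = real CARD('n) + 1"
  have d: "0 \<le> d" "real DIM(real^'n) < d" by (auto simp: d_def)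
  note [measurable] = borel_measurable_ker[OF \<psi>]
  obtain C1 where C1: "0 < C1" "\<And>j z. cmod (ker \<psi> j z) \<le> C1 * decay (2 * d) (2 ^ j) z"
    using ker_decay[OF \<psi>] by blast
  obtain D where D: "0 < D" "\<And>\<mu> x. 0 < \<mu> \<Longrightarrow> (\<integral>\<^sup>+y. ennreal (decay d \<mu> (y - x)) \<partial>(lborel :: (real^'n) measure)) \<le> ennreal D"
    using decay_integral_bound[OF d(2)] by blast
  obtain \<rho> where \<rho>: "0 < \<rho>" "\<And>x. x \<in> box a b \<Longrightarrow> norm x \<le> \<rho>"
    using bounded_box[of a b] unfolding bounded_pos by blast
  define cB where "cB = (1 + \<rho>) powr d"
  have cB: "0 < cB" using \<rho> by (simp add: cB_def)
  have ind: "indicator (box a b) x \<le> cB * decay d 1 x" for x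
  proof (cases "x \<in> box a b")
    case True
    have "(1 + \<rho>) powr - d \<le> (1 + norm x) powr - d"
      using \<rho>(2)[OF True] d by (intro powr_mono2') (auto intro: add_pos_nonneg)
    then have "cB * (1 + \<rho>) powr - d \<le> cB * decay d 1 x" using cB by (simp add: decay_one)
    moreover have "cB * (1 + \<rho>) powr - d = 1" using \<rho> by (simp add: cB_def powr_add[symmetric])
    ultimately show ?thesis using True by simp
  qed (use cB in simp)
  have pt: "cmod (indicator (box a b) x * ker \<psi> J (u - x)) \<le> (C1 * cB * decay d 1 u) * decay d (2 ^ J) (x - u)" for J u x
  proof -
    have 1: "decay d 1 x \<le> (1 + norm (u - x)) powr d * decay d 1 u"
      using decay_shift[of 1 d u "u - x"] d by simp
    have 2: "(1 + norm (u - x)) powr d * decay (2 * d) (2 ^ J) (u - x) \<le> decay d (2 ^ J) (u - x)"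
    proof -
      have pos: "0 < 1 + 2 ^ J * norm (u - x)" by (simp add: add_pos_nonneg)
      have "1 * norm (u - x) \<le> 2 ^ J * norm (u - x)" by (intro mult_right_mono) auto
      then have "(1 + norm (u - x)) powr d \<le> (1 + 2 ^ J * norm (u - x)) powr d"
        using d by (intro powr_mono2) auto
      then have "(1 + norm (u - x)) powr d * (1 + 2 ^ J * norm (u - x)) powr - (2 * d) \<le> (1 + 2 ^ J * norm (u - x)) powr d * (1 + 2 ^ J * norm (u - x)) powr - (2 * d)"
        by (intro mult_right_mono) auto
      also have "\<dots> = (1 + 2 ^ J * norm (u - x)) powr - d"
        by (simp add: powr_add[symmetric])
      finally have "(2 ^ J) ^ DIM(real^'n) * ((1 + norm (u - x)) powr d * (1 + 2 ^ J * norm (u - x)) powr - (2 * d)) \<le> (2 ^ J) ^ DIM(real^'n) * (1 + 2 ^ J * norm (u - x)) powr - d"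
        by (intro mult_left_mono) auto
      then show ?thesis by (simp add: decay_def mult_ac)
    qed
    have "cmod (indicator (box a b) x * ker \<psi> J (u - x)) = indicator (box a b) x * cmod (ker \<psi> J (u - x))"
      by (simp add: norm_mult indicator_def)
    also have "\<dots> \<le> (cB * decay d 1 x) * (C1 * decay (2 * d) (2 ^ J) (u - x))"
      using cB by (intro mult_mono ind C1) auto
    also have "\<dots> \<le> (cB * ((1 + norm (u - x)) powr d * decay d 1 u)) * (C1 * decay (2 * d) (2 ^ J) (u - x))"
      using cB C1 1 by (intro mult_right_mono mult_left_mono) auto
    also have "\<dots> = (C1 * cB * decay d 1 u) * ((1 + norm (u - x)) powr d * decay (2 * d) (2 ^ J) (u - x))"
      by (simp only: mult_ac)
    also have "\<dots> \<le> (C1 * cB * decay d 1 u) * decay d (2 ^ J) (u - x)"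
      using cB C1 by (intro mult_left_mono 2) auto
    finally show ?thesis by (simp only: decay_minus_commute[of d _ u])
  qed
  have "cmod (LINT x|lborel. indicator (box a b) x * ker \<psi> J (u - x)) \<le> (C1 * cB * D) * decay d 1 u" for J u
  proof -
    have "ennreal (cmod (LINT x|lborel. indicator (box a b) x * ker \<psi> J (u - x))) \<le> (\<integral>\<^sup>+x. ennreal (cmod (indicator (box a b) x * ker \<psi> J (u - x))) \<partial>lborel)"
      by (rule cmod_integral_le)
    also have "\<dots> \<le> (\<integral>\<^sup>+x. ennreal (C1 * cB * decay d 1 u) * ennreal (decay d (2 ^ J) (x - u)) \<partial>lborel)"
      using pt C1 cB by (intro nn_integral_mono) (auto simp: ennreal_mult[symmetric] intro!: ennreal_leI)
    also have "\<dots> = ennreal (C1 * cB * decay d 1 u) * (\<integral>\<^sup>+x. ennreal (decay d (2 ^ J) (x - u)) \<partial>lborel)"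
      by (rule nn_integral_cmult) measurable
    also have "\<dots> \<le> ennreal (C1 * cB * decay d 1 u) * ennreal D"
      by (intro mult_left_mono D) auto
    also have "\<dots> = ennreal ((C1 * cB * D) * decay d 1 u)"
      using C1 cB D by (simp add: ennreal_mult[symmetric] mult_ac)
    finally show ?thesis
      using C1 cB D by (subst (asm) ennreal_le_iff) auto
  qed
  moreover have "0 < C1 * cB * D" using C1 cB D by simp
  ultimately show ?thesis unfolding d_def by blast
qed

text \<open>Substituting x = u - 2^(-J) v gives shrinking translates of the indicator against the
  fixed kernel of mass 1. Off the boundary of the box the indicator is locally constant at
  u.\<close>

lemma ker_box_average_limit:
  fixes \<psi> :: "real^'n::finite \<Rightarrow> complex"
  assumes \<psi>: "resolution_generator \<psi>" and u: "u \<notin> cbox a b - box a b"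
  shows "(\<lambda>J. LINT x|lborel. indicator (box a b) x * ker \<psi> J (u - x)) \<longlonglongrightarrow> indicator (box a b) u"
proof -
  note [measurable] = borel_measurable_ker[OF \<psi>]
  have eq: "(LINT x|lborel. indicator (box a b) x * ker \<psi> J (u - x)) = (LINT v|lborel. indicator (box a b) (u + (- ((1/2) ^ J)) *\<^sub>R v) * ker \<psi> 0 v)" for J
  proof -
    have "(LINT x|lborel. indicator (box a b) x * ker \<psi> J (u - x)) = \<bar>- ((1/2) ^ J)\<bar> ^ DIM(real^'n) *\<^sub>R
      (LINT v|lborel. indicator (box a b) (u + (- ((1/2) ^ J)) *\<^sub>R v) * ker \<psi> J (u - (u + (- ((1/2) ^ J)) *\<^sub>R v)))"
      by (rule lborel_integral_affine) auto
    also have "\<dots> = (LINT v|lborel. indicator (box a b) (u + (- ((1/2) ^ J)) *\<^sub>R v) * ker \<psi> 0 v)"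
    proof (subst integral_scaleR_right[symmetric], intro Bochner_Integration.integral_cong refl)
      fix v
      have "ker \<psi> J (u - (u + (- ((1/2) ^ J)) *\<^sub>R v)) = complex_of_real ((2 ^ J) ^ CARD('n)) * ker \<psi> 0 v"
        by (subst ker_scale[OF \<psi>]) (simp add: power_divide)
      then show "\<bar>- ((1/2) ^ J)\<bar> ^ DIM(real^'n) *\<^sub>R (indicator (box a b) (u + (- ((1/2) ^ J)) *\<^sub>R v) * ker \<psi> J (u - (u + (- ((1/2) ^ J)) *\<^sub>R v)))
        = indicator (box a b) (u + (- ((1/2) ^ J)) *\<^sub>R v) * ker \<psi> 0 v"
        by (simp add: scaleR_conv_of_real[where 'a = complex] power_divide power_mult_distrib[symmetric])
    qed
    finally show ?thesis .
  qed
  have "(\<lambda>J. LINT v|lborel. indicator (box a b) (u + (- ((1/2) ^ J)) *\<^sub>R v) * ker \<psi> 0 v) \<longlonglongrightarrow> (LINT v|lborel. indicator (box a b) u * ker \<psi> 0 v)"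
  proof (rule integral_dominated_convergence)
    show "integrable lborel (\<lambda>v. cmod (ker \<psi> 0 v))" using ker_integrable[OF \<psi>] by (rule integrable_norm)
    show "AE v in lborel. norm (indicator (box a b) (u + (- ((1/2) ^ J)) *\<^sub>R v) * ker \<psi> 0 v) \<le> cmod (ker \<psi> 0 v)" for J
      by (auto intro!: AE_I2 simp: indicator_def)
    show "AE v in lborel. (\<lambda>J. indicator (box a b) (u + (- ((1/2) ^ J)) *\<^sub>R v) * ker \<psi> 0 v) \<longlonglongrightarrow> indicator (box a b) u * ker \<psi> 0 v"
    proof (intro AE_I2 tendsto_mult_right)
      fix v
      have "(\<lambda>J. u + (- ((1/2) ^ J)) *\<^sub>R v) \<longlonglongrightarrow> u + (- 0) *\<^sub>R v"
        by (intro tendsto_intros LIMSEQ_power_zero) auto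
      then have lim: "(\<lambda>J. u + (- ((1/2) ^ J)) *\<^sub>R v) \<longlonglongrightarrow> u" by simp
      have "\<forall>\<^sub>F J in sequentially. indicator (box a b) (u + (- ((1/2) ^ J)) *\<^sub>R v) = (indicator (box a b) u :: complex)"
      proof (cases "u \<in> box a b")
        case True
        then have "\<forall>\<^sub>F J in sequentially. u + (- ((1/2) ^ J)) *\<^sub>R v \<in> box a b"
          using lim by (intro topological_tendstoD) (auto simp: open_box)
        then show ?thesis by eventually_elim (use True in simp)
      next
        case False
        then have "u \<in> - cbox a b" using u by auto
        then have "\<forall>\<^sub>F J in sequentially. u + (- ((1/2) ^ J)) *\<^sub>R v \<in> - cbox a b"
          using lim by (intro topological_tendstoD) (auto simp: closed_cbox open_Compl)
        then show ?thesis
          by eventually_elim (use False box_subset_cbox[of a b] in \<open>auto simp: indicator_def\<close>)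
      qed
      then show "(\<lambda>J. indicator (box a b) (u + (- ((1/2) ^ J)) *\<^sub>R v) :: complex) \<longlonglongrightarrow> indicator (box a b) u"
        by (rule tendsto_eventually)
    qed
  qed measurable
  also have "(LINT v|lborel. indicator (box a b) u * ker \<psi> 0 v) = indicator (box a b) u"
    using ker_integral[OF \<psi>, of 0] by simp
  finally show ?thesis unfolding eq .
qed

text \<open>Finiteness of the norm gives absolute convergence almost everywhere to some L. To see
  that L = f, both are integrated over boxes: the partial sums are dominated by \<open>w\<close>,
  while moving the kernel from f to the indicator of the box shows that the same integrals converge
  to those of f.\<close>

lemma block_sums_AE:
  fixes \<psi> f :: "real^'n::finite \<Rightarrow> complex"
  assumes \<psi>: "resolution_generator \<psi>" and p: "1 \<le> p" and f: "borel_Lp p f" and q: "0 < q" and s: "0 < s"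
    and fin: "(\<integral>\<^sup>+x. enn_powr (lq_seq s q (\<lambda>j. block \<psi> f j x)) p \<partial>lborel) < \<infinity>"
  shows "AE x in lborel. (\<lambda>j. block \<psi> f j x) sums f x"
proof -
  note S = \<psi> p f
  note SS = f_setup[OF S]
  note [measurable] = block_measurable[OF S] borel_measurable_ker[OF \<psi>] borel_LpD(1)[OF f] corr_ker_measurable[OF S]
  let ?d = "real CARD('n) + 1"
  obtain C where C: "0 < C" "\<And>a. (\<Sum>j. ennreal (cmod (a j))) \<le> ennreal C * lq_seq s q a"
    using suminf_le_lq_seq[OF q s] by blast
  define \<Lambda> where "\<Lambda> x = lq_seq s q (\<lambda>j. block \<psi> f j x)" for x
  have [measurable]: "\<Lambda> \<in> borel_measurable borel"
    unfolding \<Lambda>_def[abs_def] lq_seq_eq by measurable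
  have "AE x in lborel. enn_powr (\<Lambda> x) p \<noteq> \<infinity>"
    using fin unfolding \<Lambda>_def[symmetric] by (intro nn_integral_PInf_AE) auto
  then have \<Lambda>fin: "AE x in lborel. \<Lambda> x < top" by (auto simp: less_top)
  \<comment> \<open>One majorant for all partial sums; \<open>ennreal_le_one_add_powr\<close> makes
    it integrable over boxes.\<close>
  define w where "w x = enn2real (ennreal C * \<Lambda> x)" for x
  have [measurable]: "w \<in> borel_measurable borel" unfolding w_def[abs_def] by measurable
  have good: "summable (\<lambda>j. cmod (block \<psi> f j x)) \<and> (\<Sum>j. cmod (block \<psi> f j x)) \<le> w x" if "\<Lambda> x < top" for x
  proof -
    have lt: "ennreal C * \<Lambda> x < top" using that by (simp add: ennreal_mult_less_top)
    have le: "(\<Sum>j. ennreal (cmod (block \<psi> f j x))) \<le> ennreal C * \<Lambda> x" unfolding \<Lambda>_def by (rule C)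
    then have sm: "summable (\<lambda>j. cmod (block \<psi> f j x))"
      using lt summable_iff_suminf_neq_top[of "\<lambda>j. cmod (block \<psi> f j x)"] by (auto simp: top_unique)
    have "ennreal (\<Sum>j. cmod (block \<psi> f j x)) \<le> ennreal (w x)"
    proof -
      have "ennreal (w x) = ennreal C * \<Lambda> x" unfolding w_def by (rule ennreal_enn2real[OF lt])
      moreover have "(\<Sum>j. ennreal (cmod (block \<psi> f j x))) = ennreal (\<Sum>j. cmod (block \<psi> f j x))"
        by (rule suminf_ennreal2[OF norm_ge_zero sm])
      ultimately show ?thesis using le by (simp only:)
    qed
    moreover have "0 \<le> w x" unfolding w_def by (rule enn2real_nonneg)
    ultimately have "(\<Sum>j. cmod (block \<psi> f j x)) \<le> w x" by (simp only: ennreal_le_iff)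
    with sm show ?thesis by (rule conjI)
  qed
  define L where "L x = (\<Sum>j. block \<psi> f j x)" for x
  have [measurable]: "L \<in> borel_measurable borel" unfolding L_def[abs_def] by measurable
  have partial: "cmod (corr f (ker \<psi> J) x) \<le> w x" if "\<Lambda> x < top" for J x
  proof -
    have "cmod (corr f (ker \<psi> J) x) \<le> (\<Sum>j<Suc J. cmod (block \<psi> f j x))"
      unfolding sum_block[OF S, symmetric] by (rule norm_sum)
    also have "\<dots> \<le> (\<Sum>j. cmod (block \<psi> f j x))" using good[OF that] by (intro sum_le_suminf) auto
    finally show ?thesis using good[OF that] by linarith
  qed
  have Lw: "cmod (L x) \<le> w x" if "\<Lambda> x < top" for x
    unfolding L_def using good[OF that] summable_norm[of "\<lambda>j. block \<psi> f j x"] by linarith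
  have conv: "(\<lambda>J. corr f (ker \<psi> J) x) \<longlonglongrightarrow> L x" if "\<Lambda> x < top" for x
  proof -
    have "(\<lambda>j. block \<psi> f j x) sums L x"
      unfolding L_def by (rule summable_sums[OF summable_norm_cancel[OF conjunct1[OF good[OF that]]]])
    then have "(\<lambda>J. \<Sum>j<Suc J. block \<psi> f j x) \<longlonglongrightarrow> L x" unfolding sums_def by (rule LIMSEQ_Suc)
    then show ?thesis by (simp only: sum_block[OF S])
  qed
  have ind [measurable]: "(indicator (box a b) :: real^'n \<Rightarrow> complex) \<in> borel_measurable borel"
      "(indicator (box a b) :: real^'n \<Rightarrow> real) \<in> borel_measurable borel"
      "(indicator (box a b) :: real^'n \<Rightarrow> ennreal) \<in> borel_measurable borel" for a b
    by (auto intro: borel_measurable_indicator)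
  have wi: "integrable lborel (\<lambda>x. w x * indicator (box a b) x)" for a b
  proof (rule integrableI_nonneg)
    have "(\<integral>\<^sup>+x. ennreal (w x * indicator (box a b) x) \<partial>lborel) \<le> (\<integral>\<^sup>+x. ennreal C * (indicator (box a b) x + enn_powr (\<Lambda> x) p) \<partial>lborel)"
    proof (rule nn_integral_mono)
      fix x
      show "ennreal (w x * indicator (box a b) x) \<le> ennreal C * (indicator (box a b) x + enn_powr (\<Lambda> x) p)"
      proof (cases "x \<in> box a b")
        case True
        have "ennreal (w x) \<le> ennreal C * \<Lambda> x" unfolding w_def by (simp add: ennreal_enn2real_if)
        also have "\<dots> \<le> ennreal C * (1 + enn_powr (\<Lambda> x) p)" by (intro mult_left_mono ennreal_le_one_add_powr p) simp
        finally show ?thesis using True by simp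
      qed simp
    qed
    also have "\<dots> = ennreal C * (emeasure lborel (box a b) + (\<integral>\<^sup>+x. enn_powr (\<Lambda> x) p \<partial>lborel))"
      by (simp add: nn_integral_cmult nn_integral_add)
    also have "\<dots> < \<infinity>"
      using fin emeasure_lborel_box_finite[of a b] unfolding \<Lambda>_def[symmetric] by (simp add: ennreal_mult_less_top)
    finally show "(\<integral>\<^sup>+x. ennreal (w x * indicator (box a b) x) \<partial>lborel) < \<infinity>" .
  qed (auto simp: w_def)
  have "AE x in lborel. L x = f x"
  proof (rule AE_eq_of_box_integrals)
    fix a b :: "real^'n"
    show Li: "integrable lborel (\<lambda>x. L x * indicator (box a b) x)"
    proof (rule Bochner_Integration.integrable_bound[OF wi[of a b]])
      show "AE x in lborel. norm (L x * indicator (box a b) x) \<le> norm (w x * indicator (box a b) x)"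
        using \<Lambda>fin by eventually_elim (use Lw in \<open>auto simp: indicator_def w_def\<close>)
    qed measurable
    obtain D where D: "0 < D" "\<And>J u. cmod (LINT x|lborel. indicator (box a b) x * ker \<psi> J (u - x)) \<le> D * decay ?d 1 u"
      using ker_box_average_bound[OF \<psi>, of a b] by blast
    let ?k = "\<lambda>J u. LINT x|lborel. indicator (box a b) x * ker \<psi> J (u - x)"
    have fd: "integrable lborel (\<lambda>x. D * (cmod (f x) * decay ?d 1 (x - 0)))"
      by (intro integrable_mult_right f_mult_decay_integrable[OF SS]) simp
    have bd: "AE u in lborel. u \<notin> cbox a b - box a b"
      using null_sets_cbox_Diff_box[of a b] by (intro AE_not_in) auto
    have lim1: "(\<lambda>J. LINT u|lborel. f u * ?k J u) \<longlonglongrightarrow> (LINT u|lborel. f u * indicator (box a b) u)"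
    proof (rule integral_dominated_convergence[OF _ _ fd])
      show "AE u in lborel. (\<lambda>J. f u * ?k J u) \<longlonglongrightarrow> f u * indicator (box a b) u"
        using bd by eventually_elim (intro tendsto_mult_left ker_box_average_limit[OF \<psi>])
      show "AE u in lborel. norm (f u * ?k J u) \<le> D * (cmod (f u) * decay ?d 1 (u - 0))" for J
      proof (rule AE_I2)
        fix u
        have "cmod (f u) * cmod (?k J u) \<le> cmod (f u) * (D * decay ?d 1 u)" by (intro mult_left_mono D) auto
        then show "norm (f u * ?k J u) \<le> D * (cmod (f u) * decay ?d 1 (u - 0))" by (simp add: norm_mult mult_ac)
      qed
    qed measurable
    have fub: "(LINT u|lborel. f u * ?k J u) = (LINT x|lborel. corr f (ker \<psi> J) x * indicator (box a b) x)" for J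
    proof -
      obtain B where B: "0 < B" "\<And>y. (LINT x|lborel. cmod (f x * ker \<psi> J (x - y))) \<le> B"
        using corr_ker_abs_bound[OF S] by blast
      have "(LINT u|lborel. f u * ?k J u) = (LINT u|lborel. (LINT x|lborel. indicator (box a b) x * (f u * ker \<psi> J (u - x))))"
        by (simp only: integral_mult_right_zero[symmetric] mult.left_commute)
      also have "\<dots> = (LINT x|lborel. (LINT u|lborel. indicator (box a b) x * (f u * ker \<psi> J (u - x))))"
      proof (rule lborel_pair.Fubini_integral)
        show "integrable (lborel \<Otimes>\<^sub>M lborel) (\<lambda>(x, u). indicator (box a b) x * (f u * ker \<psi> J (u - x)))"
        proof (rule lborel_pair.Fubini_integrable)
          show "AE x in lborel. integrable lborel (\<lambda>u. case (x, u) of (x, u) \<Rightarrow> indicator (box a b) x * (f u * ker \<psi> J (u - x)))"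
            using corr_ker_integrable[OF S] by (auto intro!: AE_I2 integrable_mult_right)
          show "integrable lborel (\<lambda>x. LINT u|lborel. norm (case (x, u) of (x, u) \<Rightarrow> indicator (box a b) x * (f u * ker \<psi> J (u - x))))"
          proof (rule Bochner_Integration.integrable_bound)
            show "integrable lborel (\<lambda>x. B * indicator (box a b) x)"
              using emeasure_lborel_box_finite[of a b] by (intro integrable_mult_right integrable_real_indicator) auto
            show "AE x in lborel. norm (LINT u|lborel. norm (case (x, u) of (x, u) \<Rightarrow> indicator (box a b) x * (f u * ker \<psi> J (u - x)))) \<le> norm (B * indicator (box a b) x)"
              using B by (auto intro!: AE_I2 simp: indicator_def)
          qed measurable
        qed measurable
      qed
      also have "\<dots> = (LINT x|lborel. corr f (ker \<psi> J) x * indicator (box a b) x)"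
        by (simp only: integral_mult_right_zero corr_def mult.commute)
      finally show ?thesis .
    qed
    have lim2: "(\<lambda>J. LINT x|lborel. corr f (ker \<psi> J) x * indicator (box a b) x) \<longlonglongrightarrow> (LINT x|lborel. L x * indicator (box a b) x)"
    proof (rule integral_dominated_convergence[OF _ _ wi[of a b]])
      show "AE x in lborel. (\<lambda>J. corr f (ker \<psi> J) x * indicator (box a b) x) \<longlonglongrightarrow> L x * indicator (box a b) x"
        using \<Lambda>fin by eventually_elim (intro tendsto_mult_right conv)
      show "AE x in lborel. norm (corr f (ker \<psi> J) x * indicator (box a b) x) \<le> w x * indicator (box a b) x" for J
        using \<Lambda>fin by eventually_elim (use partial in \<open>auto simp: indicator_def\<close>)
    qed measurable
    show "(LINT x|lborel. L x * indicator (box a b) x) = (LINT x|lborel. f x * indicator (box a b) x)"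
      using lim1 lim2 unfolding fub by (rule LIMSEQ_unique[rotated])
    show "integrable lborel (\<lambda>x. f x * indicator (box a b) x)"
    proof -
      obtain \<rho> where \<rho>: "0 < \<rho>" "\<And>x. x \<in> box a b \<Longrightarrow> norm x \<le> \<rho>"
        using bounded_box[of a b] unfolding bounded_pos by blast
      show ?thesis
      proof (rule Bochner_Integration.integrable_bound)
        show "integrable lborel (\<lambda>x. (1 + \<rho>) powr ?d * (cmod (f x) * decay ?d 1 (x - 0)))"
          by (intro integrable_mult_right f_mult_decay_integrable[OF SS]) simp
        show "AE x in lborel. norm (f x * indicator (box a b) x) \<le> norm ((1 + \<rho>) powr ?d * (cmod (f x) * decay ?d 1 (x - 0)))"
        proof (rule AE_I2)
          fix x
          show "norm (f x * indicator (box a b) x) \<le> norm ((1 + \<rho>) powr ?d * (cmod (f x) * decay ?d 1 (x - 0)))"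
          proof (cases "x \<in> box a b")
            case True
            have "(1 + \<rho>) powr - ?d \<le> (1 + norm x) powr - ?d"
              using \<rho>(2)[OF True] by (intro powr_mono2') (auto intro: add_pos_nonneg)
            then have "(1 + \<rho>) powr ?d * (1 + \<rho>) powr - ?d \<le> (1 + \<rho>) powr ?d * decay ?d 1 x"
              by (intro mult_left_mono) (auto simp: decay_one)
            moreover have "(1 + \<rho>) powr ?d * (1 + \<rho>) powr - ?d = 1" using \<rho>(1) by (simp only: powr_add[symmetric]) simp
            ultimately have "cmod (f x) * 1 \<le> cmod (f x) * ((1 + \<rho>) powr ?d * decay ?d 1 x)" by (intro mult_left_mono) auto
            then show ?thesis using True by (simp add: abs_mult mult_ac)
          qed simp
        qed
      qed measurable
    qed
  qed measurable
  with \<Lambda>fin show ?thesis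
  proof eventually_elim
    case (elim x)
    then show ?case
      using good[of x] summable_sums[OF summable_norm_cancel, of "\<lambda>j. block \<psi> f j x"] by (simp add: L_def)
  qed
qed

section \<open>Oscillation and Peetre averages\<close>

text \<open>For each fixed l other than 0 the points x with l x in N form a dilate of N, hence a
  null set; Fubini's theorem exchanges the two quantifiers.\<close>

lemma AE_ray:
  fixes N :: "'a::euclidean_space set"
  assumes N: "N \<in> null_sets lborel"
  shows "AE x in lborel. AE l in (lborel :: real measure). l \<noteq> 0 \<longrightarrow> l *\<^sub>R x \<notin> N"
proof -
  have [measurable]: "N \<in> sets borel" using N by auto
  have "AE x in lborel. l \<noteq> 0 \<longrightarrow> l *\<^sub>R x \<notin> N" for l :: real
  proof (cases "l = 0")
    case False
    have "0 = (\<integral>\<^sup>+x. indicator N x \<partial>lborel)" using N by (simp add: null_sets_def)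
    also have "\<dots> = ennreal (\<bar>l\<bar> ^ DIM('a)) * (\<integral>\<^sup>+x. indicator N (0 + l *\<^sub>R x) \<partial>lborel)"
      by (rule lborel_nn_integral_affine) (use False in auto)
    finally have "(\<integral>\<^sup>+x. indicator N (l *\<^sub>R x) \<partial>lborel) = (0 :: ennreal)" using False by simp
    then have "AE x in lborel. indicator N (l *\<^sub>R x) = (0 :: ennreal)"
      by (subst (asm) nn_integral_0_iff_AE) auto
    then show ?thesis by eventually_elim (auto simp: indicator_def)
  qed simp
  then have "AE l in lborel. AE x in lborel. l \<noteq> 0 \<longrightarrow> l *\<^sub>R x \<notin> N" by simp
  moreover have "Measurable.pred (borel \<Otimes>\<^sub>M borel) (\<lambda>z :: 'a \<times> real. snd z \<noteq> 0 \<longrightarrow> snd z *\<^sub>R fst z \<notin> N)"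
    by measurable
  then have "{z \<in> space (lborel \<Otimes>\<^sub>M lborel). snd z \<noteq> 0 \<longrightarrow> snd z *\<^sub>R fst z \<notin> N} \<in> sets ((lborel :: 'a measure) \<Otimes>\<^sub>M (lborel :: real measure))"
    by (simp add: pred_def space_pair_measure sets_pair_measure)
  ultimately show ?thesis
    by (subst lborel_pair.AE_commute)
qed

text \<open>For almost every x the block series converges at x and at almost every point of the line
  through 0 and x. There an increment of g is an increment of f along that line and can be summed
  block by block.\<close>

lemma osc_le_peetre:
  fixes \<psi> :: "real^'n::finite \<Rightarrow> complex"
  assumes \<psi>: "resolution_generator \<psi>" and p: "1 \<le> p" and b: "real CARD('n) < b" and r: "1 \<le> r"
    and q: "0 < q" and s: "0 < s"
  obtains C :: real where "0 < C" "\<And>g. g \<in> borel_measurable borel \<Longrightarrow> (\<And>t. g (- t) = g t) \<Longrightarrow> borel_Lp p (\<lambda>x::real^'n. g (norm x)) \<Longrightarrow>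
    (\<integral>\<^sup>+x. enn_powr (lq_seq s q (\<lambda>j. block \<psi> (\<lambda>x. g (norm x)) j x)) p \<partial>lborel) < \<infinity> \<Longrightarrow>
    AE x in lborel. \<forall>k. osc g (norm x) ((1/2) ^ k) \<le> (\<Sum>j. ennreal (C * wt (b / r) j k) * peetre \<psi> b r (\<lambda>x. g (norm x)) j x)"
proof -
  obtain C where C: "0 < C" "\<And>f j k x h. borel_Lp p f \<Longrightarrow> norm h \<le> (1/2) ^ k \<Longrightarrow>
    ennreal (cmod (block \<psi> f j (x + h) - block \<psi> f j x)) \<le> ennreal (C * wt (b / r) j k) * peetre \<psi> b r f j x"
    using block_increment[OF \<psi> p b r] by blast
  show ?thesis
  proof (rule that[OF C(1)])
    fix g :: "real \<Rightarrow> complex"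
    assume g [measurable]: "g \<in> borel_measurable borel" and even: "\<And>t. g (- t) = g t" and Lp: "borel_Lp p (\<lambda>x::real^'n. g (norm x))"
      and fin: "(\<integral>\<^sup>+x. enn_powr (lq_seq s q (\<lambda>j. block \<psi> (\<lambda>x. g (norm x)) j x)) p \<partial>lborel) < \<infinity>"
    define f where "f x = g (norm x)" for x :: "real^'n"
    have fL: "borel_Lp p f" using Lp by (simp add: f_def[abs_def])
    \<comment> \<open>For w below - norm x the point norm x + w is negative; evenness identifies g
      there with f on the opposite ray.\<close>
    have even': "g \<bar>t\<bar> = g t" for t using even[of t] by (cases "0 \<le> t") (auto simp: abs_of_neg)
    have "AE x in lborel. (\<lambda>j. block \<psi> f j x) sums f x"
      using block_sums_AE[OF \<psi> p fL q s] fin by (simp add: f_def[abs_def])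
    then obtain N where N: "{x \<in> space lborel. \<not> (\<lambda>j. block \<psi> f j x) sums f x} \<subseteq> N" "emeasure lborel N = 0" "N \<in> sets lborel"
      by (rule AE_E)
    then have Nn: "N \<in> null_sets lborel" by (simp add: null_sets_def)
    have good: "(\<lambda>j. block \<psi> f j x) sums f x" if "x \<notin> N" for x using N(1) that by auto
    have "AE x in lborel. x \<notin> N" by (rule AE_not_in[OF Nn])
    then show "AE x in lborel. \<forall>k. osc g (norm x) ((1/2) ^ k) \<le> (\<Sum>j. ennreal (C * wt (b / r) j k) * peetre \<psi> b r (\<lambda>x. g (norm x)) j x)"
      using AE_ray[OF Nn] AE_lborel_singleton[of 0]
    proof eventually_elim
      case (elim x)
      have x0: "norm x \<noteq> 0" using elim by simp
      show ?case
      proof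
        fix k
        show "osc g (norm x) ((1/2) ^ k) \<le> (\<Sum>j. ennreal (C * wt (b / r) j k) * peetre \<psi> b r (\<lambda>x. g (norm x)) j x)"
        proof (rule osc_le[OF g])
          have m: "{l::real. l \<noteq> 0 \<longrightarrow> l *\<^sub>R x \<notin> N} \<in> sets borel"
          proof -
            have "(\<lambda>l::real. l *\<^sub>R x) \<in> borel_measurable borel" by measurable
            from measurable_sets[OF this, of "- N"] N(3) have "(\<lambda>l::real. l *\<^sub>R x) -` (- N) \<in> sets borel" by auto
            moreover have "{l::real. l \<noteq> 0 \<longrightarrow> l *\<^sub>R x \<notin> N} = {0} \<union> (\<lambda>l::real. l *\<^sub>R x) -` (- N)" by auto
            ultimately show ?thesis by simp
          qed
          \<comment> \<open>The parameter on the line is an affine function of the increment w, so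
            null sets of parameters become null sets of increments.\<close>
          have "AE w in lborel. (1 + (1 / norm x) * w) \<noteq> 0 \<longrightarrow> (1 + (1 / norm x) * w) *\<^sub>R x \<notin> N"
            using elim(2) x0 m by (intro AE_borel_affine[where P = "\<lambda>l. l \<noteq> 0 \<longrightarrow> l *\<^sub>R x \<notin> N"]) (auto simp: pred_def)
          then show "AE w in lborel. w \<in> {- ((1/2) ^ k)..(1/2) ^ k} \<longrightarrow> ennreal (cmod (g (norm x + w) - g (norm x))) \<le> (\<Sum>j. ennreal (C * wt (b / r) j k) * peetre \<psi> b r (\<lambda>x. g (norm x)) j x)"
            using AE_lborel_singleton[of "- norm x"]
          proof eventually_elim
            case w: (elim w)
            show ?case
            proof
              assume wk: "w \<in> {- ((1/2) ^ k)..(1/2) ^ k}"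
              define l where "l = 1 + (1 / norm x) * w"
              define h where "h = (w / norm x) *\<^sub>R x"
              have lx: "l *\<^sub>R x = x + h" by (simp add: l_def h_def scaleR_add_left)
              have lr: "l * norm x = norm x + w" using x0 by (simp add: l_def field_simps)
              have "l \<noteq> 0" using w(2) lr x0 by auto
              then have xh: "x + h \<notin> N" using w(1) lx by (simp add: l_def)
              have "norm (x + h) = \<bar>norm x + w\<bar>" unfolding lx[symmetric] norm_scaleR using lr by (metis abs_mult abs_norm_cancel)
              then have fh: "f (x + h) = g (norm x + w)" by (simp add: f_def even')
              have hk: "norm h \<le> (1/2) ^ k" using wk x0 by (auto simp: h_def abs_le_iff)
              have "(\<lambda>j. block \<psi> f j (x + h) - block \<psi> f j x) sums (f (x + h) - f x)"
                by (intro sums_diff good xh elim)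
              then have "ennreal (cmod (f (x + h) - f x)) \<le> (\<Sum>j. ennreal (cmod (block \<psi> f j (x + h) - block \<psi> f j x)))"
                by (rule ennreal_norm_sums_le)
              also have "\<dots> \<le> (\<Sum>j. ennreal (C * wt (b / r) j k) * peetre \<psi> b r f j x)"
                by (intro suminf_le C(2) fL hk) (auto simp: summableI)
              finally show "ennreal (cmod (g (norm x + w) - g (norm x))) \<le> (\<Sum>j. ennreal (C * wt (b / r) j k) * peetre \<psi> b r (\<lambda>x. g (norm x)) j x)"
                unfolding fh by (simp add: f_def[abs_def])
            qed
          qed
        qed
      qed
    qed
  qed
qed

lemma osc_norm_le_peetre:
  fixes \<psi> :: "real^'n::finite \<Rightarrow> complex"
  assumes \<psi>: "resolution_generator \<psi>" and p: "1 \<le> p" and b: "real CARD('n) < b" and r: "1 \<le> r"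
    and q: "1 \<le> q" and s: "0 < s" "s < 1" and a: "b / r < s"
  obtains C :: real where "0 < C" "\<And>g. g \<in> borel_measurable borel \<Longrightarrow> (\<And>t. g (- t) = g t) \<Longrightarrow> borel_Lp p (\<lambda>x::real^'n. g (norm x)) \<Longrightarrow>
    (\<integral>\<^sup>+x. enn_powr (lq_seq s q (\<lambda>j. block \<psi> (\<lambda>x. g (norm x)) j x)) p \<partial>lborel) < \<infinity> \<Longrightarrow>
    AE x in lborel. osc_norm s q g (norm x) \<le> ennreal C * lqn q (\<lambda>j. ennreal (2 powr (real j * s)) * peetre \<psi> b r (\<lambda>x. g (norm x)) j x)"
proof -
  have q0: "0 < q" using q by (rule order_less_le_trans[rotated]) simp
  \<comment> \<open>Multiplied by 2^(k s), the weight \<open>wt\<close> becomes 2^(j s) times a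
    power of the first ratio for j \<le> k and of the second for j > k. The larger one works for
    both.\<close>
  define \<rho> where "\<rho> = max (2 powr (s - 1)) (2 powr (b / r - s))"
  have \<rho>: "0 < \<rho>" "\<rho> < 1" using s a by (auto simp: \<rho>_def max_def intro: powr_less_one)
  obtain C1 where C1: "0 < C1" "\<And>g. g \<in> borel_measurable borel \<Longrightarrow> (\<And>t. g (- t) = g t) \<Longrightarrow> borel_Lp p (\<lambda>x::real^'n. g (norm x)) \<Longrightarrow>
    (\<integral>\<^sup>+x. enn_powr (lq_seq s q (\<lambda>j. block \<psi> (\<lambda>x. g (norm x)) j x)) p \<partial>lborel) < \<infinity> \<Longrightarrow>
    AE x in lborel. \<forall>k. osc g (norm x) ((1/2) ^ k) \<le> (\<Sum>j. ennreal (C1 * wt (b / r) j k) * peetre \<psi> b r (\<lambda>x. g (norm x)) j x)"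
    using osc_le_peetre[OF \<psi> p b r q0 s(1)] by blast
  obtain C2 where C2: "0 < C2" "\<And>g r B. g \<in> borel_measurable borel \<Longrightarrow> (\<And>k. osc g r ((1/2) ^ k) \<le> B k) \<Longrightarrow>
    osc_norm s q g r \<le> ennreal C2 * lqn q (\<lambda>k. ennreal (2 powr (real k * s)) * B k)"
    using osc_norm_le_lqn[OF q0 s(1)] by blast
  obtain C3 where C3: "0 < C3" "\<And>A. lqn q (\<lambda>k. \<Sum>j. ennreal (geo \<rho> j k) * A j) \<le> ennreal C3 * lqn q A"
    using lqn_young[OF q \<rho>] by blast
  have wt: "2 powr (real k * s) * wt (b / r) j k \<le> geo \<rho> j k * 2 powr (real j * s)" for j k
  proof (cases "j \<le> k")
    case True
    have "2 powr (real k * s) * wt (b / r) j k = (2 powr (s - 1)) ^ (k - j) * 2 powr (real j * s)"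
    proof -
      have "(1/2::real) ^ (k - j) = 2 powr (- real (k - j))"
        by (simp only: powr_minus powr_realpow) (simp add: power_divide inverse_eq_divide)
      moreover have "(2 powr (s - 1)) ^ (k - j) = 2 powr ((s - 1) * real (k - j))"
        by (simp add: powr_realpow[symmetric] powr_powr)
      ultimately show ?thesis
        using True by (simp add: wt_def powr_add[symmetric] of_nat_diff algebra_simps)
    qed
    also have "\<dots> \<le> \<rho> ^ (k - j) * 2 powr (real j * s)"
      by (intro mult_right_mono power_mono) (auto simp: \<rho>_def)
    finally show ?thesis using True by (simp add: geo_def)
  next
    case False
    have "2 powr (real k * s) * wt (b / r) j k = (2 powr (b / r - s)) ^ (j - k) * 2 powr (real j * s)"
    proof -
      have "(2 powr (b / r - s)) ^ (j - k) = 2 powr ((b / r - s) * real (j - k))"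
        by (simp add: powr_realpow[symmetric] powr_powr)
      then show ?thesis
        using False by (simp add: wt_def powr_add[symmetric] of_nat_diff algebra_simps)
    qed
    also have "\<dots> \<le> \<rho> ^ (j - k) * 2 powr (real j * s)"
      by (intro mult_right_mono power_mono) (auto simp: \<rho>_def)
    finally show ?thesis using False by (simp add: geo_def)
  qed
  have C: "0 < C2 * C1 * C3" using C1 C2 C3 by simp
  show ?thesis
  proof (rule that[OF C])
    fix g :: "real \<Rightarrow> complex"
    assume g [measurable]: "g \<in> borel_measurable borel" and even: "\<And>t. g (- t) = g t" and Lp: "borel_Lp p (\<lambda>x::real^'n. g (norm x))"
      and fin: "(\<integral>\<^sup>+x. enn_powr (lq_seq s q (\<lambda>j. block \<psi> (\<lambda>x. g (norm x)) j x)) p \<partial>lborel) < \<infinity>"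
    let ?P = "peetre \<psi> b r (\<lambda>x. g (norm x))"
    show "AE x in lborel. osc_norm s q g (norm x) \<le> ennreal (C2 * C1 * C3) * lqn q (\<lambda>j. ennreal (2 powr (real j * s)) * ?P j x)"
      using C1(2)[OF g even Lp fin]
    proof eventually_elim
      case (elim x)
      have "osc_norm s q g (norm x) \<le> ennreal C2 * lqn q (\<lambda>k. ennreal (2 powr (real k * s)) * (\<Sum>j. ennreal (C1 * wt (b / r) j k) * ?P j x))"
        using elim by (intro C2(2) g) blast
      also have "\<dots> \<le> ennreal C2 * lqn q (\<lambda>k. ennreal C1 * (\<Sum>j. ennreal (geo \<rho> j k) * (ennreal (2 powr (real j * s)) * ?P j x)))"
      proof (intro mult_left_mono lqn_mono q0)
        fix k
        have "ennreal (2 powr (real k * s)) * (\<Sum>j. ennreal (C1 * wt (b / r) j k) * ?P j x) = (\<Sum>j. ennreal (2 powr (real k * s)) * (ennreal (C1 * wt (b / r) j k) * ?P j x))"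
          by simp
        also have "\<dots> \<le> (\<Sum>j. ennreal C1 * (ennreal (geo \<rho> j k) * (ennreal (2 powr (real j * s)) * ?P j x)))"
        proof (intro suminf_le)
          fix j
          have w0: "0 \<le> wt (b / r) j k" by (simp add: wt_def)
          have g0: "0 \<le> geo \<rho> j k" using \<rho> by (simp add: geo_def)
          have "C1 * (2 powr (real k * s) * wt (b / r) j k) \<le> C1 * (geo \<rho> j k * 2 powr (real j * s))"
            using C1 by (intro mult_left_mono wt) auto
          then have "ennreal (2 powr (real k * s) * (C1 * wt (b / r) j k)) * ?P j x \<le> ennreal (C1 * (geo \<rho> j k * 2 powr (real j * s))) * ?P j x"
            by (intro mult_right_mono ennreal_leI) (auto simp: mult_ac)
          then show "ennreal (2 powr (real k * s)) * (ennreal (C1 * wt (b / r) j k) * ?P j x) \<le> ennreal C1 * (ennreal (geo \<rho> j k) * (ennreal (2 powr (real j * s)) * ?P j x))"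
            using C1 w0 g0 by (simp add: ennreal_mult mult.assoc)
        qed (auto simp: summableI)
        finally show "ennreal (2 powr (real k * s)) * (\<Sum>j. ennreal (C1 * wt (b / r) j k) * ?P j x) \<le> ennreal C1 * (\<Sum>j. ennreal (geo \<rho> j k) * (ennreal (2 powr (real j * s)) * ?P j x))"
          by simp
      qed simp
      also have "\<dots> \<le> ennreal C2 * (ennreal C1 * (ennreal C3 * lqn q (\<lambda>j. ennreal (2 powr (real j * s)) * ?P j x)))"
        unfolding lqn_cmult[OF q0] by (intro mult_left_mono C3) auto
      also have "\<dots> = ennreal (C2 * C1 * C3) * lqn q (\<lambda>j. ennreal (2 powr (real j * s)) * ?P j x)"
        using C1 C2 C3 by (simp add: ennreal_mult mult.assoc)
      finally show ?case .
    qed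
  qed
qed

text \<open>With the r-th powers of the weighted blocks as entries, the norm becomes one with
  exponents p / r and q / r, both above 1. The three vector inequalities cover q infinite, q / r
  \<le> p / r and q / r > p / r.\<close>

lemma peetre_bound:
  fixes \<psi> :: "real^'n::finite \<Rightarrow> complex"
  assumes \<psi>: "resolution_generator \<psi>" and b: "real CARD('n) < b" and r: "1 \<le> r" "r < p" "ereal r < q"
  obtains C :: real where "0 < C" "\<And>f. borel_Lp p f \<Longrightarrow>
    (\<integral>\<^sup>+x. enn_powr (lqn q (\<lambda>j. ennreal (2 powr (real j * s)) * peetre \<psi> b r f j x)) p \<partial>lborel)
    \<le> ennreal C * (\<integral>\<^sup>+x. enn_powr (lq_seq s q (\<lambda>j. block \<psi> f j x)) p \<partial>lborel)"
proof -
  have p1: "1 \<le> p" and r0: "0 < r" using r by auto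
  have pr: "1 < p / r" using r by simp
  have b': "real DIM(real^'n) < b" using b by simp
  define G where "G f j y = ennreal (2 powr (real j * s) * cmod (block \<psi> f j y))" for f :: "real^'n \<Rightarrow> complex" and j y
  have Gm: "G f j \<in> borel_measurable borel" if "borel_Lp p f" for f j
  proof -
    note [measurable] = block_measurable[OF \<psi> p1 that]
    show ?thesis unfolding G_def[abs_def] by measurable
  qed
  have P: "ennreal (2 powr (real j * s)) * peetre \<psi> b r f j x = enn_powr (decay_conv b (2 ^ j) (\<lambda>y. enn_powr (G f j y) r) x) (1 / r)"
    if f: "borel_Lp p f" for f j x
  proof -
    note [measurable] = block_measurable[OF \<psi> p1 f]
    have "(\<lambda>y. enn_powr (G f j y) r) = (\<lambda>y. ennreal ((2 powr (real j * s)) powr r) * enn_powr (ennreal (cmod (block \<psi> f j y))) r)"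
      using r0 by (simp add: G_def fun_eq_iff ennreal_mult enn_powr_mult del: enn_powr_ennreal) simp
    then have "decay_conv b (2 ^ j) (\<lambda>y. enn_powr (G f j y) r) x = ennreal ((2 powr (real j * s)) powr r) * decay_conv b (2 ^ j) (\<lambda>y. enn_powr (ennreal (cmod (block \<psi> f j y))) r) x"
      by (simp only:) (rule decay_conv_cmult, measurable)
    then show ?thesis
      using r0 by (simp add: peetre_def enn_powr_mult powr_powr)
  qed
  have \<Lambda>: "lq_seq s q (\<lambda>j. block \<psi> f j x) = lqn q (\<lambda>j. G f j x)" for f x
    by (simp add: lq_seq_eq G_def)
  show ?thesis
  proof (cases "q = \<infinity>")
    case True
    obtain C where C: "0 < C" "\<And>(g :: nat \<Rightarrow> real^'n \<Rightarrow> ennreal) \<mu>. (\<And>j. 0 < \<mu> j) \<Longrightarrow> (\<And>j. g j \<in> borel_measurable borel) \<Longrightarrow>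
      (\<integral>\<^sup>+x. enn_powr (SUP j. decay_conv b (\<mu> j) (g j) x) (p / r) \<partial>lborel) \<le> ennreal C * (\<integral>\<^sup>+x. enn_powr (SUP j. g j x) (p / r) \<partial>lborel)"
      using vector_maximal_sup[OF b' pr] by blast
    show ?thesis
    proof (rule that[OF C(1)])
      fix f :: "real^'n \<Rightarrow> complex" assume f: "borel_Lp p f"
      note [measurable] = Gm[OF f]
      have "(\<integral>\<^sup>+x. enn_powr (lqn q (\<lambda>j. ennreal (2 powr (real j * s)) * peetre \<psi> b r f j x)) p \<partial>lborel)
        = (\<integral>\<^sup>+x. enn_powr (SUP j. decay_conv b (2 ^ j) (\<lambda>y. enn_powr (G f j y) r) x) (p / r) \<partial>lborel)"
        using True r0 by (simp add: P[OF f] lqn_def enn_powr_SUP[symmetric] enn_powr_powr)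
      also have "\<dots> \<le> ennreal C * (\<integral>\<^sup>+x. enn_powr (SUP j. enn_powr (G f j x) r) (p / r) \<partial>lborel)"
        by (intro C(2)) auto
      also have "\<dots> = ennreal C * (\<integral>\<^sup>+x. enn_powr (lq_seq s q (\<lambda>j. block \<psi> f j x)) p \<partial>lborel)"
        unfolding \<Lambda> using r0 by (simp add: True lqn_def enn_powr_SUP[symmetric] enn_powr_powr)
      finally show "(\<integral>\<^sup>+x. enn_powr (lqn q (\<lambda>j. ennreal (2 powr (real j * s)) * peetre \<psi> b r f j x)) p \<partial>lborel)
        \<le> ennreal C * (\<integral>\<^sup>+x. enn_powr (lq_seq s q (\<lambda>j. block \<psi> f j x)) p \<partial>lborel)" .
    qed
  next
    case False
    then obtain q' where q': "q = ereal q'" "r < q'" using r by (cases q) auto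
    define u where "u = q' / r"
    have u: "1 < u" using q' r0 by (simp add: u_def)
    have ru: "r * u = q'" and Pu: "p / r / u = p / q'" using r0 q' by (auto simp: u_def)
    obtain C where C: "0 < C" "\<And>(g :: nat \<Rightarrow> real^'n \<Rightarrow> ennreal) \<mu>. (\<And>j. 0 < \<mu> j) \<Longrightarrow> (\<And>j. g j \<in> borel_measurable borel) \<Longrightarrow>
      (\<integral>\<^sup>+x. enn_powr (\<Sum>j. enn_powr (decay_conv b (\<mu> j) (g j) x) u) (p / r / u) \<partial>lborel) \<le> ennreal C * (\<integral>\<^sup>+x. enn_powr (\<Sum>j. enn_powr (g j x) u) (p / r / u) \<partial>lborel)"
    proof (cases "u \<le> p / r")
      case True
      have u1: "1 \<le> u" using u by simp
      show ?thesis using vector_maximal_le[OF b' u1 True] that by blast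
    next
      case False
      then have up: "p / r < u" by simp
      show ?thesis using vector_maximal_gt[OF b' pr up] that by blast
    qed
    show ?thesis
    proof (rule that[OF C(1)])
      fix f :: "real^'n \<Rightarrow> complex" assume f: "borel_Lp p f"
      note [measurable] = Gm[OF f]
      have "(\<integral>\<^sup>+x. enn_powr (lqn q (\<lambda>j. ennreal (2 powr (real j * s)) * peetre \<psi> b r f j x)) p \<partial>lborel)
        = (\<integral>\<^sup>+x. enn_powr (\<Sum>j. enn_powr (decay_conv b (2 ^ j) (\<lambda>y. enn_powr (G f j y) r) x) u) (p / r / u) \<partial>lborel)"
        by (simp only: P[OF f] lqn_def) (simp add: q' enn_powr_powr ru u_def[symmetric])
      also have "\<dots> \<le> ennreal C * (\<integral>\<^sup>+x. enn_powr (\<Sum>j. enn_powr (enn_powr (G f j x) r) u) (p / r / u) \<partial>lborel)"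
        by (intro C(2)) auto
      also have "\<dots> = ennreal C * (\<integral>\<^sup>+x. enn_powr (lq_seq s q (\<lambda>j. block \<psi> f j x)) p \<partial>lborel)"
        unfolding \<Lambda> by (simp add: q' lqn_def enn_powr_powr ru Pu)
      finally show "(\<integral>\<^sup>+x. enn_powr (lqn q (\<lambda>j. ennreal (2 powr (real j * s)) * peetre \<psi> b r f j x)) p \<partial>lborel)
        \<le> ennreal C * (\<integral>\<^sup>+x. enn_powr (lq_seq s q (\<lambda>j. block \<psi> f j x)) p \<partial>lborel)" .
    qed
  qed
qed

lemma sharp_le_F:
  fixes \<psi> :: "real^'n::finite \<Rightarrow> complex"
  assumes \<psi>: "resolution_generator \<psi>" and s: "s < 1" and p: "real CARD('n) < s * p" and q: "ereal (real CARD('n) / s) < q" and n: "0 < s"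
  obtains C :: real where "0 < C" "\<And>g. g \<in> borel_measurable borel \<Longrightarrow> (\<And>t. g (- t) = g t) \<Longrightarrow> borel_Lp p (\<lambda>x::real^'n. g (norm x)) \<Longrightarrow>
    (\<integral>\<^sup>+x. ennreal (cmod (g (norm x)) powr p) \<partial>(lborel :: (real^'n) measure)) + (\<integral>\<^sup>+x. enn_powr (osc_norm s q g (norm x)) p \<partial>(lborel :: (real^'n) measure))
    \<le> ennreal C * (\<integral>\<^sup>+x. enn_powr (lq_seq s q (\<lambda>j. block \<psi> (\<lambda>x. g (norm x)) j x)) p \<partial>lborel)"
proof -
  let ?n = "real CARD('n)"
  have n1: "1 \<le> ?n" by (simp add: Suc_leI)
  have ns: "?n < ?n / s" using s n n1 by (simp add: less_divide_eq)
  have "?n / s < p" using p n by (simp add: divide_less_eq mult.commute)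
  \<comment> \<open>First r strictly between n / s and both p and q, searched among extended reals
    since q may be infinite; only then b between n and s r.\<close>
  obtain r where r: "?n / s < r" "r < p" "ereal r < q"
  proof -
    obtain c where c: "ereal (?n / s) < c" "c < min (ereal p) q"
      using dense[of "ereal (?n / s)" "min (ereal p) q"] q \<open>?n / s < p\<close> by (meson ereal_less(2) less_ereal.simps(1) min_less_iff_conj)
    then obtain r where "c = ereal r" by (cases c) auto
    with c that show ?thesis by auto
  qed
  have r1: "1 \<le> r" and r0: "0 < r" using r(1) ns n1 by linarith+
  have "?n < s * r" using r n by (simp add: divide_less_eq mult.commute)
  then obtain b where b: "?n < b" "b < s * r" using dense by blast
  have a: "b / r < s" using b r0 by (simp add: divide_less_eq)
  have p1: "1 \<le> p" using r1 r by simp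
  have q1: "1 \<le> q" using r1 r(3) by (metis ereal_less_eq(3) less_imp_le one_ereal_def order_trans)
  have q0: "0 < q" using q1 by (rule order_less_le_trans[rotated]) simp
  obtain C1 where C1: "0 < C1" "\<And>g. g \<in> borel_measurable borel \<Longrightarrow> (\<And>t. g (- t) = g t) \<Longrightarrow> borel_Lp p (\<lambda>x::real^'n. g (norm x)) \<Longrightarrow>
    (\<integral>\<^sup>+x. enn_powr (lq_seq s q (\<lambda>j. block \<psi> (\<lambda>x. g (norm x)) j x)) p \<partial>lborel) < \<infinity> \<Longrightarrow>
    AE x in lborel. osc_norm s q g (norm x) \<le> ennreal C1 * lqn q (\<lambda>j. ennreal (2 powr (real j * s)) * peetre \<psi> b r (\<lambda>x. g (norm x)) j x)"
    using osc_norm_le_peetre[OF \<psi> p1 b(1) r1 q1 n s a] by blast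
  obtain C2 where C2: "0 < C2" "\<And>f. borel_Lp p f \<Longrightarrow>
    (\<integral>\<^sup>+x. enn_powr (lqn q (\<lambda>j. ennreal (2 powr (real j * s)) * peetre \<psi> b r f j x)) p \<partial>lborel)
    \<le> ennreal C2 * (\<integral>\<^sup>+x. enn_powr (lq_seq s q (\<lambda>j. block \<psi> f j x)) p \<partial>lborel)"
    using peetre_bound[OF \<psi> b(1) r1 r(2,3)] by blast
  obtain C3 where C3: "0 < C3" "\<And>a. (\<Sum>j. ennreal (cmod (a j))) \<le> ennreal C3 * lq_seq s q a"
    using suminf_le_lq_seq[OF q0 n] by blast
  define C where "C = C3 powr p + C1 powr p * C2"
  have C: "0 < C" using C1 C2 C3 by (simp add: C_def add_pos_pos)
  show ?thesis
  proof (rule that[OF C])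
    fix g :: "real \<Rightarrow> complex"
    assume g [measurable]: "g \<in> borel_measurable borel" and even: "\<And>t. g (- t) = g t" and Lp: "borel_Lp p (\<lambda>x::real^'n. g (norm x))"
    let ?f = "\<lambda>x::real^'n. g (norm x)"
    let ?\<Lambda> = "\<lambda>x. lq_seq s q (\<lambda>j. block \<psi> ?f j x)"
    let ?X = "\<integral>\<^sup>+x. enn_powr (?\<Lambda> x) p \<partial>lborel"
    note [measurable] = block_measurable[OF \<psi> p1 Lp]
    have [measurable]: "?\<Lambda> \<in> borel_measurable borel" unfolding lq_seq_eq by measurable
    show "(\<integral>\<^sup>+x. ennreal (cmod (?f x) powr p) \<partial>lborel) + (\<integral>\<^sup>+x. enn_powr (osc_norm s q g (norm x)) p \<partial>(lborel :: (real^'n) measure)) \<le> ennreal C * ?X"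
    \<comment> \<open>Convergence of the block series to f is available for finite X; for infinite X
      the right side is infinite.\<close>
    proof (cases "?X = top")
      case True
      then show ?thesis using C by (simp add: ennreal_mult_top)
    next
      case False
      then have fin: "?X < \<infinity>" by (simp add: less_top)
      have "(\<integral>\<^sup>+x. ennreal (cmod (?f x) powr p) \<partial>lborel) \<le> (\<integral>\<^sup>+x. ennreal (C3 powr p) * enn_powr (?\<Lambda> x) p \<partial>lborel)"
      proof (rule nn_integral_mono_AE)
        show "AE x in lborel. ennreal (cmod (?f x) powr p) \<le> ennreal (C3 powr p) * enn_powr (?\<Lambda> x) p"
          using block_sums_AE[OF \<psi> p1 Lp q0 n fin]
        proof eventually_elim
          case (elim x)
          have "ennreal (cmod (?f x)) \<le> (\<Sum>j. ennreal (cmod (block \<psi> ?f j x)))" by (rule ennreal_norm_sums_le[OF elim])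
          also have "\<dots> \<le> ennreal C3 * ?\<Lambda> x" by (rule C3)
          finally have "enn_powr (ennreal (cmod (?f x))) p \<le> enn_powr (ennreal C3 * ?\<Lambda> x) p"
            using p1 by (intro enn_powr_mono) auto
          then show ?case using C3 p1 by (simp add: enn_powr_mult)
        qed
      qed
      also have "\<dots> = ennreal (C3 powr p) * ?X" by (rule nn_integral_cmult) measurable
      finally have 1: "(\<integral>\<^sup>+x. ennreal (cmod (?f x) powr p) \<partial>lborel) \<le> ennreal (C3 powr p) * ?X" .
      define L where "L x = lqn q (\<lambda>j. ennreal (2 powr (real j * s)) * peetre \<psi> b r ?f j x)" for x
      have [measurable]: "L \<in> borel_measurable borel" unfolding L_def[abs_def] peetre_def by measurable
      have "(\<integral>\<^sup>+x. enn_powr (osc_norm s q g (norm x)) p \<partial>(lborel :: (real^'n) measure)) \<le> (\<integral>\<^sup>+x. ennreal (C1 powr p) * enn_powr (L x) p \<partial>lborel)"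
      proof (rule nn_integral_mono_AE)
        show "AE x in lborel. enn_powr (osc_norm s q g (norm x)) p \<le> ennreal (C1 powr p) * enn_powr (L x) p"
          using C1(2)[OF g even Lp fin] unfolding L_def[symmetric]
        proof eventually_elim
          case (elim x)
          then have "enn_powr (osc_norm s q g (norm x)) p \<le> enn_powr (ennreal C1 * L x) p"
            using p1 by (intro enn_powr_mono) auto
          then show ?case using C1 p1 by (simp add: enn_powr_mult)
        qed
      qed
      also have "\<dots> = ennreal (C1 powr p) * (\<integral>\<^sup>+x. enn_powr (L x) p \<partial>lborel)" by (rule nn_integral_cmult) measurable
      also have "\<dots> \<le> ennreal (C1 powr p) * (ennreal C2 * ?X)" unfolding L_def by (rule mult_left_mono[OF C2(2)[OF Lp] zero_le])
      also have "\<dots> = ennreal (C1 powr p * C2) * ?X" using C2 by (simp add: ennreal_mult mult.assoc)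
      finally have "(\<integral>\<^sup>+x. enn_powr (osc_norm s q g (norm x)) p \<partial>(lborel :: (real^'n) measure)) \<le> ennreal (C1 powr p * C2) * ?X" .
      with 1 have "(\<integral>\<^sup>+x. ennreal (cmod (?f x) powr p) \<partial>lborel) + (\<integral>\<^sup>+x. enn_powr (osc_norm s q g (norm x)) p \<partial>(lborel :: (real^'n) measure)) \<le> ennreal (C3 powr p) * ?X + ennreal (C1 powr p * C2) * ?X"
        by (rule add_mono)
      also have "\<dots> = ennreal C * ?X" using C2 by (simp add: C_def distrib_right[symmetric])
      finally show ?thesis .
    qed
  qed
qed

section \<open>Traces and their Borel representatives\<close>

lemma lebesgue_complex_borel_version:
  fixes f :: "'a::euclidean_space \<Rightarrow> complex"
  assumes "f \<in> borel_measurable lebesgue"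
  obtains f0 where "f0 \<in> borel_measurable borel" "AE x in lborel. f x = f0 x"
proof -
  have "(\<lambda>x. Re (f x)) \<in> borel_measurable lebesgue" "(\<lambda>x. Im (f x)) \<in> borel_measurable lebesgue"
    using assms by (simp_all add: borel_measurable_complex_iff)
  then obtain u v where uv: "u \<in> borel_measurable lborel" "v \<in> borel_measurable lborel"
      "AE x in lborel. Re (f x) = u x" "AE x in lborel. Im (f x) = v x"
    using completion_ex_borel_measurable_real[of "\<lambda>x. Re (f x)" lborel] completion_ex_borel_measurable_real[of "\<lambda>x. Im (f x)" lborel]
    by blast
  show ?thesis
  proof (rule that[of "\<lambda>x. Complex (u x) (v x)"])
    show "(\<lambda>x. Complex (u x) (v x)) \<in> borel_measurable borel"
      using uv by (simp add: borel_measurable_complex_iff)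
    show "AE x in lborel. f x = Complex (u x) (v x)"
      using uv(3,4) by eventually_elim (simp add: complex_eq_iff)
  qed
qed

text \<open>An arbitrary P is handled through a Borel null set containing its exceptions, which is
  transported in its place.\<close>

lemma AE_affine:
  assumes "c \<noteq> 0" "AE x in lborel. P x"
  shows "AE x in (lborel :: real measure). P (t + c * x)"
proof -
  obtain N where N: "\<And>x. x \<in> space lborel - N \<Longrightarrow> P x" "N \<in> null_sets lborel"
    using AE_E3[OF assms(2)] by blast
  then have [measurable]: "N \<in> sets borel" by auto
  have "AE x in lborel. t + c * x \<notin> N"
    by (rule AE_borel_affine[OF assms(1)]) (use AE_not_in[OF N(2)] in \<open>auto simp: pred_def\<close>)
  then show ?thesis by eventually_elim (use N(1) in auto)
qed

text \<open>Composing a Borel version with the absolute value makes evenness hold everywhere, as the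
  pointwise arguments along lines through the origin require.\<close>

lemma is_trace_borel_version:
  fixes f :: "real^'n::finite \<Rightarrow> complex"
  assumes "is_trace f g"
  obtains g1 where "g1 \<in> borel_measurable borel" "\<And>t. g1 (- t) = g1 t" "AE t in lborel. g t = g1 t"
    "AE x in lborel. f x = g1 (norm x)"
proof -
  have g: "g \<in> borel_measurable lebesgue" "AE t in lborel. g (- t) = g t" "AE x in lborel. f x = g (norm x)"
    using assms by (auto simp: is_trace_def AE_completion_iff)
  obtain g0 where g0 [measurable]: "g0 \<in> borel_measurable borel" and eq: "AE t in lborel. g t = g0 t"
    using lebesgue_complex_borel_version[OF g(1)] .
  have "AE t in lborel. g (0 + (- 1) * t) = g0 (0 + (- 1) * t)"
    by (rule AE_affine[OF _ eq]) simp
  with g(2) eq have gg: "AE t in lborel. g t = g0 \<bar>t\<bar>"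
    by eventually_elim (auto simp: abs_if)
  show ?thesis
  proof (rule that[of "\<lambda>t. g0 \<bar>t\<bar>"])
    show "AE x in lborel. f x = g0 \<bar>norm x\<bar>"
      using g(3) AE_norm_of_AE[OF gg, where 'a = "real^'n"] by eventually_elim simp
  qed (use gg in auto)
qed

text \<open>Take r with g r = g1 r. Translation preserves null sets, so the increments at r agree
  for almost every w, and the inner essential suprema agree for every t.\<close>

lemma local_osc_pow_AE_cong:
  assumes g: "g \<in> borel_measurable lebesgue" and g1: "g1 \<in> borel_measurable borel"
    and eq: "AE t in lborel. g t = g1 t"
  shows "AE r in lborel. local_osc_pow s p q g r = local_osc_pow s p q g1 r"
  using eq
proof eventually_elim
  case (elim r)
  have T: "(\<lambda>w::real. r + w) \<in> lebesgue \<rightarrow>\<^sub>M lebesgue"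
    using lebesgue_affine_measurable[of "\<lambda>_::real. 1" r] by simp
  have m: "(\<lambda>w. cmod (g (r + w) - g r)) \<in> borel_measurable (lebesgue_on A)" for A
  proof -
    note [measurable] = measurable_compose[OF T g]
    show ?thesis by (rule measurable_restrict_space1) measurable
  qed
  have m1: "(\<lambda>w. cmod (g1 (r + w) - g1 r)) \<in> borel_measurable (lebesgue_on A)" for A
  proof -
    have "(\<lambda>w. cmod (g1 (r + w) - g1 r)) \<in> borel_measurable lborel" using g1 by measurable
    then show ?thesis by (intro measurable_restrict_space1 measurable_completion)
  qed
  note [measurable] = m m1
  have "AE w in lborel. g (r + 1 * w) = g1 (r + 1 * w)" by (rule AE_affine[OF _ eq]) simp
  then have ae: "AE w in lebesgue_on {-t..t}. cmod (g (r + w) - g r) = cmod (g1 (r + w) - g1 r)" for t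
    unfolding AE_lebesgue_on[OF borel_closed[OF closed_atLeastAtMost]]
    by eventually_elim (simp add: elim)
  have "esssup (lebesgue_on {-t..t}) (\<lambda>w. ennreal (cmod (g (r + w) - g r)))
      = esssup (lebesgue_on {-t..t}) (\<lambda>w. ennreal (cmod (g1 (r + w) - g1 r)))" for t
  proof (rule esssup_AE_cong)
    show "AE w in lebesgue_on {-t..t}. ennreal (cmod (g (r + w) - g r)) = ennreal (cmod (g1 (r + w) - g1 r))"
      using ae[of t] by eventually_elim simp
  qed measurable
  moreover have "esssup (lebesgue_on {-t..t}) (\<lambda>w. ennreal (cmod (g (r + w) - g r) powr a))
      = esssup (lebesgue_on {-t..t}) (\<lambda>w. ennreal (cmod (g1 (r + w) - g1 r) powr a))" for t a
  proof (rule esssup_AE_cong)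
    show "AE w in lebesgue_on {-t..t}. ennreal (cmod (g (r + w) - g r) powr a) = ennreal (cmod (g1 (r + w) - g1 r) powr a)"
      using ae[of t] by eventually_elim simp
  qed measurable
  ultimately show ?case by (simp only: local_osc_pow_def)
qed

lemma sharp_norm_eq:
  assumes q: "0 < q" and g: "g \<in> borel_measurable lebesgue" and g1 [measurable]: "g1 \<in> borel_measurable borel"
    and eq: "AE t in lborel. g t = g1 t"
  shows "sharp_norm d s p q g =
    enn_powr (\<integral>\<^sup>+t. ennreal (\<bar>t\<bar> ^ (d - 1)) * ennreal (cmod (g1 t) powr p) \<partial>lborel) (1 / p) +
    enn_powr (\<integral>\<^sup>+r. ennreal (\<bar>r\<bar> ^ (d - 1)) * enn_powr (osc_norm s q g1 r) p \<partial>lborel) (1 / p)"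
proof -
  have "(\<integral>\<^sup>+t. ennreal (cmod (g t) powr p * \<bar>t\<bar> ^ (d - 1)) \<partial>lborel) = (\<integral>\<^sup>+t. ennreal (\<bar>t\<bar> ^ (d - 1)) * ennreal (cmod (g1 t) powr p) \<partial>lborel)"
    by (rule nn_integral_cong_AE) (use eq in \<open>eventually_elim, simp add: ennreal_mult mult.commute\<close>)
  moreover have "(\<integral>\<^sup>+r. ennreal (\<bar>r\<bar> ^ (d - 1)) * local_osc_pow s p q g r \<partial>lborel)
      = (\<integral>\<^sup>+r. ennreal (\<bar>r\<bar> ^ (d - 1)) * enn_powr (osc_norm s q g1 r) p \<partial>lborel)"
    by (rule nn_integral_cong_AE)
      (use local_osc_pow_AE_cong[OF g g1 eq, of s p q] in \<open>eventually_elim, simp add: local_osc_pow_eq[OF g1 q]\<close>)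
  ultimately show ?thesis
    by (simp only: sharp_norm_def weighted_Lp_norm_def nn_integral_completion)
qed

lemma F_norm_dist_of_eq:
  fixes \<psi> f f0 :: "real^'n::finite \<Rightarrow> complex"
  assumes \<psi>: "resolution_generator \<psi>" and p: "1 \<le> p" and f: "f \<in> borel_measurable lebesgue"
    and f0: "borel_Lp p f0" and eq: "AE x in lborel. f x = f0 x"
  shows "F_norm \<psi> s p q (dist_of f) = enn_powr (\<integral>\<^sup>+x. enn_powr (lq_seq s q (\<lambda>j. block \<psi> f0 j x)) p \<partial>lborel) (1 / p)"
    and "tempered (dist_of f)"
  using lp_block_eq[OF \<psi> p f _ AE_completion[OF eq]] tempered_dist_of[OF \<psi> p f _ AE_completion[OF eq]] f0
  by (simp_all add: F_norm_def borel_Lp_def nn_integral_completion)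

text \<open>Passes from p-th powers to the quasi-norms. The root of A + B is at most 2^(1/p) times
  the sum of the roots; conversely each root is at most the root of the sum, which puts the factor 2
  into the lower constant.\<close>

lemma enn_powr_sum_equivalence:
  assumes p: "0 < p" and pos: "0 < C" "0 < D"
    and upper: "X \<le> ennreal C * (A + B)" and lower: "A + B \<le> ennreal D * X"
  shows "enn_powr X (1 / p) \<le> ennreal ((2 * C) powr (1 / p)) * (enn_powr A (1 / p) + enn_powr B (1 / p))"
    and "ennreal (1 / (2 * D powr (1 / p))) * (enn_powr A (1 / p) + enn_powr B (1 / p)) \<le> enn_powr X (1 / p)"
proof -
  have a: "0 < 1 / p" using p by simp
  have "enn_powr X (1 / p) \<le> enn_powr (ennreal C) (1 / p) * enn_powr (A + B) (1 / p)"
    unfolding enn_powr_mult[OF a, symmetric] using a by (intro enn_powr_mono upper) auto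
  also have "\<dots> \<le> enn_powr (ennreal C) (1 / p) * (ennreal (2 powr (1 / p)) * (enn_powr A (1 / p) + enn_powr B (1 / p)))"
    by (intro mult_left_mono enn_powr_add_le[OF a]) simp
  also have "\<dots> = ennreal ((2 * C) powr (1 / p)) * (enn_powr A (1 / p) + enn_powr B (1 / p))"
    using pos by (simp add: powr_mult ennreal_mult mult_ac)
  finally show "enn_powr X (1 / p) \<le> ennreal ((2 * C) powr (1 / p)) * (enn_powr A (1 / p) + enn_powr B (1 / p))" .
  have "enn_powr Y (1 / p) \<le> ennreal (D powr (1 / p)) * enn_powr X (1 / p)" if "Y \<le> A + B" for Y
  proof -
    have "enn_powr Y (1 / p) \<le> enn_powr (ennreal D * X) (1 / p)"
      using a that lower by (intro enn_powr_mono) (auto intro: order_trans)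
    then show ?thesis using pos a by (simp add: enn_powr_mult[OF a])
  qed
  from add_mono[OF this[of A] this[of B]]
  have "ennreal (1 / (2 * D powr (1 / p))) * (enn_powr A (1 / p) + enn_powr B (1 / p))
      \<le> ennreal (1 / (2 * D powr (1 / p))) * (ennreal (D powr (1 / p)) * enn_powr X (1 / p) + ennreal (D powr (1 / p)) * enn_powr X (1 / p))"
    by (intro mult_left_mono) auto
  also have "\<dots> = ennreal (1 / (2 * D powr (1 / p)) * (2 * D powr (1 / p))) * enn_powr X (1 / p)"
    by (simp only: distrib_right[symmetric] mult.assoc[symmetric] mult_2 ennreal_plus[symmetric] powr_ge_zero)
      (simp only: mult_2[symmetric], subst ennreal_mult, simp_all)
  also have "\<dots> = enn_powr X (1 / p)" using pos by simp
  finally show "ennreal (1 / (2 * D powr (1 / p))) * (enn_powr A (1 / p) + enn_powr B (1 / p)) \<le> enn_powr X (1 / p)" .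
qed

theorem theorem1:
  fixes \<psi> :: "real^'n::finite \<Rightarrow> complex" and p s :: real and q :: ereal
  assumes "CARD('n) \<ge> 2" and "0 < p" and "0 < q"
    and "ereal (real CARD('n)) * max (1 / ereal p) (1 / q) < ereal s" and "s < 1"
    and "resolution_generator \<psi>"
  shows "\<exists>c1 c2 :: real. 0 < c1 \<and> 0 < c2 \<and>
    (\<forall>(f :: real^'n \<Rightarrow> complex) g. in_Lp p f \<and> radial f \<and> is_trace f g \<longrightarrow>
      (dist_of f \<in> F_space \<psi> s p q \<longleftrightarrow> sharp_norm CARD('n) s p q g < \<infinity>) \<and>
      ennreal c1 * sharp_norm CARD('n) s p q g \<le> F_norm \<psi> s p q (dist_of f) \<and>
      F_norm \<psi> s p q (dist_of f) \<le> ennreal c2 * sharp_norm CARD('n) s p q g)"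
proof -
  let ?n = "real CARD('n)"
  note \<psi> = assms(6)
  have n2: "2 \<le> ?n" using assms(1) by simp
  have bnd: "ereal ?n * a < ereal s" if "a \<le> max (1 / ereal p) (1 / q)" for a
    using ereal_mult_left_mono[OF that, of "ereal ?n"] assms(4) by (auto intro: order_le_less_trans)
  have "ereal ?n * (1 / ereal p) < ereal s" by (rule bnd) simp
  then have nps: "?n / p < s" using assms(2) by (simp add: divide_ereal_def divide_inverse)
  moreover have "0 < ?n / p" using n2 assms(2) by simp
  ultimately have s0: "0 < s" by linarith
  have nsp: "?n < s * p" using nps assms(2) by (simp add: divide_less_eq)
  have "s * p < 1 * p" using assms(2,5) by (intro mult_strict_right_mono)
  then have p1: "1 \<le> p" using nsp n2 by linarith
  have nsq: "ereal (?n / s) < q"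
  proof (cases q)
    case (real r)
    then have r: "0 < r" using assms(3) by simp
    have "ereal ?n * (1 / q) < ereal s" by (rule bnd) simp
    then have "?n / r < s" using real r by (simp add: divide_ereal_def divide_inverse)
    then show ?thesis using real r s0 by (simp add: divide_less_eq mult.commute)
  qed (use assms(3) in auto)
  \<comment> \<open>From n \<ge> 2 and s < 1 follows n / s \<ge> 1, so that n / s < q places q in
    the range of Young's inequality.\<close>
  have "2 * s \<le> ?n * 1" using n2 assms(5) s0 by (intro mult_mono) auto
  then have "1 \<le> ?n / s" using s0 by (simp add: le_divide_eq)
  then have q1: "1 \<le> q" using nsq by (metis ereal_less_eq(3) less_imp_le one_ereal_def order_trans)
  \<comment> \<open>The factor of polar coordinates: the area of the unit sphere, halved because the
    weighted integrals run over both half-lines.\<close>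
  define K where "K = ?n * unit_ball_vol ?n / 2"
  have K: "0 < K" using n2 by (simp add: K_def)
  obtain C where C: "0 < C" "\<And>g. g \<in> borel_measurable borel \<Longrightarrow> borel_Lp p (\<lambda>x::real^'n. g (norm x)) \<Longrightarrow>
    (\<integral>\<^sup>+x. enn_powr (lq_seq s q (\<lambda>j. block \<psi> (\<lambda>x. g (norm x)) j x)) p \<partial>lborel)
    \<le> ennreal C * ((\<integral>\<^sup>+x. ennreal (cmod (g (norm x)) powr p) \<partial>(lborel :: (real^'n) measure)) + (\<integral>\<^sup>+x. enn_powr (osc_norm s q g (norm x)) p \<partial>(lborel :: (real^'n) measure)))"
    using F_le_sharp[OF \<psi> s0 assms(5) p1 q1] by blast
  obtain D where D: "0 < D" "\<And>g. g \<in> borel_measurable borel \<Longrightarrow> (\<And>t. g (- t) = g t) \<Longrightarrow> borel_Lp p (\<lambda>x::real^'n. g (norm x)) \<Longrightarrow>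
    (\<integral>\<^sup>+x. ennreal (cmod (g (norm x)) powr p) \<partial>(lborel :: (real^'n) measure)) + (\<integral>\<^sup>+x. enn_powr (osc_norm s q g (norm x)) p \<partial>(lborel :: (real^'n) measure))
    \<le> ennreal D * (\<integral>\<^sup>+x. enn_powr (lq_seq s q (\<lambda>j. block \<psi> (\<lambda>x. g (norm x)) j x)) p \<partial>lborel)"
    using sharp_le_F[OF \<psi> assms(5) nsp nsq s0] by blast
  \<comment> \<open>The constants of \<open>enn_powr_sum_equivalence\<close> for
    \<open>C * K\<close> and \<open>D / K\<close>: polar coordinates put K in front of both weighted
    integrals.\<close>
  define c1 where "c1 = 1 / (2 * (D / K) powr (1 / p))"
  define c2 where "c2 = (2 * (C * K)) powr (1 / p)"
  have c: "0 < c1" "0 < c2" using C D K by (simp_all add: c1_def c2_def)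
  have main: "(dist_of f \<in> F_space \<psi> s p q \<longleftrightarrow> sharp_norm CARD('n) s p q g < \<infinity>) \<and>
      ennreal c1 * sharp_norm CARD('n) s p q g \<le> F_norm \<psi> s p q (dist_of f) \<and>
      F_norm \<psi> s p q (dist_of f) \<le> ennreal c2 * sharp_norm CARD('n) s p q g"
    if Lp: "in_Lp p f" and tr: "is_trace f g" for f :: "real^'n \<Rightarrow> complex" and g
  proof -
    have fL: "f \<in> borel_measurable lebesgue" and gL: "g \<in> borel_measurable lebesgue"
      using Lp tr by (auto simp: in_Lp_def is_trace_def)
    \<comment> \<open>From here on f and g enter through the Borel and exactly even function h; both
      quasi-norms depend only on classes of functions equal almost everywhere.\<close>
    obtain h where h [measurable]: "h \<in> borel_measurable borel" and even: "\<And>t. h (- t) = h t"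
      and gh: "AE t in lborel. g t = h t" and fh: "AE x in lborel. f x = h (norm x)"
      using is_trace_borel_version[OF tr] by blast
    have "(\<integral>\<^sup>+x. ennreal (cmod (h (norm x)) powr p) \<partial>(lborel :: (real^'n) measure)) = (\<integral>\<^sup>+x. ennreal (cmod (f x) powr p) \<partial>lborel)"
      by (rule nn_integral_cong_AE) (use fh in \<open>eventually_elim, simp\<close>)
    then have hLp: "borel_Lp p (\<lambda>x::real^'n. h (norm x))"
      using Lp by (simp add: borel_Lp_def in_Lp_def nn_integral_completion)
    define A where "A = (\<integral>\<^sup>+r. ennreal (\<bar>r\<bar> ^ (CARD('n) - 1)) * ennreal (cmod (h r) powr p) \<partial>lborel)"
    define B where "B = (\<integral>\<^sup>+r. ennreal (\<bar>r\<bar> ^ (CARD('n) - 1)) * enn_powr (osc_norm s q h r) p \<partial>lborel)"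
    define X where "X = (\<integral>\<^sup>+x. enn_powr (lq_seq s q (\<lambda>j. block \<psi> (\<lambda>x. h (norm x)) j x)) p \<partial>lborel)"
    have A: "(\<integral>\<^sup>+x. ennreal (cmod (h (norm x)) powr p) \<partial>(lborel :: (real^'n) measure)) = ennreal K * A"
      using nn_integral_polar_even[of "\<lambda>r. ennreal (cmod (h r) powr p)", where 'a = "real^'n"]
      by (simp add: A_def K_def even)
    have B: "(\<integral>\<^sup>+x. enn_powr (osc_norm s q h (norm x)) p \<partial>(lborel :: (real^'n) measure)) = ennreal K * B"
      using nn_integral_polar_even[of "\<lambda>r. enn_powr (osc_norm s q h r) p", where 'a = "real^'n"] borel_measurable_osc_norm[OF h]
      by (simp add: B_def K_def osc_norm_even[OF h even])
    have "X \<le> ennreal C * (ennreal K * A + ennreal K * B)"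
      using C(2)[OF h hLp] by (simp only: A B X_def)
    then have upper: "X \<le> ennreal (C * K) * (A + B)"
      using C K by (simp add: ennreal_mult distrib_left mult.assoc)
    have DX: "ennreal K * A + ennreal K * B \<le> ennreal D * X"
      using D(2)[OF h even hLp] by (simp only: A B X_def)
    have "A + B = ennreal (1 / K) * (ennreal K * A + ennreal K * B)"
      using K by (simp add: distrib_left[symmetric] mult.assoc[symmetric] ennreal_mult'[symmetric])
    also have "\<dots> \<le> ennreal (1 / K) * (ennreal D * X)" using DX by (rule mult_left_mono) simp
    also have "\<dots> = ennreal (D / K) * X" using K by (simp add: mult.assoc[symmetric] ennreal_mult'[symmetric])
    finally have lower: "A + B \<le> ennreal (D / K) * X" .
    have S: "sharp_norm CARD('n) s p q g = enn_powr A (1 / p) + enn_powr B (1 / p)"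
      unfolding A_def B_def by (rule sharp_norm_eq[OF assms(3) gL h gh])
    note F = F_norm_dist_of_eq[OF \<psi> p1 fL hLp fh]
    have FX: "F_norm \<psi> s p q (dist_of f) = enn_powr X (1 / p)" unfolding X_def by (rule F(1))
    have CK: "0 < C * K" "0 < D / K" using C D K by simp_all
    note eqv = enn_powr_sum_equivalence[OF assms(2) CK upper lower, folded S FX c1_def c2_def]
    have "F_norm \<psi> s p q (dist_of f) < \<infinity>" if "sharp_norm CARD('n) s p q g < \<infinity>"
      by (rule order_le_less_trans[OF eqv(1)]) (use that in \<open>simp add: ennreal_mult_less_top\<close>)
    moreover have "sharp_norm CARD('n) s p q g < \<infinity>" if "F_norm \<psi> s p q (dist_of f) < \<infinity>"
      using order_le_less_trans[OF eqv(2) that] c(1) by (auto simp: ennreal_mult_less_top)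
    ultimately show ?thesis using eqv F(2) by (auto simp: F_space_def)
  qed
  show ?thesis using c main by blast
qed

end
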